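(* Let $0<H<\frac12$ and let $\mathbb{P}^H$ be the law on $C([0,1],\mathbb{R})$ of fractional Brownian motion of Hurst index $H$; denote by $\lambda$ the generic (canonical) path. For a cadlag nondecreasing $\gamma:[0,1]\to\mathbb{R}$ consider the reflected equation $$(\ast)\qquad dZ_t = AZ_t\,d\lambda_t-e_1\,d\gamma_t+e_1\,dK_t,\qquad Z\cdot e_1\ge0,\qquad dK=1_{\{Z\cdot e_1=0\}}|dK|$$ on $[0,1]$. (1) Let $\gamma:[0,1]\to\mathbb{R}$ be a piecewise-constant path of the form $$\gamma(t)=\sum_{k:\,0<t_k\le t}x_k,$$ where $(t_k)_{k\ge0}\subset(0,1]$ decreases to $0$ and $(x_k)_{k\ge0}$ is a summable sequence satisfying $$t_k-t_{k+1}\sim_{k\to\infty}k^{-\alpha},\qquad x_k\ge\exp(-k^\theta),$$ with $$\max\Big(\frac{5}{12H},1\Big)<\alpha<\frac{1}{2H},\qquad 0<\theta<1-2\alpha H.$$ Then for $\mathbb{P}^H$-almost every $\lambda$, $(\ast)$ admits infinitely many solutions with $Z_0=0$. More precisely, there exists a family of processes $(Z^\eta)_{\eta>0}$, with $Z^\eta_0=0$, adapted with respect to the completed natural filtration of $\lambda$, which solve $(\ast)$ almost surely, and such that almost surely, for $\eta_1,\eta_2>0$, $$\lim_{t\to0}\frac{|Z^{\eta_1}_t|}{|Z^{\eta_2}_t|}=\frac{\eta_1}{\eta_2}.$$ (2) For the equation $(\ast)$ with $\gamma(t)=t$: for $\mathbb{P}^H$-almost every path $\lambda$, there exists a family $(Z^t)_{t\in[0,1]}$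 of functions on $[0,1]$ which are solutions to $(\ast)$ and such that, for $s,t\in[0,1]$, $Z^t(s)=0$ if and only if $s\le t$ (in particular, these solutions are all distinct).
   Context: Fractional Brownian motion of Hurst index $H\in(0,1)$ is the continuous centered Gaussian process $(B_t)_{t\in[0,1]}$ with $\mathbb{E}[B_sB_t]=\frac12(t^{2H}+s^{2H}-|t-s|^{2H})$. $(e_1,e_2)$ is the canonical basis of $\mathbb{R}^2$ and $A=\begin{pmatrix}0&1\\1&0\end{pmatrix}$. For a function $f$ of a real variable, $f_{s,t}:=f(t)-f(s)$. Definition of solution. For $\lambda:[0,1]\to\mathbb{R}$ continuous and $\gamma:[0,1]\to\mathbb{R}$ cadlag and nondecreasing, a solution of $(\ast)$ on an interval $I\subset[0,1]$ is a pair $(Z,K)$ with $Z:I\to\mathbb{R}^2$, $K:I\to\mathbb{R}$, $K$ cadlag and nondecreasing, such that $Z_t\cdot e_1\ge 0$ for all $t\in I$, the measure $dK$ is carried by $\{t: Z_t\cdot e_1=0\}$, and for all $s\le t$ in $I$ $$Z_t = e^{A\lambda_{s,t}}Z_s+\int_s^t \big(e^{A\lambda_{u,t}}e_1\big)(dK_u-d\gamma_u),$$ the integral being a Stieltjes integral over $(s,t]$. One says that $Z$ itself is a solution if there exists $K$ such that $(Z,K)$ is a solution. *)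

theory Defs
  imports "HOL-Probability.Probability" "HOL-Library.Landau_Symbols"
begin

section \<open>Fractional Brownian motion\<close>

text \<open>Gaussian variables may be degenerate (almost surely constant), as in the usual definition of
  a Gaussian process.\<close>

definition gaussian_var :: "'a measure \<Rightarrow> ('a \<Rightarrow> real) \<Rightarrow> bool" where
  "gaussian_var M X \<longleftrightarrow> X \<in> borel_measurable M \<and>
     ((\<exists>\<mu>. AE \<omega> in M. X \<omega> = \<mu>) \<or>
      (\<exists>\<mu> \<sigma>. \<sigma> > 0 \<and> distributed M lborel X (\<lambda>x. ennreal (normal_density \<mu> \<sigma> x))))"

definition gaussian_process :: "'a measure \<Rightarrow> real set \<Rightarrow> (real \<Rightarrow> 'a \<Rightarrow> real) \<Rightarrow> bool" where
  "gaussian_process M T B \<longleftrightarrow>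
     (\<forall>J c. finite J \<and> J \<subseteq> T \<longrightarrow> gaussian_var M (\<lambda>\<omega>. \<Sum>j\<in>J. c j * B j \<omega>))"

definition fractional_brownian_motion :: "real \<Rightarrow> 'a measure \<Rightarrow> (real \<Rightarrow> 'a \<Rightarrow> real) \<Rightarrow> bool" where
  "fractional_brownian_motion H M B \<longleftrightarrow>
     prob_space M \<and>
     (\<forall>\<omega>\<in>space M. continuous_on {0..1} (\<lambda>t. B t \<omega>)) \<and>
     gaussian_process M {0..1} B \<and>
     (\<forall>t\<in>{0..1}. (\<integral>\<omega>. B t \<omega> \<partial>M) = 0) \<and>
     (\<forall>s\<in>{0..1}. \<forall>t\<in>{0..1}. (\<integral>\<omega>. B s \<omega> * B t \<omega> \<partial>M) =
        (t powr (2 * H) + s powr (2 * H) - \<bar>t - s\<bar> powr (2 * H)) / 2)"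

text \<open>The space \<open>C([0,1], \<real>)\<close>: continuous functions on \<open>{0..1}\<close>, represented by functions that are
  \<open>undefined\<close> outside \<open>{0..1}\<close>, with the \<open>\<sigma>\<close>-algebra generated by the evaluations (this is the Borel
  \<open>\<sigma>\<close>-algebra of the supremum norm).\<close>

definition path_space :: "(real \<Rightarrow> real) measure" where
  "path_space = restrict_space (\<Pi>\<^sub>M t\<in>{0..1}. borel) {w. continuous_on {0..1} w}"

text \<open>\<open>P\<close> is the law of fractional Brownian motion: the canonical process under \<open>P\<close> is a fractional
  Brownian motion.\<close>

definition fbm_law :: "real \<Rightarrow> (real \<Rightarrow> real) measure \<Rightarrow> bool" where
  "fbm_law H P \<longleftrightarrow> sets P = sets path_space \<and> fractional_brownian_motion H P (\<lambda>t w. w t)"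

definition completed_natural_filtration ::
    "'a measure \<Rightarrow> (real \<Rightarrow> 'a \<Rightarrow> real) \<Rightarrow> real \<Rightarrow> 'a measure" where
  "completed_natural_filtration M B t = sigma (space M)
     ({B s -` S \<inter> space M | s S. 0 \<le> s \<and> s \<le> t \<and> S \<in> sets borel} \<union> null_sets (completion M))"

section \<open>The reflected equation\<close>

definition e1 :: "real^2" where
  "e1 = axis 1 1"

definition A_mat :: "real^2^2" where
  "A_mat = vector [vector [0, 1], vector [1, 0]]"

text \<open>The library's \<open>exp\<close> does not apply: \<open>real^'n^'n\<close> carries no Banach algebra instance whose
  multiplication is the matrix product.\<close>

definition mat_exp :: "real^'n^'n \<Rightarrow> real^'n^'n" where
  "mat_exp X = (\<Sum>k. (1 / fact k) *\<^sub>R (((**) X ^^ k) (mat 1)))"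

text \<open>One-sided limits at an end point of \<open>I\<close> that cannot be approached from that side within \<open>I\<close>
  are with respect to the trivial filter, so that they impose no condition.\<close>

definition cadlag_on :: "real set \<Rightarrow> (real \<Rightarrow> 'b::topological_space) \<Rightarrow> bool" where
  "cadlag_on I f \<longleftrightarrow> (\<forall>t\<in>I. (f \<longlongrightarrow> f t) (at t within (I \<inter> {t<..})) \<and>
     (\<exists>l. (f \<longlongrightarrow> l) (at t within (I \<inter> {..<t}))))"

text \<open>The Stieltjes measure \<open>dF\<close> on \<open>{s<..t}\<close>, for \<open>F\<close> nondecreasing and right-continuous on \<open>{s..t}\<close>.
  Freezing \<open>F\<close> outside \<open>{s..t}\<close> makes it a measure on the whole line without mass outside \<open>{s<..t}\<close>, so
  that \<open>F\<close> need only be meaningful on \<open>{s..t}\<close>.\<close>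

definition stieltjes :: "(real \<Rightarrow> real) \<Rightarrow> real \<Rightarrow> real \<Rightarrow> real measure" where
  "stieltjes F s t = interval_measure (\<lambda>u. F (max s (min t u)))"

text \<open>\<open>(Z, K)\<close> solves \<open>dZ = A Z d\<lambda> - e1 d\<gamma> + e1 dK\<close> on the interval \<open>I\<close>; the driving path \<open>\<lambda>\<close> is
  written \<open>w\<close>. That \<open>dK\<close> is carried by the zero set of \<open>Z \<bullet> e1\<close> is expressed on each \<open>{s<..t}\<close> with
  \<open>s, t \<in> I\<close>; in particular \<open>dK\<close> has no atom at the left end point of \<open>I\<close>.\<close>

definition solution_pair :: "(real \<Rightarrow> real) \<Rightarrow> (real \<Rightarrow> real) \<Rightarrow> real set \<Rightarrow>
    (real \<Rightarrow> real^2) \<Rightarrow> (real \<Rightarrow> real) \<Rightarrow> bool" where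
  "solution_pair w \<gamma> I Z K \<longleftrightarrow>
     cadlag_on I K \<and> mono_on I K \<and>
     (\<forall>t\<in>I. Z t \<bullet> e1 \<ge> 0) \<and>
     (\<forall>s\<in>I. \<forall>t\<in>I. s \<le> t \<longrightarrow>
        (AE u in stieltjes K s t. u \<in> {s<..t} \<longrightarrow> Z u \<bullet> e1 = 0)) \<and>
     (\<forall>s\<in>I. \<forall>t\<in>I. s \<le> t \<longrightarrow>
        Z t = mat_exp ((w t - w s) *\<^sub>R A_mat) *v Z s
          + ((LINT u:{s<..t}|stieltjes K s t. mat_exp ((w t - w u) *\<^sub>R A_mat) *v e1)
           - (LINT u:{s<..t}|stieltjes \<gamma> s t. mat_exp ((w t - w u) *\<^sub>R A_mat) *v e1)))"

definition is_solution ::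
    "(real \<Rightarrow> real) \<Rightarrow> (real \<Rightarrow> real) \<Rightarrow> real set \<Rightarrow> (real \<Rightarrow> real^2) \<Rightarrow> bool" where
  "is_solution w \<gamma> I Z \<longleftrightarrow> (\<exists>K. solution_pair w \<gamma> I Z K)"

definition jump_path :: "(nat \<Rightarrow> real) \<Rightarrow> (nat \<Rightarrow> real) \<Rightarrow> real \<Rightarrow> real" where
  "jump_path \<tau> x t = (\<Sum>\<^sub>\<infinity>k\<in>{k. 0 < \<tau> k \<and> \<tau> k \<le> t}. x k)"

end

(* In the null coordinates U = exp (-w) (Z1 + Z2) and V = exp w (Z1 - Z2) only dK and d gamma act on Z, and
   where gamma is constant the reflected motion is explicit: Z = R (sinh (w + l), +-cosh (w + l)) with R
   constant and l pushed up by the running maximum of -w.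

   Jumps: a state of radius r on the boundary at time tau_(k+1) has radius r and height r sinh (rise) just
   before tau_k, and a jump x_k larger than that height puts it back on the boundary with radius
   r cosh (rise), where the rise is that of w above its minimum on the interval. This recursion is linear
   in r, so rescaling one solution started from 0 gives another. It can be started from 0 because the
   sums of ln cosh of the rises, once centred, converge almost surely along a subsequence: the Gaussian
   Poincare inequality and the nonpositive correlation of increments over disjoint intervals bound their
   variance. The expectations grow like k^(1 - 2 alpha H), which makes the heights at tau_k smaller than the
   jumps x_k.

   gamma t = t: by small ball estimates and Borel-Cantelli, w rises by at least a power h (slightly above H) of the
   length on every short interval. These rises beat the drift, so solutions for discretised gamma that start from
   tiny states at time t are pushed away from 0 at a rate that does not depend on the starting size, and a
   diagonal subsequence converges to a solution leaving 0 at t. *)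

theory Submission
  imports Defs "HOL-Library.Diagonal_Subsequence" "HOL-Real_Asymp.Real_Asymp"
begin

section \<open>The equation in null coordinates\<close>

text \<open>In the jump case the rises over successive intervals are dependent, and the sum of their
  ln cosh diverges. Only variances of block sums are controlled, with no maximal inequality, hence
  convergence along a subsequence. That subsequence and the centring constants are deterministic, so
  the radius at a jump time is a function of the earlier path; this gives adaptedness. With d_k =
  \<open>\<tau> k - \<tau> (Suc k)\<close>, the variances are bounded by a multiple of the sum of
  d_k^(2 (H + g)), where g < H: the exponent 2 H comes from the covariance, 2 g from the derivative
  tanh, which is small with the rise. As d_k behaves like k^(-\<alpha>), some g < H makes the sum
  finite when \<alpha> > 1/(4 H).

  In the case of linear drift, a rise d^h during time d beats the drift d for radii above a multiple
  of d^(1 - h). Doubling such a radius takes time of order d^(2 - 2 h - h/\<kappa>), where \<kappa>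
  is a Hoelder exponent of w. For h and \<kappa> near H this exponent is near 1 - 2 H > 0, so the
  times over dyadic d form a convergent geometric series, whatever the starting level.\<close>

lemma mat_exp_A:
  "mat_exp (x *\<^sub>R A_mat) = cosh x *\<^sub>R mat 1 + sinh x *\<^sub>R A_mat"
proof -
  \<comment> \<open>Powers of \<open>A_mat\<close> alternate between the identity and
    \<open>A_mat\<close>, so the exponential series separates into those of cosh and sinh.\<close>
  have AA: "A_mat ** A_mat = mat 1"
    by (simp add: A_mat_def vec_eq_iff matrix_matrix_mult_def mat_def sum_2 forall_2)
  have pow: "(((**) (x *\<^sub>R A_mat)) ^^ k) (mat 1) =
      (if even k then x ^ k *\<^sub>R mat 1 else x ^ k *\<^sub>R A_mat)" for k
    by (induction k) (simp_all add: AA matrix_scalar_ac scalar_matrix_assoc flip: scalar_matrix_assoc)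
  have "(\<lambda>k. (if even k then x ^ k /\<^sub>R fact k else 0) *\<^sub>R (mat 1 :: real^2^2) + 
      (if even k then 0 else x ^ k /\<^sub>R fact k) *\<^sub>R A_mat) sums
      (cosh x *\<^sub>R mat 1 + sinh x *\<^sub>R A_mat)"
    by (intro sums_add bounded_linear.sums[OF bounded_linear_scaleR_left] cosh_converges sinh_converges)
  also have "(\<lambda>k. (if even k then x ^ k /\<^sub>R fact k else 0) *\<^sub>R (mat 1 :: real^2^2) + 
      (if even k then 0 else x ^ k /\<^sub>R fact k) *\<^sub>R A_mat) = 
      (\<lambda>k. (1 / fact k) *\<^sub>R ((((**) (x *\<^sub>R A_mat)) ^^ k) (mat 1)))"
    by (auto simp: pow fun_eq_iff divide_inverse)
  finally show ?thesis unfolding mat_exp_def by (simp add: sums_iff)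
qed

lemma mat_exp_A_mult:
  "(mat_exp (x *\<^sub>R A_mat) *v z) $ 1 = cosh x * z $ 1 + sinh x * z $ 2"
  "(mat_exp (x *\<^sub>R A_mat) *v z) $ 2 = sinh x * z $ 1 + cosh x * z $ 2"
  unfolding mat_exp_A by (simp_all add: matrix_vector_mult_def sum_2 mat_def A_mat_def)

lemma mat_exp_A_e1:
  "(mat_exp (x *\<^sub>R A_mat) *v e1) $ 1 = cosh x"
  "(mat_exp (x *\<^sub>R A_mat) *v e1) $ 2 = sinh x"
  by (simp_all add: mat_exp_A_mult e1_def axis_def)

lemma inner_e1: "z \<bullet> e1 = z $ 1"
  by (simp add: e1_def inner_axis)

section \<open>Right-continuous nondecreasing functions and their Stieltjes integrals\<close>

definition rcont_on :: "real => real => (real => real) => bool" where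
  "rcont_on a b F \<longleftrightarrow> (\<forall>t\<in>{a..<b}. continuous (at_right t) F)"

lemma rcont_on_subset: "rcont_on a b F ==> a \<le> c ==> d \<le> b ==> rcont_on c d F"
  unfolding rcont_on_def by auto

lemma mono_on_left_limit:
  fixes K :: "real => real"
  assumes "mono_on {a..b} K" "t \<in> {a..b}"
  shows "\<exists>l. (K \<longlongrightarrow> l) (at t within ({a..b} \<inter> {..<t}))"
proof (cases "a < t")
  case True
  define l where "l = (SUP s\<in>{a..<t}. K s)"
  have bdd: "bdd_above (K ` {a..<t})"
    using assms by (intro bdd_aboveI[of _ "K t"]) (auto simp: mono_on_def)
  have eq: "at t within ({a..b} \<inter> {..<t}) = at_left t"
    using True assms(2) by (intro at_within_nhd[of _ "{a<..}"]) auto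
  have "(K \<longlongrightarrow> l) (at_left t)"
  proof (rule order_tendstoI)
    fix y assume "y < l"
    then obtain s where s: "s \<in> {a..<t}" "y < K s"
      using less_cSUP_iff[OF _ bdd, of y] True unfolding l_def by auto
    have "y < K r" if "r \<in> {s<..<t}" for r
      using s that assms by (intro less_le_trans[OF s(2)]) (auto simp: mono_on_def)
    then show "eventually (\<lambda>r. y < K r) (at_left t)"
      using s by (intro eventually_at_leftI[of s]) auto
  next
    fix y assume "l < y"
    have "K r < y" if "r \<in> {a<..<t}" for r
      using cSUP_upper[OF _ bdd, of r] that \<open>l < y\<close> unfolding l_def by auto
    then show "eventually (\<lambda>r. K r < y) (at_left t)"
      using True by (intro eventually_at_leftI[of a]) auto
  qed
  then show ?thesis using eq by auto
next
  case False
  then have "{a..b} \<inter> {..<t} = {}" using assms(2) by auto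
  then show ?thesis by simp
qed

lemma cadlag_on_mono:
  assumes "mono_on {a..b} K" "rcont_on a b K"
  shows "cadlag_on {a..b} K"
  unfolding cadlag_on_def
proof (intro ballI conjI)
  fix t assume t: "t \<in> {a..b}"
  show "\<exists>l. (K \<longlongrightarrow> l) (at t within ({a..b} \<inter> {..<t}))"
    using mono_on_left_limit[OF assms(1) t] .
  show "(K \<longlongrightarrow> K t) (at t within ({a..b} \<inter> {t<..}))"
  proof (cases "t < b")
    case True
    have eq: "at t within ({a..b} \<inter> {t<..}) = at_right t"
      using True t by (intro at_within_nhd[of _ "{..<b}"]) auto
    show ?thesis using assms(2) True t unfolding eq rcont_on_def continuous_within by auto
  next
    case False
    then have "{a..b} \<inter> {t<..} = {}" using t by auto
    then show ?thesis by simp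
  qed
qed

lemma stieltjes_props:
  assumes mono: "mono_on {s..t} F" and rc: "rcont_on s t F" and st: "s \<le> t"
  shows "sets (stieltjes F s t) = sets borel" "space (stieltjes F s t) = UNIV"
    and "\<And>u v. s \<le> u ==> u \<le> v ==> v \<le> t ==> emeasure (stieltjes F s t) {u<..v} = ennreal (F v - F u)"
proof -
  define G where "G = (\<lambda>u. F (max s (min t u)))"
  have G: "G x \<le> G y" if "x \<le> y" for x y
    unfolding G_def using mono st that by (auto simp: mono_on_def intro!: max.mono min.mono)
  have Gr: "continuous (at_right x) G" for x
  proof -
    consider "x < s" | "t \<le> x" | "s \<le> x" "x < t" by linarith
    then show ?thesis
    proof cases
      case 1
      have "eventually (\<lambda>y. G y = G x) (at_right x)"
        unfolding eventually_at_right_field using 1 st by (intro exI[of _ s]) (auto simp: G_def max_def min_def)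
      then show ?thesis unfolding continuous_within by (intro tendsto_eventually)
    next
      case 2
      have "eventually (\<lambda>y. G y = G x) (at_right x)"
        unfolding eventually_at_right_field using 2 st by (intro exI[of _ "x+1"]) (auto simp: G_def max_def min_def)
      then show ?thesis unfolding continuous_within by (intro tendsto_eventually)
    next
      case 3
      have "(F \<longlongrightarrow> F x) (at_right x)" using rc 3 by (auto simp: rcont_on_def continuous_within)
      moreover have "eventually (\<lambda>y. F y = G y) (at_right x)"
        unfolding eventually_at_right_field using 3 st by (intro exI[of _ t]) (auto simp: G_def max_def min_def)
      ultimately have "(G \<longlongrightarrow> F x) (at_right x)" by (rule Lim_transform_eventually)
      moreover have "G x = F x" using 3 by (auto simp: G_def)
      ultimately show ?thesis unfolding continuous_within by simp
    qed
  qed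
  have S: "stieltjes F s t = interval_measure G" by (simp add: stieltjes_def G_def)
  show "sets (stieltjes F s t) = sets borel" "space (stieltjes F s t) = UNIV" by (simp_all add: S)
  fix u v assume "s \<le> u" "u \<le> v" "v \<le> t"
  then have "G u = F u" "G v = F v" using st by (auto simp: G_def)
  then show "emeasure (stieltjes F s t) {u<..v} = ennreal (F v - F u)"
    using emeasure_interval_measure_Ioc[OF \<open>u \<le> v\<close> G Gr] S by simp
qed

text \<open>Telescoping over a fine uniform partition bounds the total change of D by e times the
  total change of G, for every e > 0. It plays the part of the uniqueness of a Riemann-Stieltjes
  limit.\<close>

lemma additive_gap_eq:
  fixes D G :: "real => real"
  assumes st: "s \<le> t"
    and gap: "\<And>e. e > 0 ==> \<exists>d>0. \<forall>u v. s \<le> u \<longrightarrow> u \<le> v \<longrightarrow> v \<le> t \<longrightarrow> v - u < d \<longrightarrow> \<bar>D v - D u\<bar> \<le> e * (G v - G u)"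
  shows "D t = D s"
proof -
  have main: "\<bar>D t - D s\<bar> \<le> e * (G t - G s)" if e: "e > 0" for e
  proof -
    obtain d where d: "d > 0" "\<And>u v. s \<le> u ==> u \<le> v ==> v \<le> t ==> v - u < d ==> \<bar>D v - D u\<bar> \<le> e * (G v - G u)"
      using gap[OF e] by blast
    obtain n :: nat where n: "(t - s) / d < real n" using reals_Archimedean2 by blast
    with st d(1) have n0: "real n > 0" by (metis diff_ge_0_iff_ge divide_nonneg_pos le_less_trans)
    define x where "x = (\<lambda>i::nat. s + real i * ((t - s) / real n))"
    have step: "x (Suc i) - x i = (t - s) / real n" for i unfolding x_def by (simp add: distrib_right add_divide_distrib)
    have small: "(t - s) / real n < d" using n d(1) n0 by (simp add: field_simps)
    have x0: "x 0 = s" and xn: "x n = t" using n0 by (auto simp: x_def)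
    have xs: "s \<le> x i" for i unfolding x_def using st n0 by simp
    have xt: "x i \<le> t" if "i \<le> n" for i
    proof -
      have "real i * ((t - s) / real n) \<le> real n * ((t - s) / real n)"
        using that st n0 by (intro mult_right_mono) auto
      then show ?thesis unfolding x_def using n0 by simp
    qed
    have "\<bar>D t - D s\<bar> = \<bar>\<Sum>i<n. D (x (Suc i)) - D (x i)\<bar>"
      using sum_lessThan_telescope[of "\<lambda>i. D (x i)" n] x0 xn by simp
    also have "\<dots> \<le> (\<Sum>i<n. \<bar>D (x (Suc i)) - D (x i)\<bar>)" by (rule sum_abs)
    also have "\<dots> \<le> (\<Sum>i<n. e * (G (x (Suc i)) - G (x i)))"
    proof (rule sum_mono)
      fix i assume "i \<in> {..<n}"
      then have "x (Suc i) \<le> t" using xt[of "Suc i"] by simp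
      moreover have "x i \<le> x (Suc i)" using step[of i] st n0 by (smt (verit) divide_nonneg_pos)
      ultimately show "\<bar>D (x (Suc i)) - D (x i)\<bar> \<le> e * (G (x (Suc i)) - G (x i))"
        using xs[of i] step[of i] small by (intro d(2)) auto
    qed
    also have "\<dots> = e * (G t - G s)"
      using sum_lessThan_telescope[of "\<lambda>i. G (x i)" n] x0 xn by (simp add: sum_distrib_left[symmetric])
    finally show ?thesis .
  qed
  \<comment> \<open>The estimate with e = 1 yields the sign of the increment of G.\<close>
  have G: "0 \<le> G t - G s" using order_trans[OF abs_ge_zero main[OF zero_less_one]] by simp
  have "\<bar>D t - D s\<bar> \<le> 0 + e" if "e > 0" for e
  proof -
    have "\<bar>D t - D s\<bar> \<le> e / (G t - G s + 1) * (G t - G s)" using main[of "e / (G t - G s + 1)"] G that by simp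
    also have "\<dots> \<le> e" using G that by (simp add: field_simps)
    finally show ?thesis by simp
  qed
  then have "\<bar>D t - D s\<bar> \<le> 0" by (rule field_le_epsilon)
  then show ?thesis by simp
qed

lemma stieltjes_integral:
  fixes f :: "real => real"
  assumes mono: "mono_on {s..t} F" and rc: "rcont_on s t F" and st: "s \<le> t" and cont: "continuous_on {s..t} f"
  shows "\<And>u v. s \<le> u ==> u \<le> v ==> v \<le> t ==> set_integrable (stieltjes F s t) {u<..v} f"
    and "\<And>u v m M. s \<le> u ==> u \<le> v ==> v \<le> t ==> (\<And>y. y \<in> {u..v} ==> m \<le> f y \<and> f y \<le> M) ==>
        m * (F v - F u) \<le> (LINT y:{u<..v}|stieltjes F s t. f y) \<and> (LINT y:{u<..v}|stieltjes F s t. f y) \<le> M * (F v - F u)"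
    and "\<And>u v. s \<le> u ==> u \<le> v ==> v \<le> t ==>
        (LINT y:{s<..v}|stieltjes F s t. f y) = (LINT y:{s<..u}|stieltjes F s t. f y) + (LINT y:{u<..v}|stieltjes F s t. f y)"
proof -
  let ?N = "stieltjes F s t"
  note N = stieltjes_props[OF mono rc st]
  have sets[simp]: "{u<..v} \<in> sets ?N" for u v using N(1) by simp
  obtain B where B: "\<And>y. y \<in> {s..t} ==> norm (f y) \<le> B"
    using compact_imp_bounded[OF compact_continuous_image[OF cont compact_Icc]] unfolding bounded_iff by (metis imageI)
  have si: "set_integrable ?N {u<..v} f" if "s \<le> u" "u \<le> v" "v \<le> t" for u v
  proof -
    have m: "(\<lambda>x. indicator {s..t} x *\<^sub>R f x) \<in> borel_measurable ?N"
      using borel_measurable_continuous_on_indicator[OF _ cont] by (simp add: measurable_cong_sets[OF N(1) refl])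
    have "integrable ?N (\<lambda>x. indicator {u<..v} x *\<^sub>R (indicator {s..t} x *\<^sub>R f x))"
      using that B by (intro integrableI_bounded_set_indicator[where B=B] m) (auto simp: N(3) split: split_indicator)
    also have "(\<lambda>x. indicator {u<..v} x *\<^sub>R (indicator {s..t} x *\<^sub>R f x)) = (\<lambda>x. indicator {u<..v} x *\<^sub>R f x)"
      using that by (auto simp: fun_eq_iff split: split_indicator)
    finally show ?thesis unfolding set_integrable_def .
  qed
  then show "\<And>u v. s \<le> u ==> u \<le> v ==> v \<le> t ==> set_integrable ?N {u<..v} f" by blast
  show "m * (F v - F u) \<le> (LINT y:{u<..v}|?N. f y) \<and> (LINT y:{u<..v}|?N. f y) \<le> M * (F v - F u)"
    if uv: "s \<le> u" "u \<le> v" "v \<le> t" and b: "\<And>y. y \<in> {u..v} ==> m \<le> f y \<and> f y \<le> M" for u v m M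
  proof -
    have em: "emeasure ?N {u<..v} \<noteq> \<infinity>" using uv by (simp add: N(3))
    have meas: "measure ?N {u<..v} = F v - F u" using uv mono by (auto simp: measure_def N(3) mono_on_def)
    have ci: "set_integrable ?N {u<..v} (\<lambda>_. c)" for c :: real
      using em unfolding set_integrable_def by (intro integrable_scaleR_left) (auto simp: less_top[symmetric])
    have "(LINT y:{u<..v}|?N. m) \<le> (LINT y:{u<..v}|?N. f y)" 
      using b by (intro set_integral_mono ci si uv) auto
    moreover have "(LINT y:{u<..v}|?N. f y) \<le> (LINT y:{u<..v}|?N. M)" 
      using b by (intro set_integral_mono ci si uv) auto
    ultimately show ?thesis using em by (simp add: set_integral_const meas mult.commute)
  qed
  show "(LINT y:{s<..v}|?N. f y) = (LINT y:{s<..u}|?N. f y) + (LINT y:{u<..v}|?N. f y)"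
    if uv: "s \<le> u" "u \<le> v" "v \<le> t" for u v
  proof -
    have "{s<..v} = {s<..u} \<union> {u<..v}" using uv by auto
    then show ?thesis using si[of s u] si[of u v] uv by (simp add: set_integral_Un disjoint_iff)
  qed
qed

text \<open>A solution in the hyperbolic null coordinates \<open>U = exp (- w) (Z\<^sub>1 + Z\<^sub>2)\<close> and \<open>V = exp w (Z\<^sub>1 - Z\<^sub>2)\<close>.
  The Stieltjes integral equation is replaced by inequalities on subintervals, for all integrands
  \<open>p exp (- w) + q exp w\<close>; in this form it survives pointwise limits and concatenation.\<close>

definition esol :: "(real => real) => (real => real) => real => real => (real => real) => (real => real) => (real => real) => bool" where
  "esol w \<gamma> a b U V K \<longleftrightarrow> mono_on {a..b} K \<and> rcont_on a b K \<and>
    (\<forall>t\<in>{a..b}. 0 \<le> exp (w t) * U t + exp (- w t) * V t) \<and>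
    (\<forall>u v m M p q. a \<le> u \<longrightarrow> u \<le> v \<longrightarrow> v \<le> b \<longrightarrow>
       (\<forall>y\<in>{u..v}. m \<le> p * exp (- w y) + q * exp (w y) \<and> p * exp (- w y) + q * exp (w y) \<le> M) \<longrightarrow>
       m * (K v - K u) - M * (\<gamma> v - \<gamma> u) \<le> p * (U v - U u) + q * (V v - V u)) \<and>
    (\<forall>u v. a \<le> u \<longrightarrow> u < v \<longrightarrow> v \<le> b \<longrightarrow> K u < K v \<longrightarrow>
       (\<exists>r\<in>{u<..v}. exp (w r) * U r + exp (- w r) * V r = 0 \<and> K r = K v))"

lemma esolD:
  assumes "esol w \<gamma> a b U V K"
  shows "mono_on {a..b} K" "rcont_on a b K"
    and "\<And>t. a \<le> t ==> t \<le> b ==> 0 \<le> exp (w t) * U t + exp (- w t) * V t"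
    and "\<And>u v m M p q. a \<le> u ==> u \<le> v ==> v \<le> b ==>
       (\<And>y. u \<le> y ==> y \<le> v ==> m \<le> p * exp (- w y) + q * exp (w y) \<and> p * exp (- w y) + q * exp (w y) \<le> M) ==>
       m * (K v - K u) - M * (\<gamma> v - \<gamma> u) \<le> p * (U v - U u) + q * (V v - V u)"
    and "\<And>u v m M p q. a \<le> u ==> u \<le> v ==> v \<le> b ==>
       (\<And>y. u \<le> y ==> y \<le> v ==> m \<le> p * exp (- w y) + q * exp (w y) \<and> p * exp (- w y) + q * exp (w y) \<le> M) ==>
       p * (U v - U u) + q * (V v - V u) \<le> M * (K v - K u) - m * (\<gamma> v - \<gamma> u)"
    and "\<And>u v. a \<le> u ==> u < v ==> v \<le> b ==> K u < K v ==>
       \<exists>r\<in>{u<..v}. exp (w r) * U r + exp (- w r) * V r = 0 \<and> K r = K v"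
proof -
  show low: "m * (K v - K u) - M * (\<gamma> v - \<gamma> u) \<le> p * (U v - U u) + q * (V v - V u)"
    if "a \<le> u" "u \<le> v" "v \<le> b" "\<And>y. u \<le> y ==> y \<le> v ==> m \<le> p * exp (- w y) + q * exp (w y) \<and> p * exp (- w y) + q * exp (w y) \<le> M"
    for u v m M p q using assms that unfolding esol_def by fastforce
  show "p * (U v - U u) + q * (V v - V u) \<le> M * (K v - K u) - m * (\<gamma> v - \<gamma> u)"
    if "a \<le> u" "u \<le> v" "v \<le> b" "\<And>y. u \<le> y ==> y \<le> v ==> m \<le> p * exp (- w y) + q * exp (w y) \<and> p * exp (- w y) + q * exp (w y) \<le> M"
    for u v m M p q
    \<comment> \<open>The upper estimate is the lower one for \<open>- p\<close> and
      \<open>- q\<close>, which negates and exchanges the two bounds.\<close>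
    using low[of u v "-M" "-p" "-q" "-m"] that by (simp add: algebra_simps)
qed (use assms in \<open>auto simp: esol_def\<close>)

lemma esol_subinterval:
  "esol w \<gamma> a b U V K ==> a \<le> c ==> d \<le> b ==> esol w \<gamma> c d U V K"
  unfolding esol_def by (auto simp: mono_on_def rcont_on_def)

text \<open>On short intervals the integrand is nearly constant, so the inequalities of
  \<open>esol\<close> and the bounds for the two Stieltjes integrals enclose the same increment up
  to e times the increment of K + \<gamma>; \<open>additive_gap_eq\<close> turns this into
  equality.\<close>

lemma esol_integral:
  fixes p q :: real
  assumes E: "esol w \<gamma> a b U V K" and w: "continuous_on {a..b} w"
    and g: "mono_on {a..b} \<gamma>" "rcont_on a b \<gamma>" and st: "a \<le> s" "s \<le> t" "t \<le> b"
  defines "f \<equiv> \<lambda>y. p * exp (- w y) + q * exp (w y)"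
  shows "p * (U t - U s) + q * (V t - V s) =
    (LINT y:{s<..t}|stieltjes K s t. f y) - (LINT y:{s<..t}|stieltjes \<gamma> s t. f y)"
proof -
  have sub: "{s..t} \<subseteq> {a..b}" using st by auto
  have Km: "mono_on {s..t} K" "rcont_on s t K"
    using esolD(1,2)[OF E] st mono_on_subset[OF _ sub] rcont_on_subset by blast+
  have gm: "mono_on {s..t} \<gamma>" "rcont_on s t \<gamma>"
    using g st mono_on_subset[OF _ sub] rcont_on_subset by blast+
  have f: "continuous_on {s..t} f"
    unfolding f_def by (intro continuous_intros continuous_on_subset[OF w sub])
  note IK = stieltjes_integral[OF Km st(2) f] and Ig = stieltjes_integral[OF gm st(2) f]
  define D where "D = (\<lambda>v. p * U v + q * V v - ((LINT y:{s<..v}|stieltjes K s t. f y) - (LINT y:{s<..v}|stieltjes \<gamma> s t. f y)))"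
  have uc: "uniformly_continuous_on {s..t} f" using f compact_uniformly_continuous by blast
  have "D t = D s"
  proof (rule additive_gap_eq[OF st(2), where G="\<lambda>v. K v + \<gamma> v"])
    fix e :: real assume "e > 0"
    then obtain d where d: "d > 0" "\<And>x y. x \<in> {s..t} ==> y \<in> {s..t} ==> dist y x < d ==> dist (f y) (f x) < e / 2"
      using uc[unfolded uniformly_continuous_on_def, rule_format, of "e/2"] by auto
    show "\<exists>d>0. \<forall>u v. s \<le> u \<longrightarrow> u \<le> v \<longrightarrow> v \<le> t \<longrightarrow> v - u < d \<longrightarrow> \<bar>D v - D u\<bar> \<le> e * (K v + \<gamma> v - (K u + \<gamma> u))"
    proof (intro exI[of _ d] conjI d(1) allI impI)
      fix u v assume uv: "s \<le> u" "u \<le> v" "v \<le> t" "v - u < d"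
      define m M where "m = f u - e / 2" and "M = f u + e / 2"
      have b: "m \<le> f y \<and> f y \<le> M" if "u \<le> y" "y \<le> v" for y
        using d(2)[of u y] that uv unfolding m_def M_def by (auto simp: dist_real_def abs_if split: if_splits)
      have 1: "m * (K v - K u) - M * (\<gamma> v - \<gamma> u) \<le> p * (U v - U u) + q * (V v - V u)"
        "p * (U v - U u) + q * (V v - V u) \<le> M * (K v - K u) - m * (\<gamma> v - \<gamma> u)"
        using esolD(4,5)[OF E, of u v m p q M] b uv st unfolding f_def by auto
      have b': "m \<le> f y \<and> f y \<le> M" if "y \<in> {u..v}" for y using b that by auto
      note 2 = IK(2)[OF uv(1-3) b'] Ig(2)[OF uv(1-3) b'] IK(3)[OF uv(1-3)] Ig(3)[OF uv(1-3)]
      have "D v - D u = p * (U v - U u) + q * (V v - V u) - ((LINT y:{u<..v}|stieltjes K s t. f y) - (LINT y:{u<..v}|stieltjes \<gamma> s t. f y))"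
        unfolding D_def 2(3,4) by (simp add: algebra_simps)
      moreover have "e * (K v + \<gamma> v - (K u + \<gamma> u)) = (M - m) * (K v - K u) + (M - m) * (\<gamma> v - \<gamma> u)"
        unfolding M_def m_def by (simp add: algebra_simps)
      ultimately show "\<bar>D v - D u\<bar> \<le> e * (K v + \<gamma> v - (K u + \<gamma> u))"
        using 1 2(1,2) by (simp add: abs_le_iff left_diff_distrib)
    qed
  qed
  then show ?thesis unfolding D_def by (simp add: algebra_simps set_lebesgue_integral_def)
qed

text \<open>A time u with positive first coordinate lies in some (x, y] on which K is constant, and
  rational end points reduce these intervals to countably many null sets. To the left of u the
  interval comes from the contact clause of \<open>esol\<close>: growth of K over (s, u] is complete
  at some zero, which cannot be u. To the right it comes from right-continuity of \<gamma>.\<close>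

lemma esol_carried:
  assumes E: "esol w \<gamma> a b U V K" and w: "continuous_on {a..b} w"
    and g: "rcont_on a b \<gamma>" and st: "a \<le> s" "s \<le> t" "t \<le> b"
  shows "AE u in stieltjes K s t. u \<in> {s<..t} \<longrightarrow> exp (w u) * U u + exp (- w u) * V u = 0"
proof -
  have sub: "{s..t} \<subseteq> {a..b}" using st by auto
  have Km: "mono_on {s..t} K" "rcont_on s t K"
    using esolD(1,2)[OF E] st mono_on_subset[OF _ sub] rcont_on_subset by blast+
  note N = stieltjes_props[OF Km st(2)]
  let ?N = "stieltjes K s t"
  have mono: "K x \<le> K y" if "s \<le> x" "x \<le> y" "y \<le> t" for x y using Km(1) that by (auto simp: mono_on_def)
  define Q where "Q = {(x, y). x \<in> \<rat> \<union> {t} \<and> y \<in> \<rat> \<union> {t} \<and> s \<le> x \<and> x \<le> y \<and> y \<le> t \<and> K x = K y}"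
  have "Q \<subseteq> (\<rat> \<union> {t}) \<times> (\<rat> \<union> {t})" unfolding Q_def by auto
  then have cQ: "countable Q" by (rule countable_subset) (auto intro: countable_rat)
  have "(\<Union>(x, y)\<in>Q. {x<..y}) \<in> null_sets ?N"
    by (rule null_sets_UN'[OF cQ]) (auto simp: Q_def null_sets_def N)
  moreover have "u \<in> (\<Union>(x, y)\<in>Q. {x<..y})" if u: "u \<in> {s<..t}" and nz: "exp (w u) * U u + exp (- w u) * V u \<noteq> 0" for u
  proof -
    have pos: "exp (w u) * U u + exp (- w u) * V u > 0" using esolD(3)[OF E, of u] u st nz by auto
    have "\<exists>x. s \<le> x \<and> x < u \<and> K x = K u"
    proof (rule ccontr)
      assume no: "\<not> ?thesis"
      then have "K s < K u" using u mono[of s u] by force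
      then obtain r where "r \<in> {s<..u}" "exp (w r) * U r + exp (- w r) * V r = 0" "K r = K u"
        using esolD(6)[OF E, of s u] u st by auto
      then show False using no nz by (metis greaterThanAtMost_iff less_eq_real_def)
    qed
    then obtain x where x: "s \<le> x" "x < u" "K x = K u" by blast
    obtain x' where x': "x' \<in> \<rat>" "x < x'" "x' < u" using Rats_dense_in_real[OF x(2)] by blast
    have Kx': "K x' = K u" using mono[of x x'] mono[of x' u] x x' u by auto
    have "\<exists>y. y \<in> \<rat> \<union> {t} \<and> u \<le> y \<and> y \<le> t \<and> K y = K u"
    proof (cases "u = t")
      case False
      then have ut: "u < t" using u by auto
      have "\<exists>y>u. y \<le> t \<and> K y = K u"
      proof (rule ccontr)
        assume no: "\<not> ?thesis"
        obtain B where B: "\<And>y. y \<in> {a..b} ==> norm (w y) \<le> B"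
          using compact_imp_bounded[OF compact_continuous_image[OF w compact_Icc]] unfolding bounded_iff by (metis imageI)
        have wr: "(w \<longlongrightarrow> w u) (at_right u)"
        proof -
          have "(w \<longlongrightarrow> w u) (at u within {a..b})" using w u st by (auto simp: continuous_on_def)
          then have "(w \<longlongrightarrow> w u) (at u within {u..b})" using u st by (elim tendsto_within_subset) auto
          then show ?thesis using ut st at_within_Icc_at_right[of u b] by auto
        qed
        have gr: "(\<gamma> \<longlongrightarrow> \<gamma> u) (at_right u)" using g ut u st by (auto simp: rcont_on_def continuous_within)
        \<comment> \<open>A lower bound for twice the first coordinate at r: the upward push of K is
          dropped, and \<gamma> enters with the largest possible factor. It is positive just after
          u.\<close>
        let ?h = "\<lambda>r. exp (w r) * U u + exp (- w r) * V u - exp (2 * B) * 2 * (\<gamma> r - \<gamma> u)"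
        have "(?h \<longlongrightarrow> exp (w u) * U u + exp (- w u) * V u - exp (2 * B) * 2 * (\<gamma> u - \<gamma> u)) (at_right u)"
          by (intro tendsto_intros wr gr)
        then have "(?h \<longlongrightarrow> exp (w u) * U u + exp (- w u) * V u) (at_right u)" by simp
        then have "eventually (\<lambda>r. ?h r > 0) (at_right u)" using pos by (rule order_tendstoD)
        then obtain z where z: "z > u" "\<And>r. u < r ==> r < z ==> ?h r > 0" unfolding eventually_at_right_field by blast
        define v where "v = min t ((u + z) / 2)"
        have v: "u < v" "v \<le> t" "v < z" using z ut by (auto simp: v_def min_def)
        have "K u < K v" using no v mono[of u v] u by force
        then obtain r where r: "u < r" "r \<le> v" "exp (w r) * U r + exp (- w r) * V r = 0"
          using esolD(6)[OF E, of u v] u v st by auto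
        have "0 * (K r - K u) - exp (2*B) * 2 * (\<gamma> r - \<gamma> u) \<le> exp (w r) * (U r - U u) + exp (- w r) * (V r - V u)"
        proof (rule esolD(4)[OF E])
          fix y assume y: "u \<le> y" "y \<le> r"
          have "\<bar>w y\<bar> \<le> B" "\<bar>w r\<bar> \<le> B" using B[of y] B[of r] y u v r st by auto
          then have "exp (w r - w y) \<le> exp (2*B)" "exp (w y - w r) \<le> exp (2*B)" by (auto simp: abs_le_iff)
          then have "exp (w r - w y) + exp (w y - w r) \<le> exp (2*B) * 2" by linarith
          then show "0 \<le> exp (w r) * exp (- w y) + exp (- w r) * exp (w y) \<and> exp (w r) * exp (- w y) + exp (- w r) * exp (w y) \<le> exp (2 * B) * 2"
            by (auto simp: exp_add[symmetric])
        qed (use u v r st in auto)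
        moreover have "?h r > 0" using z r v by auto
        ultimately show False using r(3) by (simp add: algebra_simps)
      qed
      then obtain y where y: "u < y" "y \<le> t" "K y = K u" by blast
      obtain y' where y': "y' \<in> \<rat>" "u < y'" "y' < y" using Rats_dense_in_real[OF y(1)] by blast
      have "K y' = K u" using mono[of u y'] mono[of y' y] y y' u by auto
      then show ?thesis using y y' by auto
    qed auto
    then obtain y where "y \<in> \<rat> \<union> {t}" "u \<le> y" "y \<le> t" "K y = K u" by blast
    then have "(x', y) \<in> Q" "u \<in> {x'<..y}" using x x' Kx' by (auto simp: Q_def)
    then show ?thesis by (intro UN_I[of "(x', y)"]) auto
  qed
  ultimately show ?thesis by (intro AE_I'[where N="\<Union>(x, y)\<in>Q. {x<..y}"]) auto
qed

text \<open>The inverse of the passage to null coordinates.\<close>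

definition zvec :: "(real => real) => (real => real) => (real => real) => real => real^2" where
  "zvec w U V t = vector [(exp (w t) * U t + exp (- w t) * V t) / 2, (exp (w t) * U t - exp (- w t) * V t) / 2]"

lemma vec2_integral_component:
  fixes f :: "real => real^2"
  assumes "\<And>i. set_integrable N A (\<lambda>y. f y $ i)"
  shows "(LINT y:A|N. f y) $ i = (LINT y:A|N. f y $ i)"
proof -
  have "integrable N (\<lambda>y. \<Sum>i\<in>UNIV. (indicator A y *\<^sub>R f y $ i) *\<^sub>R axis i (1::real))"
    using assms unfolding set_integrable_def by (intro Bochner_Integration.integrable_sum integrable_scaleR_left) auto
  also have "(\<lambda>y. \<Sum>i\<in>UNIV. (indicator A y *\<^sub>R f y $ i) *\<^sub>R axis i (1::real)) = (\<lambda>y. indicator A y *\<^sub>R f y)"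
    by (auto simp: fun_eq_iff vec_eq_iff sum_2 axis_def forall_2)
  finally have "integrable N (\<lambda>y. indicator A y *\<^sub>R f y)" .
  from integral_bounded_linear[OF bounded_linear_vec_nth this, of i] show ?thesis
    unfolding set_lebesgue_integral_def by simp
qed

text \<open>The entries cosh and sinh of \<open>w t - w u\<close> are combinations of
  \<open>exp (- w u)\<close> and \<open>exp (w u)\<close> with coefficients fixed by t, so each
  component is an instance of \<open>esol_integral\<close>.\<close>

theorem esol_imp_solution_pair:
  assumes E: "esol w \<gamma> a b U V K" and w: "continuous_on {a..b} w"
    and g: "mono_on {a..b} \<gamma>" "rcont_on a b \<gamma>"
  shows "solution_pair w \<gamma> {a..b} (zvec w U V) K"
  unfolding solution_pair_def
proof (intro conjI ballI impI)
  show "cadlag_on {a..b} K" "mono_on {a..b} K" using cadlag_on_mono esolD(1,2)[OF E] by auto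
  fix t assume t: "t \<in> {a..b}"
  show "0 \<le> zvec w U V t \<bullet> e1" using esolD(3)[OF E, of t] t by (simp add: zvec_def inner_e1)
next
  fix s t assume st: "s \<in> {a..b}" "t \<in> {a..b}" "s \<le> t"
  then have st': "a \<le> s" "s \<le> t" "t \<le> b" by auto
  show "AE u in stieltjes K s t. u \<in> {s<..t} \<longrightarrow> zvec w U V u \<bullet> e1 = 0"
    using esol_carried[OF E w g(2) st'] by (simp add: zvec_def inner_e1)
  have sub: "{s..t} \<subseteq> {a..b}" using st by auto
  have Km: "mono_on {s..t} K" "rcont_on s t K"
    using esolD(1,2)[OF E] st' mono_on_subset[OF _ sub] rcont_on_subset by blast+
  have gm: "mono_on {s..t} \<gamma>" "rcont_on s t \<gamma>"
    using g st' mono_on_subset[OF _ sub] rcont_on_subset by blast+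
  have ws: "continuous_on {s..t} w" by (rule continuous_on_subset[OF w sub])
  let ?f = "\<lambda>u. mat_exp ((w t - w u) *\<^sub>R A_mat) *v e1"
  have c: "continuous_on {s..t} (\<lambda>u. ?f u $ i)" for i
  proof -
    have "continuous_on {s..t} (\<lambda>u. ?f u $ 1)" "continuous_on {s..t} (\<lambda>u. ?f u $ 2)"
      unfolding mat_exp_A_e1 by (intro continuous_intros ws)+
    then show ?thesis using exhaust_2[of i] by auto
  qed
  have comp: "(LINT u:{s<..t}|stieltjes F s t. ?f u) $ i = (LINT u:{s<..t}|stieltjes F s t. ?f u $ i)"
    if "mono_on {s..t} F" "rcont_on s t F" for F i
    using stieltjes_integral(1)[OF that st'(2) c] st' by (intro vec2_integral_component) auto
  have I: "p * (U t - U s) + q * (V t - V s) =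
    (LINT y:{s<..t}|stieltjes K s t. p * exp (- w y) + q * exp (w y)) - (LINT y:{s<..t}|stieltjes \<gamma> s t. p * exp (- w y) + q * exp (w y))" for p q
    by (rule esol_integral[OF E w g st'])
  have ch: "cosh (w t - w y) = exp (w t) / 2 * exp (- w y) + exp (- w t) / 2 * exp (w y)"
    "sinh (w t - w y) = exp (w t) / 2 * exp (- w y) + - exp (- w t) / 2 * exp (w y)" for y
    by (simp_all add: cosh_def sinh_def exp_diff exp_minus field_simps)
  have s1: "exp (w t) / 2 * U s + exp (- w t) / 2 * V s = cosh (w t - w s) * zvec w U V s $ 1 + sinh (w t - w s) * zvec w U V s $ 2"
    "exp (w t) / 2 * U s + - exp (- w t) / 2 * V s = sinh (w t - w s) * zvec w U V s $ 1 + cosh (w t - w s) * zvec w U V s $ 2"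
    unfolding zvec_def ch by (simp_all add: field_simps exp_minus)
  have t1: "zvec w U V t $ 1 = exp (w t) / 2 * U s + exp (- w t) / 2 * V s + (exp (w t) / 2 * (U t - U s) + exp (- w t) / 2 * (V t - V s))"
    "zvec w U V t $ 2 = exp (w t) / 2 * U s + - exp (- w t) / 2 * V s + (exp (w t) / 2 * (U t - U s) + - exp (- w t) / 2 * (V t - V s))"
    by (simp_all add: zvec_def field_simps)
  show "zvec w U V t = mat_exp ((w t - w s) *\<^sub>R A_mat) *v zvec w U V s +
          ((LINT u:{s<..t}|stieltjes K s t. ?f u) - (LINT u:{s<..t}|stieltjes \<gamma> s t. ?f u))"
    unfolding vec_eq_iff forall_2 vector_add_component vector_minus_component comp[OF Km] comp[OF gm] mat_exp_A_e1
    unfolding mat_exp_A_mult t1 s1 I ch(1)[symmetric] ch(2)[symmetric] by simp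
qed

lemma esol_concat:
  assumes 1: "esol w \<gamma> a b U V K" and 2: "esol w \<gamma> b c U V K" and ab: "a \<le> b" "b \<le> c"
  shows "esol w \<gamma> a c U V K"
  unfolding esol_def
proof (intro conjI allI impI ballI)
  have K1: "K x \<le> K y" if "a \<le> x" "x \<le> y" "y \<le> b" for x y using esolD(1)[OF 1] that by (auto simp: mono_on_def)
  have K2: "K x \<le> K y" if "b \<le> x" "x \<le> y" "y \<le> c" for x y using esolD(1)[OF 2] that by (auto simp: mono_on_def)
  show "mono_on {a..c} K"
  proof (rule mono_onI)
    fix x y assume "x \<in> {a..c}" "y \<in> {a..c}" "x \<le> y"
    then show "K x \<le> K y" using K1[of x y] K2[of x y] K1[of x b] K2[of b y] ab by (cases "y \<le> b"; cases "b \<le> x") auto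
  qed
  show "rcont_on a c K" using esolD(2)[OF 1] esolD(2)[OF 2] unfolding rcont_on_def by (metis atLeastLessThan_iff not_le)
  show "0 \<le> exp (w t) * U t + exp (- w t) * V t" if "t \<in> {a..c}" for t
    using esolD(3)[OF 1, of t] esolD(3)[OF 2, of t] that by (cases "t \<le> b") auto
  show "m * (K v - K u) - M * (\<gamma> v - \<gamma> u) \<le> p * (U v - U u) + q * (V v - V u)"
    if uv: "a \<le> u" "u \<le> v" "v \<le> c" and
      b: "\<forall>y\<in>{u..v}. m \<le> p * exp (- w y) + q * exp (w y) \<and> p * exp (- w y) + q * exp (w y) \<le> M" for u v m M p q
  proof -
    consider "v \<le> b" | "b \<le> u" | "u \<le> b" "b \<le> v" by linarith
    then show ?thesis
    proof cases
      case 1 then show ?thesis using esolD(4)[OF assms(1), of u v m p q M] uv b by auto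
    next
      case 2 then show ?thesis using esolD(4)[OF assms(2), of u v m p q M] uv b by auto
    next
      case 3
      then have "m * (K b - K u) - M * (\<gamma> b - \<gamma> u) \<le> p * (U b - U u) + q * (V b - V u)"
        using esolD(4)[OF assms(1), of u b m p q M] uv b by auto
      moreover have "m * (K v - K b) - M * (\<gamma> v - \<gamma> b) \<le> p * (U v - U b) + q * (V v - V b)"
        using esolD(4)[OF assms(2), of b v m p q M] uv b 3 by auto
      ultimately show ?thesis by (simp add: algebra_simps)
    qed
  qed
  show "\<exists>r\<in>{u<..v}. exp (w r) * U r + exp (- w r) * V r = 0 \<and> K r = K v"
    if uv: "a \<le> u" "u < v" "v \<le> c" "K u < K v" for u v
  \<comment> \<open>Growth of K after b gives a contact after b. Otherwise, if u < b < v, K already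
    has its final value at b and the contact is sought in (u, b].\<close>
  proof (cases "b < v \<and> K b < K v")
    case True
    show ?thesis
    proof (cases "u \<le> b")
      case T: True
      obtain r where "r \<in> {b<..v}" "exp (w r) * U r + exp (- w r) * V r = 0 \<and> K r = K v"
        using esolD(6)[OF 2, of b v] uv True by auto
      then show ?thesis using T by (intro bexI[of _ r]) auto
    next
      case False
      then show ?thesis using esolD(6)[OF 2, of u v] uv by auto
    qed
  next
    case F: False
    show ?thesis
    proof (cases "v \<le> b")
      case True
      then show ?thesis using esolD(6)[OF 1, of u v] uv by auto
    next
      case False
      then have "K b = K v" using F K2[of b v] uv by auto
      show ?thesis
      proof (cases "u < b")
        case True
        then obtain r where "r \<in> {u<..b}" "exp (w r) * U r + exp (- w r) * V r = 0 \<and> K r = K b"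
          using esolD(6)[OF 1, of u b] uv \<open>K b = K v\<close> by auto
        then show ?thesis using False \<open>K b = K v\<close> by (intro bexI[of _ r]) auto
      next
        case False
        then show ?thesis using esolD(6)[OF 2, of u v] uv by auto
      qed
    qed
  qed
qed

lemma rcont_on_cong:
  assumes "rcont_on a b F" "\<And>t. a \<le> t ==> t < b ==> F t = G t"
  shows "rcont_on a b G"
  unfolding rcont_on_def
proof
  fix t assume t: "t \<in> {a..<b}"
  have "eventually (\<lambda>y. F y = G y) (at_right t)"
    unfolding eventually_at_right_field using t assms(2) by (intro exI[of _ b]) auto
  moreover have "(F \<longlongrightarrow> F t) (at_right t)" using assms(1) t by (auto simp: rcont_on_def continuous_within)
  ultimately have "(G \<longlongrightarrow> F t) (at_right t)" by (rule Lim_transform_eventually[rotated])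
  then show "continuous (at_right t) G" using assms(2) t by (auto simp: continuous_within)
qed

text \<open>K and \<gamma> enter only through increments, so each may be shifted by a
  constant.\<close>

lemma esol_cong:
  assumes E: "esol w \<gamma> a b U V K"
    and eq: "\<And>t. a \<le> t ==> t \<le> b ==> U' t = U t" "\<And>t. a \<le> t ==> t \<le> b ==> V' t = V t"
      "\<And>t. a \<le> t ==> t \<le> b ==> K' t = K t + c" "\<And>t. a \<le> t ==> t \<le> b ==> \<gamma>' t = \<gamma> t + d"
  shows "esol w \<gamma>' a b U' V' K'"
proof -
  have "rcont_on a b (\<lambda>t. K t + c)" using esolD(2)[OF E] unfolding rcont_on_def by (auto intro: continuous_intros)
  then have "rcont_on a b K'" by (rule rcont_on_cong) (simp add: eq)
  moreover have "mono_on {a..b} K'" using esolD(1)[OF E] by (auto simp: mono_on_def eq)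
  moreover have "\<exists>r\<in>{u<..v}. exp (w r) * U' r + exp (- w r) * V' r = 0 \<and> K' r = K' v"
    if uv: "a \<le> u" "u < v" "v \<le> b" "K' u < K' v" for u v
  proof -
    have "K u < K v" using uv eq(3)[of u] eq(3)[of v] by auto
    then obtain r where "r \<in> {u<..v}" "exp (w r) * U r + exp (- w r) * V r = 0 \<and> K r = K v"
      using esolD(6)[OF E, of u v] uv by auto
    then show ?thesis using uv by (intro bexI[of _ r]) (auto simp: eq)
  qed
  moreover have "m * (K' v - K' u) - M * (\<gamma>' v - \<gamma>' u) \<le> p * (U' v - U' u) + q * (V' v - V' u)"
    if uv: "a \<le> u" "u \<le> v" "v \<le> b" and
      b: "\<forall>y\<in>{u..v}. m \<le> p * exp (- w y) + q * exp (w y) \<and> p * exp (- w y) + q * exp (w y) \<le> M" for u v m M p q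
    using esolD(4)[OF E, of u v m p q M] uv b by (auto simp: eq)
  ultimately show ?thesis using esolD(3)[OF E] unfolding esol_def by (auto simp: eq)
qed

section \<open>Reflection of the path between two jumps\<close>

definition runmax :: "(real => real) => real => real => real" where
  "runmax w a t = (SUP y\<in>{a..t}. - w y)"

lemma runmax_attained:
  assumes "continuous_on {a..t} w" "a \<le> t"
  obtains y where "a \<le> y" "y \<le> t" "runmax w a t = - w y"
    "\<And>x. a \<le> x ==> x \<le> t ==> - w x \<le> runmax w a t"
proof -
  obtain y where y: "y \<in> {a..t}" "\<And>x. x \<in> {a..t} ==> - w x \<le> - w y"
    using continuous_attains_sup[of "{a..t}" "\<lambda>x. - w x"] assms by (force intro: continuous_intros)
  have "runmax w a t = - w y" unfolding runmax_def using y by (intro cSup_eq_maximum) auto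
  then show thesis using y that[of y] by auto
qed

lemma runmax_mono:
  assumes "continuous_on {a..t} w" "a \<le> s" "s \<le> t"
  shows "runmax w a s \<le> runmax w a t"
proof -
  have "continuous_on {a..s} w" using assms by (auto intro: continuous_on_subset)
  then obtain y where y: "a \<le> y" "y \<le> s" "runmax w a s = - w y" using runmax_attained assms(2) by metis
  obtain z where z: "\<And>x. a \<le> x ==> x \<le> t ==> - w x \<le> runmax w a t" 
    using runmax_attained[OF assms(1)] assms by (metis order_trans)
  show ?thesis using z[of y] y assms by auto
qed

text \<open>The Skorokhod reflection of the parameter l: a state R (sinh (w + l), cosh (w + l)) is
  admissible when l is at least - w, and l grows just enough to remain so.\<close>

definition flow :: "(real => real) => real => real => real => real" where
  "flow w a t l = max l (runmax w a t)"

lemma flow_self: "l \<ge> - w a ==> flow w a a l = l"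
  by (simp add: flow_def runmax_def)

lemma flow_props:
  assumes w: "continuous_on {a..b} w"
  shows "\<And>t. a \<le> t ==> t \<le> b ==> - w t \<le> flow w a t l"
    and "\<And>s t. a \<le> s ==> s \<le> t ==> t \<le> b ==> flow w a s l \<le> flow w a t l"
    and "\<And>s t. a \<le> s ==> s \<le> t ==> t \<le> b ==> flow w a s l < flow w a t l ==>
       \<exists>r. s < r \<and> r \<le> t \<and> - w r = flow w a t l"
    and "\<And>t. a \<le> t ==> t \<le> b ==> l \<le> flow w a t l"
    and "\<And>t B. a \<le> t ==> t \<le> b ==> l \<le> B ==> (\<And>y. a \<le> y ==> y \<le> t ==> - w y \<le> B) ==> flow w a t l \<le> B"
proof -
  have wt: "continuous_on {a..t} w" if "t \<le> b" for t using w that by (auto intro: continuous_on_subset)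
  show "- w t \<le> flow w a t l" if "a \<le> t" "t \<le> b" for t
    using runmax_attained[OF wt[OF that(2)] that(1)] that unfolding flow_def by (metis le_max_iff_disj order_refl)
  show "flow w a s l \<le> flow w a t l" if "a \<le> s" "s \<le> t" "t \<le> b" for s t
    unfolding flow_def using runmax_mono[OF wt[OF that(3)] that(1,2)] by auto
  show "\<exists>r. s < r \<and> r \<le> t \<and> - w r = flow w a t l" if st: "a \<le> s" "s \<le> t" "t \<le> b" "flow w a s l < flow w a t l" for s t
  proof -
    have at: "a \<le> t" and sb: "s \<le> b" using st by auto
    obtain y where y: "a \<le> y" "y \<le> t" "runmax w a t = - w y" using runmax_attained[OF wt[OF st(3)] at] by metis
    have ll: "flow w a t l = - w y" using st(4) y(3) by (auto simp: flow_def)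
    obtain z where z: "\<And>x. a \<le> x ==> x \<le> s ==> - w x \<le> runmax w a s"
      using runmax_attained[OF wt[OF sb] st(1)] by metis
    have "s < y"
    proof (rule ccontr)
      assume "\<not> s < y"
      then have "- w y \<le> flow w a s l" using z[of y] y by (auto simp: flow_def)
      then show False using ll st by auto
    qed
    then show ?thesis using y ll by auto
  qed
  show "l \<le> flow w a t l" if "a \<le> t" "t \<le> b" for t by (simp add: flow_def)
  show "flow w a t l \<le> B" if "a \<le> t" "t \<le> b" "l \<le> B" "\<And>y. a \<le> y ==> y \<le> t ==> - w y \<le> B" for t B
    using runmax_attained[OF wt[OF that(2)] that(1)] that(3,4) unfolding flow_def by (metis max.bounded_iff)
qed

lemma flow_rcont:
  assumes w: "continuous_on {a..b} w"
  shows "rcont_on a b (\<lambda>t. flow w a t l)"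
  unfolding rcont_on_def
proof
  fix t assume t: "t \<in> {a..<b}"
  have wr: "(w \<longlongrightarrow> w t) (at_right t)"
  proof -
    have "(w \<longlongrightarrow> w t) (at t within {a..b})" using w t by (auto simp: continuous_on_def)
    then have "(w \<longlongrightarrow> w t) (at t within {t..b})" using t by (elim tendsto_within_subset) auto
    then show ?thesis using t at_within_Icc_at_right[of t b] by auto
  qed
  show "continuous (at_right t) (\<lambda>t. flow w a t l)"
    unfolding continuous_within
  proof (rule order_tendstoI)
    fix y assume "y < flow w a t l"
    then have "y < flow w a s l" if "t < s" "s < b" for s using flow_props(2)[OF w, of t s l] t that by auto
    then show "eventually (\<lambda>s. y < flow w a s l) (at_right t)"
      unfolding eventually_at_right_field using t by (intro exI[of _ b]) auto
  next
    fix y assume y: "flow w a t l < y"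
    then have "- w t < y" using flow_props(1)[OF w, of t l] t by auto
    then have "eventually (\<lambda>s. - w s < y) (at_right t)" using tendsto_minus[OF wr] by (simp add: order_tendstoD)
    then obtain c where c: "c > t" "\<And>s. t < s ==> s < c ==> - w s < y" unfolding eventually_at_right_field by blast
    have "flow w a s l < y" if s: "t < s" "s < min b c" for s
    proof (rule ccontr)
      assume no: "\<not> flow w a s l < y"
      then have "flow w a t l < flow w a s l" using y by auto
      then obtain r where "t < r" "r \<le> s" "- w r = flow w a s l" using flow_props(3)[OF w, of t s l] s t by auto
      then show False using c(2)[of r] s no by auto
    qed
    then show "eventually (\<lambda>s. flow w a s l < y) (at_right t)"
      unfolding eventually_at_right_field using t c(1) by (intro exI[of _ "min b c"]) auto
  qed
qed

lemma sinh_state: "exp (w::real) * (R * exp l) + exp (- w) * (- (R * exp (- l))) = 2 * R * sinh (w + l)"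
  by (simp add: sinh_def exp_add exp_minus exp_diff field_simps)

text \<open>With R constant, dU = R exp l dl, dV = R exp (- l) dl and dK = R dl. The parameter moves
  only at times with l = - w, where these are the required exp (- w) dK and exp w dK.\<close>

lemma esol_flow:
  assumes w: "continuous_on {a..b} w" and R: "R \<ge> 0" and g: "\<And>t. a \<le> t ==> t \<le> b ==> \<gamma> t = \<gamma> a"
  shows "esol w \<gamma> a b (\<lambda>t. R * exp (flow w a t l)) (\<lambda>t. - (R * exp (- flow w a t l))) (\<lambda>t. c + R * flow w a t l)"
  unfolding esol_def sinh_state
proof (intro conjI allI impI ballI)
  note F = flow_props[OF w]
  show "mono_on {a..b} (\<lambda>t. c + R * flow w a t l)" using F(2) R by (auto simp: mono_on_def intro!: mult_left_mono)
  show "rcont_on a b (\<lambda>t. c + R * flow w a t l)" using flow_rcont[OF w] unfolding rcont_on_def by (auto intro!: continuous_intros)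
  show "0 \<le> 2 * R * sinh (w t + flow w a t l)" if "t \<in> {a..b}" for t using F(1)[of t l] that R by auto
  fix u v assume uv: "a \<le> u" "v \<le> b"
  show "\<exists>r\<in>{u<..v}. 2 * R * sinh (w r + flow w a r l) = 0 \<and> c + R * flow w a r l = c + R * flow w a v l" 
    if lt: "u < v" "c + R * flow w a u l < c + R * flow w a v l"
  proof -
    have "flow w a u l < flow w a v l" using lt R by (smt (verit) mult_left_mono)
    then obtain r where r: "u < r" "r \<le> v" "- w r = flow w a v l" using F(3)[of u v l] uv lt by auto
    then have "flow w a r l = flow w a v l" using F(1)[of r l] F(2)[of r v l] uv by auto
    then show ?thesis using r by (intro bexI[of _ r]) auto
  qed
  fix m M p q assume uv': "u \<le> v" and b: "\<forall>y\<in>{u..v}. m \<le> p * exp (- w y) + q * exp (w y) \<and> p * exp (- w y) + q * exp (w y) \<le> M"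
  let ?l = "flow w a u l" and ?l' = "flow w a v l"
  define h where "h = (\<lambda>x. p * exp x - q * exp (- x))"
  have "m * (?l' - ?l) \<le> h ?l' - h ?l"
  proof (cases "?l < ?l'")
    case True
    have dh: "DERIV h x :> p * exp x + q * exp (- x)" for x unfolding h_def by (auto intro!: derivative_eq_intros)
    \<comment> \<open>The mean value z lies between the two values of l, so by the intermediate
      value theorem it is \<open>- w x\<close> for some x in [u, v], where the lower bound m
      applies.\<close>
    obtain z where z: "?l < z" "z < ?l'" "h ?l' - h ?l = (?l' - ?l) * (p * exp z + q * exp (- z))"
      using MVT2[OF True, of h "\<lambda>x. p * exp x + q * exp (- x)"] dh by blast
    obtain r where r: "u < r" "r \<le> v" "- w r = ?l'" using F(3)[of u v l] True uv uv' by auto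
    have "- w u \<le> z" "z \<le> - w r" using F(1)[of u l] z r uv uv' by auto
    moreover have "continuous_on {u..r} (\<lambda>x. - w x)" using r uv by (intro continuous_intros continuous_on_subset[OF w]) auto
    ultimately obtain x where x: "u \<le> x" "x \<le> r" "- w x = z" using IVT'[of "\<lambda>x. - w x" u z r] r by auto
    have xv: "x \<in> {u..v}" using x r by auto
    have "m \<le> p * exp z + q * exp (- z)" using b[rule_format, OF xv] x(3)[symmetric] by simp
    then show ?thesis using z(3) True by (simp add: mult.commute)
  next
    case False
    then have "?l = ?l'" using F(2)[of u v l] uv uv' by auto
    then show ?thesis by simp
  qed
  then have "R * (m * (?l' - ?l)) \<le> R * (h ?l' - h ?l)" using R by (rule mult_left_mono)
  moreover have "\<gamma> v = \<gamma> u" using g[of u] g[of v] uv uv' by auto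
  ultimately show "m * (c + R * ?l' - (c + R * ?l)) - M * (\<gamma> v - \<gamma> u)
       \<le> p * (R * exp ?l' - R * exp ?l) + q * (- (R * exp (- ?l')) - - (R * exp (- ?l)))"
    unfolding h_def by (simp add: algebra_simps)
qed

text \<open>At b the path \<gamma> jumps by x and K by k, so the first coordinate of Z jumps by k -
  x and the second is kept. The last hypothesis preserves the contact clause: it covers both a jump
  of K at b and a contact that the unmodified path had at b.\<close>

lemma esol_jump:
  assumes E: "esol w \<gamma>0 a b U0 V0 K0" and ab: "a < b"
    and eq: "\<And>t. a \<le> t ==> t < b ==> U t = U0 t" "\<And>t. a \<le> t ==> t < b ==> V t = V0 t"
      "\<And>t. a \<le> t ==> t < b ==> K t = K0 t" "\<And>t. a \<le> t ==> t < b ==> \<gamma> t = \<gamma>0 t"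
    and jmp: "U b = U0 b + exp (- w b) * (k - x)" "V b = V0 b + exp (w b) * (k - x)" "K b = K0 b + k" "\<gamma> b = \<gamma>0 b + x"
    and k: "k \<ge> 0" "x \<ge> 0" and z: "exp (w b) * U b + exp (- w b) * V b \<ge> 0"
      "k > 0 \<or> exp (w b) * U0 b + exp (- w b) * V0 b = 0 ==> exp (w b) * U b + exp (- w b) * V b = 0"
  shows "esol w \<gamma> a b U V K"
  unfolding esol_def
proof (intro conjI allI impI ballI)
  have K0: "K0 x \<le> K0 y" if "a \<le> x" "x \<le> y" "y \<le> b" for x y using esolD(1)[OF E] that by (auto simp: mono_on_def)
  show "mono_on {a..b} K"
  proof (rule mono_onI)
    fix x y assume "x \<in> {a..b}" "y \<in> {a..b}" "x \<le> y"
    then show "K x \<le> K y" using K0[of x y] eq(3)[of x] eq(3)[of y] jmp(3) k(1) ab by (cases "y < b"; cases "x < b") auto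
  qed
  show "rcont_on a b K" by (rule rcont_on_cong[OF esolD(2)[OF E]]) (simp add: eq)
  show "0 \<le> exp (w t) * U t + exp (- w t) * V t" if "t \<in> {a..b}" for t
    using that z(1) esolD(3)[OF E, of t] eq(1,2)[of t] by (cases "t < b") auto
  fix u v assume uv: "a \<le> u" "v \<le> b"
  show "\<exists>r\<in>{u<..v}. exp (w r) * U r + exp (- w r) * V r = 0 \<and> K r = K v" if lt: "u < v" "K u < K v"
  proof (cases "v < b")
    case True
    then obtain r where "r \<in> {u<..v}" "exp (w r) * U0 r + exp (- w r) * V0 r = 0 \<and> K0 r = K0 v"
      using esolD(6)[OF E, of u v] uv lt eq(3)[of u] eq(3)[of v] by auto
    then show ?thesis using True uv by (intro bexI[of _ r]) (auto simp: eq)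
  next
    case False
    then have v: "v = b" using uv by auto
    show ?thesis
    proof (cases "k > 0")
      case True then show ?thesis using z(2) lt v by (intro bexI[of _ b]) auto
    next
      case False
      then have "k = 0" using k by auto
      then obtain r where r: "r \<in> {u<..b}" "exp (w r) * U0 r + exp (- w r) * V0 r = 0" "K0 r = K0 b"
        using esolD(6)[OF E, of u b] uv lt eq(3)[of u] jmp(3) v by auto
      then show ?thesis using z(2) uv \<open>k = 0\<close> jmp(3) v lt by (intro bexI[of _ r]; cases "r < b") (auto simp: eq)
    qed
  qed
  fix m M p q assume uv': "u \<le> v" and b: "\<forall>y\<in>{u..v}. m \<le> p * exp (- w y) + q * exp (w y) \<and> p * exp (- w y) + q * exp (w y) \<le> M"
  have E0: "m * (K0 v - K0 u) - M * (\<gamma>0 v - \<gamma>0 u) \<le> p * (U0 v - U0 u) + q * (V0 v - V0 u)"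
    using esolD(4)[OF E, of u v m p q M] uv uv' b by auto
  show "m * (K v - K u) - M * (\<gamma> v - \<gamma> u) \<le> p * (U v - U u) + q * (V v - V u)"
  proof (cases "v < b")
    case True then show ?thesis using E0 uv uv' by (simp add: eq)
  next
    case False
    then have v: "v = b" using uv by auto
    show ?thesis
    proof (cases "u < b")
      case True
      have bv: "v \<in> {u..v}" using uv' by auto
      have "m \<le> p * exp (- w b) + q * exp (w b)" "p * exp (- w b) + q * exp (w b) \<le> M" using b[rule_format, OF bv] v by auto
      then have "m * k \<le> (p * exp (- w b) + q * exp (w b)) * k" "(p * exp (- w b) + q * exp (w b)) * x \<le> M * x"
        using k by (auto intro: mult_right_mono)
      then show ?thesis using E0 True uv v eq[of u] by (simp add: jmp algebra_simps)
    next
      case False then show ?thesis using v uv' by auto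
    qed
  qed
qed

section \<open>Explicit solutions for piecewise constant gamma\<close>

lemma arsinh_le_iff: "arsinh x \<le> arsinh y \<longleftrightarrow> x \<le> (y::real)"
  by (metis arsinh_less_iff_real not_le)

text \<open>States are parametrised as \<open>Z = R (sinh (w + l), cosh (w + l))\<close>; a jump \<open>x\<close> of \<open>\<gamma>\<close> replaces \<open>Z\<^sub>1\<close> by
  the positive part of \<open>Z\<^sub>1 - x\<close> and keeps \<open>Z\<^sub>2\<close>.\<close>

definition jump_z :: "real => real => real => real => real" where
  "jump_z w x R l = max 0 (R * sinh (w + l) - x)"

definition jump_R :: "real => real => real => real => real" where
  "jump_R w x R l = sqrt ((R * cosh (w + l))\<^sup>2 - (jump_z w x R l)\<^sup>2)"

definition jump_l :: "real => real => real => real => real" where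
  "jump_l w x R l = arsinh (jump_z w x R l / jump_R w x R l) - w"

text \<open>The radius satisfies R^2 = Z2^2 - Z1^2, so keeping Z2 and lowering Z1 enlarges it. If Z1
  drops to y, then Z1^2 - y^2 is at most 2 x Z1, and completing the square gives the upper bound;
  being linear in x, it can be summed over many jumps.\<close>

lemma jump_props:
  assumes R: "R > 0" and l: "- w \<le> l" and x: "x \<ge> 0"
  shows "R \<le> jump_R w x R l" "- w \<le> jump_l w x R l" "jump_l w x R l \<le> l"
    and "jump_R w x R l \<le> R + x * sinh (w + l)"
    and "jump_R w x R l * sinh (w + jump_l w x R l) = jump_z w x R l"
    and "jump_R w x R l * cosh (w + jump_l w x R l) = R * cosh (w + l)"
proof -
  let ?y = "jump_z w x R l" and ?R = "jump_R w x R l" and ?r = "w + l"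
  have s0: "0 \<le> sinh ?r" using l by simp
  have y: "0 \<le> ?y" "?y \<le> R * sinh ?r" "R * sinh ?r - ?y \<le> x" using R s0 x unfolding jump_z_def by auto
  have id: "(R * cosh ?r)\<^sup>2 - (R * sinh ?r)\<^sup>2 = R\<^sup>2"
    using cosh_square_eq[of ?r] by (simp add: power_mult_distrib algebra_simps)
  have y2: "?y\<^sup>2 \<le> (R * sinh ?r)\<^sup>2" using y by (intro power_mono) auto
  have R2: "?R\<^sup>2 = (R * cosh ?r)\<^sup>2 - ?y\<^sup>2" unfolding jump_R_def using y2 id by (subst real_sqrt_pow2) (auto, smt (verit) zero_le_power2)
  show RR: "R \<le> ?R"
  proof (rule power2_le_imp_le)
    show "R\<^sup>2 \<le> ?R\<^sup>2" using R2 y2 id by linarith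
    show "0 \<le> ?R" unfolding jump_R_def using y2 id by (smt (verit) real_sqrt_ge_zero zero_le_power2)
  qed
  have Rp: "?R > 0" using RR R by linarith
  show sh: "?R * sinh (w + jump_l w x R l) = ?y" using Rp by (simp add: jump_l_def)
  have "(?R * cosh (w + jump_l w x R l))\<^sup>2 = (R * cosh ?r)\<^sup>2"
  proof -
    have "?R\<^sup>2 * (sinh (w + jump_l w x R l))\<^sup>2 = ?y\<^sup>2" using sh by (metis power_mult_distrib)
    then show ?thesis using R2 by (simp only: power_mult_distrib cosh_square_eq distrib_left mult_1_right)
  qed
  then show "?R * cosh (w + jump_l w x R l) = R * cosh ?r"
    using Rp R by (intro power2_eq_imp_eq[of "?R * cosh (w + jump_l w x R l)"]) auto
  have "arsinh 0 \<le> arsinh (?y / ?R)" unfolding arsinh_le_iff using y Rp by simp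
  then show "- w \<le> jump_l w x R l" by (simp add: jump_l_def)
  have "?y / ?R \<le> (R * sinh ?r) / R" using y RR R by (intro frac_le) auto
  then have "arsinh (?y / ?R) \<le> arsinh (sinh ?r)" by (subst arsinh_le_iff) (use R in simp)
  then show "jump_l w x R l \<le> l" by (simp add: jump_l_def arsinh_sinh_real)
  show "?R \<le> R + x * sinh ?r"
  proof (rule power2_le_imp_le)
    have "(R * sinh ?r)\<^sup>2 - ?y\<^sup>2 = (R * sinh ?r - ?y) * (R * sinh ?r + ?y)" by (simp add: power2_eq_square algebra_simps)
    also have "\<dots> \<le> x * (2 * (R * sinh ?r))" using y x R s0 by (intro mult_mono) auto
    finally have "?R\<^sup>2 \<le> R\<^sup>2 + x * (2 * (R * sinh ?r))" using R2 id by linarith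
    also have "\<dots> = (R + x * sinh ?r)\<^sup>2 - (x * sinh ?r)\<^sup>2" by (simp add: power2_eq_square algebra_simps)
    also have "\<dots> \<le> (R + x * sinh ?r)\<^sup>2" by simp
    finally show "?R\<^sup>2 \<le> (R + x * sinh ?r)\<^sup>2" .
    show "0 \<le> R + x * sinh ?r" using R x s0 by simp
  qed
qed

lemma jump_kill:
  assumes "R > 0" "- w \<le> l" "R * sinh (w + l) \<le> x"
  shows "jump_R w x R l = R * cosh (w + l)" "jump_l w x R l = - w"
  using assms by (simp_all add: jump_R_def jump_l_def jump_z_def)

lemma jump_0:
  assumes R: "R > 0" and l: "- w \<le> l"
  shows "jump_R w 0 R l = R" "jump_l w 0 R l = l" "jump_z w 0 R l = R * sinh (w + l)"
proof -
  show 1: "jump_z w 0 R l = R * sinh (w + l)" using R l by (simp add: jump_z_def)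
  have "(R * cosh (w + l))\<^sup>2 - (R * sinh (w + l))\<^sup>2 = R\<^sup>2"
    using cosh_square_eq[of "w + l"] by (simp add: power_mult_distrib algebra_simps)
  then show 2: "jump_R w 0 R l = R" using R by (simp add: jump_R_def 1)
  show "jump_l w 0 R l = l" using R by (simp add: jump_l_def 1 2 arsinh_sinh_real)
qed

lemma singleton_esol:
  assumes "0 \<le> exp (w a) * U a + exp (- w a) * V a"
  shows "esol w \<gamma> a a U V K"
proof -
  have "u = a \<and> v = a" if "a \<le> u" "u \<le> v" "v \<le> a" for u v :: real using that by auto
  then have "m * (K v - K u) - M * (\<gamma> v - \<gamma> u) \<le> p * (U v - U u) + q * (V v - V u)"
    if "a \<le> u" "u \<le> v" "v \<le> a" for u v m M p q using that by fastforce
  then show ?thesis using assms unfolding esol_def by (auto simp: mono_on_def rcont_on_def)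
qed

text \<open>Nodes are indexed backwards in time because the jump times accumulate at 0; starting
  earlier only means a larger n. Ties of nodes are allowed since the jump times are only
  nonincreasing. \<open>R k\<close> and \<open>l k\<close> describe the state just after the jump at
  \<open>\<tau> k\<close>.\<close>

locale chain =
  fixes w \<gamma> :: "real => real" and \<tau> :: "nat => real" and n :: nat and R l :: "nat => real"
  assumes cont: "continuous_on {\<tau> n..1} w"
    and tau: "\<And>k. k < n ==> \<tau> (Suc k) \<le> \<tau> k" "\<tau> 0 \<le> 1"
    and gconst: "\<And>k t. k < n ==> \<tau> (Suc k) \<le> t ==> t < \<tau> k ==> \<gamma> t = \<gamma> (\<tau> (Suc k))"
      "\<And>t. \<tau> 0 \<le> t ==> t \<le> 1 ==> \<gamma> t = \<gamma> (\<tau> 0)"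
    and gmono: "\<And>k. k < n ==> \<gamma> (\<tau> (Suc k)) \<le> \<gamma> (\<tau> k)"
    and init: "R n > 0" "- w (\<tau> n) \<le> l n"
    and R_step: "\<And>k. k < n ==> R k = jump_R (w (\<tau> k)) (\<gamma> (\<tau> k) - \<gamma> (\<tau> (Suc k))) (R (Suc k)) (flow w (\<tau> (Suc k)) (\<tau> k) (l (Suc k)))"
    and l_step: "\<And>k. k < n ==> l k = jump_l (w (\<tau> k)) (\<gamma> (\<tau> k) - \<gamma> (\<tau> (Suc k))) (R (Suc k)) (flow w (\<tau> (Suc k)) (\<tau> k) (l (Suc k)))"
begin

definition idx :: "real => nat" where "idx t = (LEAST k. \<tau> k \<le> t)"

text \<open>The first summand is the reflection between the nodes, the second the part of the jump
  of \<gamma> that K takes over because the first coordinate would become negative.\<close>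

definition Kinc :: "nat => real" where
  "Kinc k = (let f = flow w (\<tau> (Suc k)) (\<tau> k) (l (Suc k)); x = \<gamma> (\<tau> k) - \<gamma> (\<tau> (Suc k)) in
     R (Suc k) * (f - l (Suc k)) + (x - R (Suc k) * sinh (w (\<tau> k) + f) + jump_z (w (\<tau> k)) x (R (Suc k)) f))"

text \<open>K is normalised to vanish at node 0, the latest one, so that its values do not depend on
  the starting node n.\<close>

definition Knode :: "nat => real" where "Knode k = - (\<Sum>j<k. Kinc j)"

definition pL :: "real => real" where "pL t = flow w (\<tau> (idx t)) t (l (idx t))"
definition pU :: "real => real" where "pU t = R (idx t) * exp (pL t)"
definition pV :: "real => real" where "pV t = - (R (idx t) * exp (- pL t))"
definition pK :: "real => real" where "pK t = Knode (idx t) + R (idx t) * (pL t - l (idx t))"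

lemma tau_mono: "j \<le> k ==> k \<le> n ==> \<tau> k \<le> \<tau> j"
proof (induction rule: inc_induct)
  case (step m) then show ?case using tau(1)[of m] by auto
qed simp

lemma tau_le1: "k \<le> n ==> \<tau> k \<le> 1"
  using tau_mono[of 0 k] tau(2) by simp

lemma cont_sub: "k \<le> n ==> b \<le> 1 ==> continuous_on {\<tau> k..b} w"
  using tau_mono[of k n] by (intro continuous_on_subset[OF cont]) auto

lemma state_inv: "k \<le> n ==> R k > 0 \<and> - w (\<tau> k) \<le> l k"
proof (induction rule: inc_induct)
  case base then show ?case using init by auto
next
  case (step k)
  then have "k < n" by simp
  have f: "- w (\<tau> k) \<le> flow w (\<tau> (Suc k)) (\<tau> k) (l (Suc k))"
    using \<open>k < n\<close> tau by (intro flow_props(1)[OF cont_sub[of "Suc k" "\<tau> k"]] tau_le1) auto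
  have p: "0 < R (Suc k)" using step by blast
  have g: "0 \<le> \<gamma> (\<tau> k) - \<gamma> (\<tau> (Suc k))" using gmono[OF \<open>k < n\<close>] by linarith
  have "R (Suc k) \<le> R k" "- w (\<tau> k) \<le> l k"
    using jump_props(1,2)[OF p f g] unfolding R_step[OF \<open>k < n\<close>, symmetric] l_step[OF \<open>k < n\<close>, symmetric] by blast+
  then show ?case using p by linarith
qed

lemma flow_ge: "k < n ==> - w (\<tau> k) \<le> flow w (\<tau> (Suc k)) (\<tau> k) (l (Suc k))"
  using tau by (intro flow_props(1)[OF cont_sub[of "Suc k" "\<tau> k"]] tau_le1) auto

lemma step_props:
  assumes k: "k < n"
  shows "R (Suc k) \<le> R k"
    and "R k \<le> R (Suc k) + (\<gamma> (\<tau> k) - \<gamma> (\<tau> (Suc k))) * sinh (w (\<tau> k) + flow w (\<tau> (Suc k)) (\<tau> k) (l (Suc k)))"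
    and "l k \<le> flow w (\<tau> (Suc k)) (\<tau> k) (l (Suc k))"
  using jump_props[OF _ flow_ge[OF k], of "R (Suc k)" "\<gamma> (\<tau> k) - \<gamma> (\<tau> (Suc k))"] state_inv[of "Suc k"] k gmono[OF k]
  by (auto simp: R_step[OF k, symmetric] l_step[OF k, symmetric])

lemma R_antimono: "j \<le> k ==> k \<le> n ==> R k \<le> R j"
proof (induction rule: inc_induct)
  case (step m) then show ?case using step_props(1)[of m] by auto
qed simp

lemma l_bound:
  assumes "k \<le> n" "\<And>t. \<tau> n \<le> t ==> t \<le> 1 ==> \<bar>w t\<bar> \<le> B" "l n \<le> B"
  shows "l k \<le> B"
  using assms(1)
proof (induction rule: inc_induct)
  case (step k)
  have wB: "- w y \<le> B" if "\<tau> (Suc k) \<le> y" "y \<le> \<tau> k" for y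
    using assms(2)[of y] that tau_mono[of "Suc k" n] step tau_le1[of k] by auto
  have "flow w (\<tau> (Suc k)) (\<tau> k) (l (Suc k)) \<le> B"
    using step tau(1)[of k] tau_le1[of k] wB by (intro flow_props(5)[OF cont_sub[of "Suc k" "\<tau> k"]]) auto
  then show ?case using step_props(3)[of k] step by auto
qed (use assms in auto)

text \<open>The linear bound of \<open>jump_props\<close>, summed. The result depends on the total
  jump of \<gamma> and not on the number of nodes; \<open>2 * B\<close> dominates w + l.\<close>

lemma R_bound:
  assumes "k \<le> n" "\<And>t. \<tau> n \<le> t ==> t \<le> 1 ==> \<bar>w t\<bar> \<le> B" "l n \<le> B"
  shows "R k \<le> R n + (\<gamma> (\<tau> k) - \<gamma> (\<tau> n)) * sinh (2 * B)"
  using assms(1)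
proof (induction rule: inc_induct)
  case (step k)
  have "l (Suc k) \<le> B" using l_bound[OF _ assms(2,3), of "Suc k"] step by auto
  moreover have wB: "- w y \<le> B" if "\<tau> (Suc k) \<le> y" "y \<le> \<tau> k" for y
    using assms(2)[of y] that tau_mono[of "Suc k" n] step tau_le1[of k] by auto
  ultimately have "flow w (\<tau> (Suc k)) (\<tau> k) (l (Suc k)) \<le> B"
    using step tau(1)[of k] tau_le1[of k] by (intro flow_props(5)[OF cont_sub[of "Suc k" "\<tau> k"]]) auto
  moreover have "w (\<tau> k) \<le> B" using assms(2)[of "\<tau> k"] tau_mono[of k n] step tau_le1[of k] by auto
  ultimately have "sinh (w (\<tau> k) + flow w (\<tau> (Suc k)) (\<tau> k) (l (Suc k))) \<le> sinh (2 * B)" by simp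
  then have "(\<gamma> (\<tau> k) - \<gamma> (\<tau> (Suc k))) * sinh (w (\<tau> k) + flow w (\<tau> (Suc k)) (\<tau> k) (l (Suc k))) \<le> (\<gamma> (\<tau> k) - \<gamma> (\<tau> (Suc k))) * sinh (2 * B)"
    using gmono[of k] step by (intro mult_left_mono) auto
  then show ?case using step_props(2)[of k] step by (simp add: algebra_simps)
qed simp

text \<open>Between equal nodes \<gamma> does not jump and the step is the identity. So it does not
  matter that \<open>idx\<close> picks the least of several equal nodes.\<close>

lemma tie:
  assumes "j \<le> k" "k \<le> n" "\<tau> j = \<tau> k"
  shows "R j = R k \<and> l j = l k \<and> Knode j = Knode k"
  using assms
proof (induction rule: inc_induct)
  case (step m)
  have e: "\<tau> (Suc m) = \<tau> m" using tau_mono[of "Suc m" k] tau(1)[of m] step by auto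
  have m: "m < n" using step by auto
  have i: "R (Suc m) > 0" "- w (\<tau> m) \<le> l (Suc m)" using state_inv[of "Suc m"] m e by auto
  have f: "flow w (\<tau> (Suc m)) (\<tau> m) (l (Suc m)) = l (Suc m)" using flow_self[of w "\<tau> m"] i e by auto
  have "R m = R (Suc m)" "l m = l (Suc m)" "Kinc m = 0"
    unfolding R_step[OF m] l_step[OF m] Kinc_def f using jump_0[OF i] e by (simp_all add: Let_def)
  then show ?case using step e by (simp add: Knode_def)
qed simp

lemma idx_le: "k \<le> n ==> \<tau> k \<le> t ==> idx t \<le> k \<and> \<tau> (idx t) \<le> t"
  unfolding idx_def by (meson LeastI Least_le)

lemma idx_open:
  assumes "k < n" "\<tau> (Suc k) \<le> t" "t < \<tau> k"
  shows "idx t = Suc k"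
  unfolding idx_def
proof (rule Least_equality)
  fix j assume "\<tau> j \<le> t"
  then show "Suc k \<le> j" using tau_mono[of j k] assms by (metis not_less not_less_eq_eq order.trans less_imp_le)
qed (use assms in auto)

lemma idx_0: "\<tau> 0 \<le> t ==> idx t = 0"
  unfolding idx_def by (rule Least_equality) auto

lemma node_props:
  assumes "k \<le> n"
  shows "pL (\<tau> k) = l k" "R (idx (\<tau> k)) = R k" "Knode (idx (\<tau> k)) = Knode k" "pK (\<tau> k) = Knode k" "\<tau> (idx (\<tau> k)) = \<tau> k"
proof -
  have i: "idx (\<tau> k) \<le> k" "\<tau> (idx (\<tau> k)) \<le> \<tau> k" using idx_le[of k "\<tau> k"] assms by auto
  then show e: "\<tau> (idx (\<tau> k)) = \<tau> k" using tau_mono[of "idx (\<tau> k)" k] assms by auto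
  from tie[OF i(1) assms this] have t: "R (idx (\<tau> k)) = R k" "l (idx (\<tau> k)) = l k" "Knode (idx (\<tau> k)) = Knode k" by auto
  then show "R (idx (\<tau> k)) = R k" "Knode (idx (\<tau> k)) = Knode k" by auto
  show pL: "pL (\<tau> k) = l k" unfolding pL_def e t using state_inv[OF assms] flow_self by auto
  show "pK (\<tau> k) = Knode k" unfolding pK_def pL t by simp
qed

text \<open>The flow for \<gamma> frozen at its left value, modified at the right end by
  \<open>esol_jump\<close>.\<close>

lemma esol_step:
  assumes k: "k < n" and lt: "\<tau> (Suc k) < \<tau> k"
  shows "esol w \<gamma> (\<tau> (Suc k)) (\<tau> k) pU pV pK"
proof -
  let ?a = "\<tau> (Suc k)" and ?b = "\<tau> k"
  define f where "f = flow w ?a ?b (l (Suc k))"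
  define x where "x = \<gamma> ?b - \<gamma> ?a"
  define y where "y = jump_z (w ?b) x (R (Suc k)) f"
  define kk where "kk = x - R (Suc k) * sinh (w ?b + f) + y"
  have x0: "x \<ge> 0" using gmono[OF k] by (simp add: x_def)
  have i: "R (Suc k) > 0" using state_inv[of "Suc k"] k by auto
  have fg: "- w ?b \<le> f" unfolding f_def by (rule flow_ge[OF k])
  note J = jump_props[OF i fg x0]
  have Rk: "R k = jump_R (w ?b) x (R (Suc k)) f" and lk: "l k = jump_l (w ?b) x (R (Suc k)) f"
    using R_step[OF k] l_step[OF k] by (simp_all add: x_def f_def)
  have E: "esol w (\<lambda>_. \<gamma> ?a) ?a ?b (\<lambda>t. R (Suc k) * exp (flow w ?a t (l (Suc k))))
     (\<lambda>t. - (R (Suc k) * exp (- flow w ?a t (l (Suc k))))) (\<lambda>t. Knode (Suc k) - R (Suc k) * l (Suc k) + R (Suc k) * flow w ?a t (l (Suc k)))"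
    using i k tau_le1[of k] by (intro esol_flow cont_sub) auto
  have open_eq: "pL t = flow w ?a t (l (Suc k))" "idx t = Suc k" if "?a \<le> t" "t < ?b" for t
    using idx_open[OF k that] by (simp_all add: pL_def)
  have s2: "R k * sinh (w ?b + l k) = y" "R k * cosh (w ?b + l k) = R (Suc k) * cosh (w ?b + f)"
    using J(5,6) by (simp_all add: Rk lk y_def)
  have eU: "exp (w ?b) * (R k * exp (l k)) = y + R (Suc k) * cosh (w ?b + f)"
    unfolding s2[symmetric] by (simp add: sinh_def cosh_def exp_add field_simps)
  have eV: "exp (- w ?b) * (R k * exp (- l k)) = R (Suc k) * cosh (w ?b + f) - y"
    unfolding s2[symmetric] by (simp add: sinh_def cosh_def exp_add exp_minus exp_diff field_simps)
  have eU0: "exp (w ?b) * (R (Suc k) * exp f) = R (Suc k) * sinh (w ?b + f) + R (Suc k) * cosh (w ?b + f)"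
    by (simp add: sinh_def cosh_def exp_add field_simps)
  have eV0: "exp (- w ?b) * (R (Suc k) * exp (- f)) = R (Suc k) * cosh (w ?b + f) - R (Suc k) * sinh (w ?b + f)"
    by (simp add: sinh_def cosh_def exp_add exp_minus exp_diff field_simps)
  have U: "pU ?b = R k * exp (l k)" and V: "pV ?b = - (R k * exp (- l k))"
    using node_props[of k] k by (auto simp: pU_def pV_def)
  have fb: "flow w ?a ?b (l (Suc k)) = f" by (simp add: f_def)
  have kx: "kk - x = y - R (Suc k) * sinh (w ?b + f)" by (simp add: kk_def)
  have cancel: "exp (- w ?b) * (exp (w ?b) * X) = X" "exp (w ?b) * (exp (- w ?b) * X) = X" for X
    by (simp_all add: mult.assoc[symmetric] exp_add[symmetric])
  show ?thesis
  proof (rule esol_jump[OF E lt, of pU pV pK \<gamma> kk x])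
    show "pU t = R (Suc k) * exp (flow w ?a t (l (Suc k)))" "pV t = - (R (Suc k) * exp (- flow w ?a t (l (Suc k))))"
      "pK t = Knode (Suc k) - R (Suc k) * l (Suc k) + R (Suc k) * flow w ?a t (l (Suc k))"
      "\<gamma> t = \<gamma> ?a" if "?a \<le> t" "t < ?b" for t
      using open_eq[OF that] gconst(1)[OF k that] by (simp_all add: pU_def pV_def pK_def algebra_simps)
    have "exp (- w ?b) * (exp (w ?b) * pU ?b) = exp (- w ?b) * (exp (w ?b) * (R (Suc k) * exp f) + (kk - x))"
      unfolding U eU eU0 kx by simp
    then show "pU ?b = R (Suc k) * exp (flow w ?a ?b (l (Suc k))) + exp (- w ?b) * (kk - x)"
      unfolding fb cancel distrib_left mult_minus_right .
    have "exp (w ?b) * (exp (- w ?b) * pV ?b) = exp (w ?b) * (- (exp (- w ?b) * (R (Suc k) * exp (- f))) + (kk - x))"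
      unfolding V mult_minus_right eV eV0 kx by (simp add: algebra_simps)
    then show "pV ?b = - (R (Suc k) * exp (- flow w ?a ?b (l (Suc k)))) + exp (w ?b) * (kk - x)"
      unfolding fb cancel distrib_left mult_minus_right .
    show "pK ?b = Knode (Suc k) - R (Suc k) * l (Suc k) + R (Suc k) * flow w ?a ?b (l (Suc k)) + kk"
      using node_props(4)[of k] k unfolding Knode_def
      by (simp add: Kinc_def Let_def kk_def y_def x_def f_def algebra_simps)
    show "\<gamma> ?b = \<gamma> ?a + x" by (simp add: x_def)
    show "0 \<le> kk" unfolding kk_def y_def jump_z_def by simp
    show "0 \<le> x" by fact
    have z1: "exp (w ?b) * pU ?b + exp (- w ?b) * pV ?b = 2 * y"
      unfolding U V mult_minus_right eU eV by simp
    show "0 \<le> exp (w ?b) * pU ?b + exp (- w ?b) * pV ?b" unfolding z1 y_def jump_z_def by simp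
    show "exp (w ?b) * pU ?b + exp (- w ?b) * pV ?b = 0"
      if "0 < kk \<or> exp (w ?b) * (R (Suc k) * exp (flow w ?a ?b (l (Suc k)))) + exp (- w ?b) * (- (R (Suc k) * exp (- flow w ?a ?b (l (Suc k))))) = 0"
      unfolding z1 using that x0 unfolding fb mult_minus_right eU0 eV0 by (auto simp: kk_def y_def jump_z_def)
  qed
qed

theorem esol_path: "esol w \<gamma> (\<tau> n) 1 pU pV pK"
proof -
  have "esol w \<gamma> (\<tau> n) (\<tau> k) pU pV pK" if "k \<le> n" for k
    using that
  proof (induction rule: inc_induct)
    case base
    show ?case
    proof (rule singleton_esol)
      have "exp (w (\<tau> n)) * pU (\<tau> n) + exp (- w (\<tau> n)) * pV (\<tau> n) = 2 * R n * sinh (w (\<tau> n) + l n)"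
        using node_props[of n] by (simp only: pU_def pV_def sinh_state)
      then show "0 \<le> exp (w (\<tau> n)) * pU (\<tau> n) + exp (- w (\<tau> n)) * pV (\<tau> n)" using init by simp
    qed
  next
    case (step k)
    show ?case
    proof (cases "\<tau> (Suc k) = \<tau> k")
      case False
      then have "\<tau> (Suc k) < \<tau> k" using tau(1)[of k] step by auto
      from esol_concat[OF step.IH esol_step[OF _ this]] step tau_mono[of "Suc k" n] this show ?thesis by auto
    qed (use step in simp)
  qed
  from this[of 0] have 1: "esol w \<gamma> (\<tau> n) (\<tau> 0) pU pV pK" by simp
  have R0: "0 \<le> R 0" using state_inv[of 0] by linarith
  have c0: "continuous_on {\<tau> 0..1} w" by (rule cont_sub) simp_all
  have F: "esol w (\<lambda>_. \<gamma> (\<tau> 0)) (\<tau> 0) 1 (\<lambda>t. R 0 * exp (flow w (\<tau> 0) t (l 0)))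
     (\<lambda>t. - (R 0 * exp (- flow w (\<tau> 0) t (l 0)))) (\<lambda>t. Knode 0 - R 0 * l 0 + R 0 * flow w (\<tau> 0) t (l 0))"
    by (rule esol_flow[OF c0 R0]) (rule refl)
  have "esol w \<gamma> (\<tau> 0) 1 pU pV pK"
  proof (rule esol_cong[OF F, where c=0 and d=0])
    show "\<gamma> t = \<gamma> (\<tau> 0) + 0" if "\<tau> 0 \<le> t" "t \<le> 1" for t using gconst(2)[OF that] by simp
  qed (simp_all add: pU_def pV_def pK_def pL_def idx_0 right_diff_distrib)
  then show ?thesis using esol_concat[OF 1] tau_mono[of 0 n] tau(2) by auto
qed

lemma path_state:
  assumes "\<tau> n \<le> t" "t \<le> 1"
  shows "idx t \<le> n" "\<tau> (idx t) \<le> t" "- w t \<le> pL t" "R (idx t) > 0"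
    and "(\<And>t. \<tau> n \<le> t ==> t \<le> 1 ==> \<bar>w t\<bar> \<le> B) ==> l n \<le> B ==> pL t \<le> B"
proof -
  show i: "idx t \<le> n" "\<tau> (idx t) \<le> t" using idx_le[OF _ assms(1)] by auto
  show "- w t \<le> pL t" unfolding pL_def using i assms by (intro flow_props(1)[OF cont_sub[of "idx t" t]]) auto
  show "R (idx t) > 0" using state_inv i by auto
  assume B: "\<And>t. \<tau> n \<le> t ==> t \<le> 1 ==> \<bar>w t\<bar> \<le> B" "l n \<le> B"
  have "l (idx t) \<le> B" using l_bound[OF i(1) B] .
  have wB: "- w y \<le> B" if "\<tau> (idx t) \<le> y" "y \<le> t" for y
    using B(1)[of y] that tau_mono[of "idx t" n] i assms by auto
  show "pL t \<le> B" unfolding pL_def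
    by (rule flow_props(5)[OF cont_sub[OF i(1) assms(2)] i(2) order_refl \<open>l (idx t) \<le> B\<close> wB])
qed

lemma idx_antimono: "\<tau> n \<le> s ==> s \<le> t ==> idx t \<le> idx s"
  using idx_le[of "idx s" t] idx_le[of n s] by auto

end

section \<open>Leaving 0 under a linear drift\<close>

lemma exp_lipschitz:
  fixes x y B :: real
  assumes "x \<le> B" "y \<le> B"
  shows "\<bar>exp x - exp y\<bar> \<le> exp B * \<bar>x - y\<bar>"
proof -
  have *: "exp y - exp x \<le> exp B * (y - x)" if "x \<le> y" "y \<le> B" for x y :: real
  proof -
    have "exp y - exp x = exp y * (1 - exp (x - y))" by (simp add: algebra_simps exp_diff)
    also have "\<dots> \<le> exp y * (y - x)"
    proof (rule mult_left_mono)
      show "1 - exp (x - y) \<le> y - x" using exp_ge_add_one_self[of "x - y"] by linarith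
    qed simp
    also have "\<dots> \<le> exp B * (y - x)" using that by (intro mult_right_mono) auto
    finally show ?thesis .
  qed
  show ?thesis using *[of x y] *[of y x] assms by (cases "x \<le> y") auto
qed

text \<open>At the contact r given by \<open>esol\<close>, K has its final value and the first
  coordinate is 0. As that coordinate was nonnegative at u, K has only compensated the increase of
  \<gamma> and the change of w in the factors \<open>exp (w r)\<close> and
  \<open>exp (- w r)\<close>. This supplies the equicontinuity of the approximations.\<close>

lemma esol_K_increment:
  assumes E: "esol w g a b U V K" and B: "\<And>y. a \<le> y ==> y \<le> b ==> \<bar>w y\<bar> \<le> B"
    and gm: "mono_on {a..b} g" and uv: "a \<le> u" "u \<le> v" "v \<le> b"
    and UV: "\<bar>U u\<bar> \<le> C" "\<bar>V u\<bar> \<le> C"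
    and d: "\<And>y. u \<le> y ==> y \<le> v ==> \<bar>w y - w u\<bar> \<le> d"
  shows "K v - K u \<le> exp (2 * B) * (g v - g u) + C * exp B * d"
proof (cases "K u < K v")
  case True
  then have "u < v" using uv by (cases "u = v") auto
  with esolD(6)[OF E, of u v] uv True obtain r where r: "u < r" "r \<le> v"
    "exp (w r) * U r + exp (- w r) * V r = 0" "K r = K v" by auto
  have wr: "\<bar>w r\<bar> \<le> B" "\<bar>w u\<bar> \<le> B" using B r uv by auto
  have "2 * (K r - K u) - (2 * exp (2*B)) * (g r - g u) \<le> exp (w r) * (U r - U u) + exp (- w r) * (V r - V u)"
  proof (rule esolD(4)[OF E])
    fix y assume y: "u \<le> y" "y \<le> r"
    have "\<bar>w y\<bar> \<le> B" using B[of y] y r uv by auto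
    then have "exp (w r - w y) \<le> exp (2*B)" "exp (w y - w r) \<le> exp (2*B)" using wr by (auto simp: abs_le_iff)
    then have 1: "exp (w r - w y) + exp (w y - w r) \<le> 2 * exp (2*B)" by linarith
    have 2: "exp (w r) * exp (- w y) + exp (- w r) * exp (w y) = exp (w r - w y) + exp (w y - w r)" by (simp add: exp_add[symmetric])
    have "exp (w r - w y) + exp (w y - w r) = 2 * cosh (w r - w y)" by (simp add: cosh_def)
    also have "\<dots> \<ge> 2" using cosh_real_ge_1[of "w r - w y"] by simp
    finally show "2 \<le> exp (w r) * exp (- w y) + exp (- w r) * exp (w y) \<and> exp (w r) * exp (- w y) + exp (- w r) * exp (w y) \<le> 2 * exp (2 * B)"
      using 1 2 by simp
  qed (use r uv in auto)
  moreover have "- (exp (w r) * U u + exp (- w r) * V u) \<le> 2 * (C * exp B * d)"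
  proof -
    have "- (exp (w r) * U u + exp (- w r) * V u) \<le> (exp (w u) - exp (w r)) * U u + (exp (- w u) - exp (- w r)) * V u"
      using esolD(3)[OF E, of u] uv by (simp add: algebra_simps)
    also have "\<dots> \<le> \<bar>(exp (w u) - exp (w r)) * U u\<bar> + \<bar>(exp (- w u) - exp (- w r)) * V u\<bar>" by linarith
    also have "\<dots> \<le> (exp B * d) * C + (exp B * d) * C"
      unfolding abs_mult
    proof (intro add_mono mult_mono UV)
      have dd: "\<bar>w r - w u\<bar> \<le> d" using d[of r] r by auto
      show "\<bar>exp (w u) - exp (w r)\<bar> \<le> exp B * d"
        using dd wr by (intro order_trans[OF exp_lipschitz[of _ B]] mult_left_mono) auto
      show "\<bar>exp (- w u) - exp (- w r)\<bar> \<le> exp B * d"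
        using dd wr by (intro order_trans[OF exp_lipschitz[of _ B]] mult_left_mono) auto
      show "0 \<le> exp B * d" "0 \<le> exp B * d" using dd by auto
    qed auto
    finally show ?thesis by (simp add: algebra_simps)
  qed
  moreover have "exp (2*B) * (g r - g u) \<le> exp (2*B) * (g v - g u)"
    using gm r uv by (intro mult_left_mono) (auto simp: mono_on_def)
  ultimately show ?thesis using r(3) unfolding r(4)[symmetric] right_diff_distrib by linarith
next
  case False
  have "0 \<le> d" using d[of u] uv by auto
  moreover have "0 \<le> C" using UV by linarith
  moreover have "g u \<le> g v" using gm uv by (auto simp: mono_on_def)
  ultimately have "0 \<le> exp (2 * B) * (g v - g u) + C * exp B * d" by simp
  then show ?thesis using False by linarith
qed

lemma esol_UV_increment:
  assumes E: "esol w g a b U V K" and B: "\<And>y. a \<le> y ==> y \<le> b ==> \<bar>w y\<bar> \<le> B"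
    and uv: "a \<le> u" "u \<le> v" "v \<le> b"
  shows "- (exp B * (g v - g u)) \<le> U v - U u" "U v - U u \<le> exp B * (K v - K u)"
    "- (exp B * (g v - g u)) \<le> V v - V u" "V v - V u \<le> exp B * (K v - K u)"
proof -
  have b: "exp (- w y) \<le> exp B" "exp (w y) \<le> exp B" if "u \<le> y" "y \<le> v" for y
    using B[of y] that uv by (auto simp: abs_le_iff)
  show "- (exp B * (g v - g u)) \<le> U v - U u" "U v - U u \<le> exp B * (K v - K u)"
    using esolD(4,5)[OF E uv, of 0 1 0 "exp B"] b by auto
  show "- (exp B * (g v - g u)) \<le> V v - V u" "V v - V u \<le> exp B * (K v - K u)"
    using esolD(4,5)[OF E uv, of 0 0 1 "exp B"] b by auto
qed

text \<open>\<open>- U * V\<close> is the squared radius Z2^2 - Z1^2. A rise of w by \<eta> lifts Z1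
  to order r \<eta>, and the condition on \<open>r * \<eta>\<close> says that the drift during D
  takes away at most half of that. On the final stretch of length L, over which w moves by at most
  \<eta>/2, the state is therefore off the boundary and K is constant; there the drift increases the
  squared radius at rate 2 Z1.\<close>

lemma growth_step:
  assumes E: "esol w g t0 1 U V K" and B: "\<And>y. t0 \<le> y ==> y \<le> 1 ==> \<bar>w y\<bar> \<le> B"
    and sgn: "\<And>y. t0 \<le> y ==> y \<le> 1 ==> U y > 0" "\<And>y. t0 \<le> y ==> y \<le> 1 ==> V y < 0"
    and Nm: "\<And>x y. t0 \<le> x ==> x \<le> y ==> y \<le> 1 ==> - U x * V x \<le> - U y * V y"
    and g: "mono_on {t0..1} g" "\<And>x y. t0 \<le> x ==> x + L \<le> y ==> y \<le> 1 ==> (y - x) / 2 \<le> g y - g x \<and> g y - g x \<le> 2 * (y - x)"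
    and ho: "\<And>x y. t0 \<le> x ==> x \<le> y ==> y \<le> 1 ==> y - x \<le> L ==> \<bar>w y - w x\<bar> \<le> \<eta> / 2"
    and st: "t0 \<le> a" "a \<le> s" "s \<le> t" "t \<le> a + D" "a + D \<le> 1" "\<eta> \<le> w t - w s"
    and pos: "0 < \<eta>" "0 < L" "L \<le> D" "0 < r"
    and r: "r\<^sup>2 \<le> - U a * V a" "8 * exp (2 * B) * D \<le> r * \<eta>"
  shows "- U a * V a + L * \<eta> * r / 8 \<le> - U (a + D) * V (a + D)"
proof -
  define x0 where "x0 = t - L"
  have sL: "s < x0"
  proof (rule ccontr)
    assume "\<not> s < x0"
    then have "\<bar>w t - w s\<bar> \<le> \<eta> / 2" using ho[of s t] st by (auto simp: x0_def)
    then show False using st(6) pos by linarith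
  qed
  have gD: "g (a + D) - g a \<le> 2 * D" using g(2)[of a "a + D"] st pos by auto
  define Q where "Q = (\<lambda>x. exp (w x) * U x + exp (- w x) * V x)"
  have Q: "r * \<eta> / 2 \<le> Q x" if x: "x0 \<le> x" "x \<le> t" for x
  proof -
    have xs: "s \<le> x" "t0 \<le> s" "x \<le> 1" using x sL st by auto
    have wx: "\<bar>w x\<bar> \<le> B" "\<bar>w s\<bar> \<le> B" using B xs by auto
    have "0 * (K x - K s) - (2 * exp (2*B)) * (g x - g s) \<le> exp (w x) * (U x - U s) + exp (- w x) * (V x - V s)"
    proof (rule esolD(4)[OF E])
      fix y assume y: "s \<le> y" "y \<le> x"
      have "\<bar>w y\<bar> \<le> B" using B[of y] y xs by auto
      then have "exp (w x - w y) \<le> exp (2*B)" "exp (w y - w x) \<le> exp (2*B)" using wx by (auto simp: abs_le_iff)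
      then have "exp (w x - w y) + exp (w y - w x) \<le> 2 * exp (2*B)" by linarith
      then show "0 \<le> exp (w x) * exp (- w y) + exp (- w x) * exp (w y) \<and> exp (w x) * exp (- w y) + exp (- w x) * exp (w y) \<le> 2 * exp (2 * B)"
        by (simp add: exp_add[symmetric])
    qed (use xs in auto)
    moreover have "(2 * exp (2*B)) * (g x - g s) \<le> (2 * exp (2*B)) * (2 * D)"
    proof (rule mult_left_mono)
      have "g x \<le> g (a + D)" "g a \<le> g s" using g(1) xs x st by (auto simp: mono_on_def)
      then show "g x - g s \<le> 2 * D" using gD by linarith
    qed simp
    moreover have "r * \<eta> \<le> exp (w x) * U s + exp (- w x) * V s"
    proof -
      define \<delta> where "\<delta> = w x - w s"
      define P q where "P = exp (w s) * U s" and "q = exp (- w s) * V s"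
      have "\<bar>w t - w x\<bar> \<le> \<eta> / 2" using ho[of x t] x xs st by (auto simp: x0_def)
      then have \<delta>: "\<eta> / 2 \<le> \<delta>" using st(6) unfolding \<delta>_def by linarith
      have Pq: "0 \<le> P + q" using esolD(3)[OF E, of s] xs by (auto simp: P_def q_def)
      have "r\<^sup>2 \<le> - U s * V s" using Nm[of a s] r(1) st xs by auto
      also have "- U s * V s = - P * q" by (simp add: P_def q_def exp_minus)
      \<comment> \<open>(P - q)^2 = (P + q)^2 - 4 P q: the second coordinate is at least the
        radius.\<close>
      finally have "4 * r\<^sup>2 \<le> (P - q)\<^sup>2" using zero_le_power2[of "P + q"] by (simp add: power2_eq_square algebra_simps)
      then have "(2 * r)\<^sup>2 \<le> (P - q)\<^sup>2" by (simp add: power_mult_distrib)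
      moreover have "0 < P" "q < 0" using sgn[of s] xs by (auto simp: P_def q_def intro: mult_pos_neg)
      then have "0 \<le> P - q" by linarith
      ultimately have Pmq: "2 * r \<le> P - q" by (rule power2_le_imp_le)
      have "exp (w x) * U s + exp (- w x) * V s = exp \<delta> * P + exp (- \<delta>) * q"
        unfolding P_def q_def \<delta>_def mult.assoc[symmetric] exp_add[symmetric] by simp
      also have "\<dots> = (P + q) * cosh \<delta> + (P - q) * sinh \<delta>" by (simp add: cosh_def sinh_def field_simps)
      also have "\<dots> \<ge> 0 + (2 * r) * (\<eta> / 2)"
      proof (intro add_mono mult_mono)
        show "0 \<le> (P + q) * cosh \<delta>" using Pq cosh_real_ge_1[of \<delta>] by (intro mult_nonneg_nonneg) auto
        have "exp \<delta> \<ge> 1 + \<delta>" "exp (- \<delta>) \<le> 1" using exp_ge_add_one_self[of \<delta>] \<delta> pos by auto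
        moreover have "\<delta> \<le> sinh \<delta>"
        proof -
          have "((\<lambda>x. sinh x - x) has_real_derivative (cosh x - 1)) (at x)" for x :: real
            by (auto intro!: derivative_eq_intros)
          then have "sinh 0 - 0 \<le> sinh \<delta> - \<delta>" using \<delta> pos
            by (intro DERIV_nonneg_imp_nondecreasing[of 0 \<delta> "\<lambda>x. sinh x - x"]) (auto intro!: exI simp: cosh_real_ge_1)
          then show ?thesis by simp
        qed
        ultimately show "\<eta> / 2 \<le> sinh \<delta>" using \<delta> by linarith
      qed (use Pmq pos in auto)
      finally show ?thesis by simp
    qed
    ultimately show ?thesis unfolding Q_def using r(2) by (simp add: algebra_simps)
  qed
  have x0: "t0 \<le> x0" "x0 \<le> t" "t \<le> 1" "a \<le> x0" using sL st pos by (auto simp: x0_def)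
  have Kc: "K y = K x0" if "x0 \<le> y" "y \<le> t" for y
  proof -
    have "K x0 \<le> K y" "K y \<le> K t" using esolD(1)[OF E] that x0 by (auto simp: mono_on_def)
    moreover have "\<not> K x0 < K t"
    proof
      assume k: "K x0 < K t"
      then have "x0 < t" using x0 by (cases "x0 = t") auto
      with esolD(6)[OF E, of x0 t] k x0 obtain q where "x0 < q" "q \<le> t" "Q q = 0" unfolding Q_def by auto
      then show False using Q[of q] pos by (smt (verit) divide_pos_pos less_imp_le mult_pos_pos)
    qed
    ultimately show ?thesis by linarith
  qed
  have dec: "U y - U x0 \<le> 0" "V y - V x0 \<le> 0" if "x0 \<le> y" "y \<le> t" for y
    using esol_UV_increment[OF E B, of x0 y] Kc[OF that] that x0 by auto
  define dg where "dg = g t - g x0"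
  have dg: "L / 2 \<le> dg" "dg \<le> 2 * L" using g(2)[of x0 t] x0 by (auto simp: dg_def x0_def)
  have low: "- (exp B * dg) \<le> U t - U x0" "- (exp B * dg) \<le> V t - V x0"
    using esol_UV_increment[OF E B, of x0 t] x0 by (auto simp: dg_def)
  \<comment> \<open>The weights \<open>- V x0\<close> and \<open>- U x0\<close> give the first-order
    change of \<open>- U * V\<close> from x0. The value of the lower bound does not matter, since K
    is constant on [x0, t].\<close>
  have "(- (U x0 * exp B)) * (K t - K x0) - (- (r * \<eta> / 2)) * (g t - g x0) \<le> (- V x0) * (U t - U x0) + (- U x0) * (V t - V x0)"
  proof (rule esolD(4)[OF E])
    fix y assume y: "x0 \<le> y" "y \<le> t"
    have "Q y \<le> exp (w y) * U x0 + exp (- w y) * V x0"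
      unfolding Q_def using dec[OF y] by (intro add_mono mult_left_mono) auto
    then have 1: "- V x0 * exp (- w y) + - U x0 * exp (w y) \<le> - (r * \<eta> / 2)" using Q[OF y] by (simp add: algebra_simps)
    have "exp (w y) \<le> exp B" using B[of y] y x0 by (auto simp: abs_le_iff)
    then have "U x0 * exp (w y) \<le> U x0 * exp B" using sgn(1)[of x0] x0 by (intro mult_left_mono) auto
    moreover have "0 \<le> - V x0 * exp (- w y)" using sgn(2)[of x0] x0 by (auto intro!: mult_nonpos_nonneg)
    ultimately show "- (U x0 * exp B) \<le> - V x0 * exp (- w y) + - U x0 * exp (w y) \<and> - V x0 * exp (- w y) + - U x0 * exp (w y) \<le> - (r * \<eta> / 2)"
      using 1 by linarith
  qed (use x0 in auto)
  then have main: "r * \<eta> / 2 * dg \<le> - V x0 * (U t - U x0) + - U x0 * (V t - V x0)"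
    using Kc[of t] x0 by (simp add: dg_def)
  \<comment> \<open>The second-order term uses up at most half of the first-order gain.\<close>
  have "(U t - U x0) * (V t - V x0) = (- (U t - U x0)) * (- (V t - V x0))" by (rule minus_mult_minus[symmetric])
  also have "\<dots> \<le> (exp B * dg) * (exp B * dg)" using low dec[of t] x0 dg pos by (intro mult_mono) auto
  also have "\<dots> = exp (2 * B) * dg * dg" by (simp add: exp_add[symmetric] mult_exp_exp algebra_simps)
  also have "\<dots> \<le> (r * \<eta> / 4) * dg"
  proof (rule mult_right_mono)
    have "exp (2*B) * dg \<le> exp (2*B) * (2 * D)" using dg pos by (intro mult_left_mono) auto
    then show "exp (2*B) * dg \<le> r * \<eta> / 4" using r(2) by linarith
  qed (use dg pos in auto)
  finally have prod: "(U t - U x0) * (V t - V x0) \<le> (r * \<eta> / 4) * dg" .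
  have "- U t * V t - (- U x0 * V x0) = - V x0 * (U t - U x0) + - U x0 * (V t - V x0) - (U t - U x0) * (V t - V x0)"
    by (simp add: algebra_simps)
  then have "- U t * V t - (- U x0 * V x0) \<ge> r * \<eta> / 4 * dg" using main prod by linarith
  moreover have "r * \<eta> / 4 * dg \<ge> r * \<eta> / 4 * (L / 2)" using dg pos by (intro mult_left_mono) auto
  moreover have "- U a * V a \<le> - U x0 * V x0" "- U t * V t \<le> - U (a + D) * V (a + D)"
    using Nm[of a x0] Nm[of t "a + D"] x0 st by auto
  ultimately show ?thesis by (simp add: algebra_simps)
qed

section \<open>Escape from 0 at a rate independent of the start\<close>

lemma half_power_powr: "((1/2::real) ^ m) powr a = ((1/2) powr a) ^ m"
  by (simp add: powr_power powr_powr powr_realpow[symmetric] mult.commute)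

text \<open>\<kappa> and h stand for exponents just below and just above H; for \<kappa> = h = H the
  last condition reads 2 H + 1 < 2.\<close>

locale rough_path =
  fixes w :: "real => real" and B C \<kappa> h D0 :: real
  assumes cont: "continuous_on {0..1} w"
    and B: "\<And>y. 0 \<le> y ==> y \<le> 1 ==> \<bar>w y\<bar> \<le> B"
    and holder: "\<And>x y. 0 \<le> x ==> x \<le> y ==> y \<le> 1 ==> \<bar>w y - w x\<bar> \<le> C * (y - x) powr \<kappa>"
    and upward: "\<And>a D. 0 \<le> a ==> 0 < D ==> D \<le> D0 ==> a + D \<le> 1 ==> \<exists>s t. a \<le> s \<and> s \<le> t \<and> t \<le> a + D \<and> D powr h \<le> w t - w s"
    and par: "0 < \<kappa>" "\<kappa> \<le> h" "h < 1" "1 \<le> C" "0 < D0" "2 * h + h / \<kappa> < 2"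
begin

definition dd :: "nat => real" where "dd m = (1/2) ^ m"
definition k0 :: real where "k0 = (1 / (2 * C)) powr (1 / \<kappa>)"
text \<open>A time in which w moves by at most half of the rise \<open>dd m powr h\<close>;
  \<open>k0\<close> solves \<open>C * k0 powr \<kappa> = 1 / 2\<close>.\<close>

definition LL :: "nat => real" where "LL m = k0 * dd m powr (h / \<kappa>)"
text \<open>Equality in the condition \<open>8 * exp (2 * B) * D \<le> r * \<eta>\<close> of
  \<open>growth_step\<close> for D = \<open>dd m\<close> and \<eta> = \<open>dd m powr h\<close>:
  the smallest radius at which it applies on this scale.\<close>

definition rr :: "nat => real" where "rr m = 8 * exp (2 * B) * dd m powr (1 - h)"
text \<open>Up to constants, doubling the radius takes r / (L \<eta>) steps of length d =
  \<open>dd m\<close>, with r = d^(1 - h), L = d^(h/\<kappa>) and \<eta> = d^h. The total time is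
  d^(2 - 2 h - h/\<kappa>) = \<theta>^m.\<close>

definition \<theta> :: real where "\<theta> = (1/2) powr (2 - 2 * h - h / \<kappa>)"
text \<open>192 = 24 * 8, with 24 from the number of steps in \<open>level_up\<close> and 8 from
  \<open>rr\<close>; the summand 1 pays for rounding that number up.\<close>

definition Dc :: real where "Dc = 1 + 192 * exp (2 * B) / k0"

text \<open>Here g is \<gamma> discretised on a mesh finer than L, so it is comparable to the
  identity only over lengths of at least L, as \<open>growth_step\<close> asks.\<close>

definition good :: "(real => real) => real => (real => real) => (real => real) => (real => real) => real => bool" where
  "good g t0 U V K L \<longleftrightarrow> 0 \<le> t0 \<and> esol w g t0 1 U V K \<and> (\<forall>y\<in>{t0..1}. U y > 0 \<and> V y < 0) \<and>
     (\<forall>x y. t0 \<le> x \<longrightarrow> x \<le> y \<longrightarrow> y \<le> 1 \<longrightarrow> - U x * V x \<le> - U y * V y) \<and> mono_on {t0..1} g \<and>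
     (\<forall>x y. t0 \<le> x \<longrightarrow> x + L \<le> y \<longrightarrow> y \<le> 1 \<longrightarrow> (y - x) / 2 \<le> g y - g x \<and> g y - g x \<le> 2 * (y - x))"

lemma dd_pos: "dd m > 0" "dd m \<le> 1" by (simp_all add: dd_def power_le_one)

lemma dd_nz [simp]: "dd m \<noteq> 0" by (simp add: dd_def)

lemma k0: "0 < k0" "k0 \<le> 1" "C * k0 powr \<kappa> = 1 / 2"
proof -
  show "0 < k0" using par by (simp add: k0_def)
  show "k0 \<le> 1" unfolding k0_def using par by (intro powr_le1) auto
  show "C * k0 powr \<kappa> = 1 / 2" using par by (simp add: k0_def powr_powr)
qed

lemma LL: "0 < LL m" "LL m \<le> dd m" "C * LL m powr \<kappa> = dd m powr h / 2" "n \<ge> m ==> LL n \<le> LL m"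
proof -
  show "0 < LL m" using k0 dd_pos by (simp add: LL_def)
  have "1 \<le> h / \<kappa>" using par by simp
  then have "dd m powr (h / \<kappa>) \<le> dd m powr 1" using dd_pos[of m] by (intro powr_mono') auto
  then have "k0 * dd m powr (h / \<kappa>) \<le> 1 * dd m" using k0 dd_pos[of m] by (intro mult_mono) auto
  then show "LL m \<le> dd m" by (simp add: LL_def)
  show "C * LL m powr \<kappa> = dd m powr h / 2"
    using k0 dd_pos[of m] par by (simp add: LL_def powr_mult powr_powr mult.assoc[symmetric])
  assume "n \<ge> m"
  then have "dd n \<le> dd m" unfolding dd_def by (intro power_decreasing) auto
  then show "LL n \<le> LL m" unfolding LL_def using k0 dd_pos par by (intro mult_left_mono powr_mono2) (auto intro: less_imp_le)
qed

lemma rr: "0 < rr m" "rr m * dd m powr h = 8 * exp (2 * B) * dd m" "rr m \<le> 2 * rr (Suc m)"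
proof -
  show "0 < rr m" using dd_pos by (simp add: rr_def)
  show "rr m * dd m powr h = 8 * exp (2 * B) * dd m"
    using dd_pos[of m] by (simp add: rr_def mult.assoc powr_add[symmetric])
  have "dd m = 2 * dd (Suc m)" by (simp add: dd_def)
  then have "dd m powr (1 - h) = 2 powr (1 - h) * dd (Suc m) powr (1 - h)" using dd_pos[of "Suc m"] by (simp add: powr_mult)
  also have "2 powr (1 - h) \<le> (2::real) powr 1" using par by (intro powr_mono) auto
  finally have "dd m powr (1 - h) \<le> 2 * dd (Suc m) powr (1 - h)" by (simp add: mult_right_mono)
  then show "rr m \<le> 2 * rr (Suc m)" by (simp add: rr_def)
qed

lemma theta: "0 < \<theta>" "\<theta> < 1" "dd m \<le> \<theta> ^ m" "Dc \<ge> 0"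
proof -
  show "0 < \<theta>" by (simp add: \<theta>_def)
  show "\<theta> < 1" unfolding \<theta>_def using par by (subst powr01_less_one) auto
  have "1 \<le> h / \<kappa>" "0 < h" using par by auto
  then have "2 - 2 * h - h / \<kappa> \<le> 1" by linarith
  then have "(1/2::real) powr 1 \<le> \<theta>" unfolding \<theta>_def by (intro powr_mono') auto
  then show "dd m \<le> \<theta> ^ m" unfolding dd_def by (intro power_mono) auto
  show "Dc \<ge> 0" unfolding Dc_def using k0 by simp
qed

lemma goodD:
  assumes "good g t0 U V K L"
  shows "0 \<le> t0" "esol w g t0 1 U V K" "\<And>y. t0 \<le> y ==> y \<le> 1 ==> U y > 0" "\<And>y. t0 \<le> y ==> y \<le> 1 ==> V y < 0"
    "\<And>x y. t0 \<le> x ==> x \<le> y ==> y \<le> 1 ==> - U x * V x \<le> - U y * V y" "mono_on {t0..1} g"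
    "\<And>x y. t0 \<le> x ==> x + L \<le> y ==> y \<le> 1 ==> (y - x) / 2 \<le> g y - g x \<and> g y - g x \<le> 2 * (y - x)"
  using assms unfolding good_def by auto

lemma level_steps:
  assumes G: "good g t0 U V K L" and L: "L \<le> LL m" and D0: "dd m \<le> D0"
    and a: "t0 \<le> a" "(rr m)\<^sup>2 \<le> - U a * V a"
  shows "a + real j * dd m \<le> 1 ==>
    (rr m)\<^sup>2 + real j * (LL m * dd m powr h * rr m / 8) \<le> - U (a + real j * dd m) * V (a + real j * dd m)"
proof (induction j)
  case 0 then show ?case using a by simp
next
  case (Suc j)
  define b where "b = a + real j * dd m"
  have "0 \<le> real j * dd m" using dd_pos[of m] by simp
  then have b: "t0 \<le> b" "b + dd m \<le> 1" "0 \<le> b" using a(1) Suc.prems goodD(1)[OF G] by (simp_all add: b_def distrib_right)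
  have e: "a + real (Suc j) * dd m = b + dd m" by (simp add: b_def algebra_simps)
  have "a + real j * dd m \<le> 1" using b dd_pos[of m] unfolding b_def by linarith
  from Suc.IH[OF this] have IH: "(rr m)\<^sup>2 + real j * (LL m * dd m powr h * rr m / 8) \<le> - U b * V b" unfolding b_def .
  have "0 \<le> LL m * dd m powr h * rr m / 8" using LL(1) rr(1) by (simp add: less_imp_le)
  then have rb: "(rr m)\<^sup>2 \<le> - U b * V b" using IH by (smt (verit) mult_nonneg_nonneg of_nat_0_le_iff)
  obtain s t where st: "b \<le> s" "s \<le> t" "t \<le> b + dd m" "dd m powr h \<le> w t - w s"
    using upward[of b "dd m"] b dd_pos[of m] D0 by auto
  have "- U b * V b + LL m * dd m powr h * rr m / 8 \<le> - U (b + dd m) * V (b + dd m)"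
  proof (rule growth_step[OF goodD(2)[OF G], where s=s and t=t and L="LL m" and \<eta>="dd m powr h" and r="rr m"])
    show "\<bar>w y\<bar> \<le> B" if "t0 \<le> y" "y \<le> 1" for y using B[of y] that goodD(1)[OF G] by auto
    show "(y - x) / 2 \<le> g y - g x \<and> g y - g x \<le> 2 * (y - x)" if "t0 \<le> x" "x + LL m \<le> y" "y \<le> 1" for x y
      using goodD(7)[OF G, of x y] that L by auto
    show "\<bar>w y - w x\<bar> \<le> dd m powr h / 2" if "t0 \<le> x" "x \<le> y" "y \<le> 1" "y - x \<le> LL m" for x y
    proof -
      have "\<bar>w y - w x\<bar> \<le> C * (y - x) powr \<kappa>" using holder[of x y] that goodD(1)[OF G] by auto
      also have "\<dots> \<le> C * LL m powr \<kappa>" using that par by (intro mult_left_mono powr_mono2) auto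
      finally show ?thesis using LL(3) by simp
    qed
    show "8 * exp (2 * B) * dd m \<le> rr m * dd m powr h" using rr(2) by simp
  qed (use goodD[OF G] st b rb LL(1,2) rr(1) dd_pos[of m] in auto)
  moreover have "real (Suc j) * (LL m * dd m powr h * rr m / 8) = real j * (LL m * dd m powr h * rr m / 8) + LL m * dd m powr h * rr m / 8"
    by (simp add: distrib_right)
  ultimately show ?case unfolding e using IH by linarith
qed

lemma level_up:
  assumes G: "good g t0 U V K L" and L: "L \<le> LL (Suc m)" and D0: "dd (Suc m) \<le> D0"
    and a: "t0 \<le> a" "(rr (Suc m))\<^sup>2 \<le> - U a * V a" "a + Dc * \<theta> ^ Suc m \<le> 1"
  shows "(rr m)\<^sup>2 \<le> - U (a + Dc * \<theta> ^ Suc m) * V (a + Dc * \<theta> ^ Suc m)"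
proof -
  let ?m = "Suc m"
  \<comment> \<open>Each step gains L \<eta> r / 8, so 24 r / (L \<eta>) steps gain 3 r^2. Together
    with the initial r^2 this is (2 r)^2, enough for the next level because
    \<open>rr m \<le> 2 * rr (Suc m)\<close>.\<close>
  define X where "X = 24 * rr ?m / (LL ?m * dd ?m powr h)"
  have pos: "0 < LL ?m * dd ?m powr h" "0 < rr ?m" using LL(1)[of ?m] rr(1)[of ?m] dd_pos[of ?m] by auto
  define j where "j = nat \<lceil>X\<rceil>"
  have X0: "0 \<le> X" unfolding X_def using pos by simp
  have j: "X \<le> real j" "real j \<le> X + 1" using X0 unfolding j_def by linarith+
  have Xd: "X * dd ?m = 192 * exp (2 * B) / k0 * \<theta> ^ ?m"
  proof -
    have d: "dd ?m > 0" by (rule dd_pos)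
    have "X * dd ?m = 192 * exp (2*B) / k0 * (dd ?m powr (1 - h) * dd ?m powr 1 / (dd ?m powr (h / \<kappa>) * dd ?m powr h))"
      unfolding X_def rr_def LL_def using d k0 by (simp add: field_simps)
    also have "dd ?m powr (1 - h) * dd ?m powr 1 / (dd ?m powr (h / \<kappa>) * dd ?m powr h) = dd ?m powr (2 - 2 * h - h / \<kappa>)"
      unfolding powr_add[symmetric] powr_diff[symmetric] by (simp add: algebra_simps)
    also have "\<dots> = \<theta> ^ ?m" unfolding dd_def \<theta>_def by (rule half_power_powr)
    finally show ?thesis .
  qed
  have "real j * dd ?m \<le> (X + 1) * dd ?m" using j dd_pos[of ?m] by (intro mult_right_mono) auto
  also have "\<dots> \<le> Dc * \<theta> ^ ?m" using theta(3)[of ?m] Xd by (simp add: Dc_def algebra_simps)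
  finally have T: "real j * dd ?m \<le> Dc * \<theta> ^ ?m" .
  then have T1: "a + real j * dd ?m \<le> 1" using a by linarith
  have "X * (LL ?m * dd ?m powr h) = 24 * rr ?m" using pos LL(1)[of ?m] unfolding X_def by simp
  moreover have "X * (LL ?m * dd ?m powr h) \<le> real j * (LL ?m * dd ?m powr h)" using j pos by (intro mult_right_mono) auto
  ultimately have "24 * rr ?m * rr ?m \<le> real j * (LL ?m * dd ?m powr h) * rr ?m" using pos by (intro mult_right_mono) auto
  then have gain: "3 * (rr ?m)\<^sup>2 \<le> real j * (LL ?m * dd ?m powr h * rr ?m / 8)" by (simp add: power2_eq_square algebra_simps)
  have "(rr m)\<^sup>2 \<le> (2 * rr ?m)\<^sup>2" using rr(1)[of m] rr(3)[of m] by (intro power_mono) auto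
  then have "(rr m)\<^sup>2 \<le> (rr ?m)\<^sup>2 + 3 * (rr ?m)\<^sup>2" by (simp add: power_mult_distrib)
  also have "\<dots> \<le> (rr ?m)\<^sup>2 + real j * (LL ?m * dd ?m powr h * rr ?m / 8)" using gain by simp
  also have "\<dots> \<le> - U (a + real j * dd ?m) * V (a + real j * dd ?m)"
    by (rule level_steps[OF G L D0 a(1,2) T1])
  also have "\<dots> \<le> - U (a + Dc * \<theta> ^ Suc m) * V (a + Dc * \<theta> ^ Suc m)"
  proof (rule goodD(5)[OF G])
    have "0 \<le> real j * dd ?m" using dd_pos[of ?m] by simp
    then show "t0 \<le> a + real j * dd ?m" using a(1) by linarith
  qed (use T a in auto)
  finally show ?thesis .
qed

lemma climb:
  assumes G: "good g t0 U V K L" and L: "L \<le> LL (m + d)" and D0: "dd m \<le> D0"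
  shows "t0 \<le> a ==> (rr (m + d))\<^sup>2 \<le> - U a * V a ==> a + (\<Sum>i<d. Dc * \<theta> ^ (m + Suc i)) \<le> 1 ==>
    (rr m)\<^sup>2 \<le> - U (a + (\<Sum>i<d. Dc * \<theta> ^ (m + Suc i))) * V (a + (\<Sum>i<d. Dc * \<theta> ^ (m + Suc i)))"
  using L
proof (induction d arbitrary: a)
  case (Suc d)
  have D: "dd (Suc (m + d)) \<le> D0"
  proof -
    have "dd (Suc (m + d)) \<le> dd m" unfolding dd_def by (intro power_decreasing) auto
    then show ?thesis using D0 by simp
  qed
  have s0: "0 \<le> (\<Sum>i<d. Dc * \<theta> ^ (m + Suc i))" using theta by (intro sum_nonneg) auto
  have T0: "0 \<le> Dc * \<theta> ^ Suc (m + d)" using theta by simp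
  have e: "a + (\<Sum>i<Suc d. Dc * \<theta> ^ (m + Suc i)) = (a + Dc * \<theta> ^ Suc (m + d)) + (\<Sum>i<d. Dc * \<theta> ^ (m + Suc i))" by simp
  have "(rr (m + d))\<^sup>2 \<le> - U (a + Dc * \<theta> ^ Suc (m + d)) * V (a + Dc * \<theta> ^ Suc (m + d))"
    using Suc.prems s0 D unfolding e by (intro level_up[OF G]) auto
  moreover have "L \<le> LL (m + d)" using Suc.prems(4) LL(4)[of "m + d" "m + Suc d"] by auto
  ultimately show ?case using Suc.IH[of "a + Dc * \<theta> ^ Suc (m + d)"] Suc.prems T0 unfolding e by auto
qed simp

text \<open>The times spent on the levels form a geometric series. Choose m so that its tail from m
  on is shorter than s - t0: a solution started at any deeper level n has passed level m by time
  s.\<close>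

lemma uniform_lower_bound:
  assumes "t0 < s" "s \<le> 1"
  obtains c m where "c > 0"
    "\<And>n g U V K. n \<ge> m ==> good g t0 U V K (LL n) ==> - U t0 * V t0 = (rr n)\<^sup>2 ==> c \<le> - U s * V s"
proof -
  have "(\<lambda>m. Dc * (\<theta> ^ m / (1 - \<theta>))) \<longlonglongrightarrow> Dc * (0 / (1 - \<theta>))"
    using theta by (intro tendsto_intros LIMSEQ_power_zero) auto
  then have "eventually (\<lambda>m. Dc * (\<theta> ^ m / (1 - \<theta>)) < s - t0) sequentially" using assms by (intro order_tendstoD) auto
  moreover have "(\<lambda>m. dd m) \<longlonglongrightarrow> 0" unfolding dd_def by (intro LIMSEQ_power_zero) auto
  then have "eventually (\<lambda>m. dd m < D0) sequentially" using par by (intro order_tendstoD) auto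
  ultimately have "eventually (\<lambda>m. Dc * (\<theta> ^ m / (1 - \<theta>)) < s - t0 \<and> dd m < D0) sequentially" by (rule eventually_conj)
  then obtain m where m: "Dc * (\<theta> ^ m / (1 - \<theta>)) < s - t0" "dd m < D0" by (auto simp: eventually_sequentially)
  show thesis
  proof (rule that[of "(rr m)\<^sup>2" m])
    show "0 < (rr m)\<^sup>2" using rr(1)[of m] by simp
    fix n g U V K assume n: "n \<ge> m" and G: "good g t0 U V K (LL n)" and N: "- U t0 * V t0 = (rr n)\<^sup>2"
    define d where "d = n - m"
    have nd: "n = m + d" using n by (simp add: d_def)
    have "(\<Sum>i<d. Dc * \<theta> ^ (m + Suc i)) = Dc * \<theta> ^ Suc m * (\<Sum>i<d. \<theta> ^ i)"
      by (simp add: sum_distrib_left power_add algebra_simps)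
    also have "\<dots> \<le> Dc * \<theta> ^ m * (1 / (1 - \<theta>))"
    proof (intro mult_mono)
      show "\<theta> ^ Suc m \<le> \<theta> ^ m" using theta by (intro power_decreasing) auto
      have "(\<Sum>i<d. \<theta> ^ i) = (1 - \<theta> ^ d) / (1 - \<theta>)" using theta by (simp add: sum_gp_strict)
      also have "\<dots> \<le> 1 / (1 - \<theta>)" using theta by (intro divide_right_mono) auto
      finally show "(\<Sum>i<d. \<theta> ^ i) \<le> 1 / (1 - \<theta>)" .
    qed (use theta in \<open>auto intro!: sum_nonneg\<close>)
    finally have S: "(\<Sum>i<d. Dc * \<theta> ^ (m + Suc i)) \<le> s - t0" using m by simp
    have S0: "0 \<le> (\<Sum>i<d. Dc * \<theta> ^ (m + Suc i))" using theta by (intro sum_nonneg) auto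
    have "(rr m)\<^sup>2 \<le> - U (t0 + (\<Sum>i<d. Dc * \<theta> ^ (m + Suc i))) * V (t0 + (\<Sum>i<d. Dc * \<theta> ^ (m + Suc i)))"
      using N nd m S assms by (intro climb[OF G]) auto
    also have "\<dots> \<le> - U s * V s" using S S0 assms by (intro goodD(5)[OF G]) auto
    finally show "(rr m)\<^sup>2 \<le> - U s * V s" .
  qed
qed

end

section \<open>Backward recursion, compactness and the limit solution\<close>

definition backrec :: "(nat => 'a => 'a) => 'a => nat => nat => 'a" where
  "backrec F x n k = rec_nat x (\<lambda>j y. F (n - Suc j) y) (n - k)"

lemma backrec_start: "backrec F x n n = x" by (simp add: backrec_def)

lemma backrec_step:
  assumes "k < n" shows "backrec F x n k = F k (backrec F x n (Suc k))"
proof -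
  have "n - k = Suc (n - Suc k)" "n - Suc (n - Suc k) = k" using assms by auto
  then show ?thesis by (simp add: backrec_def)
qed

text \<open>The approximations may jump, so they share a modulus only up to errors
  \<open>e n\<close> tending to 0; convergence at rationals still spreads to all points.\<close>

lemma equicontinuous_pointwise_limit:
  fixes f :: "nat => real => real"
  assumes ab: "a < b" and eq: "\<And>n x y. a \<le> x ==> x \<le> y ==> y \<le> b ==> \<bar>f n y - f n x\<bar> \<le> om (y - x) + e n"
    and om: "(om \<longlongrightarrow> 0) (at_right 0)" and e: "e \<longlonglongrightarrow> 0"
    and Q: "\<And>q. q \<in> \<rat> ==> a \<le> q ==> q \<le> b ==> convergent (\<lambda>n. f n q)" and x: "a \<le> x" "x \<le> b"
  shows "convergent (\<lambda>n. f n x)"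
proof -
  have "Cauchy (\<lambda>n. f n x)"
  proof (rule metric_CauchyI)
    fix \<epsilon> :: real assume \<epsilon>: "\<epsilon> > 0"
    have "eventually (\<lambda>r. om r < \<epsilon> / 6) (at_right 0)" using om \<epsilon> by (intro order_tendstoD) auto
    then obtain d where d: "d > 0" "\<And>r. 0 < r ==> r < d ==> om r < \<epsilon> / 6" unfolding eventually_at_right_field by auto
    have "\<exists>q\<in>\<rat>. a \<le> q \<and> q \<le> b \<and> q \<noteq> x \<and> \<bar>q - x\<bar> < d"
    proof (cases "x < b")
      case True
      then obtain q where "q \<in> \<rat>" "x < q" "q < min b (x + d)" using Rats_dense_in_real[of x "min b (x + d)"] d by auto
      then show ?thesis using x by (intro bexI[of _ q]) auto
    next
      case False
      then have "max a (x - d) < x" using ab x d by auto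
      then obtain q where "q \<in> \<rat>" "max a (x - d) < q" "q < x" using Rats_dense_in_real by blast
      then show ?thesis using x by (intro bexI[of _ q]) auto
    qed
    then obtain q where q: "q \<in> \<rat>" "a \<le> q" "q \<le> b" "q \<noteq> x" "\<bar>q - x\<bar> < d" by auto
    have near: "\<bar>f n x - f n q\<bar> \<le> \<epsilon> / 6 + e n" for n
    proof (cases "x < q")
      case True
      then have "\<bar>f n q - f n x\<bar> \<le> om (q - x) + e n" "om (q - x) < \<epsilon> / 6" using eq[of x q n] q x d(2)[of "q - x"] by auto
      then show ?thesis by linarith
    next
      case False
      then have "\<bar>f n x - f n q\<bar> \<le> om (x - q) + e n" "om (x - q) < \<epsilon> / 6" using eq[of q x n] q x d(2)[of "x - q"] by auto
      then show ?thesis by linarith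
    qed
    have "Cauchy (\<lambda>n. f n q)" using Q[OF q(1-3)] convergent_Cauchy by blast
    then obtain N1 where N1: "\<And>m n. m \<ge> N1 ==> n \<ge> N1 ==> dist (f m q) (f n q) < \<epsilon> / 6"
      using metric_CauchyD[of "\<lambda>n. f n q" "\<epsilon>/6"] \<epsilon> by auto
    have "eventually (\<lambda>n. e n < \<epsilon> / 6) sequentially" using e \<epsilon> by (intro order_tendstoD) auto
    then obtain N2 where N2: "\<And>n. n \<ge> N2 ==> e n < \<epsilon> / 6" by (auto simp: eventually_sequentially)
    show "\<exists>M. \<forall>m\<ge>M. \<forall>n\<ge>M. dist (f m x) (f n x) < \<epsilon>"
    proof (intro exI[of _ "max N1 N2"] allI impI)
      fix m n assume "max N1 N2 \<le> m" "max N1 N2 \<le> n"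
      then have "\<bar>f m q - f n q\<bar> < \<epsilon> / 6" "e m < \<epsilon> / 6" "e n < \<epsilon> / 6" using N1[of m n] N2 by (auto simp: dist_real_def)
      then show "dist (f m x) (f n x) < \<epsilon>" using near[of m] near[of n] \<epsilon> unfolding dist_real_def by linarith
    qed
  qed
  then show ?thesis by (simp add: Cauchy_convergent_iff)
qed

lemma pointwise_convergent_subsequence:
  fixes f :: "nat => 'a => 'b::heine_borel"
  assumes S: "countable S" and b: "\<And>x. x \<in> S ==> bounded (range (\<lambda>n. f n x))"
  obtains k :: "nat => nat" where "strict_mono k" "\<And>x. x \<in> S ==> convergent (\<lambda>n. f (k n) x)"
proof (cases "S = {}")
  case True then show ?thesis using that[of id] by (simp add: strict_mono_id)
next
  case False
  define x where "x = from_nat_into S"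
  have xS: "x n \<in> S" for n using False by (simp add: x_def from_nat_into)
  interpret subseqs "\<lambda>n s. convergent (\<lambda>m. f (s m) (x n))"
  proof
    fix n and s :: "nat => nat" assume s: "strict_mono s"
    have "bounded (range (\<lambda>m. f (s m) (x n)))" by (rule bounded_subset[OF b[OF xS[of n]]]) auto
    from bounded_imp_convergent_subsequence[OF this] obtain l r
      where "strict_mono r" "((\<lambda>m. f (s m) (x n)) \<circ> r) \<longlonglongrightarrow> l" by blast
    then show "\<exists>r'. strict_mono r' \<and> convergent (\<lambda>m. f ((s \<circ> r') m) (x n))"
      by (intro exI[of _ r]) (auto simp: convergent_def o_def)
  qed
  show ?thesis
  proof (rule that[OF subseq_diagseq])
    fix y assume "y \<in> S"
    then obtain n where y: "y = x n" using from_nat_into_surj[OF S] unfolding x_def by metis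
    have "convergent (\<lambda>m. f ((diagseq \<circ> ((+) (Suc n))) m) (x n))"
    proof (rule diagseq_holds)
      fix r s :: "nat => nat" and n assume "strict_mono r" "convergent (\<lambda>m. f (s m) (x n))"
      then show "convergent (\<lambda>m. f ((s \<circ> r) m) (x n))"
        using LIMSEQ_subseq_LIMSEQ[of "\<lambda>m. f (s m) (x n)" _ r] unfolding convergent_def o_def by blast
    qed
    then have "convergent (\<lambda>m. f (diagseq (m + Suc n)) (x n))" by (simp add: add.commute)
    then show "convergent (\<lambda>m. f (diagseq m) y)"
      unfolding y using LIMSEQ_offset[of "\<lambda>m. f (diagseq m) (x n)"] by (blast dest: convergentD intro: convergentI)
  qed
qed

context rough_path
begin

text \<open>\<open>R_bound\<close> with a starting radius of at most \<open>8 * exp (2 * B)\<close>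
  and a total jump of at most 1, times the bound \<open>exp B\<close> for \<open>exp\<close> of the
  parameter and of its negative.\<close>

definition MM :: real where "MM = (8 * exp (2 * B) + sinh (2 * B)) * exp B"

text \<open>Replacing \<gamma> by a staircase makes the explicit solutions of \<open>chain\<close>
  available.\<close>

lemma approx_exists:
  assumes t0: "0 \<le> t0" "t0 < 1"
  shows "\<exists>g U V K. good g t0 U V K (LL n) \<and> U t0 = rr n * exp (- w t0) \<and> V t0 = - (rr n * exp (w t0)) \<and> K t0 = 0 \<and>
     (\<forall>y. t0 \<le> y \<longrightarrow> y \<le> 1 \<longrightarrow> \<bar>U y\<bar> \<le> MM \<and> \<bar>V y\<bar> \<le> MM) \<and>
     (\<forall>u v. t0 \<le> u \<longrightarrow> u \<le> v \<longrightarrow> v \<le> 1 \<longrightarrow> \<bar>g v - g u - (v - u)\<bar> \<le> LL n / 2)"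
proof -
  \<comment> \<open>N makes the mesh \<delta> at most \<open>LL n / 2\<close>. Over lengths of at
    least \<open>LL n\<close> the error \<delta> then changes increments by at most half of the
    length.\<close>
  obtain N' :: nat where N': "2 * (1 - t0) / LL n < real N'" using reals_Archimedean2 by blast
  define N where "N = max 1 N'"
  have N: "0 < N" "2 * (1 - t0) / LL n < real N" using N' unfolding N_def by auto
  define \<delta> where "\<delta> = (1 - t0) / real N"
  have \<delta>: "0 < \<delta>" "\<delta> \<le> LL n / 2" "real N * \<delta> = 1 - t0" using N t0 LL(1)[of n] by (auto simp: \<delta>_def field_simps)
  define g where "g = (\<lambda>u. \<delta> * of_int \<lfloor>(u - t0) / \<delta>\<rfloor>)"
  define \<tau> where "\<tau> = (\<lambda>k::nat. t0 + (real N - real k) * \<delta>)"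
  have gd: "\<bar>g v - g u - (v - u)\<bar> \<le> \<delta>" for u v
  proof -
    have gf: "g u = (u - t0) - \<delta> * frac ((u - t0) / \<delta>)" for u
    proof -
      have "\<delta> * ((u - t0) / \<delta>) = u - t0" using \<delta> by simp
      then show ?thesis by (simp only: g_def frac_def right_diff_distrib)
    qed
    have "g v - g u - (v - u) = \<delta> * (frac ((u - t0) / \<delta>) - frac ((v - t0) / \<delta>))" unfolding gf by (simp add: algebra_simps)
    also have "\<bar>\<dots>\<bar> = \<delta> * \<bar>frac ((u - t0) / \<delta>) - frac ((v - t0) / \<delta>)\<bar>" using \<delta> by (simp add: abs_mult)
    also have "\<dots> \<le> \<delta> * 1"
    proof (rule mult_left_mono)
      show "\<bar>frac ((u - t0) / \<delta>) - frac ((v - t0) / \<delta>)\<bar> \<le> 1"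
        using frac_ge_0[of "(u - t0) / \<delta>"] frac_ge_0[of "(v - t0) / \<delta>"]
          frac_lt_1[of "(u - t0) / \<delta>"] frac_lt_1[of "(v - t0) / \<delta>"] by linarith
    qed (use \<delta> in simp)
    finally show ?thesis by simp
  qed
  have g_le: "g u \<le> g v" if "u \<le> v" for u v
    unfolding g_def using \<delta> that by (intro mult_left_mono) (auto intro!: floor_mono divide_right_mono)
  have gtau: "g (\<tau> k) = \<delta> * (real N - real k)" if "k \<le> N" for k
  proof -
    have "(\<tau> k - t0) / \<delta> = of_int (int N - int k)" using \<delta> by (simp add: \<tau>_def)
    then show ?thesis by (simp only: g_def floor_of_int) simp
  qed
  have tau_ends: "\<tau> N = t0" "\<tau> 0 = 1" using \<delta> by (auto simp: \<tau>_def)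
  have tau_Suc: "\<tau> k = \<tau> (Suc k) + \<delta>" for k by (simp add: \<tau>_def algebra_simps)
  define F where "F = (\<lambda>k (p::real\<times>real). let f = flow w (\<tau> (Suc k)) (\<tau> k) (snd p); x = g (\<tau> k) - g (\<tau> (Suc k)) in
     (jump_R (w (\<tau> k)) x (fst p) f, jump_l (w (\<tau> k)) x (fst p) f))"
  \<comment> \<open>The start is on the boundary: l = - w t0 makes sinh (w + l) vanish.\<close>
  define s where "s = backrec F (rr n, - w t0) N"
  define R l where "R = (\<lambda>k. fst (s k))" and "l = (\<lambda>k. snd (s k))"
  interpret chain w g \<tau> N R l
  proof
    show "continuous_on {\<tau> N..1} w" unfolding tau_ends using t0 by (intro continuous_on_subset[OF cont]) auto
    show "\<tau> (Suc k) \<le> \<tau> k" for k using \<delta> tau_Suc[of k] by simp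
    show "\<tau> 0 \<le> 1" by (simp add: tau_ends)
    show "g (\<tau> (Suc k)) \<le> g (\<tau> k)" for k using \<delta> tau_Suc[of k] by (intro g_le) simp
    show "g t = g (\<tau> (Suc k))" if "k < N" "\<tau> (Suc k) \<le> t" "t < \<tau> k" for k t
    proof -
      have "real N - real (Suc k) \<le> (t - t0) / \<delta>" "(t - t0) / \<delta> < real N - real k"
        using that \<delta>(1) by (auto simp: \<tau>_def field_simps)
      then have "\<lfloor>(t - t0) / \<delta>\<rfloor> = int N - int (Suc k)" by (intro floor_unique) auto
      then have "g t = \<delta> * (real N - real (Suc k))" by (simp add: g_def)
      then show ?thesis using gtau[of "Suc k"] that by simp
    qed
    show "g t = g (\<tau> 0)" if "\<tau> 0 \<le> t" "t \<le> 1" for t using that tau_ends by simp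
    show "R N > 0" "- w (\<tau> N) \<le> l N" using rr(1) by (auto simp: R_def l_def s_def backrec_start tau_ends)
    fix k assume k: "k < N"
    show "R k = jump_R (w (\<tau> k)) (g (\<tau> k) - g (\<tau> (Suc k))) (R (Suc k)) (flow w (\<tau> (Suc k)) (\<tau> k) (l (Suc k)))"
      unfolding R_def l_def s_def by (subst backrec_step[OF k]) (simp add: F_def Let_def)
    show "l k = jump_l (w (\<tau> k)) (g (\<tau> k) - g (\<tau> (Suc k))) (R (Suc k)) (flow w (\<tau> (Suc k)) (\<tau> k) (l (Suc k)))"
      unfolding R_def l_def s_def by (subst (1) backrec_step[OF k]) (simp add: F_def Let_def)
  qed
  have E: "esol w g t0 1 pU pV pK" using esol_path tau_ends by simp
  have E': "esol w g t0 1 pU pV (\<lambda>t. pK t - pK t0)" by (rule esol_cong[OF E, where c="- pK t0" and d=0]) auto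
  have RN: "R N = rr n" "l N = - w t0" by (simp_all add: R_def l_def s_def backrec_start)
  have Bt: "\<bar>w t\<bar> \<le> B" if "\<tau> N \<le> t" "t \<le> 1" for t using B[of t] that t0 tau_ends by auto
  have lB: "l N \<le> B" using Bt[of t0] RN tau_ends t0 by auto
  have N: "- pU x * pV x = (R (idx x))\<^sup>2" for x
    by (simp add: pU_def pV_def power2_eq_square mult.assoc exp_minus)
  have st: "idx t \<le> N" "- B \<le> pL t" "pL t \<le> B" "R (idx t) > 0" if t: "t0 \<le> t" "t \<le> 1" for t
  proof -
    have t': "\<tau> N \<le> t" using t tau_ends by simp
    show "idx t \<le> N" "R (idx t) > 0" using path_state(1,4)[OF t' t(2)] by auto
    show "- B \<le> pL t" using path_state(3)[OF t' t(2)] Bt[OF t' t(2)] by linarith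
    show "pL t \<le> B" by (rule path_state(5)[OF t' t(2) Bt lB])
  qed
  show ?thesis
  proof (intro exI conjI allI impI)
    show "good g t0 pU pV (\<lambda>t. pK t - pK t0) (LL n)"
      unfolding good_def
    proof (intro conjI ballI allI impI)
      show "mono_on {t0..1} g" using g_le by (auto simp: mono_on_def)
      show "0 < pU y" "pV y < 0" if "y \<in> {t0..1}" for y using st[of y] that by (auto simp: pU_def pV_def)
      show "- pU x * pV x \<le> - pU y * pV y" if "t0 \<le> x" "x \<le> y" "y \<le> 1" for x y
        unfolding N using st[of x] st[of y] that idx_antimono[of x y] R_antimono[of "idx y" "idx x"] tau_ends by (intro power_mono) auto
      fix x y assume xy: "t0 \<le> x" "x + LL n \<le> y" "y \<le> 1"
      show "(y - x) / 2 \<le> g y - g x" "g y - g x \<le> 2 * (y - x)" using gd[of y x] \<delta> xy by (auto simp: abs_le_iff)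
    qed (use t0 E' in auto)
    have n: "pL t0 = l N" "R (idx t0) = R N" using node_props[of N] tau_ends by auto
    show "pU t0 = rr n * exp (- w t0)" "pV t0 = - (rr n * exp (w t0))" unfolding pU_def pV_def n RN by simp_all
    show "pK t0 - pK t0 = 0" by simp
    show "\<bar>g v - g u - (v - u)\<bar> \<le> LL n / 2" for u v using gd[of v u] \<delta> by linarith
    fix y assume y: "t0 \<le> y" "y \<le> 1"
    have B0: "0 \<le> B" using Bt[of t0] tau_ends t0 by auto
    have "R (idx y) \<le> R N + (g (\<tau> (idx y)) - g (\<tau> N)) * sinh (2 * B)"
      using st[OF y] Bt lB by (intro R_bound) auto
    also have "\<dots> \<le> 8 * exp (2 * B) + 1 * sinh (2 * B)"
    proof (intro add_mono mult_right_mono)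
      have "dd n powr (1 - h) \<le> 1" using dd_pos[of n] par by (intro powr_le1) auto
      then show "R N \<le> 8 * exp (2 * B)" unfolding RN rr_def by simp
      have "g (\<tau> (idx y)) \<le> g 1" using tau_le1[of "idx y"] st[OF y] by (intro g_le) auto
      also have "g 1 = 1 - t0" using gtau[of 0] tau_ends \<delta> by (simp add: mult.commute)
      finally show "g (\<tau> (idx y)) - g (\<tau> N) \<le> 1" using gtau[of N] t0 by simp
      show "0 \<le> sinh (2 * B)" using B0 by simp
    qed
    finally have "R (idx y) \<le> 8 * exp (2 * B) + sinh (2 * B)" by simp
    then have "R (idx y) * exp (pL y) \<le> MM" "R (idx y) * exp (- pL y) \<le> MM"
      unfolding MM_def using st[OF y] B0 by (auto intro!: mult_mono)
    then show "\<bar>pU y\<bar> \<le> MM" "\<bar>pV y\<bar> \<le> MM" unfolding pU_def pV_def using st(4)[OF y] by (auto simp: abs_mult)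
  qed
qed

text \<open>Positivity, monotonicity and the integral inequalities pass to pointwise limits.
  Right-continuity of K follows from the common modulus, and the contact clause from compactness of
  the contact times. The lower bound after t0 survives because \<open>uniform_lower_bound\<close>
  does not depend on the index.\<close>

theorem exists_from_zero:
  assumes t0: "0 \<le> t0" "t0 < 1"
  shows "\<exists>U V K. esol w (\<lambda>u. u) t0 1 U V K \<and> U t0 = 0 \<and> V t0 = 0 \<and> (\<forall>s. t0 < s \<longrightarrow> s \<le> 1 \<longrightarrow> 0 < - U s * V s)"
proof -
  define P where "P = (\<lambda>n g U V K. good g t0 U V K (LL n) \<and> U t0 = rr n * exp (- w t0) \<and> V t0 = - (rr n * exp (w t0)) \<and> K t0 = 0 \<and>
     (\<forall>y. t0 \<le> y \<longrightarrow> y \<le> 1 \<longrightarrow> \<bar>U y\<bar> \<le> MM \<and> \<bar>V y\<bar> \<le> MM) \<and>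
     (\<forall>u v. t0 \<le> u \<longrightarrow> u \<le> v \<longrightarrow> v \<le> 1 \<longrightarrow> \<bar>g v - g u - (v - u)\<bar> \<le> LL n / 2))"
  have "\<forall>n. \<exists>g U V K. P n g U V K" unfolding P_def using approx_exists[OF t0] by blast
  then obtain g U V K where P: "\<And>n. P n (g n) (U n) (V n) (K n)" by metis
  have G: "good (g n) t0 (U n) (V n) (K n) (LL n)" and st: "U n t0 = rr n * exp (- w t0)" "V n t0 = - (rr n * exp (w t0))" "K n t0 = 0"
    and bd: "\<And>y. t0 \<le> y ==> y \<le> 1 ==> \<bar>U n y\<bar> \<le> MM \<and> \<bar>V n y\<bar> \<le> MM"
    and gd: "\<And>u v. t0 \<le> u ==> u \<le> v ==> v \<le> 1 ==> \<bar>g n v - g n u - (v - u)\<bar> \<le> LL n / 2" for n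
    using P[of n] unfolding P_def by blast+
  have E: "esol w (g n) t0 1 (U n) (V n) (K n)" for n by (rule goodD(2)[OF G])
  have Bt: "\<bar>w y\<bar> \<le> B" if "t0 \<le> y" "y \<le> 1" for y using B[of y] that t0 by auto
  have B0: "0 \<le> B" using Bt[of t0] t0 by auto
  have MM0: "0 \<le> MM" using bd[of t0 0] t0 by auto
  \<comment> \<open>The modulus of K from \<open>esol_K_increment\<close> and the Hoelder bound; the
    terms with \<open>dd n\<close> in e come from the steps of the staircase
    \<open>g n\<close>.\<close>
  define omK where "omK = (\<lambda>x. exp (2 * B) * x + MM * exp B * (C * x powr \<kappa>))"
  define om where "om = (\<lambda>x. exp B * (omK x + x))"
  define e where "e = (\<lambda>n. exp B * (exp (2 * B) * dd n + dd n))"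
  have dg: "0 \<le> g n v - g n u" "g n v - g n u \<le> (v - u) + dd n" if "t0 \<le> u" "u \<le> v" "v \<le> 1" for n u v
  proof -
    show "0 \<le> g n v - g n u" using goodD(6)[OF G[of n]] that by (auto simp: mono_on_def)
    show "g n v - g n u \<le> (v - u) + dd n" using gd[OF that, of n] LL(1,2)[of n] by linarith
  qed
  have eB: "1 \<le> exp B" using B0 by simp
  have Kinc: "0 \<le> K n v - K n u" "K n v - K n u \<le> omK (v - u) + exp (2 * B) * dd n" if uv: "t0 \<le> u" "u \<le> v" "v \<le> 1" for n u v
  proof -
    show "0 \<le> K n v - K n u" using esolD(1)[OF E[of n]] uv by (auto simp: mono_on_def)
    have "K n v - K n u \<le> exp (2 * B) * (g n v - g n u) + MM * exp B * (C * (v - u) powr \<kappa>)"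
    proof (rule esol_K_increment[OF E Bt goodD(6)[OF G] uv])
      show "\<bar>U n u\<bar> \<le> MM" "\<bar>V n u\<bar> \<le> MM" using bd[of u n] uv by auto
      show "\<bar>w y - w u\<bar> \<le> C * (v - u) powr \<kappa>" if "u \<le> y" "y \<le> v" for y
      proof -
        have "\<bar>w y - w u\<bar> \<le> C * (y - u) powr \<kappa>" using that uv t0 by (intro holder) auto
        also have "\<dots> \<le> C * (v - u) powr \<kappa>" using that par by (intro mult_left_mono powr_mono2) auto
        finally show ?thesis .
      qed
    qed
    also have "exp (2 * B) * (g n v - g n u) \<le> exp (2 * B) * ((v - u) + dd n)" using dg[OF uv] by (intro mult_left_mono) auto
    finally show "K n v - K n u \<le> omK (v - u) + exp (2 * B) * dd n" by (simp add: omK_def algebra_simps)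
  qed
  have omK0: "0 \<le> omK x" if "0 \<le> x" for x unfolding omK_def using that MM0 par by simp
  have eqK: "\<bar>K n v - K n u\<bar> \<le> om (v - u) + e n" and eqU: "\<bar>U n v - U n u\<bar> \<le> om (v - u) + e n" and eqV: "\<bar>V n v - V n u\<bar> \<le> om (v - u) + e n"
    if uv: "t0 \<le> u" "u \<le> v" "v \<le> 1" for n u v
  proof -
    let ?k = "K n v - K n u" and ?g = "g n v - g n u"
    have tot: "exp B * (?k + ?g) \<le> om (v - u) + e n"
    proof -
      have "?k + ?g \<le> (omK (v - u) + (v - u)) + (exp (2 * B) * dd n + dd n)" using Kinc[OF uv, of n] dg[OF uv, of n] by linarith
      then have "exp B * (?k + ?g) \<le> exp B * ((omK (v - u) + (v - u)) + (exp (2 * B) * dd n + dd n))" by (intro mult_left_mono) auto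
      then show ?thesis by (simp add: om_def e_def distrib_left)
    qed
    have k0: "0 \<le> ?k" and g0: "0 \<le> ?g" using Kinc[OF uv] dg[OF uv] by auto
    have "?k + ?g \<le> exp B * (?k + ?g)" using eB k0 g0 mult_right_mono[of 1 "exp B" "?k + ?g"] by simp
    then show "\<bar>K n v - K n u\<bar> \<le> om (v - u) + e n" using tot k0 g0 by linarith
    have "0 \<le> exp B * ?k" "0 \<le> exp B * ?g" using k0 g0 by auto
    then show "\<bar>U n v - U n u\<bar> \<le> om (v - u) + e n" "\<bar>V n v - V n u\<bar> \<le> om (v - u) + e n"
      using esol_UV_increment[OF E Bt uv, of n] tot unfolding distrib_left by linarith+
  qed
  have omlim: "((\<lambda>n. om (x n)) \<longlongrightarrow> 0) F" if "(x \<longlongrightarrow> 0) F" "eventually (\<lambda>n. 0 \<le> x n) F" for x :: "'z => real" and F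
  proof -
    have "((\<lambda>n. x n powr \<kappa>) \<longlongrightarrow> 0 powr \<kappa>) F" using that par by (intro tendsto_powr2) auto
    then have "((\<lambda>n. exp B * (exp (2 * B) * x n + MM * exp B * (C * x n powr \<kappa>) + x n)) \<longlongrightarrow> exp B * (exp (2 * B) * 0 + MM * exp B * (C * 0 powr \<kappa>) + 0)) F"
      using that par by (intro tendsto_intros) auto
    then show ?thesis unfolding om_def omK_def by simp
  qed
  have dd0: "dd \<longlonglongrightarrow> 0" unfolding dd_def[abs_def] by (intro LIMSEQ_power_zero) auto
  have e0: "e \<longlonglongrightarrow> 0"
  proof -
    have "(\<lambda>n. exp B * (exp (2 * B) * dd n + dd n)) \<longlonglongrightarrow> exp B * (exp (2 * B) * 0 + 0)" by (intro tendsto_intros dd0)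
    then show ?thesis by (simp add: e_def)
  qed
  obtain k where k: "strict_mono k" and kc: "\<And>q. q \<in> \<rat> \<inter> {t0..1} ==> convergent (\<lambda>n. (U (k n) q, V (k n) q, K (k n) q))"
  proof (rule pointwise_convergent_subsequence[of "\<rat> \<inter> {t0..1}" "\<lambda>n q. (U n q, V n q, K n q)"])
    show "countable (\<rat> \<inter> {t0..1})" by (intro countable_Int1 countable_rat)
    fix q assume q: "q \<in> \<rat> \<inter> {t0..1}"
    show "bounded (range (\<lambda>n. (U n q, V n q, K n q)))"
    proof (rule boundedI, elim rangeE, hypsubst)
      fix n
      have "K n q - K n t0 \<le> omK (q - t0) + exp (2 * B) * dd n" using Kinc[of t0 q n] q t0 by auto
      also have "\<dots> \<le> omK (q - t0) + exp (2 * B) * 1" using dd_pos[of n] by (intro add_left_mono mult_left_mono) auto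
      finally have "\<bar>K n q\<bar> \<le> omK (q - t0) + exp (2 * B)" using Kinc[of t0 q n] q t0 st[of n] by auto
      then show "norm (U n q, V n q, K n q) \<le> MM + (MM + (omK (q - t0) + exp (2 * B)))"
        using bd[of q n] q by (intro order_trans[OF norm_Pair_le] add_mono) auto
    qed
  qed blast
  have kn: "n \<le> k n" for n using seq_suble[OF k] .
  have ek: "(\<lambda>n. e (k n)) \<longlonglongrightarrow> 0" using LIMSEQ_subseq_LIMSEQ[OF e0 k] by (simp add: o_def)
  have c3: "convergent (\<lambda>n. U (k n) q)" "convergent (\<lambda>n. V (k n) q)" "convergent (\<lambda>n. K (k n) q)" if "q \<in> \<rat>" "t0 \<le> q" "q \<le> 1" for q
  proof -
    have "convergent (\<lambda>n. (U (k n) q, V (k n) q, K (k n) q))" by (rule kc) (use that in simp)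
    then obtain l where l: "(\<lambda>n. (U (k n) q, V (k n) q, K (k n) q)) \<longlonglongrightarrow> l" unfolding convergent_def by blast
    show "convergent (\<lambda>n. U (k n) q)" using tendsto_fst[OF l] by (auto simp: convergent_def)
    show "convergent (\<lambda>n. V (k n) q)" using tendsto_fst[OF tendsto_snd[OF l]] by (auto simp: convergent_def)
    show "convergent (\<lambda>n. K (k n) q)" using tendsto_snd[OF tendsto_snd[OF l]] by (auto simp: convergent_def)
  qed
  have omr: "(om \<longlongrightarrow> 0) (at_right 0)"
    by (rule omlim[of "\<lambda>x. x"]) (auto intro!: tendsto_ident_at simp: eventually_at_right_less eventually_at_filter)
  define Ul Vl Kl where "Ul = (\<lambda>x. lim (\<lambda>n. U (k n) x))" and "Vl = (\<lambda>x. lim (\<lambda>n. V (k n) x))" and "Kl = (\<lambda>x. lim (\<lambda>n. K (k n) x))"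
  have limU: "(\<lambda>n. U (k n) x) \<longlonglongrightarrow> Ul x" and limV: "(\<lambda>n. V (k n) x) \<longlonglongrightarrow> Vl x" and limK: "(\<lambda>n. K (k n) x) \<longlonglongrightarrow> Kl x"
    if x: "t0 \<le> x" "x \<le> 1" for x
  proof -
    have "convergent (\<lambda>n. U (k n) x)" by (rule equicontinuous_pointwise_limit[OF t0(2) eqU omr ek c3(1) x])
    then show "(\<lambda>n. U (k n) x) \<longlonglongrightarrow> Ul x" by (simp add: convergent_LIMSEQ_iff Ul_def)
    have "convergent (\<lambda>n. V (k n) x)" by (rule equicontinuous_pointwise_limit[OF t0(2) eqV omr ek c3(2) x])
    then show "(\<lambda>n. V (k n) x) \<longlonglongrightarrow> Vl x" by (simp add: convergent_LIMSEQ_iff Vl_def)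
    have "convergent (\<lambda>n. K (k n) x)" by (rule equicontinuous_pointwise_limit[OF t0(2) eqK omr ek c3(3) x])
    then show "(\<lambda>n. K (k n) x) \<longlonglongrightarrow> Kl x" by (simp add: convergent_LIMSEQ_iff Kl_def)
  qed
  have limg: "(\<lambda>n. g (k n) v - g (k n) u) \<longlonglongrightarrow> v - u" if uv: "t0 \<le> u" "u \<le> v" "v \<le> 1" for u v
  proof -
    have "(\<lambda>n. g (k n) v - g (k n) u - (v - u)) \<longlonglongrightarrow> 0"
    proof (rule Lim_null_comparison)
      show "eventually (\<lambda>n. norm (g (k n) v - g (k n) u - (v - u)) \<le> dd (k n)) sequentially"
      proof (intro always_eventually allI)
        fix n
        show "norm (g (k n) v - g (k n) u - (v - u)) \<le> dd (k n)"
          using gd[OF uv, of "k n"] LL(1,2)[of "k n"] unfolding real_norm_def by linarith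
      qed
      show "(\<lambda>n. dd (k n)) \<longlonglongrightarrow> 0" using LIMSEQ_subseq_LIMSEQ[OF dd0 k] by (simp add: o_def)
    qed
    then have "(\<lambda>n. g (k n) v - g (k n) u - (v - u) + (v - u)) \<longlonglongrightarrow> 0 + (v - u)" by (intro tendsto_intros)
    then show ?thesis by simp
  qed
  have abs_eq: "\<bar>X n y - X n x\<bar> \<le> om \<bar>y - x\<bar> + e n" if X: "X = U \<or> X = V \<or> X = K" and xy: "t0 \<le> x" "x \<le> 1" "t0 \<le> y" "y \<le> 1" for X n x y
  proof (cases "x \<le> y")
    case True then show ?thesis using X eqU[of x y n] eqV[of x y n] eqK[of x y n] xy by auto
  next
    case False then show ?thesis using X eqU[of y x n] eqV[of y x n] eqK[of y x n] xy by (auto simp: abs_minus_commute)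
  qed
  have Kl_inc: "Kl y - Kl x \<le> om (y - x)" if "t0 \<le> x" "x \<le> y" "y \<le> 1" for x y
  proof (rule LIMSEQ_le)
    show "(\<lambda>n. K (k n) y - K (k n) x) \<longlonglongrightarrow> Kl y - Kl x" using that by (intro tendsto_intros limK) auto
    show "(\<lambda>n. om (y - x) + e (k n)) \<longlonglongrightarrow> om (y - x)" using tendsto_add[OF tendsto_const ek] by simp
    show "\<exists>N. \<forall>n\<ge>N. K (k n) y - K (k n) x \<le> om (y - x) + e (k n)" using eqK[OF that] by (auto simp: abs_le_iff)
  qed
  have Kl_mono: "Kl x \<le> Kl y" if "t0 \<le> x" "x \<le> y" "y \<le> 1" for x y
    using Kinc(1)[OF that] that by (intro LIMSEQ_le[OF limK limK]) auto
  have "esol w (\<lambda>u. u) t0 1 Ul Vl Kl"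
    unfolding esol_def
  proof (intro conjI allI impI ballI)
    show "mono_on {t0..1} Kl" using Kl_mono by (auto simp: mono_on_def)
    show "rcont_on t0 1 Kl"
      unfolding rcont_on_def continuous_within
    proof
      fix t assume t: "t \<in> {t0..<1}"
      have "((\<lambda>s. Kl s - Kl t) \<longlongrightarrow> 0) (at_right t)"
      proof (rule Lim_null_comparison)
        show "eventually (\<lambda>s. norm (Kl s - Kl t) \<le> om (s - t)) (at_right t)"
        proof -
          have "norm (Kl s - Kl t) \<le> om (s - t)" if "t < s" "s < 1" for s
            using Kl_inc[of t s] Kl_mono[of t s] that t by auto
          then show ?thesis unfolding eventually_at_right_field using t by (intro exI[of _ 1]) auto
        qed
        show "((\<lambda>s. om (s - t)) \<longlongrightarrow> 0) (at_right t)"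
        proof (rule omlim)
          show "((\<lambda>s. s - t) \<longlongrightarrow> 0) (at_right t)" by (auto intro!: tendsto_eq_intros)
          show "eventually (\<lambda>s. 0 \<le> s - t) (at_right t)" by (auto simp: eventually_at_filter)
        qed
      qed
      then show "(Kl \<longlongrightarrow> Kl t) (at_right t)" by (rule LIM_zero_cancel)
    qed
    show "0 \<le> exp (w t) * Ul t + exp (- w t) * Vl t" if "t \<in> {t0..1}" for t
    proof (rule LIMSEQ_le_const)
      show "(\<lambda>n. exp (w t) * U (k n) t + exp (- w t) * V (k n) t) \<longlonglongrightarrow> exp (w t) * Ul t + exp (- w t) * Vl t"
        using that by (intro tendsto_intros limU limV) auto
      show "\<exists>N. \<forall>n\<ge>N. 0 \<le> exp (w t) * U (k n) t + exp (- w t) * V (k n) t" using esolD(3)[OF E] that by auto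
    qed
    show "m * (Kl v - Kl u) - M * (v - u) \<le> p * (Ul v - Ul u) + q * (Vl v - Vl u)"
      if uv: "t0 \<le> u" "u \<le> v" "v \<le> 1" and
      b: "\<forall>y\<in>{u..v}. m \<le> p * exp (- w y) + q * exp (w y) \<and> p * exp (- w y) + q * exp (w y) \<le> M" for u v m M p q
    proof (rule LIMSEQ_le)
      show "(\<lambda>n. m * (K (k n) v - K (k n) u) - M * (g (k n) v - g (k n) u)) \<longlonglongrightarrow> m * (Kl v - Kl u) - M * (v - u)"
        using uv by (intro tendsto_intros limK limg) auto
      show "(\<lambda>n. p * (U (k n) v - U (k n) u) + q * (V (k n) v - V (k n) u)) \<longlonglongrightarrow> p * (Ul v - Ul u) + q * (Vl v - Vl u)"
        using uv by (intro tendsto_intros limU limV) auto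
      show "\<exists>N. \<forall>n\<ge>N. m * (K (k n) v - K (k n) u) - M * (g (k n) v - g (k n) u) \<le> p * (U (k n) v - U (k n) u) + q * (V (k n) v - V (k n) u)"
        using esolD(4)[OF E uv, of m p q M] b by auto
    qed
    fix u v assume uv: "t0 \<le> u" "u < v" "v \<le> 1" "Kl u < Kl v"
    have "eventually (\<lambda>n. K (k n) v - K (k n) u > 0) sequentially"
      using uv by (intro order_tendstoD(1)[OF tendsto_diff[OF limK limK]]) auto
    then obtain N where N: "\<And>n. n \<ge> N ==> K (k n) u < K (k n) v" by (auto simp: eventually_sequentially)
    have "\<forall>n. \<exists>r. n \<ge> N \<longrightarrow> r \<in> {u<..v} \<and> exp (w r) * U (k n) r + exp (- w r) * V (k n) r = 0 \<and> K (k n) r = K (k n) v"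
      using esolD(6)[OF E, of u v] N uv by blast
    then obtain r where r: "\<And>n. n \<ge> N ==> r n \<in> {u<..v} \<and> exp (w (r n)) * U (k n) (r n) + exp (- w (r n)) * V (k n) (r n) = 0 \<and> K (k n) (r n) = K (k n) v"
      by metis
    \<comment> \<open>The shift by N skips the indices for which no contact is known.\<close>
    have "\<forall>n. r (n + N) \<in> {u..v}" using r by (metis greaterThanAtMost_iff atLeastAtMost_iff le_add2 less_imp_le)
    then obtain l s where l: "l \<in> {u..v}" "strict_mono s" "((\<lambda>n. r (n + N)) \<circ> s) \<longlonglongrightarrow> l"
      using compact_Icc[of u v, unfolded compact_eq_seq_compact_metric seq_compact_def] by meson
    define \<rho> where "\<rho> = (\<lambda>n. r (s n + N))"
    define m where "m = (\<lambda>n. k (s n + N))"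
    have sm: "strict_mono (\<lambda>n. s n + N)" using l(2) by (auto simp: strict_mono_def)
    have \<rho>: "\<rho> \<longlonglongrightarrow> l" using l(3) by (simp add: \<rho>_def o_def)
    have \<rho>r: "u < \<rho> n" "\<rho> n \<le> v" "exp (w (\<rho> n)) * U (m n) (\<rho> n) + exp (- w (\<rho> n)) * V (m n) (\<rho> n) = 0" "K (m n) (\<rho> n) = K (m n) v" for n
      using r[of "s n + N"] by (auto simp: \<rho>_def m_def)
    have em: "(\<lambda>n. e (m n)) \<longlonglongrightarrow> 0" using LIMSEQ_subseq_LIMSEQ[OF ek sm] by (simp add: o_def m_def)
    \<comment> \<open>Convergence along the moving contact times: the common modulus at the distance
      to l, plus the error, tends to 0.\<close>
    have close: "(\<lambda>n. X (m n) (\<rho> n)) \<longlonglongrightarrow> L" if X: "X = U \<or> X = V \<or> X = K" and L: "(\<lambda>n. X (k n) l) \<longlonglongrightarrow> L" for X L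
    proof -
      have "(\<lambda>n. X (m n) (\<rho> n) - X (m n) l) \<longlonglongrightarrow> 0"
      proof (rule Lim_null_comparison)
        show "eventually (\<lambda>n. norm (X (m n) (\<rho> n) - X (m n) l) \<le> om \<bar>\<rho> n - l\<bar> + e (m n)) sequentially"
        proof (intro always_eventually allI)
          fix n
          have "t0 \<le> \<rho> n" "\<rho> n \<le> 1" "t0 \<le> l" "l \<le> 1" using \<rho>r(1,2)[of n] uv l(1) by auto
          then show "norm (X (m n) (\<rho> n) - X (m n) l) \<le> om \<bar>\<rho> n - l\<bar> + e (m n)" unfolding real_norm_def by (intro abs_eq[OF X])
        qed
        have "(\<lambda>n. \<bar>\<rho> n - l\<bar>) \<longlonglongrightarrow> 0" using \<rho> by (intro tendsto_rabs_zero LIM_zero)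
        then show "(\<lambda>n. om \<bar>\<rho> n - l\<bar> + e (m n)) \<longlonglongrightarrow> 0" by (intro tendsto_add_zero omlim em) auto
      qed
      moreover have "(\<lambda>n. X (m n) l) \<longlonglongrightarrow> L" using LIMSEQ_subseq_LIMSEQ[OF L sm] by (simp add: o_def m_def)
      ultimately have "(\<lambda>n. (X (m n) (\<rho> n) - X (m n) l) + X (m n) l) \<longlonglongrightarrow> 0 + L" by (rule tendsto_add)
      then show ?thesis by simp
    qed
    have ll: "t0 \<le> l" "l \<le> 1" using l uv by auto
    have "(\<lambda>n. K (m n) (\<rho> n)) \<longlonglongrightarrow> Kl l" by (rule close[of K]) (use limK[OF ll] in simp_all)
    then have "(\<lambda>n. K (m n) v) \<longlonglongrightarrow> Kl l" by (simp add: \<rho>r(4))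
    moreover have "(\<lambda>n. K (m n) v) \<longlonglongrightarrow> Kl v" using LIMSEQ_subseq_LIMSEQ[OF limK sm, of v] uv by (simp add: o_def m_def)
    ultimately have Klv: "Kl l = Kl v" by (rule LIMSEQ_unique)
    have wl: "(\<lambda>n. w (\<rho> n)) \<longlonglongrightarrow> w l"
    proof -
      have "\<rho> n \<in> {0..1}" for n using \<rho>r(1,2)[of n] uv t0 by auto
      moreover have "l \<in> {0..1}" using ll t0 by auto
      ultimately have "(w \<circ> \<rho>) \<longlonglongrightarrow> w l" using cont \<rho> unfolding continuous_on_sequentially by blast
      then show ?thesis by (simp add: o_def)
    qed
    have "(\<lambda>n. exp (w (\<rho> n)) * U (m n) (\<rho> n) + exp (- w (\<rho> n)) * V (m n) (\<rho> n)) \<longlonglongrightarrow> exp (w l) * Ul l + exp (- w l) * Vl l"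
      using close[of U, OF _ limU[OF ll]] close[of V, OF _ limV[OF ll]] by (intro tendsto_intros wl) simp_all
    then have z: "exp (w l) * Ul l + exp (- w l) * Vl l = 0" by (simp add: \<rho>r(3) LIMSEQ_const_iff)
    \<comment> \<open>Times in (u, v] could converge to u; K l = K v > K u excludes it.\<close>
    have "l \<noteq> u" using Klv uv by auto
    then show "\<exists>r\<in>{u<..v}. exp (w r) * Ul r + exp (- w r) * Vl r = 0 \<and> Kl r = Kl v"
      using z Klv l by (intro bexI[of _ l]) auto
  qed
  moreover have rr0: "(\<lambda>n. rr (k n)) \<longlonglongrightarrow> 0"
  proof -
    have "(1/2::real) powr (1 - h) < 1" using par by (subst powr01_less_one) auto
    then have "(\<lambda>n. 8 * exp (2 * B) * ((1/2) powr (1 - h)) ^ n) \<longlonglongrightarrow> 8 * exp (2 * B) * 0"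
      by (intro tendsto_intros LIMSEQ_power_zero) auto
    then have "rr \<longlonglongrightarrow> 0" unfolding rr_def[abs_def] dd_def half_power_powr by simp
    then show ?thesis using LIMSEQ_subseq_LIMSEQ[OF _ k, of rr] by (simp add: o_def)
  qed
  have "Ul t0 = 0"
    using tendsto_mult_left_zero[OF rr0, of "exp (- w t0)"] limU[of t0] t0 by (intro LIMSEQ_unique[of "\<lambda>n. U (k n) t0"]) (auto simp: st)
  moreover have "Vl t0 = 0"
    using tendsto_minus[OF tendsto_mult_left_zero[OF rr0, of "exp (w t0)"]] limV[of t0] t0 by (intro LIMSEQ_unique[of "\<lambda>n. V (k n) t0"]) (auto simp: st)
  moreover have "0 < - Ul s * Vl s" if s: "t0 < s" "s \<le> 1" for s
  proof -
    obtain c m where c: "c > 0"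
      "\<And>n g U V K. n \<ge> m ==> good g t0 U V K (LL n) ==> - U t0 * V t0 = (rr n)\<^sup>2 ==> c \<le> - U s * V s"
      using uniform_lower_bound[OF s] by blast
    have "- U n t0 * V n t0 = (rr n)\<^sup>2" for n by (simp add: st power2_eq_square exp_minus)
    then have "c \<le> - U (k n) s * V (k n) s" if "n \<ge> m" for n using c(2)[OF _ G] kn[of n] that by (meson order_trans)
    moreover have "(\<lambda>n. - U (k n) s * V (k n) s) \<longlonglongrightarrow> - Ul s * Vl s" using s by (intro tendsto_intros limU limV) auto
    ultimately have "c \<le> - Ul s * Vl s" by (intro LIMSEQ_le_const) auto
    then show ?thesis using c by linarith
  qed
  ultimately show ?thesis by blast
qed

end

text \<open>At the origin K compensates \<gamma> exactly, and the integral inequality reduces to m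
  <= M.\<close>

lemma esol_zero: "esol w (\<lambda>u. u) a b (\<lambda>_. 0) (\<lambda>_. 0) (\<lambda>u. u)"
  unfolding esol_def
proof (intro conjI allI impI ballI)
  show "rcont_on a b (\<lambda>u. u)" unfolding rcont_on_def by (auto intro: continuous_intros)
  fix u v m M p q :: real
  assume uv: "u \<le> v" and b: "\<forall>y\<in>{u..v}. m \<le> p * exp (- w y) + q * exp (w y) \<and> p * exp (- w y) + q * exp (w y) \<le> M"
  have "m \<le> M" using b[rule_format, of u] uv by auto
  then show "m * (v - u) - M * (v - u) \<le> p * (0 - 0) + q * (0 - 0)" using uv by (simp add: mult_right_mono)
qed (auto simp: mono_on_def)

lemma zvec_eq_0_iff: "zvec w U V t = 0 \<longleftrightarrow> U t = 0 \<and> V t = 0"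
proof -
  have "zvec w U V t = 0 \<longleftrightarrow> exp (w t) * U t + exp (- w t) * V t = 0 \<and> exp (w t) * U t - exp (- w t) * V t = 0"
    by (simp add: zvec_def vec_eq_iff forall_2)
  also have "\<dots> \<longleftrightarrow> exp (w t) * U t = 0 \<and> exp (- w t) * V t = 0" by linarith
  finally show ?thesis by simp
qed

context rough_path
begin

lemma esol_from:
  assumes t0: "0 \<le> t0" "t0 \<le> 1"
  shows "\<exists>U V K. esol w (\<lambda>u. u) 0 1 U V K \<and> (\<forall>s. 0 \<le> s \<longrightarrow> s \<le> 1 \<longrightarrow> (U s = 0 \<and> V s = 0 \<longleftrightarrow> s \<le> t0))"
proof (cases "t0 = 1")
  case True
  then show ?thesis using esol_zero[of w 0 1] by auto
next
  case False
  then have "t0 < 1" using t0 by auto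
  then obtain U V K where E: "esol w (\<lambda>u. u) t0 1 U V K" and z: "U t0 = 0" "V t0 = 0"
    and nz: "\<And>s. t0 < s ==> s \<le> 1 ==> 0 < - U s * V s" using exists_from_zero[OF t0(1)] by blast
  define U' V' K' where "U' = (\<lambda>s. if s \<le> t0 then 0 else U s)" and "V' = (\<lambda>s. if s \<le> t0 then 0 else V s)"
    and "K' = (\<lambda>s. if s \<le> t0 then s else K s + (t0 - K t0))"
  have "esol w (\<lambda>u. u) 0 t0 U' V' K'"
    by (rule esol_cong[OF esol_zero[of w 0 t0], where c=0 and d=0]) (auto simp: U'_def V'_def K'_def)
  moreover have "esol w (\<lambda>u. u) t0 1 U' V' K'"
    by (rule esol_cong[OF E, where c="t0 - K t0" and d=0]) (auto simp: U'_def V'_def K'_def z)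
  ultimately have "esol w (\<lambda>u. u) 0 1 U' V' K'" using t0 by (rule esol_concat)
  moreover have "U' s = 0 \<and> V' s = 0 \<longleftrightarrow> s \<le> t0" if "0 \<le> s" "s \<le> 1" for s
    using nz[of s] that by (auto simp: U'_def V'_def)
  ultimately show ?thesis by blast
qed

theorem solutions_from_all_times:
  "\<exists>Z :: real => real => real^2.
        (\<forall>t\<in>{0..1}. is_solution w (\<lambda>u. u) {0..1} (Z t)) \<and>
        (\<forall>s\<in>{0..1}. \<forall>t\<in>{0..1}. Z t s = 0 \<longleftrightarrow> s \<le> t) \<and>
        inj_on (\<lambda>t. restrict (Z t) {0..1}) {0..1}"
proof -
  have "\<forall>t. \<exists>Z. t \<in> {0..1} \<longrightarrow> is_solution w (\<lambda>u. u) {0..1} Z \<and> (\<forall>s\<in>{0..1}. Z s = 0 \<longleftrightarrow> s \<le> t)"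
  proof (intro allI)
    fix t show "\<exists>Z. t \<in> {0..1} \<longrightarrow> is_solution w (\<lambda>u. u) {0..1} Z \<and> (\<forall>s\<in>{0..1}. Z s = 0 \<longleftrightarrow> s \<le> t)"
    proof (cases "t \<in> {0..1}")
      case True
      then obtain U V K where E: "esol w (\<lambda>u. u) 0 1 U V K" and z: "\<forall>s. 0 \<le> s \<longrightarrow> s \<le> 1 \<longrightarrow> (U s = 0 \<and> V s = 0 \<longleftrightarrow> s \<le> t)"
        using esol_from[of t] by auto
      have "solution_pair w (\<lambda>u. u) {0..1} (zvec w U V) K"
        by (rule esol_imp_solution_pair[OF E cont]) (auto simp: mono_on_def rcont_on_def intro: continuous_intros)
      then show ?thesis using z by (intro exI[of _ "zvec w U V"]) (auto simp: is_solution_def zvec_eq_0_iff)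
    qed blast
  qed
  then obtain Z where Z: "\<And>t. t \<in> {0..1} ==> is_solution w (\<lambda>u. u) {0..1} (Z t)"
    "\<And>s t. s \<in> {0..1} ==> t \<in> {0..1} ==> Z t s = 0 \<longleftrightarrow> s \<le> t" by metis
  have "inj_on (\<lambda>t. restrict (Z t) {0..1}) {0..1}"
  proof (rule inj_onI)
    fix s t assume st: "s \<in> {0..1::real}" "t \<in> {0..1}" "restrict (Z s) {0..1} = restrict (Z t) {0..1}"
    then have "Z s r = Z t r" if "r \<in> {0..1}" for r using that by (metis restrict_apply')
    then have "r \<le> s \<longleftrightarrow> r \<le> t" if "r \<in> {0..1}" for r using Z(2) st that by metis
    from this[of s] this[of t] show "s = t" using st by auto
  qed
  then show ?thesis using Z by blast
qed

end

section \<open>Solutions driven by a jump path\<close>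

locale jump_times =
  fixes \<tau> x :: "nat => real"
  assumes tau01: "\<And>k. 0 < \<tau> k" "\<And>k. \<tau> k \<le> 1" and tau_dec: "decseq \<tau>" and tau_lim: "\<tau> \<longlonglongrightarrow> 0"
    and x: "summable x" "\<And>k. 0 \<le> x k"
begin

abbreviation \<gamma> where "\<gamma> \<equiv> jump_path \<tau> x"

lemma tau_le: "j \<le> k ==> \<tau> k \<le> \<tau> j" using tau_dec by (simp add: decseq_def)

lemma gamma_eq: "\<gamma> t = infsum x {k. \<tau> k \<le> t}"
  unfolding jump_path_def using tau01(1) by simp

lemma x_summable_on: "x summable_on A"
proof -
  have "x summable_on UNIV" using x by (simp add: summable_on_UNIV_nonneg_real_iff)
  then show ?thesis by (rule summable_on_subset_banach) simp
qed

lemma gamma_mono: "s \<le> t ==> \<gamma> s \<le> \<gamma> t"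
  unfolding gamma_eq using x by (intro infsum_mono_neutral x_summable_on) auto

lemma gamma_0: "\<gamma> 0 = 0"
proof -
  have "{k. \<tau> k \<le> 0} = {}" using tau01(1) by (auto simp: not_le)
  then show ?thesis unfolding gamma_eq by simp
qed

lemma exists_index: "0 < t ==> \<exists>n. \<tau> n < t"
  using order_tendstoD(2)[OF tau_lim, of t] by (auto simp: eventually_sequentially)

lemma gamma_const:
  assumes "\<tau> (Suc k) \<le> t" "t < \<tau> k"
  shows "\<gamma> t = \<gamma> (\<tau> (Suc k))"
proof -
  have "\<tau> j \<le> t \<longleftrightarrow> \<tau> j \<le> \<tau> (Suc k)" for j
  proof (cases "Suc k \<le> j")
    case True then show ?thesis using tau_le[OF True] assms by auto
  next
    case False
    then have "\<tau> k \<le> \<tau> j" using tau_le[of j k] by auto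
    then show ?thesis using assms by auto
  qed
  then show ?thesis unfolding gamma_eq by simp
qed

lemma gamma_const_top: "\<tau> 0 \<le> t ==> \<gamma> t = \<gamma> (\<tau> 0)"
proof -
  assume t: "\<tau> 0 \<le> t"
  have "\<tau> j \<le> t \<longleftrightarrow> \<tau> j \<le> \<tau> 0" for j using tau_le[of 0 j] t by auto
  then show ?thesis unfolding gamma_eq by simp
qed

text \<open>An inequality because further indices may share the time
  \<open>\<tau> k\<close>.\<close>

lemma gamma_jump: 
  assumes "\<tau> (Suc k) < \<tau> k"
  shows "x k \<le> \<gamma> (\<tau> k) - \<gamma> (\<tau> (Suc k))"
proof -
  let ?A = "{j. \<tau> j \<le> \<tau> (Suc k)}"
  have "infsum x (insert k ?A) = x k + infsum x ?A" using assms by (intro infsum_insert x_summable_on) auto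
  moreover have "infsum x (insert k ?A) \<le> infsum x {j. \<tau> j \<le> \<tau> k}"
    using x assms by (intro infsum_mono_neutral x_summable_on) auto
  ultimately show ?thesis unfolding gamma_eq by simp
qed

lemma interval_index:
  assumes "0 < t" "t < \<tau> n"
  obtains k where "n \<le> k" "\<tau> (Suc k) \<le> t" "t < \<tau> k"
proof -
  define j where "j = (LEAST k. \<tau> k \<le> t)"
  have ex: "\<exists>k. \<tau> k \<le> t" using exists_index[OF assms(1)] less_imp_le by blast
  have j: "\<tau> j \<le> t" unfolding j_def using ex by (rule LeastI_ex)
  have nj: "n < j" using tau_le[of j n] j assms by (meson not_le order.strict_trans1 order.strict_trans2 less_irrefl)
  then obtain k where k: "j = Suc k" by (metis less_imp_Suc_add)
  have "\<not> \<tau> k \<le> t" using not_less_Least[of k "\<lambda>k. \<tau> k \<le> t"] k unfolding j_def by auto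
  then show thesis using that[of k] j k nj by auto
qed

text \<open>Right-continuity at 0, where the jump times accumulate: \<gamma> up to a small time is
  bounded by a tail of the series.\<close>

lemma gamma_lim0: "(\<gamma> \<longlongrightarrow> 0) (at_right 0)"
proof (rule order_tendstoI)
  fix y :: real assume "y < 0"
  then show "eventually (\<lambda>t. y < \<gamma> t) (at_right 0)"
    using gamma_mono[of 0] gamma_0 unfolding eventually_at_right_field by (intro exI[of _ 1]) (auto intro: less_le_trans)
next
  fix y :: real assume y: "0 < y"
  have tot: "infsum x UNIV = suminf x" using x x_summable_on[of UNIV] by (metis has_sum_imp_sums infsum_cong has_sum_infsum sums_unique)
  have "(\<lambda>n. sum x {..<n}) \<longlonglongrightarrow> suminf x" using x(1) by (rule summable_LIMSEQ)
  then have "eventually (\<lambda>n. suminf x - y < sum x {..<n}) sequentially" using y by (intro order_tendstoD) auto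
  then obtain n where n: "suminf x - y < sum x {..<n}" by (auto simp: eventually_sequentially)
  have "\<gamma> t < y" if t: "0 < t" "t < \<tau> n" for t
  proof -
    have sub: "{k. \<tau> k \<le> t} \<subseteq> - {..<n}"
    proof
      fix k assume "k \<in> {k. \<tau> k \<le> t}"
      then show "k \<in> - {..<n}" using t tau_le[of k n] by (cases "k < n") auto
    qed
    have "\<gamma> t \<le> infsum x (- {..<n})" unfolding gamma_eq using x sub by (intro infsum_mono_neutral x_summable_on) auto
    moreover have "infsum x UNIV = infsum x {..<n} + infsum x (- {..<n})"
      by (metis Compl_partition Compl_disjoint infsum_Un_disjoint x_summable_on)
    ultimately show ?thesis using n tot by simp
  qed
  then show "eventually (\<lambda>t. \<gamma> t < y) (at_right 0)"
    unfolding eventually_at_right_field using tau01 by (intro exI[of _ "\<tau> n"]) auto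
qed

lemma gamma_rcont: "rcont_on 0 1 \<gamma>"
  unfolding rcont_on_def
proof
  fix t :: real assume t: "t \<in> {0..<1}"
  show "continuous (at_right t) \<gamma>"
  proof (cases "t = 0")
    case True then show ?thesis using gamma_lim0 gamma_0 by (simp add: continuous_within)
  next
    case False
    then have t0: "0 < t" using t by auto
    have "\<exists>c>t. \<forall>s. t < s \<and> s < c \<longrightarrow> \<gamma> s = \<gamma> t"
    proof (cases "t < \<tau> 0")
      case True
      then obtain k where k: "\<tau> (Suc k) \<le> t" "t < \<tau> k" using interval_index[OF t0] by blast
      have "\<gamma> s = \<gamma> t" if "t < s" "s < \<tau> k" for s using gamma_const[of k s] gamma_const[of k t] k that by linarith
      then show ?thesis using k(2) by blast
    next
      case False
      have "\<gamma> s = \<gamma> t" if "t < s" for s using gamma_const_top[of s] gamma_const_top[of t] False that by linarith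
      then show ?thesis by (intro exI[of _ "t + 1"]) simp
    qed
    then have "eventually (\<lambda>s. \<gamma> s = \<gamma> t) (at_right t)" unfolding eventually_at_right_field by blast
    then show ?thesis unfolding continuous_within by (rule tendsto_eventually)
  qed
qed

end

section \<open>Solutions started at jump times and their limit\<close>

lemma backrec_shift:
  assumes "F n y = z" "k \<le> n"
  shows "backrec F y (Suc n) k = backrec F z n k"
  using assms(2)
proof (induction rule: inc_induct)
  case base
  then show ?case using backrec_step[of n "Suc n" F y] assms(1) by (simp add: backrec_start)
next
  case (step m)
  then show ?case using backrec_step[of m "Suc n" F y] backrec_step[of m n F z] by simp
qed

definition state_step :: "(real => real) => (nat => real) => (real => real) => nat => real \<times> real => real \<times> real" where
  "state_step w \<tau> \<gamma> k p = (let f = flow w (\<tau> (Suc k)) (\<tau> k) (snd p); x = \<gamma> (\<tau> k) - \<gamma> (\<tau> (Suc k)) in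
     (jump_R (w (\<tau> k)) x (fst p) f, jump_l (w (\<tau> k)) x (fst p) f))"

definition start_state :: "(real => real) => (nat => real) => (real => real) => real => nat => nat => real \<times> real" where
  "start_state w \<tau> \<gamma> r n k = backrec (state_step w \<tau> \<gamma>) (r, - w (\<tau> n)) n k"

text \<open>The index of \<open>chain.idx\<close>, defined outside the locale: \<open>Zsol\<close>
  has to make sense for every path before one can speak of its measurability.\<close>

definition tidx :: "(nat => real) => real => nat" where "tidx \<tau> t = (LEAST k. \<tau> k \<le> t)"

definition started_U :: "(real => real) => (nat => real) => (real => real) => real => nat => real => real" where
  "started_U w \<tau> \<gamma> r n t = (if \<tau> n \<le> t then let k = tidx \<tau> t; s = start_state w \<tau> \<gamma> r n k in fst s * exp (flow w (\<tau> k) t (snd s)) else 0)"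

definition started_V :: "(real => real) => (nat => real) => (real => real) => real => nat => real => real" where
  "started_V w \<tau> \<gamma> r n t = (if \<tau> n \<le> t then let k = tidx \<tau> t; s = start_state w \<tau> \<gamma> r n k in - (fst s * exp (- flow w (\<tau> k) t (snd s))) else 0)"

text \<open>The solution \<open>Z\<^sup>\<eta>\<close>: solve forward from \<open>(0, \<eta> r\<^sub>n)\<close> at time \<open>\<tau> n\<close> and let \<open>n\<close> tend to infinity. The limit
  is attained for all large \<open>n\<close> when the exact dynamics maps \<open>(0, \<eta> r\<^sub>n\<^sub>+\<^sub>1)\<close> to \<open>(0, \<eta> r\<^sub>n)\<close>.\<close>

definition Zsol :: "(nat => real) => (real => real) => (nat => real) => real => (real => real) => real => real^2" where
  "Zsol \<tau> \<gamma> r \<eta> w = zvec w (\<lambda>t. lim (\<lambda>n. started_U w \<tau> \<gamma> (\<eta> * r n) n t)) (\<lambda>t. lim (\<lambda>n. started_V w \<tau> \<gamma> (\<eta> * r n) n t))"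

text \<open>The point is that K has finite mass near 0: the lower inequality for U alone bounds
  \<open>K b - K s\<close> by changes of U and \<gamma>. Subtracting the infimum then makes K
  right-continuous at 0 with value 0, and the inequalities with left end point 0 follow by a
  limit.\<close>

lemma esol_extend_zero:
  assumes E: "\<And>a. 0 < a ==> a \<le> 1 ==> esol w g a 1 U V K"
    and B: "\<And>y. 0 \<le> y ==> y \<le> 1 ==> \<bar>w y\<bar> \<le> B"
    and g: "mono_on {0..1} g" "rcont_on 0 1 g"
    and U: "(U \<longlongrightarrow> 0) (at_right 0)" "(V \<longlongrightarrow> 0) (at_right 0)" "U 0 = 0" "V 0 = 0"
  shows "\<exists>K. esol w g 0 1 U V K"
proof -
  have gr: "(g \<longlongrightarrow> g 0) (at_right 0)" using g(2) by (auto simp: rcont_on_def continuous_within)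
  have Km: "K s \<le> K t" if "0 < s" "s \<le> t" "t \<le> 1" for s t
    using esolD(1)[OF E[of s]] that by (auto simp: mono_on_def)
  have "eventually (\<lambda>t. U t < 1) (at_right 0)" "eventually (\<lambda>t. -1 < U t) (at_right 0)"
    using order_tendstoD[OF U(1)] by auto
  then have "eventually (\<lambda>t. -1 < U t) (at_right 0)" by simp
  then obtain c where c: "c > 0" "\<And>t. 0 < t ==> t < c ==> -1 < U t" unfolding eventually_at_right_field by auto
  define b where "b = min (c/2) 1"
  have b: "0 < b" "b < c" "b \<le> 1" using c by (auto simp: b_def)
  have low: "K b - exp B * (U b + 1 + exp B * (g 1 - g 0)) \<le> K s" if s: "0 < s" "s \<le> b" for s
  proof -
    have "exp (- B) * (K b - K s) - exp B * (g b - g s) \<le> 1 * (U b - U s) + 0 * (V b - V s)"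
    proof (rule esolD(4)[OF E[of s]])
      fix y assume "s \<le> y" "y \<le> b"
      then have "\<bar>w y\<bar> \<le> B" using B[of y] s b by auto
      then show "exp (- B) \<le> 1 * exp (- w y) + 0 * exp (w y) \<and> 1 * exp (- w y) + 0 * exp (w y) \<le> exp B" by (auto simp: abs_le_iff)
    qed (use s b in auto)
    moreover have "exp B * (g b - g s) \<le> exp B * (g 1 - g 0)"
      using g(1) s b by (intro mult_left_mono diff_mono) (auto simp: mono_on_def)
    moreover have "-1 < U s" using c s b by auto
    moreover have "p - q \<le> 1 * (u - u') + 0 * z ==> q \<le> r ==> -1 < u' ==> p \<le> u + 1 + r" for p q r u u' z :: real by simp
    ultimately have "exp (- B) * (K b - K s) \<le> U b + 1 + exp B * (g 1 - g 0)" by blast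
    then have "exp B * (exp (- B) * (K b - K s)) \<le> exp B * (U b + 1 + exp B * (g 1 - g 0))" by (intro mult_left_mono) auto
    then show ?thesis by (simp add: mult.assoc[symmetric] exp_add[symmetric])
  qed
  have bdd: "bdd_below (K ` {0<..1})"
  proof (rule bdd_belowI2)
    fix s assume s: "s \<in> {0<..1::real}"
    show "K b - exp B * (U b + 1 + exp B * (g 1 - g 0)) \<le> K s"
    proof (cases "s \<le> b")
      case True then show ?thesis using low[of s] s by auto
    next
      case False then show ?thesis using low[of b] Km[of b s] s b by auto
    qed
  qed
  define \<kappa> where "\<kappa> = (INF s\<in>{0<..1}. K s)"
  have \<kappa>: "\<kappa> \<le> K s" if "0 < s" "s \<le> 1" for s unfolding \<kappa>_def using that by (intro cINF_lower bdd) auto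
  have \<kappa>_ex: "\<exists>s. 0 < s \<and> s \<le> 1 \<and> K s < y" if "\<kappa> < y" for y
    using that cINF_less_iff[OF _ bdd, of y] unfolding \<kappa>_def by auto
  define K' where "K' = (\<lambda>s. if s \<le> 0 then 0 else K s - \<kappa>)"
  have K'0: "(K' \<longlongrightarrow> 0) (at_right 0)"
  proof (rule order_tendstoI)
    fix y :: real assume "y < 0"
    then show "eventually (\<lambda>s. y < K' s) (at_right 0)"
      unfolding eventually_at_right_field using \<kappa> by (intro exI[of _ 1]) (auto simp: K'_def intro: less_le_trans)
  next
    fix y :: real assume "0 < y"
    then obtain s where s: "0 < s" "s \<le> 1" "K s < \<kappa> + y" using \<kappa>_ex[of "\<kappa> + y"] by auto
    have "K' r < y" if "0 < r" "r < s" for r using Km[of r s] s that by (simp add: K'_def)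
    then show "eventually (\<lambda>s. K' s < y) (at_right 0)"
      unfolding eventually_at_right_field using s by (intro exI[of _ s]) auto
  qed
  have E': "esol w g a 1 U V K'" if "0 < a" "a \<le> 1" for a
    by (rule esol_cong[OF E[OF that], where c="-\<kappa>" and d=0]) (use that in \<open>auto simp: K'_def\<close>)
  have "esol w g 0 1 U V K'"
    unfolding esol_def
  proof (intro conjI allI impI ballI)
    show "mono_on {0..1} K'"
      using Km \<kappa> by (auto simp: mono_on_def K'_def)
    show "rcont_on 0 1 K'"
      unfolding rcont_on_def
    proof
      fix t :: real assume t: "t \<in> {0..<1}"
      show "continuous (at_right t) K'"
      proof (cases "t = 0")
        case True then show ?thesis using K'0 by (simp add: continuous_within K'_def)
      next
        case False then show ?thesis using esolD(2)[OF E'[of t]] t by (auto simp: rcont_on_def)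
      qed
    qed
    show "0 \<le> exp (w t) * U t + exp (- w t) * V t" if "t \<in> {0..1}" for t
      using esolD(3)[OF E'[of t]] U that by (cases "t = 0") auto
    show "\<exists>r\<in>{u<..v}. exp (w r) * U r + exp (- w r) * V r = 0 \<and> K' r = K' v"
      if uv: "0 \<le> u" "u < v" "v \<le> 1" "K' u < K' v" for u v
    proof (cases "u = 0")
      case True
      then have "\<kappa> < K v" using uv by (auto simp: K'_def)
      then obtain s where s: "0 < s" "s \<le> 1" "K s < K v" using \<kappa>_ex by auto
      have "s < v" using Km[of v s] s uv True by (intro not_le_imp_less) auto
      then obtain r where "r \<in> {s<..v}" "exp (w r) * U r + exp (- w r) * V r = 0 \<and> K' r = K' v"
        using esolD(6)[OF E'[of s], of s v] s uv by (auto simp: K'_def)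
      then show ?thesis using s True by (intro bexI[of _ r]) auto
    next
      case False then show ?thesis using esolD(6)[OF E'[of u], of u v] uv by auto
    qed
    fix u v m M p q
    assume uv: "0 \<le> u" "u \<le> v" "v \<le> 1" and
      b: "\<forall>y\<in>{u..v}. m \<le> p * exp (- w y) + q * exp (w y) \<and> p * exp (- w y) + q * exp (w y) \<le> M"
    show "m * (K' v - K' u) - M * (g v - g u) \<le> p * (U v - U u) + q * (V v - V u)"
    proof (cases "u = 0 \<and> v \<noteq> 0")
      case True
      have "m * (K' v - 0) - M * (g v - g 0) \<le> p * (U v - 0) + q * (V v - 0)"
      proof (rule tendsto_le)
        show "((\<lambda>s. m * (K' v - K' s) - M * (g v - g s)) \<longlongrightarrow> m * (K' v - 0) - M * (g v - g 0)) (at_right 0)"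
          by (intro tendsto_intros K'0 gr)
        show "((\<lambda>s. p * (U v - U s) + q * (V v - V s)) \<longlongrightarrow> p * (U v - 0) + q * (V v - 0)) (at_right 0)"
          by (intro tendsto_intros U)
        show "eventually (\<lambda>s. m * (K' v - K' s) - M * (g v - g s) \<le> p * (U v - U s) + q * (V v - V s)) (at_right 0)"
          unfolding eventually_at_right_field
        proof (intro exI[of _ v] conjI allI impI)
          fix s assume s: "0 < s" "s < v"
          show "m * (K' v - K' s) - M * (g v - g s) \<le> p * (U v - U s) + q * (V v - V s)"
            using esolD(4)[OF E'[of s], of s v m p q M] s uv b True by auto
        qed (use True uv in auto)
      qed simp
      then show ?thesis using True U by (simp add: K'_def)
    next
      case False
      show ?thesis
      proof (cases "u = 0")
        case True then show ?thesis using False by simp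
      next
        case False then show ?thesis using esolD(4)[OF E'[of u], of u v m p q M] uv b by auto
      qed
    qed
  qed
  then show ?thesis by blast
qed

text \<open>The index from which \<eta> r is below the jumps depends on \<eta>. At smaller indices,
  that is at later times, a jump need not return the state to the boundary and the general rule
  \<open>state_step\<close> takes over.\<close>

locale jump_solution = jump_times +
  fixes w :: "real => real" and r :: "nat => real" and B :: real
  assumes w: "continuous_on {0..1} w" and B: "\<And>y. 0 \<le> y ==> y \<le> 1 ==> \<bar>w y\<bar> \<le> B"
    and r_pos: "\<And>k. 0 < r k"
    and r_rec: "\<And>k. r k = r (Suc k) * cosh (w (\<tau> k) + flow w (\<tau> (Suc k)) (\<tau> k) (- w (\<tau> (Suc k))))"
    and r_small: "\<And>\<eta>. 0 < \<eta> ==> eventually (\<lambda>k. \<tau> (Suc k) < \<tau> k \<and> \<eta> * r k \<le> x k) sequentially"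
    and r_lim: "r \<longlonglongrightarrow> 0"
begin

abbreviation "st \<eta> n k \<equiv> start_state w \<tau> \<gamma> (\<eta> * r n) n k"

lemma w_sub: "0 \<le> a ==> b \<le> 1 ==> continuous_on {a..b} w"
  by (rule continuous_on_subset[OF w]) auto

lemma tau_nonneg: "0 \<le> \<tau> k" using tau01(1)[of k] by simp

text \<open>With \<rho> the rise, the height before the jump is \<eta> r(k+1) sinh \<rho>, at most
  \<eta> r(k+1) cosh \<rho> = \<eta> r(k), hence at most the jump.\<close>

lemma step_exact:
  assumes \<eta>: "0 < \<eta>" and k: "\<tau> (Suc k) < \<tau> k" "\<eta> * r k \<le> x k"
  shows "state_step w \<tau> \<gamma> k (\<eta> * r (Suc k), - w (\<tau> (Suc k))) = (\<eta> * r k, - w (\<tau> k))"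
proof -
  define f where "f = flow w (\<tau> (Suc k)) (\<tau> k) (- w (\<tau> (Suc k)))"
  have f: "- w (\<tau> k) \<le> f" unfolding f_def
    using k tau01 by (intro flow_props(1)[OF w_sub[of "\<tau> (Suc k)" "\<tau> k"]]) (auto simp: tau_nonneg)
  have R: "0 < \<eta> * r (Suc k)" using \<eta> r_pos by simp
  have "\<eta> * r (Suc k) * sinh (w (\<tau> k) + f) \<le> \<eta> * r (Suc k) * cosh (w (\<tau> k) + f)"
    using R by (intro mult_left_mono sinh_le_cosh_real) auto
  also have "\<dots> = \<eta> * r k" using r_rec[of k] by (simp add: f_def)
  also have "\<dots> \<le> \<gamma> (\<tau> k) - \<gamma> (\<tau> (Suc k))" using gamma_jump[OF k(1)] k(2) by linarith
  finally have K: "\<eta> * r (Suc k) * sinh (w (\<tau> k) + f) \<le> \<gamma> (\<tau> k) - \<gamma> (\<tau> (Suc k))" .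
  show ?thesis
    unfolding state_step_def Let_def fst_conv snd_conv f_def[symmetric] jump_kill[OF R f K]
    using r_rec[of k] by (simp add: f_def)
qed

text \<open>By \<open>step_exact\<close> the path started at index Suc n passes through the starting
  state of index n, so the start can be moved down to the larger of N and k.\<close>

lemma stable:
  assumes \<eta>: "0 < \<eta>" and N: "\<And>k. N \<le> k ==> \<tau> (Suc k) < \<tau> k \<and> \<eta> * r k \<le> x k" and n: "N \<le> n" "k \<le> n"
  shows "st \<eta> n k = st \<eta> (max N k) k"
  using n(1) n(2)
proof (induction n)
  case 0 then show ?case by simp
next
  case (Suc n)
  show ?case
  proof (cases "N \<le> n \<and> k \<le> n")
    case True
    have "st \<eta> (Suc n) k = st \<eta> n k" unfolding start_state_def
      using step_exact[OF \<eta>, of n] N[of n] True by (intro backrec_shift) auto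
    then show ?thesis using Suc True by simp
  next
    case False
    then have "max N k = Suc n" using Suc.prems by auto
    then show ?thesis by simp
  qed
qed

text \<open>By \<open>stable\<close> every start index beyond N and k gives this state;
  \<open>max N k\<close> is the first of them.\<close>

definition R_st :: "real => nat => nat => real" where "R_st \<eta> N k = fst (st \<eta> (max N k) k)"
definition l_st :: "real => nat => nat => real" where "l_st \<eta> N k = snd (st \<eta> (max N k) k)"

lemma started_path:
  assumes \<eta>: "0 < \<eta>" and N: "\<And>k. N \<le> k ==> \<tau> (Suc k) < \<tau> k \<and> \<eta> * r k \<le> x k"
  defines "R \<equiv> R_st \<eta> N" and "l \<equiv> l_st \<eta> N"
  shows "\<And>n. N \<le> n ==> chain w \<gamma> \<tau> n R l"
    and "\<And>t. 0 < t ==> lim (\<lambda>n. started_U w \<tau> \<gamma> (\<eta> * r n) n t) = chain.pU w \<tau> R l t"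
    and "\<And>t. 0 < t ==> lim (\<lambda>n. started_V w \<tau> \<gamma> (\<eta> * r n) n t) = chain.pV w \<tau> R l t"
    and "\<And>k. N \<le> k ==> R k = \<eta> * r k \<and> l k = - w (\<tau> k)"
proof -
  have start: "st \<eta> n n = (\<eta> * r n, - w (\<tau> n))" for n by (simp add: start_state_def backrec_start)
  show top: "R k = \<eta> * r k \<and> l k = - w (\<tau> k)" if "N \<le> k" for k using that by (simp add: R_def l_def R_st_def l_st_def max_def start)
  have S: "(R k, l k) = st \<eta> n k" if "N \<le> n" "k \<le> n" for k n using stable[OF \<eta> N that] by (simp add: R_def l_def R_st_def l_st_def)
  have rec: "(R k, l k) = state_step w \<tau> \<gamma> k (R (Suc k), l (Suc k))" for k
    unfolding S[OF le_SucI[OF max.cobounded1[of N k]] le_SucI[OF max.cobounded2[of k N]]] 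
      S[of "Suc (max N k)" "Suc k", OF le_SucI[OF max.cobounded1] Suc_le_mono[THEN iffD2, OF max.cobounded2]]
    unfolding start_state_def by (rule backrec_step) simp
  show C: "chain w \<gamma> \<tau> n R l" if n: "N \<le> n" for n
  proof
    show "continuous_on {\<tau> n..1} w" by (rule w_sub) (auto simp: tau_nonneg)
    show "\<tau> (Suc k) \<le> \<tau> k" for k by (rule tau_le) simp
    show "\<gamma> (\<tau> (Suc k)) \<le> \<gamma> (\<tau> k)" for k by (intro gamma_mono tau_le) simp
    show "\<tau> 0 \<le> 1" by (rule tau01)
    show "\<gamma> t = \<gamma> (\<tau> (Suc k))" if "\<tau> (Suc k) \<le> t" "t < \<tau> k" for k t by (rule gamma_const[OF that])
    show "\<gamma> t = \<gamma> (\<tau> 0)" if "\<tau> 0 \<le> t" for t by (rule gamma_const_top[OF that])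
    show "0 < R n" "- w (\<tau> n) \<le> l n" using top[OF n] r_pos \<eta> by auto
    fix k
    show "R k = jump_R (w (\<tau> k)) (\<gamma> (\<tau> k) - \<gamma> (\<tau> (Suc k))) (R (Suc k)) (flow w (\<tau> (Suc k)) (\<tau> k) (l (Suc k)))"
      "l k = jump_l (w (\<tau> k)) (\<gamma> (\<tau> k) - \<gamma> (\<tau> (Suc k))) (R (Suc k)) (flow w (\<tau> (Suc k)) (\<tau> k) (l (Suc k)))"
      using rec[of k] by (auto simp: state_step_def Let_def)
  qed
  interpret C: chain w \<gamma> \<tau> N R l by (rule C) simp
  have ev: "started_U w \<tau> \<gamma> (\<eta> * r n) n t = C.pU t \<and> started_V w \<tau> \<gamma> (\<eta> * r n) n t = C.pV t" if n: "N \<le> n" "\<tau> n \<le> t" for n t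
  proof -
    have i: "tidx \<tau> t \<le> n" unfolding tidx_def using n by (intro Least_le)
    have idx: "C.idx t = tidx \<tau> t" by (simp add: C.idx_def tidx_def)
    show ?thesis unfolding started_U_def started_V_def C.pU_def C.pV_def C.pL_def idx
      using S[OF n(1) i, symmetric] n by (simp add: Let_def)
  qed
  have lim: "\<exists>M. \<forall>n\<ge>M. N \<le> n \<and> \<tau> n \<le> t" if t: "0 < t" for t
  proof -
    obtain m where "\<tau> m < t" using exists_index[OF t] by blast
    then show ?thesis using tau_le[of m] by (intro exI[of _ "max N m"]) (auto intro: order_trans less_imp_le)
  qed
  show "lim (\<lambda>n. started_U w \<tau> \<gamma> (\<eta> * r n) n t) = C.pU t" if "0 < t" for t
    by (intro limI tendsto_eventually) (use lim[OF that] ev in \<open>auto simp: eventually_sequentially\<close>)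
  show "lim (\<lambda>n. started_V w \<tau> \<gamma> (\<eta> * r n) n t) = C.pV t" if "0 < t" for t
    by (intro limI tendsto_eventually) (use lim[OF that] ev in \<open>auto simp: eventually_sequentially\<close>)
qed

lemma started_zero:
  "lim (\<lambda>n. started_U w \<tau> \<gamma> (\<eta> * r n) n 0) = 0" "lim (\<lambda>n. started_V w \<tau> \<gamma> (\<eta> * r n) n 0) = 0"
  using tau01(1) by (auto simp: started_U_def started_V_def not_le[symmetric] intro!: limI)

lemma eventual_threshold:
  assumes "0 < \<eta>"
  obtains N where "\<And>k. N \<le> k ==> \<tau> (Suc k) < \<tau> k \<and> \<eta> * r k \<le> x k"
  using r_small[OF assms] unfolding eventually_sequentially by blast

text \<open>Near 0 the state is on the boundary after every jump, and U is \<eta> times this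
  function; \<open>base_V\<close> serves in the same way for - V.\<close>

definition base_U :: "real => real" where "base_U t = r (tidx \<tau> t) * exp (flow w (\<tau> (tidx \<tau> t)) t (- w (\<tau> (tidx \<tau> t))))"
definition base_V :: "real => real" where "base_V t = r (tidx \<tau> t) * exp (- flow w (\<tau> (tidx \<tau> t)) t (- w (\<tau> (tidx \<tau> t))))"

lemma near_zero:
  assumes \<eta>: "0 < \<eta>"
  obtains N where "\<And>t. 0 < t ==> t < \<tau> N ==> lim (\<lambda>n. started_U w \<tau> \<gamma> (\<eta> * r n) n t) = \<eta> * base_U t \<and>
    lim (\<lambda>n. started_V w \<tau> \<gamma> (\<eta> * r n) n t) = - (\<eta> * base_V t)"
proof -
  obtain N where N: "\<And>k. N \<le> k ==> \<tau> (Suc k) < \<tau> k \<and> \<eta> * r k \<le> x k" using eventual_threshold[OF \<eta>] by blast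
  define R l where "R = R_st \<eta> N" and "l = l_st \<eta> N"
  have P: "\<And>n. N \<le> n ==> chain w \<gamma> \<tau> n R l"
    "\<And>t. 0 < t ==> lim (\<lambda>n. started_U w \<tau> \<gamma> (\<eta> * r n) n t) = chain.pU w \<tau> R l t"
    "\<And>t. 0 < t ==> lim (\<lambda>n. started_V w \<tau> \<gamma> (\<eta> * r n) n t) = chain.pV w \<tau> R l t"
    "\<And>k. N \<le> k ==> R k = \<eta> * r k \<and> l k = - w (\<tau> k)"
    unfolding R_def l_def by (rule started_path[OF \<eta> N]; assumption)+
  interpret C: chain w \<gamma> \<tau> N R l by (rule P(1)) simp
  show thesis
  proof (rule that[of N])
    fix t assume t: "0 < t" "t < \<tau> N"
    then obtain k where k: "N \<le> k" "\<tau> (Suc k) \<le> t" "t < \<tau> k" using interval_index by blast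
    interpret C': chain w \<gamma> \<tau> "Suc k" R l by (rule P(1)) (use k in simp)
    have i: "C.idx t = Suc k" using C'.idx_open[of k t] k by simp
    have it: "tidx \<tau> t = Suc k" using i by (simp add: C.idx_def tidx_def)
    have tp: "R (Suc k) = \<eta> * r (Suc k)" "l (Suc k) = - w (\<tau> (Suc k))" using P(4)[of "Suc k"] k by auto
    show "lim (\<lambda>n. started_U w \<tau> \<gamma> (\<eta> * r n) n t) = \<eta> * base_U t \<and> lim (\<lambda>n. started_V w \<tau> \<gamma> (\<eta> * r n) n t) = - (\<eta> * base_V t)"
      unfolding P(2)[OF t(1)] P(3)[OF t(1)] C.pU_def C.pV_def C.pL_def i base_U_def base_V_def it tp by simp
  qed
qed

lemma base_pos: "0 < base_U t" "0 < base_V t"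
  using r_pos by (simp_all add: base_U_def base_V_def)

lemma base_lim: "(base_U \<longlongrightarrow> 0) (at_right 0)" "(base_V \<longlongrightarrow> 0) (at_right 0)"
proof -
  have le: "base_U t \<le> r (tidx \<tau> t) * exp B \<and> base_V t \<le> r (tidx \<tau> t) * exp B" if t: "0 < t" "t \<le> 1" for t
  proof -
    have "\<exists>k. \<tau> k \<le> t" using exists_index[OF t(1)] less_imp_le by blast
    then have i: "\<tau> (tidx \<tau> t) \<le> t" unfolding tidx_def by (rule LeastI_ex)
    let ?f = "flow w (\<tau> (tidx \<tau> t)) t (- w (\<tau> (tidx \<tau> t)))"
    have c: "continuous_on {\<tau> (tidx \<tau> t)..t} w" using t by (intro w_sub tau_nonneg) auto
    have wB: "- w y \<le> B" if "\<tau> (tidx \<tau> t) \<le> y" "y \<le> t" for y using B[of y] that t tau_nonneg[of "tidx \<tau> t"] by auto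
    have "?f \<le> B" by (rule flow_props(5)[OF c i order_refl]) (use wB i in auto)
    moreover have "- ?f \<le> B" using flow_props(1)[OF c i order_refl, of "- w (\<tau> (tidx \<tau> t))"] B[of t] t by linarith
    ultimately show ?thesis unfolding base_U_def base_V_def using r_pos[of "tidx \<tau> t"] by (auto intro!: mult_left_mono)
  qed
  have lim: "((\<lambda>t. r (tidx \<tau> t) * exp B) \<longlongrightarrow> 0) (at_right 0)"
  proof (rule tendsto_mult_left_zero)
    show "((\<lambda>t. r (tidx \<tau> t)) \<longlongrightarrow> 0) (at_right 0)"
    proof (rule order_tendstoI)
      fix y :: real assume "y < 0"
      then show "eventually (\<lambda>t. y < r (tidx \<tau> t)) (at_right 0)" using r_pos by (intro always_eventually) (auto intro: less_trans)
    next
      fix y :: real assume "0 < y"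
      then have "eventually (\<lambda>k. r k < y) sequentially" using r_lim by (intro order_tendstoD) auto
      then obtain N where N: "\<And>k. N \<le> k ==> r k < y" by (auto simp: eventually_sequentially)
      have "r (tidx \<tau> t) < y" if t: "0 < t" "t < \<tau> N" for t
      proof -
        have "\<exists>k. \<tau> k \<le> t" using exists_index[OF t(1)] less_imp_le by blast
        then have "\<tau> (tidx \<tau> t) \<le> t" unfolding tidx_def by (rule LeastI_ex)
        then have "N \<le> tidx \<tau> t" using tau_le[of "tidx \<tau> t" N] t by (cases "N \<le> tidx \<tau> t") auto
        then show ?thesis using N by auto
      qed
      then show "eventually (\<lambda>t. r (tidx \<tau> t) < y) (at_right 0)"
        unfolding eventually_at_right_field using tau01(1) by blast
    qed
  qed
  have ev: "eventually (\<lambda>t. norm (base_U t) \<le> r (tidx \<tau> t) * exp B) (at_right 0)" "eventually (\<lambda>t. norm (base_V t) \<le> r (tidx \<tau> t) * exp B) (at_right 0)"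
    unfolding eventually_at_right_field using le base_pos by (auto intro!: exI[of _ 1] simp: abs_of_pos)
  show "(base_U \<longlongrightarrow> 0) (at_right 0)" "(base_V \<longlongrightarrow> 0) (at_right 0)"
    using Lim_null_comparison[OF ev(1) lim] Lim_null_comparison[OF ev(2) lim] by auto
qed

theorem Zsol_is_solution:
  assumes \<eta>: "0 < \<eta>"
  shows "is_solution w \<gamma> {0..1} (Zsol \<tau> \<gamma> r \<eta> w)"
proof -
  obtain N where N: "\<And>k. N \<le> k ==> \<tau> (Suc k) < \<tau> k \<and> \<eta> * r k \<le> x k" using eventual_threshold[OF \<eta>] by blast
  define R l where "R = R_st \<eta> N" and "l = l_st \<eta> N"
  have P: "\<And>n. N \<le> n ==> chain w \<gamma> \<tau> n R l"
    "\<And>t. 0 < t ==> lim (\<lambda>n. started_U w \<tau> \<gamma> (\<eta> * r n) n t) = chain.pU w \<tau> R l t"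
    "\<And>t. 0 < t ==> lim (\<lambda>n. started_V w \<tau> \<gamma> (\<eta> * r n) n t) = chain.pV w \<tau> R l t"
    "\<And>k. N \<le> k ==> R k = \<eta> * r k \<and> l k = - w (\<tau> k)"
    unfolding R_def l_def by (rule started_path[OF \<eta> N]; assumption)+
  interpret C: chain w \<gamma> \<tau> N R l by (rule P(1)) simp
  define U V where "U = (\<lambda>t. lim (\<lambda>n. started_U w \<tau> \<gamma> (\<eta> * r n) n t))" and "V = (\<lambda>t. lim (\<lambda>n. started_V w \<tau> \<gamma> (\<eta> * r n) n t))"
  obtain M where M: "\<And>t. 0 < t ==> t < \<tau> M ==> U t = \<eta> * base_U t \<and> V t = - (\<eta> * base_V t)"
    unfolding U_def V_def using near_zero[OF \<eta>] by blast
  have E: "esol w \<gamma> a 1 U V C.pK" if a: "0 < a" "a \<le> 1" for a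
  proof -
    obtain m where m: "\<tau> m < a" using exists_index[OF a(1)] by blast
    interpret C': chain w \<gamma> \<tau> "max N m" R l by (rule P(1)) simp
    have "\<tau> (max N m) \<le> a" using tau_le[of m "max N m"] m by auto
    \<comment> \<open>\<open>pU\<close>, \<open>pV\<close> and \<open>pK\<close> do not involve the
      starting node, so C and C' define the same functions and a single K serves for all a.\<close>
    then have "esol w \<gamma> a 1 C.pU C.pV C.pK" using esol_subinterval[OF C'.esol_path] by auto
    then show ?thesis
      by (rule esol_cong[where c=0 and d=0]) (use P(2,3) a in \<open>auto simp: U_def V_def\<close>)
  qed
  have Ulim: "(U \<longlongrightarrow> 0) (at_right 0)"
  proof (rule Lim_transform_eventually)
    show "((\<lambda>t. \<eta> * base_U t) \<longlongrightarrow> 0) (at_right 0)" by (intro tendsto_mult_right_zero base_lim)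
    show "eventually (\<lambda>t. \<eta> * base_U t = U t) (at_right 0)" unfolding eventually_at_right_field using M tau01(1)[of M] by (intro exI[of _ "\<tau> M"]) auto
  qed
  have Vlim: "(V \<longlongrightarrow> 0) (at_right 0)"
  proof (rule Lim_transform_eventually)
    show "((\<lambda>t. - (\<eta> * base_V t)) \<longlongrightarrow> 0) (at_right 0)" using tendsto_minus[OF tendsto_mult_right_zero[OF base_lim(2), of \<eta>]] by simp
    show "eventually (\<lambda>t. - (\<eta> * base_V t) = V t) (at_right 0)" unfolding eventually_at_right_field using M tau01(1)[of M] by (intro exI[of _ "\<tau> M"]) auto
  qed
  have gm: "mono_on {0..1} \<gamma>" using gamma_mono by (auto simp: mono_on_def)
  obtain K where "esol w \<gamma> 0 1 U V K"
    using esol_extend_zero[OF E B gm gamma_rcont Ulim Vlim] started_zero by (auto simp: U_def V_def)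
  from esol_imp_solution_pair[OF this w gm gamma_rcont] show ?thesis
    unfolding is_solution_def Zsol_def U_def V_def by blast
qed

theorem Zsol_ratio:
  assumes "0 < \<eta>1" "0 < \<eta>2"
  shows "eventually (\<lambda>t. norm (Zsol \<tau> \<gamma> r \<eta>1 w t) / norm (Zsol \<tau> \<gamma> r \<eta>2 w t) = \<eta>1 / \<eta>2) (at_right 0)"
proof -
  define Y where "Y = zvec w base_U (\<lambda>t. - base_V t)"
  have Z: "\<exists>N. \<forall>t. 0 < t \<longrightarrow> t < \<tau> N \<longrightarrow> Zsol \<tau> \<gamma> r \<eta> w t = \<eta> *\<^sub>R Y t" if "0 < \<eta>" for \<eta>
  proof -
    obtain N where N: "\<And>t. 0 < t ==> t < \<tau> N ==> lim (\<lambda>n. started_U w \<tau> \<gamma> (\<eta> * r n) n t) = \<eta> * base_U t \<and>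
    lim (\<lambda>n. started_V w \<tau> \<gamma> (\<eta> * r n) n t) = - (\<eta> * base_V t)" using near_zero[OF \<open>0 < \<eta>\<close>] by blast
    have "Zsol \<tau> \<gamma> r \<eta> w t = \<eta> *\<^sub>R Y t" if "0 < t" "t < \<tau> N" for t
      using N[OF that] unfolding Zsol_def Y_def zvec_def by (simp add: vec_eq_iff forall_2 algebra_simps)
    then show ?thesis by blast
  qed
  obtain N1 N2 where N: "\<And>t. 0 < t ==> t < \<tau> N1 ==> Zsol \<tau> \<gamma> r \<eta>1 w t = \<eta>1 *\<^sub>R Y t"
    "\<And>t. 0 < t ==> t < \<tau> N2 ==> Zsol \<tau> \<gamma> r \<eta>2 w t = \<eta>2 *\<^sub>R Y t" using Z[OF assms(1)] Z[OF assms(2)] by blast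
  have Y: "Y t \<noteq> 0" for t unfolding Y_def zvec_eq_0_iff using base_pos[of t] by simp
  show ?thesis
    unfolding eventually_at_right_field
    using N Y assms tau01(1) by (intro exI[of _ "min (\<tau> N1) (\<tau> N2)"]) auto
qed

end

section \<open>Gaussian vectors and fractional Brownian motion\<close>

text \<open>The probability that a nondegenerate centred Gaussian variable is at least its standard
  deviation.\<close>

definition std_normal_tail :: real where "std_normal_tail = measure std_normal_distribution {1..}"

lemma std_normal_tail_pos: "0 < std_normal_tail"
proof -
  have nz: "emeasure std_normal_distribution {1..} \<noteq> 0"
  proof
    assume "emeasure std_normal_distribution {1..} = 0"
    then have "(\<integral>\<^sup>+x. ennreal (std_normal_density x) * indicator {1..} x \<partial>lborel) = 0" by (simp add: emeasure_density)
    then have "AE x in lborel. ennreal (std_normal_density x) * indicator {1..} x = 0" by (subst (asm) nn_integral_0_iff_AE) auto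
    moreover have "ennreal (std_normal_density x) \<noteq> 0" for x using normal_density_pos[of 1 0 x] by (simp add: ennreal_eq_0_iff not_le)
    ultimately have "AE x in lborel. x \<notin> {1..2::real}" by (auto simp: indicator_def elim!: eventually_mono)
    then have "emeasure lborel {x \<in> space lborel. \<not> x \<notin> {1..2::real}} = 0" by (subst (asm) AE_iff_measurable[OF _ refl]) auto
    moreover have "{x \<in> space lborel. \<not> x \<notin> {1..2::real}} = {1..2}" by auto
    ultimately have "emeasure lborel {1..2::real} = 0" by simp
    then show False by simp
  qed
  interpret prob_space std_normal_distribution by (rule prob_space_normal_density) simp
  show ?thesis using nz unfolding std_normal_tail_def by (simp add: emeasure_eq_measure zero_less_measure_iff)
qed

context prob_space
begin

text \<open>The almost surely constant case is treated apart because \<open>gaussian_var\<close>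
  admits it. In the other case the density gives the moments, and the transform and the tail come
  from the standard normal law.\<close>

lemma centered_gaussian:
  assumes g: "gaussian_var M Y" and E: "expectation Y = 0"
  defines "v \<equiv> expectation (\<lambda>om. (Y om)\<^sup>2)"
  shows "\<And>k. integrable M (\<lambda>om. Y om ^ k)"
    and "\<And>k. 0 < k ==> expectation (\<lambda>om. Y om ^ (2 * k)) = v ^ k * (fact (2 * k) / (2 ^ k * fact k))"
    and "\<And>\<theta>. expectation (\<lambda>om. cos (Y om + \<theta>)) = cos \<theta> * exp (- v / 2)"
    and "0 < v ==> prob {om \<in> space M. sqrt v \<le> Y om} = std_normal_tail"
proof -
  have [measurable]: "Y \<in> borel_measurable M" using g by (simp add: gaussian_var_def)
  have "(\<forall>k. integrable M (\<lambda>om. Y om ^ k)) \<and> (\<forall>k>0. expectation (\<lambda>om. Y om ^ (2 * k)) = v ^ k * (fact (2 * k) / (2 ^ k * fact k))) \<and>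
     (\<forall>\<theta>. expectation (\<lambda>om. cos (Y om + \<theta>)) = cos \<theta> * exp (- v / 2)) \<and>
     (0 < v \<longrightarrow> prob {om \<in> space M. sqrt v \<le> Y om} = std_normal_tail)"
  proof (cases "\<exists>\<mu>. AE om in M. Y om = \<mu>")
    case True
    then obtain \<mu> where \<mu>: "AE om in M. Y om = \<mu>" by blast
    have "expectation Y = expectation (\<lambda>_. \<mu>)" by (rule integral_cong_AE) (use \<mu> in auto)
    then have "\<mu> = 0" using E by (simp add: prob_space)
    then have Y0: "AE om in M. Y om = 0" using \<mu> by simp
    have v0: "v = 0" unfolding v_def using Y0 by (subst integral_cong_AE[of _ _ "\<lambda>_. 0"]) auto
    have "integrable M (\<lambda>om. Y om ^ k)" for k
      by (rule integrable_cong_AE_imp[of M "\<lambda>_. 0 ^ k"]) (use Y0 in auto)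
    moreover have "expectation (\<lambda>om. Y om ^ (2 * k)) = v ^ k * (fact (2 * k) / (2 ^ k * fact k))" if "0 < k" for k
      using Y0 that v0 by (subst integral_cong_AE[of _ _ "\<lambda>_. 0"]) auto
    moreover have "expectation (\<lambda>om. cos (Y om + \<theta>)) = cos \<theta> * exp (- v / 2)" for \<theta>
      using Y0 v0 by (subst integral_cong_AE[of _ _ "\<lambda>_. cos \<theta>"]) (auto simp: prob_space)
    ultimately show ?thesis using v0 by auto
  next
    case False
    then obtain \<mu> \<sigma> where \<sigma>: "\<sigma> > 0" and D: "distributed M lborel Y (\<lambda>x. ennreal (normal_density \<mu> \<sigma> x))"
      using g unfolding gaussian_var_def by blast
    have "\<mu> = 0" using normal_distributed_expectation[OF \<sigma> D] E by simp
    note D = D[unfolded this]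
    have int: "integrable M (\<lambda>om. Y om ^ k)" for k
      using distributed_integrable[OF D, of "\<lambda>x. x ^ k"] integrable_normal_moment[OF \<sigma>, of 0 k] by simp
    have mom: "expectation (\<lambda>om. Y om ^ (2 * k)) = (\<sigma>\<^sup>2) ^ k * (fact (2 * k) / (2 ^ k * fact k))" for k
      using distributed_integral[OF D, of "\<lambda>x. x ^ (2 * k)"] integral_normal_moment_even[OF \<sigma>, of 0 k] by (simp add: power_divide)
    have v: "v = \<sigma>\<^sup>2" unfolding v_def using mom[of 1] by (simp add: fact_numeral)
    have S: "distributed M lborel (\<lambda>om. Y om / \<sigma>) std_normal_density"
      using normal_standard_normal_convert[OF \<sigma>, of Y 0] D by simp
    have dist: "distr M borel (\<lambda>om. Y om / \<sigma>) = std_normal_distribution"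
      using distributed_distr_eq_density[OF S] distr_cong[OF refl sets_lborel refl, of M "\<lambda>om. Y om / \<sigma>"] by simp
    have ch: "expectation (\<lambda>om. cos (Y om + \<theta>)) = cos \<theta> * exp (- v / 2)" for \<theta>
    proof -
      have "char (distr M borel (\<lambda>om. Y om / \<sigma>)) \<sigma> = (CLINT om|M. iexp (Y om))"
        unfolding char_def using \<sigma> by (subst integral_distr) auto
      then have c: "(CLINT om|M. iexp (Y om)) = complex_of_real (exp (- \<sigma>\<^sup>2 / 2))" unfolding dist char_std_normal_distribution by simp
      have I: "complex_integrable M (\<lambda>om. iexp (Y om))" by (rule integrable_iexp) auto
      have "expectation (\<lambda>om. cos (Y om)) = exp (- \<sigma>\<^sup>2 / 2)" using integral_Re[OF I] unfolding c by (simp add: Re_exp)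
      moreover have "expectation (\<lambda>om. sin (Y om)) = 0" using integral_Im[OF I] unfolding c by (simp add: Im_exp)
      moreover have "expectation (\<lambda>om. cos (Y om + \<theta>)) = expectation (\<lambda>om. cos (Y om)) * cos \<theta> - expectation (\<lambda>om. sin (Y om)) * sin \<theta>"
      proof -
        have "integrable M (\<lambda>om. cos (Y om))" "integrable M (\<lambda>om. sin (Y om))"
          by (rule integrable_const_bound[of _ 1]; simp)+
        then show ?thesis unfolding cos_add by simp
      qed
      ultimately show ?thesis by (simp add: v)
    qed
    have "prob {om \<in> space M. sqrt v \<le> Y om} = std_normal_tail"
    proof -
      have "std_normal_tail = measure (distr M borel (\<lambda>om. Y om / \<sigma>)) {1..}" unfolding dist std_normal_tail_def ..
      also have "\<dots> = prob ((\<lambda>om. Y om / \<sigma>) -` {1..} \<inter> space M)" by (rule measure_distr) auto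
      also have "(\<lambda>om. Y om / \<sigma>) -` {1..} \<inter> space M = {om \<in> space M. sqrt v \<le> Y om}" using \<sigma> by (auto simp: v field_simps)
      finally show ?thesis by simp
    qed
    then show ?thesis using int mom ch by (auto simp: v)
  qed
  then show "\<And>k. integrable M (\<lambda>om. Y om ^ k)"
    "\<And>k. 0 < k ==> expectation (\<lambda>om. Y om ^ (2 * k)) = v ^ k * (fact (2 * k) / (2 ^ k * fact k))"
    "\<And>\<theta>. expectation (\<lambda>om. cos (Y om + \<theta>)) = cos \<theta> * exp (- v / 2)"
    "0 < v ==> prob {om \<in> space M. sqrt v \<le> Y om} = std_normal_tail" by blast+
qed

end

section \<open>Increments of fractional Brownian motion\<close>

lemma concave_increment:
  fixes p a b d :: real
  assumes "0 < p" "p \<le> 1" "0 \<le> a" "a \<le> b" "0 \<le> d"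
  shows "(b + d) powr p - b powr p \<le> (a + d) powr p - a powr p"
proof (cases "a = b \<or> d = 0")
  case False
  then have ab: "a < b" "0 < d" using assms by auto
  define f where "f = (\<lambda>x. (x + d) powr p - x powr p)"
  have "f b \<le> f a"
  proof (rule DERIV_nonpos_imp_decreasing_open[OF less_imp_le[OF ab(1)]])
    fix x assume x: "a < x" "x < b"
    then have x0: "0 < x" using assms by auto
    have "(f has_real_derivative p * (x + d) powr (p - 1) - p * x powr (p - 1)) (at x)"
      unfolding f_def using x0 ab by (auto intro!: derivative_eq_intros simp: field_simps powr_diff)
    moreover have "(x + d) powr (p - 1) \<le> x powr (p - 1)" using x0 ab assms by (intro powr_mono2') auto
    ultimately show "\<exists>y. DERIV f x :> y \<and> y \<le> 0" using assms by (intro exI[of _ "p * (x + d) powr (p - 1) - p * x powr (p - 1)"]) (auto simp: mult_left_mono)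
  next
    show "continuous_on {a..b} f" unfolding f_def using assms
      by (intro continuous_on_diff continuous_on_powr' continuous_intros) auto
  qed
  then show ?thesis by (simp add: f_def)
qed auto

locale fbm = prob_space M for M :: "'a measure" +
  fixes H :: real and B :: "real => 'a => real"
  assumes H: "0 < H" "H < 1 / 2" and fbm: "fractional_brownian_motion H M B"
begin

lemma path_cont: "om \<in> space M ==> continuous_on {0..1} (\<lambda>t. B t om)"
  using fbm by (auto simp: fractional_brownian_motion_def)

text \<open>The times \<open>p i\<close> may coincide, whereas \<open>gaussian_process\<close>
  speaks of sets of times; the coefficients are first collected for each time.\<close>

lemma lincomb_gaussian:
  assumes I: "finite I" and p: "\<And>i. i \<in> I ==> p i \<in> {0..1}"
  shows "gaussian_var M (\<lambda>om. \<Sum>i\<in>I. c i * B (p i) om)"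
proof -
  have "(\<Sum>i\<in>I. c i * B (p i) om) = (\<Sum>j\<in>p ` I. (\<Sum>i\<in>{i\<in>I. p i = j}. c i) * B j om)" for om
  proof -
    have "(\<Sum>i\<in>I. c i * B (p i) om) = (\<Sum>j\<in>p ` I. \<Sum>i\<in>{i\<in>I. p i = j}. c i * B (p i) om)" by (rule sum.image_gen[OF I])
    also have "\<dots> = (\<Sum>j\<in>p ` I. (\<Sum>i\<in>{i\<in>I. p i = j}. c i) * B j om)"
      by (intro sum.cong refl) (auto simp: sum_distrib_right intro!: sum.cong)
    finally show ?thesis .
  qed
  moreover have "gaussian_process M {0..1} B" using fbm by (simp add: fractional_brownian_motion_def)
  ultimately show ?thesis unfolding gaussian_process_def using I p by (auto simp: image_subset_iff)
qed

lemma B_gaussian: "t \<in> {0..1} ==> gaussian_var M (B t)"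
  using lincomb_gaussian[of "{()}" "\<lambda>_. t" "\<lambda>_. 1"] by simp

lemma B_meas: "t \<in> {0..1} ==> B t \<in> borel_measurable M"
  using B_gaussian by (simp add: gaussian_var_def)

lemma B_mean: "t \<in> {0..1} ==> expectation (B t) = 0"
  using fbm unfolding fractional_brownian_motion_def by (metis (no_types))

lemma B_integrable: "t \<in> {0..1} ==> integrable M (B t)" "t \<in> {0..1} ==> integrable M (\<lambda>om. (B t om)\<^sup>2)"
  using centered_gaussian(1)[OF B_gaussian B_mean, of t 1] centered_gaussian(1)[OF B_gaussian B_mean, of t 2] by auto

lemma abs_mult_le_sum_squares: "\<bar>a * b\<bar> \<le> a\<^sup>2 + (b::real)\<^sup>2"
proof -
  have "2 * (\<bar>a\<bar> * \<bar>b\<bar>) \<le> a\<^sup>2 + b\<^sup>2" using sum_squares_bound[of "\<bar>a\<bar>" "\<bar>b\<bar>"] by simp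
  moreover have "0 \<le> \<bar>a\<bar> * \<bar>b\<bar>" by simp
  ultimately show ?thesis unfolding abs_mult by linarith
qed

lemma B_prod_integrable: "s \<in> {0..1} ==> t \<in> {0..1} ==> integrable M (\<lambda>om. B s om * B t om)"
  by (rule Bochner_Integration.integrable_bound[OF Bochner_Integration.integrable_add[OF B_integrable(2)[of s] B_integrable(2)[of t]]])
     (auto intro!: borel_measurable_times B_meas AE_I2 abs_mult_le_sum_squares simp: abs_of_nonneg)

lemma B_cov: "s \<in> {0..1} ==> t \<in> {0..1} ==> expectation (\<lambda>om. B s om * B t om) = (t powr (2 * H) + s powr (2 * H) - \<bar>t - s\<bar> powr (2 * H)) / 2"
  using fbm unfolding fractional_brownian_motion_def by blast

definition cov :: "real => real => real => real => real" where
  "cov s t u v = (\<bar>t - u\<bar> powr (2 * H) + \<bar>s - v\<bar> powr (2 * H) - \<bar>t - v\<bar> powr (2 * H) - \<bar>s - u\<bar> powr (2 * H)) / 2"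

lemma incr_cov:
  assumes "s \<in> {0..1}" "t \<in> {0..1}" "u \<in> {0..1}" "v \<in> {0..1}"
  shows "integrable M (\<lambda>om. (B t om - B s om) * (B v om - B u om))"
    and "expectation (\<lambda>om. (B t om - B s om) * (B v om - B u om)) = cov s t u v"
proof -
  have e: "(B t om - B s om) * (B v om - B u om) = B t om * B v om - B t om * B u om - B s om * B v om + B s om * B u om" for om
    by (simp add: algebra_simps)
  show "integrable M (\<lambda>om. (B t om - B s om) * (B v om - B u om))"
    unfolding e using B_prod_integrable assms by (intro Bochner_Integration.integrable_add Bochner_Integration.integrable_diff) auto
  show "expectation (\<lambda>om. (B t om - B s om) * (B v om - B u om)) = cov s t u v"
    unfolding e using B_prod_integrable assms by (simp add: B_cov cov_def abs_minus_commute field_simps)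
qed

lemma cov_self: "cov s t s t = \<bar>t - s\<bar> powr (2 * H)"
  by (simp add: cov_def abs_minus_commute)

text \<open>Twice the covariance is a difference of two increments of the concave function x^(2 H)
  over the same length t - s, the one with the larger starting point coming first.\<close>

lemma cov_disjoint_nonpos:
  assumes "u \<le> v" "v \<le> s" "s \<le> t"
  shows "cov s t u v \<le> 0" "cov u v s t \<le> 0"
proof -
  have "((s - u) + (t - s)) powr (2 * H) - (s - u) powr (2 * H) \<le> ((s - v) + (t - s)) powr (2 * H) - (s - v) powr (2 * H)"
    using assms H by (intro concave_increment) auto
  then show "cov s t u v \<le> 0" "cov u v s t \<le> 0" using assms by (auto simp: cov_def abs_of_nonneg abs_of_nonpos)
qed

lemma increments_gaussian:
  assumes I: "finite I" and p: "\<And>i. i \<in> I ==> s i \<in> {0..1}" "\<And>i. i \<in> I ==> t i \<in> {0..1}"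
  shows "gaussian_var M (\<lambda>om. \<Sum>i\<in>I. c i * (B (t i) om - B (s i) om))"
    and "expectation (\<lambda>om. \<Sum>i\<in>I. c i * (B (t i) om - B (s i) om)) = 0"
    and "expectation (\<lambda>om. (\<Sum>i\<in>I. c i * (B (t i) om - B (s i) om))\<^sup>2) = (\<Sum>i\<in>I. \<Sum>j\<in>I. c i * c j * cov (s i) (t i) (s j) (t j))"
proof -
  \<comment> \<open>Each increment contributes two signed points, told apart by a bool.\<close>
  have "(\<Sum>(i,b)\<in>I \<times> UNIV. (if b then c i else - c i) * B (if b then t i else s i) om) = (\<Sum>i\<in>I. c i * (B (t i) om - B (s i) om))" for om
    unfolding sum.cartesian_product[symmetric] by (simp add: UNIV_bool algebra_simps)
  moreover have "gaussian_var M (\<lambda>om. \<Sum>x\<in>I \<times> UNIV. (\<lambda>(i,b). if b then c i else - c i) x * B ((\<lambda>(i,b). if b then t i else s i) x) om)"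
    by (rule lincomb_gaussian) (use I p in \<open>auto split: if_splits\<close>)
  ultimately show "gaussian_var M (\<lambda>om. \<Sum>i\<in>I. c i * (B (t i) om - B (s i) om))" by (simp add: split_beta)
  have "expectation (\<lambda>om. \<Sum>i\<in>I. c i * (B (t i) om - B (s i) om)) = (\<Sum>i\<in>I. expectation (\<lambda>om. c i * (B (t i) om - B (s i) om)))"
    using B_integrable(1) p by (intro Bochner_Integration.integral_sum) auto
  also have "\<dots> = (\<Sum>i\<in>I. 0)"
    by (rule sum.cong[OF refl]) (use B_integrable(1) B_mean p in auto)
  finally show "expectation (\<lambda>om. \<Sum>i\<in>I. c i * (B (t i) om - B (s i) om)) = 0" by simp
  have "expectation (\<lambda>om. (\<Sum>i\<in>I. c i * (B (t i) om - B (s i) om))\<^sup>2) = expectation (\<lambda>om. \<Sum>i\<in>I. \<Sum>j\<in>I. c i * c j * ((B (t i) om - B (s i) om) * (B (t j) om - B (s j) om)))"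
    by (intro Bochner_Integration.integral_cong refl) (simp add: power2_eq_square sum_product mult_ac)
  also have "\<dots> = (\<Sum>i\<in>I. \<Sum>j\<in>I. c i * c j * cov (s i) (t i) (s j) (t j))"
    using incr_cov p by (simp add: Bochner_Integration.integral_sum)
  finally show "expectation (\<lambda>om. (\<Sum>i\<in>I. c i * (B (t i) om - B (s i) om))\<^sup>2) = (\<Sum>i\<in>I. \<Sum>j\<in>I. c i * c j * cov (s i) (t i) (s j) (t j))" .
qed

lemma increment_gaussian:
  assumes "s \<in> {0..1}" "t \<in> {0..1}"
  shows "gaussian_var M (\<lambda>om. B t om - B s om)" "expectation (\<lambda>om. B t om - B s om) = 0"
    "expectation (\<lambda>om. (B t om - B s om)\<^sup>2) = \<bar>t - s\<bar> powr (2 * H)"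
  using increments_gaussian[of "{()}" "\<lambda>_. s" "\<lambda>_. t" "\<lambda>_. 1"] assms by (simp_all add: cov_self)

end

section \<open>Joint laws determined by cosine transforms\<close>

lemma weighted_levy:
  fixes X :: "'a => real" and Y :: "'b => real"
  assumes "prob_space M1" "prob_space M2"
    and meas[measurable]: "X \<in> borel_measurable M1" "Y \<in> borel_measurable M2" "f \<in> borel_measurable M1" "g \<in> borel_measurable M2"
    and fg: "\<And>om. 0 \<le> f om" "\<And>om. f om \<le> C" "\<And>om. 0 \<le> g om" "\<And>om. g om \<le> C"
    and eq: "\<And>v \<phi>. (\<integral>om. f om * cos (v * X om + \<phi>) \<partial>M1) = (\<integral>om. g om * cos (v * Y om + \<phi>) \<partial>M2)"
    and A[measurable]: "A \<in> sets borel"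
  shows "(\<integral>om. f om * indicator A (X om) \<partial>M1) = (\<integral>om. g om * indicator A (Y om) \<partial>M2)"
proof -
  interpret M1: prob_space M1 by fact
  interpret M2: prob_space M2 by fact
  have If: "integrable M1 f" by (rule M1.integrable_const_bound[of _ C]) (use fg in auto)
  have Ig: "integrable M2 g" by (rule M2.integrable_const_bound[of _ C]) (use fg in auto)
  define m where "m = (\<integral>om. f om \<partial>M1)"
  have m2: "m = (\<integral>om. g om \<partial>M2)" using eq[of 0 0] by (simp add: m_def)
  have m0: "0 \<le> m" unfolding m_def using fg by (intro integral_nonneg_AE) auto
  show ?thesis
  proof (cases "m = 0")
    case True
    have "AE om in M1. f om = 0" using integral_nonneg_eq_0_iff_AE[OF If] fg True unfolding m_def by auto
    then have "(\<integral>om. f om * indicator A (X om) \<partial>M1) = (\<integral>om. 0 \<partial>M1)" by (intro integral_cong_AE) auto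
    moreover have "AE om in M2. g om = 0" using integral_nonneg_eq_0_iff_AE[OF Ig] fg True unfolding m2 by auto
    then have "(\<integral>om. g om * indicator A (Y om) \<partial>M2) = (\<integral>om. 0 \<partial>M2)" by (intro integral_cong_AE) auto
    ultimately show ?thesis by simp
  next
    case False
    then have m: "0 < m" using m0 by simp
    \<comment> \<open>Divided by their common mass m, the weights become probability densities, so
      the uniqueness theorem for characteristic functions applies to the image laws.\<close>
    define D1 where "D1 = distr (density M1 (\<lambda>om. ennreal (f om / m))) borel X"
    define D2 where "D2 = distr (density M2 (\<lambda>om. ennreal (g om / m))) borel Y"
    have p1: "prob_space (density M1 (\<lambda>om. ennreal (f om / m)))"
    proof
      have "(\<integral>\<^sup>+ om. ennreal (f om / m) \<partial>M1) = ennreal (\<integral>om. f om / m \<partial>M1)"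
        using If fg m by (intro nn_integral_eq_integral) auto
      also have "\<dots> = 1" using m by (simp add: m_def)
      finally show "emeasure (density M1 (\<lambda>om. ennreal (f om / m))) (space (density M1 (\<lambda>om. ennreal (f om / m)))) = 1"
        by (simp add: emeasure_density cong: nn_integral_cong)
    qed
    have p2: "prob_space (density M2 (\<lambda>om. ennreal (g om / m)))"
    proof
      have "(\<integral>\<^sup>+ om. ennreal (g om / m) \<partial>M2) = ennreal (\<integral>om. g om / m \<partial>M2)"
        using Ig fg m by (intro nn_integral_eq_integral) auto
      also have "\<dots> = 1" using m by (simp add: m2)
      finally show "emeasure (density M2 (\<lambda>om. ennreal (g om / m))) (space (density M2 (\<lambda>om. ennreal (g om / m)))) = 1"
        by (simp add: emeasure_density cong: nn_integral_cong)
    qed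
    have r: "real_distribution D1" "real_distribution D2"
      unfolding D1_def D2_def by (intro prob_space.real_distribution_distr p1 p2; simp)+
    have c1: "char D1 v = Complex ((\<integral>om. f om * cos (v * X om) \<partial>M1) / m) ((\<integral>om. f om * sin (v * X om) \<partial>M1) / m)" for v
    proof -
      have I: "complex_integrable M1 (\<lambda>om. (f om / m) *\<^sub>R iexp (v * X om))"
        by (rule M1.integrable_const_bound[of _ "C / m"]) (use fg m in \<open>auto simp: divide_right_mono\<close>)
      have "char D1 v = (CLINT om|M1. (f om / m) *\<^sub>R iexp (v * X om))"
        unfolding char_def D1_def using fg m by (subst integral_distr) (auto simp: integral_density)
      moreover have "Re \<dots> = (\<integral>om. f om * cos (v * X om) / m \<partial>M1)"
        unfolding integral_Re[OF I, symmetric] by (simp add: Re_exp)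
      moreover have "Im (CLINT om|M1. (f om / m) *\<^sub>R iexp (v * X om)) = (\<integral>om. f om * sin (v * X om) / m \<partial>M1)"
        unfolding integral_Im[OF I, symmetric] by (simp add: Im_exp)
      ultimately show ?thesis by (simp add: complex_eq_iff)
    qed
    have c2: "char D2 v = Complex ((\<integral>om. g om * cos (v * Y om) \<partial>M2) / m) ((\<integral>om. g om * sin (v * Y om) \<partial>M2) / m)" for v
    proof -
      have I: "complex_integrable M2 (\<lambda>om. (g om / m) *\<^sub>R iexp (v * Y om))"
        by (rule M2.integrable_const_bound[of _ "C / m"]) (use fg m in \<open>auto simp: divide_right_mono\<close>)
      have "char D2 v = (CLINT om|M2. (g om / m) *\<^sub>R iexp (v * Y om))"
        unfolding char_def D2_def using fg m by (subst integral_distr) (auto simp: integral_density)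
      moreover have "Re \<dots> = (\<integral>om. g om * cos (v * Y om) / m \<partial>M2)"
        unfolding integral_Re[OF I, symmetric] by (simp add: Re_exp)
      moreover have "Im (CLINT om|M2. (g om / m) *\<^sub>R iexp (v * Y om)) = (\<integral>om. g om * sin (v * Y om) / m \<partial>M2)"
        unfolding integral_Im[OF I, symmetric] by (simp add: Im_exp)
      ultimately show ?thesis by (simp add: complex_eq_iff)
    qed
    have "char D1 = char D2"
    proof
      fix v
      \<comment> \<open>The phase in the hypothesis turns the cosine into a sine, so both parts of
        the characteristic function are determined.\<close>
      have "cos (y - pi / 2) = sin y" for y :: real by (simp add: cos_diff)
      then show "char D1 v = char D2 v" using eq[of v 0] eq[of v "- pi/2"] unfolding c1 c2 by simp
    qed
    then have D: "D1 = D2" by (rule Levy_uniqueness[OF r])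
    have "(\<integral>x. indicator A x \<partial>D1) = (\<integral>om. f om / m * indicator A (X om) \<partial>M1)"
      unfolding D1_def using fg m by (subst integral_distr) (auto simp: integral_density)
    moreover have "(\<integral>x. indicator A x \<partial>D2) = (\<integral>om. g om / m * indicator A (Y om) \<partial>M2)"
      unfolding D2_def using fg m by (subst integral_distr) (auto simp: integral_density)
    ultimately have "(\<integral>om. f om * indicator A (X om) / m \<partial>M1) = (\<integral>om. g om * indicator A (Y om) / m \<partial>M2)"
      using D by simp
    then show ?thesis using m by simp
  qed
qed

text \<open>The coordinates are exchanged one at a time, from a share in the cosine of a linear
  combination to an indicator of a Borel set. The induction carries \<open>mix\<close>, with
  indicators on J and a cosine of the remaining coordinates.\<close>

theorem cramer_wold:
  fixes X :: "'i => 'a => real" and Y :: "'i => 'b => real"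
  assumes p: "prob_space M1" "prob_space M2" and I: "finite I"
    and meas: "\<And>i. i \<in> I ==> X i \<in> borel_measurable M1" "\<And>i. i \<in> I ==> Y i \<in> borel_measurable M2"
    and eq: "\<And>c \<theta>. (\<integral>om. cos ((\<Sum>i\<in>I. c i * X i om) + \<theta>) \<partial>M1) = (\<integral>om. cos ((\<Sum>i\<in>I. c i * Y i om) + \<theta>) \<partial>M2)"
  shows "distr M1 (\<Pi>\<^sub>M i\<in>I. borel) (\<lambda>om. \<lambda>i\<in>I. X i om) = distr M2 (\<Pi>\<^sub>M i\<in>I. borel) (\<lambda>om. \<lambda>i\<in>I. Y i om)"
proof -
  interpret M1: prob_space M1 by fact
  interpret M2: prob_space M2 by fact
  have mix: "(\<integral>om. (\<Prod>i\<in>J. indicator (A i) (X i om)) * cos ((\<Sum>i\<in>I-J. c i * X i om) + \<theta>) \<partial>M1) =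
      (\<integral>om. (\<Prod>i\<in>J. indicator (A i) (Y i om)) * cos ((\<Sum>i\<in>I-J. c i * Y i om) + \<theta>) \<partial>M2)"
    if "J \<subseteq> I" "\<And>i. i \<in> J ==> A i \<in> sets borel" for J A c \<theta>
    using finite_subset[OF that(1) I] that
  proof (induction J arbitrary: c \<theta> rule: finite_induct)
    case empty
    then show ?case using eq by simp
  next
    case (insert j J)
    have j: "j \<in> I" "j \<notin> J" "J \<subseteq> I" and A: "\<And>i. i \<in> J ==> A i \<in> sets borel" "A j \<in> sets borel" using insert by auto
    note IH = insert.IH[OF j(3) A(1)]
    have mX[measurable]: "X j \<in> borel_measurable M1" "Y j \<in> borel_measurable M2" using meas j by auto
    have mX': "X i \<in> borel_measurable M1" "Y i \<in> borel_measurable M2" if "i \<in> I" for i using meas that by auto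
    define f where "f = (\<lambda>om. (\<Prod>i\<in>J. indicator (A i) (X i om)) :: real)"
    define g where "g = (\<lambda>om. (\<Prod>i\<in>J. indicator (A i) (Y i om)) :: real)"
    define a where "a = (\<lambda>om. (\<Sum>i\<in>I - insert j J. c i * X i om) + \<theta>)"
    define b where "b = (\<lambda>om. (\<Sum>i\<in>I - insert j J. c i * Y i om) + \<theta>)"
    have [measurable]: "f \<in> borel_measurable M1" "g \<in> borel_measurable M2"
      unfolding f_def g_def using A(1) mX' j(3)
      by (auto intro!: borel_measurable_prod borel_measurable_indicator' measurable_sets simp: measurable_sets intro: measurable_sets_borel)
    have [measurable]: "a \<in> borel_measurable M1" "b \<in> borel_measurable M2"
      unfolding a_def b_def using mX' by (auto intro!: borel_measurable_sum borel_measurable_add borel_measurable_times)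
    have f01: "0 \<le> f om" "f om \<le> 1" for om
    proof -
      show "0 \<le> f om" unfolding f_def by (rule prod_nonneg) simp
      show "f om \<le> 1" unfolding f_def by (rule prod_le_1) (simp add: indicator_def)
    qed
    have g01: "0 \<le> g om" "g om \<le> 1" for om
    proof -
      show "0 \<le> g om" unfolding g_def by (rule prod_nonneg) simp
      show "g om \<le> 1" unfolding g_def by (rule prod_le_1) (simp add: indicator_def)
    qed
    have I1: "integrable M1 (\<lambda>om. f om * h om)" if [measurable]: "h \<in> borel_measurable M1" and "\<And>om. \<bar>h om\<bar> \<le> 2" for h
    proof (rule M1.integrable_const_bound[of _ 2])
      have "norm (f om * h om) \<le> 2" for om
        using mult_mono[of "f om" 1 "\<bar>h om\<bar>" 2] that(2)[of om] f01[of om] by (simp add: abs_mult)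
      then show "AE om in M1. norm (f om * h om) \<le> 2" by simp
    qed simp
    have I2: "integrable M2 (\<lambda>om. g om * h om)" if [measurable]: "h \<in> borel_measurable M2" and "\<And>om. \<bar>h om\<bar> \<le> 2" for h
    proof (rule M2.integrable_const_bound[of _ 2])
      have "norm (g om * h om) \<le> 2" for om
        using mult_mono[of "g om" 1 "\<bar>h om\<bar>" 2] that(2)[of om] g01[of om] by (simp add: abs_mult)
      then show "AE om in M2. norm (g om * h om) \<le> 2" by simp
    qed simp
    have split: "I - J = insert j (I - insert j J)" using j by auto
    have key: "(\<integral>om. f om * cos (k * a om + (v * X j om + \<phi>)) \<partial>M1) = (\<integral>om. g om * cos (k * b om + (v * Y j om + \<phi>)) \<partial>M2)" for k v \<phi>
    proof -
      let ?c = "\<lambda>i. if i = j then v else k * c i"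
      have e1: "(\<Sum>i\<in>I-J. ?c i * X i om) + (k * \<theta> + \<phi>) = k * a om + (v * X j om + \<phi>)" for om
        unfolding split a_def using I by (subst sum.insert) (auto simp: sum_distrib_left algebra_simps intro!: sum.cong)
      have e2: "(\<Sum>i\<in>I-J. ?c i * Y i om) + (k * \<theta> + \<phi>) = k * b om + (v * Y j om + \<phi>)" for om
        unfolding split b_def using I by (subst sum.insert) (auto simp: sum_distrib_left algebra_simps intro!: sum.cong)
      show ?thesis using IH[of ?c "k * \<theta> + \<phi>"] unfolding e1 e2 f_def g_def .
    qed
    \<comment> \<open>\<open>weighted_levy\<close> wants a nonnegative weight; 1 + cos is one. The
      cases k = 0 and k = 1 together isolate the cosine.\<close>
    have W: "(\<integral>om. f om * (1 + cos (k * a om)) * indicator (A j) (X j om) \<partial>M1) = (\<integral>om. g om * (1 + cos (k * b om)) * indicator (A j) (Y j om) \<partial>M2)" for k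
    proof (rule weighted_levy[OF p, where C=2])
      show "0 \<le> f om * (1 + cos (k * a om))" for om using f01(1)[of om] cos_ge_minus_one[of "k * a om"] by (intro mult_nonneg_nonneg) linarith+
      show "0 \<le> g om * (1 + cos (k * b om))" for om using g01(1)[of om] cos_ge_minus_one[of "k * b om"] by (intro mult_nonneg_nonneg) linarith+
      show "f om * (1 + cos (k * a om)) \<le> 2" for om
      proof -
        have "0 \<le> 1 + cos (k * a om)" "1 + cos (k * a om) \<le> 2" using cos_ge_minus_one[of "k * a om"] cos_le_one[of "k * a om"] by linarith+
        then show ?thesis using mult_mono[of "f om" 1 "1 + cos (k * a om)" 2] f01[of om] by simp
      qed
      show "g om * (1 + cos (k * b om)) \<le> 2" for om
      proof -
        have "0 \<le> 1 + cos (k * b om)" "1 + cos (k * b om) \<le> 2" using cos_ge_minus_one[of "k * b om"] cos_le_one[of "k * b om"] by linarith+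
        then show ?thesis using mult_mono[of "g om" 1 "1 + cos (k * b om)" 2] g01[of om] by simp
      qed
      show "A j \<in> sets borel" by fact
      fix v \<phi>
      have e: "F * (1 + cos (k * A)) * cos (v * B + \<phi>) = F * cos (v * B + \<phi>) + F * cos (k * A + (v * B + \<phi>)) / 2 + F * cos (- k * A + (v * B + \<phi>)) / 2" for F A B :: real
      proof -
        have "cos (- k * A + y) = cos (k * A) * cos y + sin (k * A) * sin y" for y by (simp add: cos_diff)
        then show ?thesis unfolding cos_add[of "k * A"] by (simp add: field_simps)
      qed
      have "(\<integral>om. f om * (1 + cos (k * a om)) * cos (v * X j om + \<phi>) \<partial>M1) =
        (\<integral>om. f om * cos (v * X j om + \<phi>) \<partial>M1) + (\<integral>om. f om * cos (k * a om + (v * X j om + \<phi>)) \<partial>M1) / 2 + (\<integral>om. f om * cos (- k * a om + (v * X j om + \<phi>)) \<partial>M1) / 2"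
        unfolding e by (subst Bochner_Integration.integral_add Bochner_Integration.integral_add; (intro Bochner_Integration.integrable_add integrable_divide I1)?; (auto intro: order_trans[OF abs_cos_le_one])?)+
      also have "\<dots> = (\<integral>om. g om * cos (v * Y j om + \<phi>) \<partial>M2) + (\<integral>om. g om * cos (k * b om + (v * Y j om + \<phi>)) \<partial>M2) / 2 + (\<integral>om. g om * cos (- k * b om + (v * Y j om + \<phi>)) \<partial>M2) / 2"
        using key[of 0 v \<phi>] key[of k v \<phi>] key[of "-k" v \<phi>] by simp
      also have "\<dots> = (\<integral>om. g om * (1 + cos (k * b om)) * cos (v * Y j om + \<phi>) \<partial>M2)"
        unfolding e by (subst Bochner_Integration.integral_add Bochner_Integration.integral_add; (intro Bochner_Integration.integrable_add integrable_divide I2)?; (auto intro: order_trans[OF abs_cos_le_one])?)+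
      finally show "(\<integral>om. f om * (1 + cos (k * a om)) * cos (v * X j om + \<phi>) \<partial>M1) = (\<integral>om. g om * (1 + cos (k * b om)) * cos (v * Y j om + \<phi>) \<partial>M2)" .
    qed measurable
    have ind: "\<bar>indicator S x :: real\<bar> \<le> 2" "\<bar>cos y * indicator S x\<bar> \<le> 2" for S and x y :: real
    proof -
      have "\<bar>cos y\<bar> \<le> 2" using abs_cos_le_one[of y] by linarith
      then show "\<bar>indicator S x :: real\<bar> \<le> 2" "\<bar>cos y * indicator S x\<bar> \<le> 2" by (auto simp: indicator_def)
    qed
    have [measurable]: "(\<lambda>om. indicator (A j) (X j om) :: real) \<in> borel_measurable M1" "(\<lambda>om. indicator (A j) (Y j om) :: real) \<in> borel_measurable M2"
      using A(2) by measurable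
    have "(\<integral>om. f om * (1 + cos (1 * a om)) * indicator (A j) (X j om) \<partial>M1) =
       (\<integral>om. f om * (cos (a om) * indicator (A j) (X j om)) + f om * indicator (A j) (X j om) \<partial>M1)"
      by (intro Bochner_Integration.integral_cong) (auto simp: algebra_simps)
    also have "\<dots> = (\<integral>om. f om * (cos (a om) * indicator (A j) (X j om)) \<partial>M1) + (\<integral>om. f om * indicator (A j) (X j om) \<partial>M1)"
      by (intro Bochner_Integration.integral_add I1 ind) measurable
    finally have e1: "(\<integral>om. f om * (1 + cos (1 * a om)) * indicator (A j) (X j om) \<partial>M1) = \<dots>" .
    have "(\<integral>om. g om * (1 + cos (1 * b om)) * indicator (A j) (Y j om) \<partial>M2) =
       (\<integral>om. g om * (cos (b om) * indicator (A j) (Y j om)) + g om * indicator (A j) (Y j om) \<partial>M2)"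
      by (intro Bochner_Integration.integral_cong) (auto simp: algebra_simps)
    also have "\<dots> = (\<integral>om. g om * (cos (b om) * indicator (A j) (Y j om)) \<partial>M2) + (\<integral>om. g om * indicator (A j) (Y j om) \<partial>M2)"
      by (intro Bochner_Integration.integral_add I2 ind) measurable
    finally have e2: "(\<integral>om. g om * (1 + cos (1 * b om)) * indicator (A j) (Y j om) \<partial>M2) = \<dots>" .
    have "(\<integral>om. f om * 2 * indicator (A j) (X j om) \<partial>M1) = (\<integral>om. g om * 2 * indicator (A j) (Y j om) \<partial>M2)"
      using W[of 0] by simp
    then have e3: "(\<integral>om. f om * indicator (A j) (X j om) \<partial>M1) = (\<integral>om. g om * indicator (A j) (Y j om) \<partial>M2)"
      by (simp add: mult.commute[of _ 2] mult.assoc)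
    have "(\<integral>om. f om * (cos (a om) * indicator (A j) (X j om)) \<partial>M1) = (\<integral>om. g om * (cos (b om) * indicator (A j) (Y j om)) \<partial>M2)"
      using W[of 1] unfolding e1 e2 e3 by simp
    then show ?case using insert.hyps unfolding f_def g_def a_def b_def by (simp add: mult_ac)
  qed
  show ?thesis
  proof (rule measure_eqI_PiM_finite[OF I, where A="\<lambda>_::nat. \<Pi>\<^sub>E i\<in>I. UNIV"])
    let ?D1 = "distr M1 (\<Pi>\<^sub>M i\<in>I. borel) (\<lambda>om. \<lambda>i\<in>I. X i om)" and ?D2 = "distr M2 (\<Pi>\<^sub>M i\<in>I. borel) (\<lambda>om. \<lambda>i\<in>I. Y i om)"
    have mm[measurable]: "(\<lambda>om. \<lambda>i\<in>I. X i om) \<in> measurable M1 (\<Pi>\<^sub>M i\<in>I. borel)" "(\<lambda>om. \<lambda>i\<in>I. Y i om) \<in> measurable M2 (\<Pi>\<^sub>M i\<in>I. borel)"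
      using meas by (auto intro!: measurable_restrict)
    show "sets ?D1 = sets (\<Pi>\<^sub>M i\<in>I. borel)" "sets ?D2 = sets (\<Pi>\<^sub>M i\<in>I. borel)" by simp_all
    fix A :: "'i => real set" assume A: "\<And>i. i \<in> I ==> A i \<in> sets borel"
    have S: "Pi\<^sub>E I A \<in> sets (\<Pi>\<^sub>M i\<in>I. borel)" using A I by (intro sets_PiM_I_finite) auto
    interpret D1: prob_space ?D1 by (rule M1.prob_space_distr) simp
    interpret D2: prob_space ?D2 by (rule M2.prob_space_distr) simp
    have "measure ?D1 (Pi\<^sub>E I A) = (\<integral>om. indicator (Pi\<^sub>E I A) (\<lambda>i\<in>I. X i om) \<partial>M1)"
      using S by (subst integral_distr[symmetric, of _ M1 "\<Pi>\<^sub>M i\<in>I. borel" "indicator (Pi\<^sub>E I A)"]) auto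
    also have "\<dots> = (\<integral>om. (\<Prod>i\<in>I. indicator (A i) (X i om)) * cos ((\<Sum>i\<in>I-I. 0 * X i om) + 0) \<partial>M1)"
      using I by (intro Bochner_Integration.integral_cong) (auto simp: indicator_def PiE_iff prod_zero_iff split: if_splits)
    also have "\<dots> = (\<integral>om. (\<Prod>i\<in>I. indicator (A i) (Y i om)) * cos ((\<Sum>i\<in>I-I. 0 * Y i om) + 0) \<partial>M2)"
      using A by (intro mix[of I A "\<lambda>_. 0" 0]) auto
    also have "\<dots> = (\<integral>om. indicator (Pi\<^sub>E I A) (\<lambda>i\<in>I. Y i om) \<partial>M2)"
      using I by (intro Bochner_Integration.integral_cong) (auto simp: indicator_def PiE_iff prod_zero_iff split: if_splits)
    also have "\<dots> = measure ?D2 (Pi\<^sub>E I A)"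
      using S by (subst integral_distr[symmetric, of _ M2 "\<Pi>\<^sub>M i\<in>I. borel" "indicator (Pi\<^sub>E I A)"]) auto
    finally show "emeasure ?D1 (Pi\<^sub>E I A) = emeasure ?D2 (Pi\<^sub>E I A)"
      by (simp add: D1.emeasure_eq_measure D2.emeasure_eq_measure)
  next
    show "range (\<lambda>_::nat. \<Pi>\<^sub>E i\<in>I. UNIV) \<subseteq> prod_algebra I (\<lambda>_. borel :: real measure)"
      using space_in_prod_algebra[of I "\<lambda>_. borel :: real measure"] by auto
    show "(\<Union>i::nat. \<Pi>\<^sub>E i\<in>I. UNIV) = space (\<Pi>\<^sub>M i\<in>I. borel :: real measure)" by (simp add: space_PiM)
    show "emeasure (distr M1 (\<Pi>\<^sub>M i\<in>I. borel) (\<lambda>om. \<lambda>i\<in>I. X i om)) (\<Pi>\<^sub>E i\<in>I. UNIV) \<noteq> \<infinity>"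
      using meas(1) by (auto intro!: finite_measure.emeasure_finite[OF M1.finite_measure_distr] measurable_restrict)
  qed
qed

section \<open>A Poincare inequality for Gaussian vectors\<close>

locale gaussian_vector = prob_space M for M :: "'a measure" +
  fixes J :: "'i set" and X :: "'i => 'a => real"
  assumes finJ: "finite J" and meas: "\<And>j. j \<in> J ==> X j \<in> borel_measurable M"
    and square: "\<And>j. j \<in> J ==> integrable M (\<lambda>om. (X j om)\<^sup>2)"
    and gauss: "\<And>c \<theta>. (\<integral>om. cos ((\<Sum>j\<in>J. c j * X j om) + \<theta>) \<partial>M) = cos \<theta> * exp (- (\<integral>om. (\<Sum>j\<in>J. c j * X j om)\<^sup>2 \<partial>M) / 2)"
begin

sublocale MM: pair_prob_space M M ..

definition lin :: "('i => real) => 'a => real" where "lin c om = (\<Sum>j\<in>J. c j * X j om)"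

lemma lin_meas[measurable]: "lin c \<in> borel_measurable M"
  unfolding lin_def[abs_def] using meas by (intro borel_measurable_sum borel_measurable_times) auto

lemma lin_square: "integrable M (\<lambda>om. (lin c om)\<^sup>2)"
proof (rule Bochner_Integration.integrable_bound)
  show "integrable M (\<lambda>om. (\<Sum>j\<in>J. (c j)\<^sup>2) * (\<Sum>j\<in>J. (X j om)\<^sup>2))"
    using square by (intro Bochner_Integration.integrable_mult_right Bochner_Integration.integrable_sum) auto
  show "AE om in M. norm ((lin c om)\<^sup>2) \<le> norm ((\<Sum>j\<in>J. (c j)\<^sup>2) * (\<Sum>j\<in>J. (X j om)\<^sup>2))"
  proof (rule AE_I2)
    fix om
    have "(lin c om)\<^sup>2 \<le> (\<Sum>j\<in>J. (c j)\<^sup>2) * (\<Sum>j\<in>J. (X j om)\<^sup>2)" unfolding lin_def by (rule Cauchy_Schwarz_ineq_sum)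
    then show "norm ((lin c om)\<^sup>2) \<le> norm ((\<Sum>j\<in>J. (c j)\<^sup>2) * (\<Sum>j\<in>J. (X j om)\<^sup>2))" by (simp add: abs_of_nonneg[OF zero_le_power2])
  qed
qed measurable

lemma lin_prod: "integrable M (\<lambda>om. lin c om * lin d om)"
proof (rule Bochner_Integration.integrable_bound)
  show "integrable M (\<lambda>om. (lin c om)\<^sup>2 + (lin d om)\<^sup>2)" using lin_square by (intro Bochner_Integration.integrable_add) auto
  have "\<bar>a * b\<bar> \<le> a\<^sup>2 + b\<^sup>2" for a b :: real
  proof -
    have "2 * (\<bar>a\<bar> * \<bar>b\<bar>) \<le> a\<^sup>2 + b\<^sup>2" using sum_squares_bound[of "\<bar>a\<bar>" "\<bar>b\<bar>"] by simp
    moreover have "0 \<le> \<bar>a\<bar> * \<bar>b\<bar>" by simp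
    ultimately show ?thesis unfolding abs_mult by linarith
  qed
  then show "AE om in M. norm (lin c om * lin d om) \<le> norm ((lin c om)\<^sup>2 + (lin d om)\<^sup>2)" by (intro AE_I2) auto
qed measurable

lemma lin_combine: "lin (\<lambda>j. a * c j + b * d j) om = a * lin c om + b * lin d om"
  unfolding lin_def by (simp add: sum_distrib_left sum.distrib[symmetric] algebra_simps)

definition Q :: "('i => real) => real" where "Q c = (\<integral>om. (lin c om)\<^sup>2 \<partial>M)"

lemma Q_combine: "Q (\<lambda>j. a * c j + b * d j) = a\<^sup>2 * Q c + b\<^sup>2 * Q d + 2 * a * b * (\<integral>om. lin c om * lin d om \<partial>M)"
proof -
  have "Q (\<lambda>j. a * c j + b * d j) = (\<integral>om. a\<^sup>2 * (lin c om)\<^sup>2 + b\<^sup>2 * (lin d om)\<^sup>2 + 2 * a * b * (lin c om * lin d om) \<partial>M)"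
    unfolding Q_def lin_combine by (intro Bochner_Integration.integral_cong refl) (simp add: power2_eq_square algebra_simps)
  also have "\<dots> = a\<^sup>2 * Q c + b\<^sup>2 * Q d + 2 * a * b * (\<integral>om. lin c om * lin d om \<partial>M)"
    unfolding Q_def using lin_square lin_prod by (simp add: Bochner_Integration.integral_add)
  finally show ?thesis .
qed

lemma gauss_lin: "(\<integral>om. cos (lin c om + \<theta>) \<partial>M) = cos \<theta> * exp (- Q c / 2)"
  using gauss[of c \<theta>] by (simp add: lin_def Q_def)

lemma gauss_pair:
  "(\<integral>z. cos (lin c (fst z) + lin d (snd z) + \<theta>) \<partial>(M \<Otimes>\<^sub>M M)) = cos \<theta> * exp (- (Q c + Q d) / 2)"
proof -
  have I: "integrable (M \<Otimes>\<^sub>M M) (\<lambda>z. cos (lin c (fst z) + lin d (snd z) + \<theta>))"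
    by (rule MM.P.integrable_const_bound[of _ 1]) auto
  have "(\<integral>z. cos (lin c (fst z) + lin d (snd z) + \<theta>) \<partial>(M \<Otimes>\<^sub>M M)) = (\<integral>x. (\<integral>y. cos (lin d y + (lin c x + \<theta>)) \<partial>M) \<partial>M)"
    using MM.integral_fst'[OF I] by (simp add: add_ac)
  also have "\<dots> = (\<integral>x. cos (lin c x + \<theta>) \<partial>M) * exp (- Q d / 2)" by (simp add: gauss_lin)
  also have "\<dots> = cos \<theta> * exp (- (Q c + Q d) / 2)"
    unfolding gauss_lin by (simp add: exp_add[symmetric] add_divide_distrib diff_divide_distrib)
  finally show ?thesis .
qed

definition rot :: "real => 'a \<times> 'a => 'i => real" where
  "rot s z = (\<lambda>j\<in>J. cos s * X j (fst z) + sin s * X j (snd z))"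

lemma rot_meas[measurable]: "rot s \<in> measurable (M \<Otimes>\<^sub>M M) (\<Pi>\<^sub>M j\<in>J. borel)"
  unfolding rot_def[abs_def] 
  by (intro measurable_restrict borel_measurable_add borel_measurable_times borel_measurable_const)
     (auto intro: measurable_compose[OF measurable_fst meas] measurable_compose[OF measurable_snd meas])

text \<open>The joint law of two rotated copies depends on the angle between them only.\<close>

lemma rot_law:
  assumes \<Psi>: "\<Psi> \<in> borel_measurable ((\<Pi>\<^sub>M j\<in>J. borel) \<Otimes>\<^sub>M (\<Pi>\<^sub>M j\<in>J. borel))" and c: "cos (s - t) = cos (s' - t')"
  shows "(\<integral>\<^sup>+z. \<Psi> (rot s z, rot t z) \<partial>(M \<Otimes>\<^sub>M M)) = (\<integral>\<^sup>+z. \<Psi> (rot s' z, rot t' z) \<partial>(M \<Otimes>\<^sub>M M))"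
proof -
  define I where "I = J \<times> (UNIV :: bool set)"
  define W where "W = (\<lambda>s t (i, b) z. rot (if b then t else s) z i)"
  have finI: "finite I" unfolding I_def using finJ by auto
  have mW: "W s t i \<in> borel_measurable (M \<Otimes>\<^sub>M M)" if "i \<in> I" for s t i
  proof -
    have "(\<lambda>z. rot u z (fst i)) \<in> borel_measurable (M \<Otimes>\<^sub>M M)" for u
      by (rule measurable_compose[OF rot_meas measurable_component_singleton]) (use that in \<open>auto simp: I_def\<close>)
    then show ?thesis unfolding W_def by (auto simp: split_beta)
  qed
  have comb: "(\<Sum>i\<in>I. c i * W s t i z) = lin (\<lambda>j. cos s * c (j, False) + cos t * c (j, True)) (fst z) + lin (\<lambda>j. sin s * c (j, False) + sin t * c (j, True)) (snd z)" for c s t z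
  proof -
    have "(\<Sum>i\<in>I. c i * W s t i z) = (\<Sum>j\<in>J. \<Sum>b\<in>UNIV. c (j, b) * W s t (j, b) z)"
      unfolding I_def by (subst sum.cartesian_product) (simp add: split_beta)
    also have "\<dots> = (\<Sum>j\<in>J. c (j, False) * rot s z j + c (j, True) * rot t z j)"
      by (intro sum.cong refl) (simp add: UNIV_bool W_def)
    also have "\<dots> = lin (\<lambda>j. cos s * c (j, False) + cos t * c (j, True)) (fst z) + lin (\<lambda>j. sin s * c (j, False) + sin t * c (j, True)) (snd z)"
      unfolding lin_def sum.distrib[symmetric] by (intro sum.cong refl) (simp add: rot_def algebra_simps)
    finally show ?thesis .
  qed
  \<comment> \<open>The angles enter the variance of a combination of the two rotated copies only
    through cos (s - t), hence also the joint law.\<close>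
  have Qsum: "Q (\<lambda>j. cos s * c j + cos t * d j) + Q (\<lambda>j. sin s * c j + sin t * d j) = Q c + Q d + 2 * cos (s - t) * (\<integral>om. lin c om * lin d om \<partial>M)" for s t c d
  proof -
    have alg: "p\<^sup>2 * q + r\<^sup>2 * e + 2 * p * r * z + (u\<^sup>2 * q + v\<^sup>2 * e + 2 * u * v * z) = (p\<^sup>2 + u\<^sup>2) * q + (r\<^sup>2 + v\<^sup>2) * e + 2 * (p * r + u * v) * z"
      for p q r e u v z :: real by (simp add: algebra_simps)
    have "Q (\<lambda>j. cos s * c j + cos t * d j) + Q (\<lambda>j. sin s * c j + sin t * d j) =
       ((cos s)\<^sup>2 + (sin s)\<^sup>2) * Q c + ((cos t)\<^sup>2 + (sin t)\<^sup>2) * Q d + 2 * (cos s * cos t + sin s * sin t) * (\<integral>om. lin c om * lin d om \<partial>M)"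
      unfolding Q_combine by (rule alg)
    then show ?thesis by (simp only: sin_cos_squared_add2 cos_diff mult_1_left)
  qed
  have law: "distr (M \<Otimes>\<^sub>M M) (\<Pi>\<^sub>M i\<in>I. borel) (\<lambda>z. \<lambda>i\<in>I. W s t i z) = distr (M \<Otimes>\<^sub>M M) (\<Pi>\<^sub>M i\<in>I. borel) (\<lambda>z. \<lambda>i\<in>I. W s' t' i z)"
  proof (rule cramer_wold[where X="W s t" and Y="W s' t'" and I=I])
    show "prob_space (M \<Otimes>\<^sub>M M)" "prob_space (M \<Otimes>\<^sub>M M)" by (rule MM.P.prob_space_axioms)+
    show "finite I" by fact
    show "W s t i \<in> borel_measurable (M \<Otimes>\<^sub>M M)" "W s' t' i \<in> borel_measurable (M \<Otimes>\<^sub>M M)" if "i \<in> I" for i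
      using mW[OF that] by auto
    fix k \<theta>
    show "(\<integral>z. cos ((\<Sum>i\<in>I. k i * W s t i z) + \<theta>) \<partial>(M \<Otimes>\<^sub>M M)) = (\<integral>z. cos ((\<Sum>i\<in>I. k i * W s' t' i z) + \<theta>) \<partial>(M \<Otimes>\<^sub>M M))"
      unfolding comb gauss_pair Qsum c ..
  qed
  define T where "T = (\<lambda>y :: 'i \<times> bool => real. (\<lambda>j\<in>J. y (j, False), \<lambda>j\<in>J. y (j, True)))"
  have T[measurable]: "T \<in> measurable (\<Pi>\<^sub>M i\<in>I. borel) ((\<Pi>\<^sub>M j\<in>J. borel) \<Otimes>\<^sub>M (\<Pi>\<^sub>M j\<in>J. borel))"
    unfolding T_def by (intro measurable_Pair measurable_restrict measurable_component_singleton) (auto simp: I_def)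
  have m[measurable]: "(\<lambda>z. \<lambda>i\<in>I. W s t i z) \<in> measurable (M \<Otimes>\<^sub>M M) (\<Pi>\<^sub>M i\<in>I. borel)" for s t
    using mW by (intro measurable_restrict) auto
  have TW: "T (\<lambda>i\<in>I. W s t i z) = (rot s z, rot t z)" for s t z
    unfolding T_def by (auto simp: I_def W_def rot_def fun_eq_iff restrict_def)
  have "(\<integral>\<^sup>+z. \<Psi> (rot s z, rot t z) \<partial>(M \<Otimes>\<^sub>M M)) = (\<integral>\<^sup>+y. \<Psi> (T y) \<partial>distr (M \<Otimes>\<^sub>M M) (\<Pi>\<^sub>M i\<in>I. borel) (\<lambda>z. \<lambda>i\<in>I. W s t i z))" for s t
    using measurable_compose[OF T \<Psi>] m by (subst nn_integral_distr) (auto simp: TW)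
  then show ?thesis using law by simp
qed

text \<open>Twice the variance is the mean square of F(X') - F(X) for an independent copy X'. The
  rotation from X to X' is cut into n steps of angle h = pi/(2 n). By \<open>rot_law\<close> all
  steps have the same law, so Cauchy-Schwarz gives n^2 times the mean square of one step. That is at
  most 4 h^2 V up to a higher order term, whence 2 Var <= pi^2 V. D is a subgradient of the convex
  F, linear in its second argument.\<close>

theorem gaussian_poincare:
  fixes F :: "('i => real) => real" and D :: "('i => real) => ('i => real) => real"
  defines "Xv \<equiv> \<lambda>om. \<lambda>j\<in>J. X j om"
  assumes F[measurable]: "F \<in> borel_measurable (\<Pi>\<^sub>M j\<in>J. borel)"
    and D[measurable]: "(\<lambda>p. D (fst p) (snd p)) \<in> borel_measurable ((\<Pi>\<^sub>M j\<in>J. borel) \<Otimes>\<^sub>M (\<Pi>\<^sub>M j\<in>J. borel))"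
    and lin: "\<And>x y z a b. D x (\<lambda>j\<in>J. a * y j + b * z j) = a * D x y + b * D x z"
    and sub: "\<And>x y. D x (\<lambda>j\<in>J. y j - x j) \<le> F y - F x"
    and IF: "integrable M (\<lambda>om. (F (Xv om))\<^sup>2)"
    and ID: "integrable M (\<lambda>om. (D (Xv om) (Xv om))\<^sup>2)"
    and V: "(\<integral>\<^sup>+om. (\<integral>\<^sup>+om'. ennreal ((D (Xv om) (Xv om'))\<^sup>2) \<partial>M) \<partial>M) \<le> ennreal V" "0 \<le> V"
  shows "variance (\<lambda>om. F (Xv om)) \<le> (pi\<^sup>2 / 2) * V"
proof -
  let ?N = "M \<Otimes>\<^sub>M M"
  let ?P = "\<Pi>\<^sub>M j\<in>J. (borel :: real measure)"
  have Xm[measurable]: "Xv \<in> measurable M ?P" unfolding Xv_def using meas by (intro measurable_restrict) auto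
  have r0: "rot 0 z = Xv (fst z)" "rot (pi/2) z = Xv (snd z)" for z by (simp_all add: rot_def Xv_def)
  define A where "A = (\<integral>om. (D (Xv om) (Xv om))\<^sup>2 \<partial>M)"
  have A0: "0 \<le> A" unfolding A_def by (intro integral_nonneg_AE) auto
  have DA: "(\<integral>\<^sup>+z. ennreal ((D (Xv (fst z)) (Xv (fst z)))\<^sup>2) \<partial>?N) = ennreal A"
  proof -
    have m: "(\<lambda>om. D (Xv om) (Xv om)) \<in> borel_measurable M"
      using measurable_compose[OF measurable_Pair[OF Xm Xm] D] by simp
    have "(\<integral>\<^sup>+z. ennreal ((D (Xv (fst z)) (Xv (fst z)))\<^sup>2) \<partial>?N) = (\<integral>\<^sup>+om. (\<integral>\<^sup>+om'. ennreal ((D (Xv om) (Xv om))\<^sup>2) \<partial>M) \<partial>M)"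
      using m by (subst nn_integral_fst[symmetric]) auto
    also have "\<dots> = (\<integral>\<^sup>+om. ennreal ((D (Xv om) (Xv om))\<^sup>2) \<partial>M)" by (simp add: emeasure_space_1)
    also have "\<dots> = ennreal A" unfolding A_def by (rule nn_integral_eq_integral[OF ID]) simp
    finally show ?thesis .
  qed
  have DV: "(\<integral>\<^sup>+z. ennreal ((D (Xv (fst z)) (Xv (snd z)))\<^sup>2) \<partial>?N) \<le> ennreal V"
  proof -
    have m: "(\<lambda>z. D (Xv (fst z)) (Xv (snd z))) \<in> borel_measurable ?N"
      using measurable_compose[OF measurable_Pair[OF measurable_compose[OF measurable_fst Xm] measurable_compose[OF measurable_snd Xm]] D] by simp
    show ?thesis using V(1) m by (subst nn_integral_fst[symmetric]) auto
  qed
  \<comment> \<open>A rotation by h moves X by (cos h - 1) X + sin h X'. The first part is of second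
    order in h; it produces the term with A, which disappears as n grows.\<close>
  have step: "(\<integral>\<^sup>+z. ennreal ((F (rot h z) - F (rot 0 z))\<^sup>2) \<partial>?N) \<le> ennreal (4 * ((1 - cos h)\<^sup>2 * A + (sin h)\<^sup>2 * V))" for h
  proof -
    let ?d = "\<lambda>s t z. ennreal ((D (rot s z) (\<lambda>j\<in>J. rot t z j - rot s z j))\<^sup>2)"
    define \<Psi> where "\<Psi> = (\<lambda>p :: ('i => real) \<times> ('i => real). ennreal ((D (fst p) (\<lambda>j\<in>J. snd p j - fst p j))\<^sup>2))"
    have mdiff: "(\<lambda>p. \<lambda>j\<in>J. snd p j - fst p j) \<in> measurable (?P \<Otimes>\<^sub>M ?P) ?P"
      by (intro measurable_restrict borel_measurable_diff)
         (auto intro: measurable_compose[OF measurable_snd measurable_component_singleton] measurable_compose[OF measurable_fst measurable_component_singleton])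
    have \<Psi>: "\<Psi> \<in> borel_measurable (?P \<Otimes>\<^sub>M ?P)"
      using measurable_compose[OF measurable_Pair[OF measurable_fst mdiff] D] unfolding \<Psi>_def by simp
    have d: "?d s t z = \<Psi> (rot s z, rot t z)" for s t z by (simp add: \<Psi>_def)
    have md: "?d s t \<in> borel_measurable ?N" for s t
      unfolding d using measurable_compose[OF measurable_Pair[OF rot_meas rot_meas] \<Psi>] by simp
    have s1: "(\<integral>\<^sup>+z. ennreal ((F (rot h z) - F (rot 0 z))\<^sup>2) \<partial>?N) \<le> (\<integral>\<^sup>+z. ?d 0 h z + ?d h 0 z \<partial>?N)"
    proof (rule nn_integral_mono)
      fix z
      let ?a = "D (rot 0 z) (\<lambda>j\<in>J. rot h z j - rot 0 z j)" and ?b = "D (rot h z) (\<lambda>j\<in>J. rot 0 z j - rot h z j)" and ?c = "F (rot h z) - F (rot 0 z)"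
      \<comment> \<open>The increment of F lies between ?a and - ?b, the subgradients at its two
        ends. Both have the same law, because exchanging the angles 0 and h keeps the cosine of
        their difference.\<close>
      have "?a \<le> ?c" "?b \<le> - ?c" using sub[of "rot 0 z" "rot h z"] sub[of "rot h z" "rot 0 z"] by auto
      then have "\<bar>?c\<bar> \<le> \<bar>?a\<bar> \<or> \<bar>?c\<bar> \<le> \<bar>?b\<bar>" by linarith
      then have "?c\<^sup>2 \<le> ?a\<^sup>2 \<or> ?c\<^sup>2 \<le> ?b\<^sup>2" by (simp add: abs_le_square_iff)
      then have "?c\<^sup>2 \<le> ?a\<^sup>2 + ?b\<^sup>2" using zero_le_power2[of ?a] zero_le_power2[of ?b] by linarith
      then show "ennreal (?c\<^sup>2) \<le> ennreal (?a\<^sup>2) + ennreal (?b\<^sup>2)" by (simp add: ennreal_plus[symmetric] del: ennreal_plus)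
    qed
    have s2: "(\<integral>\<^sup>+z. ?d 0 h z + ?d h 0 z \<partial>?N) = (\<integral>\<^sup>+z. ?d 0 h z \<partial>?N) + (\<integral>\<^sup>+z. ?d h 0 z \<partial>?N)" by (intro nn_integral_add md)
    have s3: "(\<integral>\<^sup>+z. ?d h 0 z \<partial>?N) = (\<integral>\<^sup>+z. ?d 0 h z \<partial>?N)"
      unfolding d by (rule rot_law[OF \<Psi>]) simp
    have "(\<integral>\<^sup>+z. ?d 0 h z \<partial>?N) \<le> (\<integral>\<^sup>+z. ennreal (2 * (1 - cos h)\<^sup>2) * ennreal ((D (Xv (fst z)) (Xv (fst z)))\<^sup>2) + ennreal (2 * (sin h)\<^sup>2) * ennreal ((D (Xv (fst z)) (Xv (snd z)))\<^sup>2) \<partial>?N)"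
    proof (rule nn_integral_mono)
      fix z
      let ?a = "D (Xv (fst z)) (Xv (fst z))" and ?b = "D (Xv (fst z)) (Xv (snd z))"
      have "(\<lambda>j\<in>J. rot h z j - rot 0 z j) = (\<lambda>j\<in>J. (cos h - 1) * Xv (fst z) j + sin h * Xv (snd z) j)"
        by (auto simp: fun_eq_iff rot_def Xv_def algebra_simps)
      then have "D (rot 0 z) (\<lambda>j\<in>J. rot h z j - rot 0 z j) = (cos h - 1) * ?a + sin h * ?b" by (simp add: lin r0)
      moreover have "(u * a + v * b)\<^sup>2 \<le> 2 * u\<^sup>2 * a\<^sup>2 + 2 * v\<^sup>2 * b\<^sup>2" for u v a b :: real
        using zero_le_power2[of "u * a - v * b"] by (simp add: power2_eq_square algebra_simps)
      ultimately have "(D (rot 0 z) (\<lambda>j\<in>J. rot h z j - rot 0 z j))\<^sup>2 \<le> 2 * (1 - cos h)\<^sup>2 * ?a\<^sup>2 + 2 * (sin h)\<^sup>2 * ?b\<^sup>2"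
        by (simp only: power2_commute[of 1 "cos h"])
      then show "?d 0 h z \<le> ennreal (2 * (1 - cos h)\<^sup>2) * ennreal (?a\<^sup>2) + ennreal (2 * (sin h)\<^sup>2) * ennreal (?b\<^sup>2)"
        by (simp add: ennreal_mult[symmetric] ennreal_plus[symmetric] del: ennreal_plus)
    qed
    also have "\<dots> = ennreal (2 * (1 - cos h)\<^sup>2) * ennreal A + ennreal (2 * (sin h)\<^sup>2) * (\<integral>\<^sup>+z. ennreal ((D (Xv (fst z)) (Xv (snd z)))\<^sup>2) \<partial>?N)"
    proof -
      have m1: "(\<lambda>z. D (Xv (fst z)) (Xv (fst z))) \<in> borel_measurable ?N"
        using measurable_compose[OF measurable_Pair[OF measurable_compose[OF measurable_fst Xm] measurable_compose[OF measurable_fst Xm]] D] by simp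
      have m2: "(\<lambda>z. D (Xv (fst z)) (Xv (snd z))) \<in> borel_measurable ?N"
        using measurable_compose[OF measurable_Pair[OF measurable_compose[OF measurable_fst Xm] measurable_compose[OF measurable_snd Xm]] D] by simp
      show ?thesis using m1 m2 by (subst nn_integral_add) (auto simp: nn_integral_cmult DA)
    qed
    also have "\<dots> \<le> ennreal (2 * (1 - cos h)\<^sup>2) * ennreal A + ennreal (2 * (sin h)\<^sup>2) * ennreal V"
      by (intro add_left_mono mult_left_mono DV) auto
    also have "\<dots> = ennreal (2 * ((1 - cos h)\<^sup>2 * A + (sin h)\<^sup>2 * V))"
      using A0 V(2) by (simp add: ennreal_mult[symmetric] ennreal_plus[symmetric] del: ennreal_plus)
    finally have one: "(\<integral>\<^sup>+z. ?d 0 h z \<partial>?N) \<le> ennreal (2 * ((1 - cos h)\<^sup>2 * A + (sin h)\<^sup>2 * V))" .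
    have "(\<integral>\<^sup>+z. ennreal ((F (rot h z) - F (rot 0 z))\<^sup>2) \<partial>?N) \<le> ennreal (2 * ((1 - cos h)\<^sup>2 * A + (sin h)\<^sup>2 * V)) + ennreal (2 * ((1 - cos h)\<^sup>2 * A + (sin h)\<^sup>2 * V))"
      using s1 unfolding s2 s3 by (rule order_trans[OF _ add_mono[OF one one]])
    also have "\<dots> = ennreal (4 * ((1 - cos h)\<^sup>2 * A + (sin h)\<^sup>2 * V))"
    proof -
      have dbl: "ennreal (2 * c) + ennreal (2 * c) = ennreal (4 * c)" if "0 \<le> c" for c using ennreal_plus[of "2 * c" "2 * c"] that by simp
      show ?thesis by (rule dbl) (use A0 V(2) in simp)
    qed
    finally show ?thesis .
  qed
  define G where "G = (\<lambda>om. F (Xv om))"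
  have G[measurable]: "G \<in> borel_measurable M" unfolding G_def by measurable
  have IG2: "integrable M (\<lambda>om. (G om)\<^sup>2)" using IF by (simp add: G_def)
  have IG: "integrable M G" by (rule square_integrable_imp_integrable[OF G IG2])
  define m1 m2 where "m1 = expectation G" and "m2 = expectation (\<lambda>om. (G om)\<^sup>2)"
  \<comment> \<open>The angles 0 and pi/2 give X and its independent copy.\<close>
  have T: "(\<integral>\<^sup>+z. ennreal ((F (rot (pi/2) z) - F (rot 0 z))\<^sup>2) \<partial>?N) = ennreal (2 * (m2 - m1\<^sup>2))"
  proof -
    have "(\<integral>\<^sup>+z. ennreal ((F (rot (pi/2) z) - F (rot 0 z))\<^sup>2) \<partial>?N) = (\<integral>\<^sup>+x. (\<integral>\<^sup>+y. ennreal ((G y - G x)\<^sup>2) \<partial>M) \<partial>M)"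
      unfolding r0 by (subst nn_integral_fst[symmetric]) (auto simp: G_def)
    also have "\<dots> = (\<integral>\<^sup>+x. ennreal (m2 - 2 * m1 * G x + (G x)\<^sup>2) \<partial>M)"
    proof (rule nn_integral_cong)
      fix x
      have e: "(G y - G x)\<^sup>2 = (G y)\<^sup>2 - 2 * G x * G y + (G x)\<^sup>2" for y by (simp add: power2_eq_square algebra_simps)
      have I: "integrable M (\<lambda>y. (G y - G x)\<^sup>2)" unfolding e using IG IG2 by auto
      have "(\<integral>\<^sup>+y. ennreal ((G y - G x)\<^sup>2) \<partial>M) = ennreal (\<integral>y. (G y - G x)\<^sup>2 \<partial>M)" by (rule nn_integral_eq_integral[OF I]) simp
      also have "(\<integral>y. (G y - G x)\<^sup>2 \<partial>M) = m2 - 2 * m1 * G x + (G x)\<^sup>2"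
        unfolding e using IG IG2 by (simp add: m1_def m2_def prob_space)
      finally show "(\<integral>\<^sup>+y. ennreal ((G y - G x)\<^sup>2) \<partial>M) = ennreal (m2 - 2 * m1 * G x + (G x)\<^sup>2)" .
    qed
    also have "\<dots> = ennreal (\<integral>x. m2 - 2 * m1 * G x + (G x)\<^sup>2 \<partial>M)"
    proof (rule nn_integral_eq_integral)
      show "integrable M (\<lambda>x. m2 - 2 * m1 * G x + (G x)\<^sup>2)" using IG IG2 by auto
      have v: "0 \<le> m2 - m1\<^sup>2" using variance_positive[of G] variance_eq[OF IG IG2] by (simp add: m1_def m2_def)
      have "0 \<le> (m2 - m1\<^sup>2) + (G x - m1)\<^sup>2" for x using v by simp
      then show "AE x in M. 0 \<le> m2 - 2 * m1 * G x + (G x)\<^sup>2" by (simp add: power2_eq_square algebra_simps)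
    qed
    also have "(\<integral>x. m2 - 2 * m1 * G x + (G x)\<^sup>2 \<partial>M) = 2 * (m2 - m1\<^sup>2)"
      using IG IG2 by (simp add: m1_def[symmetric] m2_def[symmetric] prob_space) (simp add: power2_eq_square)
    finally show ?thesis .
  qed
  have bound: "2 * (m2 - m1\<^sup>2) \<le> pi\<^sup>2 * V + pi ^ 4 / 16 * A * (1 / real (Suc k))\<^sup>2" for k
  proof -
    define n where "n = Suc k"
    define h where "h = pi / (2 * real n)"
    have n0: "0 < real n" by (simp add: n_def)
    define d where "d = (\<lambda>i z. F (rot (real (Suc i) * h) z) - F (rot (real i * h) z))"
    have md[measurable]: "d i \<in> borel_measurable ?N" for i unfolding d_def by measurable
    have di: "(\<integral>\<^sup>+z. ennreal ((d i z)\<^sup>2) \<partial>?N) = (\<integral>\<^sup>+z. ennreal ((F (rot h z) - F (rot 0 z))\<^sup>2) \<partial>?N)" for i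
    proof -
      define \<Psi> where "\<Psi> = (\<lambda>p :: ('i => real) \<times> ('i => real). ennreal ((F (fst p) - F (snd p))\<^sup>2))"
      have "\<Psi> \<in> borel_measurable (?P \<Otimes>\<^sub>M ?P)" unfolding \<Psi>_def by measurable
      from rot_law[OF this, of "real (Suc i) * h" "real i * h" h 0] show ?thesis
        by (simp add: \<Psi>_def d_def algebra_simps)
    qed
    have tel: "(\<Sum>i<n. d i z) = F (rot (pi/2) z) - F (rot 0 z)" for z
      using sum_lessThan_telescope[of "\<lambda>i. F (rot (real i * h) z)" n] n0 by (simp add: d_def h_def)
    have "ennreal (2 * (m2 - m1\<^sup>2)) \<le> (\<integral>\<^sup>+z. ennreal (real n) * (\<Sum>i<n. ennreal ((d i z)\<^sup>2)) \<partial>?N)"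
      unfolding T[symmetric] tel[symmetric]
    proof (rule nn_integral_mono)
      fix z
      have "(\<Sum>i<n. 1 * d i z)\<^sup>2 \<le> (\<Sum>i<n. 1\<^sup>2) * (\<Sum>i<n. (d i z)\<^sup>2)" by (rule Cauchy_Schwarz_ineq_sum)
      then show "ennreal ((\<Sum>i<n. d i z)\<^sup>2) \<le> ennreal (real n) * (\<Sum>i<n. ennreal ((d i z)\<^sup>2))"
        by (simp add: ennreal_mult[symmetric] sum_nonneg)
    qed
    also have "\<dots> = ennreal (real n) * (\<Sum>i<n. \<integral>\<^sup>+z. ennreal ((d i z)\<^sup>2) \<partial>?N)"
    proof -
      have "(\<integral>\<^sup>+z. (\<Sum>i<n. ennreal ((d i z)\<^sup>2)) \<partial>?N) = (\<Sum>i<n. \<integral>\<^sup>+z. ennreal ((d i z)\<^sup>2) \<partial>?N)" by (intro nn_integral_sum) measurable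
      moreover have "(\<integral>\<^sup>+z. ennreal (real n) * (\<Sum>i<n. ennreal ((d i z)\<^sup>2)) \<partial>?N) = ennreal (real n) * (\<integral>\<^sup>+z. (\<Sum>i<n. ennreal ((d i z)\<^sup>2)) \<partial>?N)"
        by (intro nn_integral_cmult) measurable
      ultimately show ?thesis by simp
    qed
    also have "\<dots> \<le> ennreal (real n) * (\<Sum>i<n. ennreal (4 * ((1 - cos h)\<^sup>2 * A + (sin h)\<^sup>2 * V)))"
      unfolding di by (intro mult_left_mono sum_mono step) auto
    also have "\<dots> = ennreal (real n * (real n * (4 * ((1 - cos h)\<^sup>2 * A + (sin h)\<^sup>2 * V))))"
    proof -
      have "ennreal (real n) * (\<Sum>i<n. ennreal c) = ennreal (real n * (real n * c))" if "0 \<le> c" for c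
        using that by (simp add: ennreal_mult[symmetric] ennreal_of_nat_eq_real_of_nat)
      from this[of "4 * ((1 - cos h)\<^sup>2 * A + (sin h)\<^sup>2 * V)"] show ?thesis using A0 V(2) by fastforce
    qed
    finally have "2 * (m2 - m1\<^sup>2) \<le> real n * (real n * (4 * ((1 - cos h)\<^sup>2 * A + (sin h)\<^sup>2 * V)))"
      using A0 V(2) by (subst (asm) ennreal_le_iff) auto
    also have "\<dots> \<le> real n * (real n * (4 * ((h\<^sup>2 / 2)\<^sup>2 * A + h\<^sup>2 * V)))"
    proof -
      have s: "(sin x)\<^sup>2 \<le> x\<^sup>2" for x :: real using abs_sin_x_le_abs_x[of x] by (simp add: abs_le_square_iff)
      have "1 - cos h = 2 * (sin (h/2))\<^sup>2" using cos_double_sin[of "h/2"] by simp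
      then have "1 - cos h \<le> h\<^sup>2 / 2" using s[of "h/2"] by (simp add: power_divide)
      moreover have "0 \<le> 1 - cos h" using cos_le_one[of h] by simp
      ultimately have "(1 - cos h)\<^sup>2 \<le> (h\<^sup>2 / 2)\<^sup>2" by (intro power_mono)
      then show ?thesis using s[of h] A0 V(2) n0 by (intro mult_left_mono add_mono mult_right_mono) auto
    qed
    also have "\<dots> = pi\<^sup>2 * V + pi ^ 4 / 16 * A * (1 / real n)\<^sup>2"
      using n0 by (simp add: h_def field_simps power2_eq_square power4_eq_xxxx)
    finally show ?thesis by (simp add: n_def)
  qed
  have "(\<lambda>k. pi\<^sup>2 * V + pi ^ 4 / 16 * A * (1 / real (Suc k))\<^sup>2) \<longlonglongrightarrow> pi\<^sup>2 * V + pi ^ 4 / 16 * A * 0\<^sup>2"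
    by (intro tendsto_intros LIMSEQ_Suc[OF lim_1_over_n])
  then have "2 * (m2 - m1\<^sup>2) \<le> pi\<^sup>2 * V + pi ^ 4 / 16 * A * 0\<^sup>2" using bound by (intro LIMSEQ_le_const) auto
  moreover have "variance G = m2 - m1\<^sup>2" using variance_eq[OF IG IG2] by (simp add: m1_def m2_def)
  ultimately show ?thesis unfolding G_def by simp
qed

end

section \<open>Hoelder continuity with a square integrable constant\<close>

lemma dyadic_holder:
  fixes f :: "real => real"
  assumes f: "continuous_on {0..1} f" and A: "0 \<le> A" and g: "0 < g"
    and d: "\<And>n i. i < 2 ^ n ==> \<bar>f (real (Suc i) / 2 ^ n) - f (real i / 2 ^ n)\<bar> \<le> A * ((1/2) powr g) ^ n"
    and st: "s \<in> {0..1}" "t \<in> {0..1}"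
  shows "\<bar>f t - f s\<bar> \<le> (1 + 2 / (1 - (1/2) powr g)) * 2 powr g * A * \<bar>t - s\<bar> powr g"
proof -
  define \<rho> :: real where "\<rho> = (1/2) powr g"
  have \<rho>: "0 < \<rho>" "\<rho> < 1" unfolding \<rho>_def using g by (simp, subst powr01_less_one) auto
  define k where "k = (\<lambda>(n::nat) (x::real). nat \<lfloor>2 ^ n * x\<rfloor>)"
  define q where "q = (\<lambda>(n::nat) (x::real). real (k n x) / 2 ^ n)"
  have kx: "real (k n x) \<le> 2 ^ n * x" "2 ^ n * x < real (k n x) + 1" if "x \<in> {0..1}" for n x
    using that by (auto simp: k_def)
  have q01: "q n x \<in> {0..1}" if "x \<in> {0..1}" for n x
  proof -
    have "2 ^ n * x \<le> 2 ^ n * 1" by (intro mult_left_mono) (use that in auto)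
    then have "real (k n x) \<le> 2 ^ n" using kx(1)[OF that, of n] by linarith
    then show ?thesis by (simp add: q_def divide_le_eq)
  qed
  have near: "\<bar>f (real j / 2 ^ n) - f (real i / 2 ^ n)\<bar> \<le> A * \<rho> ^ n" if "i \<le> j" "j \<le> Suc i" "j \<le> 2 ^ n" for i j n
  proof (cases "j = i")
    case True then show ?thesis using A \<rho> by simp
  next
    case False
    then have "j = Suc i" "i < 2 ^ n" using that by auto
    then show ?thesis using d[of i n] by (simp add: \<rho>_def)
  qed
  have k2: "k n x \<le> 2 ^ n" if "x \<in> {0..1}" for n x
  proof -
    have "real (k n x) \<le> 2 ^ n" using q01[OF that, of n] by (simp add: q_def divide_le_eq)
    then show ?thesis by (metis of_nat_le_iff of_nat_numeral of_nat_power)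
  qed
  have step: "\<bar>f (q (Suc n) x) - f (q n x)\<bar> \<le> A * \<rho> ^ Suc n" if x: "x \<in> {0..1}" for n x
  proof -
    have e: "q n x = real (2 * k n x) / 2 ^ Suc n" by (simp add: q_def)
    have "real (2 * k n x) < real (k (Suc n) x) + 1" "real (k (Suc n) x) < real (2 * k n x) + 2"
      using kx[OF x, of n] kx[OF x, of "Suc n"] by auto
    then have "2 * k n x \<le> k (Suc n) x" "k (Suc n) x \<le> Suc (2 * k n x)" by linarith+
    then show ?thesis using near[of "2 * k n x" "k (Suc n) x" "Suc n"] k2[OF x, of "Suc n"] unfolding e by (simp add: q_def)
  qed
  have tail: "\<bar>f (q (n + m) x) - f (q n x)\<bar> \<le> A * \<rho> ^ n * (\<Sum>i<m. \<rho> ^ i)" if x: "x \<in> {0..1}" for n m x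
  proof (induction m)
    case (Suc m)
    have "\<bar>f (q (n + Suc m) x) - f (q (n + m) x)\<bar> \<le> A * \<rho> ^ Suc (n + m)" using step[OF x, of "n + m"] by simp
    also have "\<dots> \<le> A * \<rho> ^ (n + m)" using A \<rho> by (intro mult_left_mono power_decreasing) auto
    finally show ?case using Suc by (simp add: power_add algebra_simps)
  qed simp
  have geo: "(\<Sum>i<m. \<rho> ^ i) \<le> 1 / (1 - \<rho>)" for m
    using \<rho> by (simp add: sum_gp_strict divide_right_mono)
  have appr: "\<bar>f x - f (q n x)\<bar> \<le> A * \<rho> ^ n / (1 - \<rho>)" if x: "x \<in> {0..1}" for n x
  proof -
    have "(\<lambda>m. q m x) \<longlonglongrightarrow> x"
    proof (rule LIMSEQ_I)
      fix e :: real assume "0 < e"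
      then obtain N where N: "(1/2) ^ N < e" using real_arch_pow_inv[of e "1/2"] by auto
      have "norm (q m x - x) < e" if "m \<ge> N" for m
      proof -
        have e: "2 ^ m * (x - q m x) = 2 ^ m * x - real (k m x)" by (simp add: q_def right_diff_distrib)
        have P: "0 < (2::real) ^ m" by simp
        have "0 \<le> 2 ^ m * (x - q m x)" "2 ^ m * (x - q m x) \<le> 1" using kx[OF x, of m] unfolding e by linarith+
        then have "0 \<le> x - q m x" "x - q m x \<le> 1 / 2 ^ m"
          by (metis P mult_pos_neg not_le, metis P pos_le_divide_eq mult.commute)
        then have "\<bar>q m x - x\<bar> \<le> (1/2) ^ m" by (simp add: power_divide)
        also have "\<dots> \<le> (1/2) ^ N" using that by (intro power_decreasing) auto
        finally show ?thesis using N by simp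
      qed
      then show "\<exists>N. \<forall>m\<ge>N. norm (q m x - x) < e" by blast
    qed
    then have "(\<lambda>m. f (q m x)) \<longlonglongrightarrow> f x"
      by (rule continuous_on_tendsto_compose[OF f _ x]) (intro always_eventually allI q01[OF x])
    then have "(\<lambda>m. f (q (n + m) x)) \<longlonglongrightarrow> f x" using LIMSEQ_ignore_initial_segment[of _ _ n] by (simp add: add.commute)
    then have l: "(\<lambda>m. \<bar>f (q (n + m) x) - f (q n x)\<bar>) \<longlonglongrightarrow> \<bar>f x - f (q n x)\<bar>" by (intro tendsto_intros)
    have "\<bar>f (q (n + m) x) - f (q n x)\<bar> \<le> A * \<rho> ^ n / (1 - \<rho>)" for m
    proof -
      have "A * \<rho> ^ n * (\<Sum>i<m. \<rho> ^ i) \<le> A * \<rho> ^ n * (1 / (1 - \<rho>))" using A \<rho> geo by (intro mult_left_mono) auto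
      then show ?thesis using tail[OF x, of n m] by simp
    qed
    then show ?thesis by (intro LIMSEQ_le_const2[OF l]) auto
  qed
  have main: "\<bar>f t - f s\<bar> \<le> (1 + 2 / (1 - \<rho>)) * 2 powr g * A * (t - s) powr g" if st: "s \<in> {0..1}" "t \<in> {0..1}" "s < t" for s t
  proof -
    \<comment> \<open>With m = Suc n, t - s is at most 2^(-n) but more than half of it. The dyadic
      points of level n below s and t are then equal or adjacent.\<close>
    define m where "m = (LEAST m. (1/2) ^ m < t - s)"
    have ex: "\<exists>m. (1/2::real) ^ m < t - s" using st real_arch_pow_inv[of "t - s" "1/2"] by auto
    have m: "(1/2) ^ m < t - s" unfolding m_def using ex by (rule LeastI_ex)
    have "m \<noteq> 0" using m st by (intro notI) auto
    then obtain n where n: "m = Suc n" by (metis not0_implies_Suc)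
    have tn: "t - s \<le> (1/2) ^ n" using not_less_Least[of n "\<lambda>m. (1/2) ^ m < t - s"] n unfolding m_def by auto
    have "2 ^ n * (t - s) \<le> 2 ^ n * (1/2) ^ n" using tn by (intro mult_left_mono) auto
    then have le1: "2 ^ n * t \<le> 2 ^ n * s + 1" by (simp add: power_divide algebra_simps)
    have "2 ^ n * s \<le> 2 ^ n * t" using st by simp
    then have "k n s \<le> k n t" unfolding k_def by (intro nat_mono floor_mono)
    moreover have "real (k n t) < real (k n s) + 2" using kx[OF st(1), of n] kx[OF st(2), of n] le1 by linarith
    then have "k n t \<le> Suc (k n s)" by linarith
    ultimately have mid: "\<bar>f (q n t) - f (q n s)\<bar> \<le> A * \<rho> ^ n" using near[of "k n s" "k n t" n] k2[OF st(2), of n] by (simp add: q_def)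
    have "\<bar>f t - f s\<bar> \<le> A * \<rho> ^ n / (1 - \<rho>) + A * \<rho> ^ n + A * \<rho> ^ n / (1 - \<rho>)"
      using appr[OF st(1), of n] appr[OF st(2), of n] mid by linarith
    also have "\<dots> = (1 + 2 / (1 - \<rho>)) * A * \<rho> ^ n"
    proof -
      have "y / d + y + y / d = (1 + 2 / d) * y" for y d :: real by (simp add: distrib_right)
      from this[of "A * \<rho> ^ n" "1 - \<rho>"] show ?thesis by (simp only: mult.assoc)
    qed
    also have "\<dots> \<le> (1 + 2 / (1 - \<rho>)) * A * (2 powr g * (t - s) powr g)"
    proof (rule mult_left_mono)
      have "\<rho> ^ n = ((1/2) ^ n) powr g" by (simp add: \<rho>_def powr_power powr_powr powr_realpow[symmetric] mult.commute)
      also have "(1/2) ^ n = 2 * (1/2::real) ^ m" by (simp add: n)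
      also have "(2 * (1/2) ^ m) powr g = 2 powr g * ((1/2) ^ m) powr g" by (simp add: powr_mult)
      also have "\<dots> \<le> 2 powr g * (t - s) powr g" using m g by (intro mult_left_mono powr_mono2) auto
      finally show "\<rho> ^ n \<le> 2 powr g * (t - s) powr g" .
    qed (use A \<rho> in auto)
    finally show ?thesis by (simp add: mult_ac)
  qed
  consider "s < t" | "t < s" | "s = t" by linarith
  then show ?thesis
  proof cases
    case 1 then show ?thesis using main[of s t] st by (simp add: \<rho>_def)
  next
    case 2 then show ?thesis using main[of t s] st by (simp add: \<rho>_def abs_minus_commute)
  qed simp
qed

context fbm
begin

text \<open>Kolmogorov's argument, with the scaled 2k-th powers of all dyadic increments summed into
  S. Level n has 2^n increments with moments of order 2^(- 2 n k (H - g)), and k (H - g) >= 1 makes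
  its expectation at most a multiple of 2^(-n).\<close>

theorem holder_constant:
  assumes g: "0 < g" "g < H"
  obtains K where "K \<in> borel_measurable M" "\<And>om. 0 \<le> K om" "integrable M (\<lambda>om. (K om)\<^sup>2)"
    "AE om in M. \<forall>s\<in>{0..1}. \<forall>t\<in>{0..1}. \<bar>B t om - B s om\<bar> \<le> K om * \<bar>t - s\<bar> powr g"
proof -
  obtain k0 :: nat where k0: "1 / (H - g) < real k0" using reals_Archimedean2 by blast
  define k where "k = Suc k0"
  have k: "1 \<le> real k * (H - g)" "0 < k"
  proof -
    have "1 / (H - g) < real k" using k0 by (simp add: k_def)
    then show "1 \<le> real k * (H - g)" using g by (simp add: field_simps)
  qed (simp add: k_def)
  define \<rho> :: real where "\<rho> = (1/2) powr g"
  have \<rho>: "0 < \<rho>" "\<rho> < 1" unfolding \<rho>_def using g by (simp, subst powr01_less_one) auto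
  define \<Delta> where "\<Delta> = (\<lambda>n i om. B (real (Suc i) / 2 ^ n) om - B (real i / 2 ^ n) om)"
  have pt: "real i / 2 ^ n \<in> {0..1}" if "i \<le> 2 ^ n" for i n
  proof -
    have "real i \<le> 2 ^ n" using that by (metis of_nat_le_iff of_nat_numeral of_nat_power)
    then show ?thesis by (simp add: divide_le_eq)
  qed
  have \<Delta>g: "gaussian_var M (\<Delta> n i)" "expectation (\<Delta> n i) = 0" "expectation (\<lambda>om. (\<Delta> n i om)\<^sup>2) = ((1/2) ^ n) powr (2 * H)" if "i < 2 ^ n" for n i
  proof -
    have d: "real (Suc i) / 2 ^ n - real i / 2 ^ n = (1/2) ^ n" by (simp add: diff_divide_distrib[symmetric] power_divide)
    show "gaussian_var M (\<Delta> n i)" "expectation (\<Delta> n i) = 0" "expectation (\<lambda>om. (\<Delta> n i om)\<^sup>2) = ((1/2) ^ n) powr (2 * H)"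
      using increment_gaussian[OF pt[of i n] pt[of "Suc i" n]] that unfolding \<Delta>_def d by auto
  qed
  have \<Delta>m: "\<Delta> n i \<in> borel_measurable M" if "i < 2 ^ n" for n i using \<Delta>g(1)[OF that] by (simp add: gaussian_var_def)
  define c :: real where "c = fact (2 * k) / (2 ^ k * fact k)"
  have c0: "0 \<le> c" by (simp add: c_def)
  define S where "S = (\<lambda>om. \<Sum>n. \<Sum>i<2 ^ n. ennreal ((\<Delta> n i om / \<rho> ^ n) ^ (2 * k)))"
  have Sm[measurable]: "S \<in> borel_measurable M"
    unfolding S_def using \<Delta>m by (intro borel_measurable_suminf_order borel_measurable_sum) auto
  have term_le: "(\<integral>\<^sup>+om. (\<Sum>i<2 ^ n. ennreal ((\<Delta> n i om / \<rho> ^ n) ^ (2 * k))) \<partial>M) \<le> ennreal (c * (1/2) ^ n)" for n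
  proof -
    have one: "(\<integral>\<^sup>+om. ennreal ((\<Delta> n i om / \<rho> ^ n) ^ (2 * k)) \<partial>M) = ennreal (c * (((1/2) ^ n) powr (2 * H)) ^ k / (\<rho> ^ n) ^ (2 * k))" if i: "i < 2 ^ n" for i
    proof -
      note G = centered_gaussian[OF \<Delta>g(1,2)[OF i]]
      have "(\<integral>\<^sup>+om. ennreal ((\<Delta> n i om / \<rho> ^ n) ^ (2 * k)) \<partial>M) = ennreal (expectation (\<lambda>om. (\<Delta> n i om / \<rho> ^ n) ^ (2 * k)))"
        using G(1)[of "2 * k"] by (intro nn_integral_eq_integral) (auto simp: power_divide)
      also have "expectation (\<lambda>om. (\<Delta> n i om / \<rho> ^ n) ^ (2 * k)) = c * (((1/2) ^ n) powr (2 * H)) ^ k / (\<rho> ^ n) ^ (2 * k)"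
        using G(2)[OF k(2)] by (simp add: power_divide \<Delta>g(3)[OF i] c_def mult_ac)
      finally show ?thesis .
    qed
    have "(\<integral>\<^sup>+om. (\<Sum>i<2 ^ n. ennreal ((\<Delta> n i om / \<rho> ^ n) ^ (2 * k))) \<partial>M) = (\<Sum>i<2 ^ n. \<integral>\<^sup>+om. ennreal ((\<Delta> n i om / \<rho> ^ n) ^ (2 * k)) \<partial>M)"
      using \<Delta>m by (intro nn_integral_sum) auto
    also have "\<dots> = (\<Sum>i<(2::nat) ^ n. ennreal (c * (((1/2) ^ n) powr (2 * H)) ^ k / (\<rho> ^ n) ^ (2 * k)))"
      by (intro sum.cong refl one) auto
    also have "\<dots> = ennreal (2 ^ n * (c * (((1/2) ^ n) powr (2 * H)) ^ k / (\<rho> ^ n) ^ (2 * k)))"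
      using c0 \<rho> by (simp add: ennreal_mult[symmetric] ennreal_of_nat_eq_real_of_nat)
    also have "\<dots> \<le> ennreal (c * (1/2) ^ n)"
    proof (rule ennreal_leI)
      have h: "((1/2::real) ^ n) powr a = (1/2) powr (real n * a)" for a by (simp add: powr_realpow[symmetric] powr_powr)
      have r: "\<rho> ^ n = (1/2) powr (real n * g)" by (simp add: \<rho>_def powr_power mult.commute)
      have "2 ^ n * (c * (((1/2) ^ n) powr (2 * H)) ^ k / (\<rho> ^ n) ^ (2 * k)) = c * ((1/2) powr (- real n) * (1/2) powr (real k * (real n * (2 * H))) / (1/2) powr (real (2 * k) * (real n * g)))"
        unfolding h r by (simp add: powr_power powr_minus powr_realpow power_divide field_simps)
      also have "\<dots> = c * (1/2) powr (real n * (2 * (real k * (H - g)) - 1))"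
        unfolding powr_add[symmetric] powr_diff[symmetric] by (simp add: algebra_simps)
      also have "\<dots> \<le> c * (1/2) powr (real n * 1)"
        using k c0 by (intro mult_left_mono powr_mono' mult_left_mono) auto
      also have "\<dots> = c * (1/2) ^ n" by (simp add: powr_realpow)
      finally show "2 ^ n * (c * (((1/2) ^ n) powr (2 * H)) ^ k / (\<rho> ^ n) ^ (2 * k)) \<le> c * (1/2) ^ n" .
    qed
    finally show ?thesis .
  qed
  have "(\<integral>\<^sup>+om. S om \<partial>M) = (\<Sum>n. \<integral>\<^sup>+om. (\<Sum>i<2 ^ n. ennreal ((\<Delta> n i om / \<rho> ^ n) ^ (2 * k))) \<partial>M)"
    unfolding S_def using \<Delta>m by (intro nn_integral_suminf borel_measurable_sum) auto
  also have "\<dots> \<le> (\<Sum>n. ennreal (c * (1/2) ^ n))" by (intro suminf_le term_le) auto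
  also have "\<dots> = ennreal (\<Sum>n. c * (1/2) ^ n)" using c0 by (intro suminf_ennreal2 summable_mult summable_geometric) auto
  finally have S_fin: "(\<integral>\<^sup>+om. S om \<partial>M) < \<infinity>" by (rule le_less_trans) simp
  have S_ae: "AE om in M. S om \<noteq> \<infinity>" using nn_integral_PInf_AE[OF Sm] S_fin by auto
  define S' where "S' = (\<lambda>om. enn2real (S om))"
  have IS: "integrable M S'"
  proof (rule integrableI_bounded)
    have "(\<integral>\<^sup>+om. ennreal (norm (S' om)) \<partial>M) \<le> (\<integral>\<^sup>+om. S om \<partial>M)"
    proof (rule nn_integral_mono)
      fix om show "ennreal (norm (S' om)) \<le> S om" unfolding S'_def by (cases "S om" rule: ennreal_cases) auto
    qed
    then show "(\<integral>\<^sup>+om. ennreal (norm (S' om)) \<partial>M) < \<infinity>" using S_fin by (rule le_less_trans)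
  qed (simp add: S'_def)
  define C where "C = (1 + 2 / (1 - \<rho>)) * 2 powr g"
  have C0: "0 \<le> C" unfolding C_def using \<rho> by simp
  \<comment> \<open>The 2k-th powers yield a multiple of (1 + S)^(1/(2 k)); the larger sqrt (1 + S)
    has an integrable square.\<close>
  define K where "K = (\<lambda>om. C * sqrt (1 + S' om))"
  have S'0: "0 \<le> S' om" for om by (simp add: S'_def)
  show thesis
  proof (rule that[of K])
    show "K \<in> borel_measurable M" unfolding K_def S'_def by measurable
    show "0 \<le> K om" for om unfolding K_def using C0 S'0 by simp
    have "(K om)\<^sup>2 = C\<^sup>2 * (1 + S' om)" for om unfolding K_def power_mult_distrib using S'0[of om] by simp
    then show "integrable M (\<lambda>om. (K om)\<^sup>2)" using IS by simp
    show "AE om in M. \<forall>s\<in>{0..1}. \<forall>t\<in>{0..1}. \<bar>B t om - B s om\<bar> \<le> K om * \<bar>t - s\<bar> powr g"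
      using S_ae AE_space
    proof eventually_elim
      fix om assume fin: "S om \<noteq> \<infinity>" and om: "om \<in> space M"
      have inc: "\<bar>\<Delta> n i om\<bar> \<le> sqrt (1 + S' om) * \<rho> ^ n" if i: "i < 2 ^ n" for n i
      proof -
        have "ennreal ((\<Delta> n i om / \<rho> ^ n) ^ (2 * k)) \<le> (\<Sum>i<2 ^ n. ennreal ((\<Delta> n i om / \<rho> ^ n) ^ (2 * k)))"
          using i by (intro member_le_sum) auto
        also have "\<dots> \<le> S om" unfolding S_def
          using sum_le_suminf[of "\<lambda>n. \<Sum>i<2 ^ n. ennreal ((\<Delta> n i om / \<rho> ^ n) ^ (2 * k))" "{n}"] by simp
        also have "S om = ennreal (S' om)" using fin by (simp add: S'_def less_top)
        finally have "(\<Delta> n i om / \<rho> ^ n) ^ (2 * k) \<le> S' om" using S'0 by (simp add: ennreal_le_iff)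
        also have "\<dots> \<le> (1 + S' om) ^ 1" by simp
        also have "\<dots> \<le> (1 + S' om) ^ k" using S'0[of om] k by (intro power_increasing) auto
        finally have "((\<bar>\<Delta> n i om\<bar> / \<rho> ^ n)\<^sup>2) ^ k \<le> (1 + S' om) ^ k" by (simp add: power_mult power_divide)
        then have "(\<bar>\<Delta> n i om\<bar> / \<rho> ^ n)\<^sup>2 \<le> 1 + S' om" using k S'0[of om] by (subst (asm) power_mono_iff) auto
        then have "\<bar>\<Delta> n i om\<bar> / \<rho> ^ n \<le> sqrt (1 + S' om)" by (rule real_le_rsqrt)
        then show ?thesis using \<rho> by (simp add: divide_le_eq)
      qed
      have "\<bar>B t om - B s om\<bar> \<le> (1 + 2 / (1 - (1/2) powr g)) * 2 powr g * sqrt (1 + S' om) * \<bar>t - s\<bar> powr g" if "s \<in> {0..1}" "t \<in> {0..1}" for s t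
        using S'0[of om] inc g that unfolding \<Delta>_def \<rho>_def
        by (intro dyadic_holder[of "\<lambda>t. B t om"] path_cont[OF om]) auto
      then show "\<forall>s\<in>{0..1}. \<forall>t\<in>{0..1}. \<bar>B t om - B s om\<bar> \<le> K om * \<bar>t - s\<bar> powr g" unfolding K_def C_def \<rho>_def by simp
    qed
  qed
qed

end

section \<open>Sums of ln cosh of the rises\<close>

definition lncosh :: "real => real" where "lncosh x = ln (cosh x)"

lemma lncosh_deriv: "(lncosh has_real_derivative tanh x) (at x)"
  unfolding lncosh_def[abs_def] tanh_def by (auto intro!: derivative_eq_intros simp: cosh_real_pos)

lemma lncosh_meas[measurable]: "lncosh \<in> borel_measurable borel"
  by (intro borel_measurable_continuous_onI DERIV_continuous_on) (auto intro: has_field_derivative_at_within lncosh_deriv)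

lemma lncosh_cont: "isCont lncosh x" using lncosh_deriv by (rule DERIV_isCont)

text \<open>Convexity: the derivative tanh is nondecreasing.\<close>

lemma lncosh_tangent: "tanh u * (v - u) \<le> lncosh v - lncosh u"
proof -
  consider "u < v" | "v < u" | "u = v" by linarith
  then show ?thesis
  proof cases
    case 1
    obtain z where z: "u < z" "z < v" "lncosh v - lncosh u = (v - u) * tanh z" using MVT2[OF 1, of lncosh tanh] lncosh_deriv by blast
    have "tanh u \<le> tanh z" using z by simp
    then have "(v - u) * tanh u \<le> (v - u) * tanh z" using 1 by (intro mult_left_mono) auto
    then show ?thesis using z by (simp add: mult.commute)
  next
    case 2
    obtain z where z: "v < z" "z < u" "lncosh u - lncosh v = (u - v) * tanh z" using MVT2[OF 2, of lncosh tanh] lncosh_deriv by blast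
    have "tanh z \<le> tanh u" using z by simp
    then have "(u - v) * tanh z \<le> (u - v) * tanh u" using 2 by (intro mult_left_mono) auto
    then show ?thesis using z by (simp add: algebra_simps)
  qed simp
qed

lemma tanh_bounds: "0 \<le> x ==> 0 \<le> tanh x" "0 \<le> x ==> tanh x \<le> x" "tanh x \<le> (1::real)" for x :: real
proof -
  show "0 \<le> x ==> 0 \<le> tanh x" by simp
  show "tanh x \<le> 1" using tanh_real_lt_1[of x] by simp
  assume x: "0 \<le> x"
  have "((\<lambda>x. x - tanh x) has_real_derivative 1 - (1 - (tanh x)\<^sup>2)) (at x)" for x :: real
    by (auto intro!: derivative_eq_intros simp: cosh_real_pos)
  then have "0 - tanh 0 \<le> x - tanh x" using x
    by (intro DERIV_nonneg_imp_nondecreasing[of 0 x "\<lambda>x. x - tanh x"]) (auto intro!: exI)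
  then show "tanh x \<le> x" by simp
qed

lemma lncosh_bounds: "0 \<le> lncosh x" "0 \<le> x ==> lncosh x \<le> x" "0 \<le> x ==> x \<le> y ==> lncosh x \<le> lncosh y" for x y :: real
proof -
  show "0 \<le> lncosh x" unfolding lncosh_def using cosh_real_ge_1[of x] by simp
  show "lncosh x \<le> x" if "0 \<le> x"
  proof -
    have "cosh x \<le> exp x" using that by (simp add: cosh_def)
    then have "ln (cosh x) \<le> ln (exp x)" by (subst ln_le_cancel_iff) (auto simp: cosh_real_pos)
    then show ?thesis by (simp add: lncosh_def)
  qed
  show "lncosh x \<le> lncosh y" if "0 \<le> x" "x \<le> y"
    using lncosh_tangent[of x y] tanh_bounds(1)[OF that(1)] that by (smt (verit) mult_nonneg_nonneg)
qed

section \<open>Rises over finite sets of times and the variance of their sums\<close>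

definition maxrise :: "real => real set => (real => real) => real" where
  "maxrise b T x = (MAX p\<in>T. x b - x p)"

text \<open>The earliest time at which the maximum is attained: a fixed choice, so that the
  subgradient built from it is measurable.\<close>

definition argrise :: "real => real set => (real => real) => real" where
  "argrise b T x = Min {p\<in>T. x b - x p = maxrise b T x}"

lemma maxrise_props:
  assumes "finite T" "b \<in> T"
  shows "0 \<le> maxrise b T x" "p \<in> T ==> x b - x p \<le> maxrise b T x"
    "argrise b T x \<in> T" "maxrise b T x = x b - x (argrise b T x)"
proof -
  show ge: "x b - x p \<le> maxrise b T x" if "p \<in> T" for p unfolding maxrise_def using assms that by (intro Max_ge) auto
  show "0 \<le> maxrise b T x" using ge[OF assms(2)] by simp
  have "maxrise b T x \<in> (\<lambda>p. x b - x p) ` T" unfolding maxrise_def using assms by (intro Max_in) auto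
  then have "{p\<in>T. x b - x p = maxrise b T x} \<noteq> {}" by auto
  then have "argrise b T x \<in> {p\<in>T. x b - x p = maxrise b T x}" unfolding argrise_def using assms by (intro Min_in) auto
  then show "argrise b T x \<in> T" "maxrise b T x = x b - x (argrise b T x)" by auto
qed

lemma borel_measurable_MAX:
  fixes f :: "'i => 'a => real"
  assumes "finite T" "T \<noteq> {}" "\<And>p. p \<in> T ==> f p \<in> borel_measurable M"
  shows "(\<lambda>x. MAX p\<in>T. f p x) \<in> borel_measurable M"
  using assms
proof (induction T rule: finite_ne_induct)
  case (insert p T)
  have "(\<lambda>x. max (f p x) (MAX p\<in>T. f p x)) \<in> borel_measurable M" using insert by (intro borel_measurable_max) auto
  then show ?case using insert by (simp add: Max_insert)
qed simp

lemma maxrise_measurable: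
  assumes T: "finite T" "b \<in> T" "T \<subseteq> J"
  shows "maxrise b T \<in> borel_measurable (\<Pi>\<^sub>M j\<in>J. borel)"
proof -
  have "maxrise b T = (\<lambda>x. MAX p\<in>T. x b - x p)" by (simp add: fun_eq_iff maxrise_def)
  moreover have "(\<lambda>x. MAX p\<in>T. x b - x p) \<in> borel_measurable (\<Pi>\<^sub>M j\<in>J. (borel :: real measure))"
    using T by (intro borel_measurable_MAX borel_measurable_diff measurable_component_singleton) auto
  ultimately show ?thesis by simp
qed

lemma argrise_measurable:
  assumes T: "finite T" "b \<in> T" "T \<subseteq> J"
  shows "{x \<in> space (\<Pi>\<^sub>M j\<in>J. (borel :: real measure)). argrise b T x = p} \<in> sets (\<Pi>\<^sub>M j\<in>J. borel)"
proof -
  let ?P = "\<Pi>\<^sub>M j\<in>J. (borel :: real measure)"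
  have eq: "argrise b T x = p \<longleftrightarrow> p \<in> T \<and> x b - x p = maxrise b T x \<and> (\<forall>q\<in>{q\<in>T. q < p}. x b - x q \<noteq> maxrise b T x)" for x
  proof
    assume a: "argrise b T x = p"
    show "p \<in> T \<and> x b - x p = maxrise b T x \<and> (\<forall>q\<in>{q\<in>T. q < p}. x b - x q \<noteq> maxrise b T x)"
    proof (intro conjI ballI notI)
      show "p \<in> T" "x b - x p = maxrise b T x" using maxrise_props(3,4)[OF T(1,2), of x] a by auto
      fix q assume q: "q \<in> {q\<in>T. q < p}" "x b - x q = maxrise b T x"
      then have "argrise b T x \<le> q" unfolding argrise_def using T(1) by (intro Min_le) auto
      then show False using q a by auto
    qed
  next
    assume a: "p \<in> T \<and> x b - x p = maxrise b T x \<and> (\<forall>q\<in>{q\<in>T. q < p}. x b - x q \<noteq> maxrise b T x)"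
    show "argrise b T x = p" unfolding argrise_def
      by (rule Min_eqI) (use a T(1) in \<open>auto simp: not_less[symmetric]\<close>)
  qed
  have m: "(\<lambda>x. x b - x q) \<in> borel_measurable ?P" if "q \<in> T" for q
    using T that by (intro borel_measurable_diff measurable_component_singleton) auto
  note mr = maxrise_measurable[OF T]
  show ?thesis
  proof (cases "p \<in> T")
    case True
    have fT: "finite {q\<in>T. q < p}" using T(1) by simp
    have "{x \<in> space ?P. argrise b T x = p} = {x \<in> space ?P. x b - x p = maxrise b T x \<and> (\<forall>q\<in>{q\<in>T. q < p}. x b - x q \<noteq> maxrise b T x)}"
      using eq True by auto
    also have "\<dots> \<in> sets ?P"
    proof (rule sets.sets_Collect_conj)
      show "{x \<in> space ?P. x b - x p = maxrise b T x} \<in> sets ?P" using m[OF True] mr by (rule borel_measurable_eq)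
      show "{x \<in> space ?P. \<forall>q\<in>{q\<in>T. q < p}. x b - x q \<noteq> maxrise b T x} \<in> sets ?P"
        using fT m mr by (intro sets.sets_Collect_finite_All sets.sets_Collect_neg borel_measurable_eq) auto
    qed
    finally show ?thesis .
  next
    case False
    have e: "{x \<in> space ?P. argrise b T x = p} = {}" using eq False by auto
    show ?thesis unfolding e by simp
  qed
qed

context fbm
begin

text \<open>Each rise is a maximum of linear forms and ln cosh is convex and increasing on
  nonnegative numbers, so the sum F is convex, with subgradient D. For a fixed first argument, D is
  a combination of increments over disjoint intervals with coefficients tanh >= 0. Their covariances
  are nonpositive, so only the diagonal remains. Bounding tanh by the rise, and the rise by the
  Hoelder bound, adds 2 g to the exponent 2 H.\<close>

lemma variance_sum_lncosh_finite:
  fixes S :: "'k set" and a b :: "'k => real" and T :: "'k => real set"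
  assumes S: "finite S" and ab: "\<And>j. j \<in> S ==> 0 \<le> a j \<and> a j \<le> b j \<and> b j \<le> 1"
    and dis: "\<And>j k. j \<in> S ==> k \<in> S ==> j \<noteq> k ==> b j \<le> a k \<or> b k \<le> a j"
    and T: "\<And>j. j \<in> S ==> finite (T j) \<and> b j \<in> T j \<and> T j \<subseteq> {a j..b j}"
    and K: "K \<in> borel_measurable M" "\<And>om. 0 \<le> K om" "integrable M (\<lambda>om. (K om)\<^sup>2)"
      "AE om in M. \<forall>s\<in>{0..1}. \<forall>t\<in>{0..1}. \<bar>B t om - B s om\<bar> \<le> K om * \<bar>t - s\<bar> powr g" and g: "0 < g"
  shows "variance (\<lambda>om. \<Sum>j\<in>S. lncosh (maxrise (b j) (T j) (\<lambda>t. B t om))) \<le>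
     (pi\<^sup>2 / 2) * (expectation (\<lambda>om. (K om)\<^sup>2) * (\<Sum>j\<in>S. (b j - a j) powr (2 * (H + g))))"
proof -
  define J where "J = (\<Union>j\<in>S. T j)"
  have finJ: "finite J" unfolding J_def using S T by auto
  have T01: "p \<in> {0..1}" if "j \<in> S" "p \<in> T j" for j p using T[OF that(1)] ab[OF that(1)] that by fastforce
  have J01: "J \<subseteq> {0..1}" unfolding J_def using T01 by blast
  have TJ: "T j \<subseteq> J" "b j \<in> J" if "j \<in> S" for j unfolding J_def using that T by blast+
  interpret G: gaussian_vector M J B
  proof
    show "finite J" by fact
    show "B j \<in> borel_measurable M" "integrable M (\<lambda>om. (B j om)\<^sup>2)" if "j \<in> J" for j using B_meas B_integrable(2) J01 that by auto
    fix c \<theta>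
    have gv: "gaussian_var M (\<lambda>om. \<Sum>j\<in>J. c j * B j om)" by (rule lincomb_gaussian[OF finJ, of "\<lambda>j. j"]) (use J01 in auto)
    have "expectation (\<lambda>om. \<Sum>j\<in>J. c j * B j om) = (\<Sum>j\<in>J. expectation (\<lambda>om. c j * B j om))"
      using B_integrable(1) J01 by (intro Bochner_Integration.integral_sum) auto
    also have "\<dots> = (\<Sum>j\<in>J. 0)" by (rule sum.cong[OF refl]) (use B_mean J01 in auto)
    finally show "expectation (\<lambda>om. cos ((\<Sum>j\<in>J. c j * B j om) + \<theta>)) = cos \<theta> * exp (- expectation (\<lambda>om. (\<Sum>j\<in>J. c j * B j om)\<^sup>2) / 2)"
      using centered_gaussian(3)[OF gv] by simp
  qed
  let ?P = "\<Pi>\<^sub>M j\<in>J. (borel :: real measure)"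
  define m where "m = (\<lambda>j. maxrise (b j) (T j))"
  define I where "I = (\<lambda>j. argrise (b j) (T j))"
  have mp: "0 \<le> m j x" "p \<in> T j ==> x (b j) - x p \<le> m j x" "I j x \<in> T j" "m j x = x (b j) - x (I j x)" if "j \<in> S" for j x p
    unfolding m_def I_def using maxrise_props[of "T j" "b j"] T[OF that] by auto
  define F where "F = (\<lambda>x. \<Sum>j\<in>S. lncosh (m j x))"
  define D where "D = (\<lambda>x y. \<Sum>j\<in>S. tanh (m j x) * (y (b j) - y (I j x)))"
  define Xv where "Xv = (\<lambda>om. \<lambda>j\<in>J. B j om)"
  have mm: "m j \<in> borel_measurable ?P" if "j \<in> S" for j unfolding m_def using T[OF that] TJ[OF that] by (intro maxrise_measurable) auto
  have mXv: "m j (Xv om) = maxrise (b j) (T j) (\<lambda>t. B t om)" if "j \<in> S" for j om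
    unfolding m_def maxrise_def Xv_def using TJ[OF that] by (intro arg_cong[where f=Max] image_cong refl) auto
  have IJ: "I j x \<in> J" if "j \<in> S" for j x using mp(3)[OF that] TJ[OF that] by auto
  have mK: "AE om in M. \<forall>j\<in>S. m j (Xv om) \<le> K om * (b j - a j) powr g"
    using K(4)
  proof eventually_elim
    fix om assume h: "\<forall>s\<in>{0..1}. \<forall>t\<in>{0..1}. \<bar>B t om - B s om\<bar> \<le> K om * \<bar>t - s\<bar> powr g"
    show "\<forall>j\<in>S. m j (Xv om) \<le> K om * (b j - a j) powr g"
    proof
      fix j assume j: "j \<in> S"
      let ?p = "I j (Xv om)"
      have p: "?p \<in> T j" by (rule mp(3)[OF j])
      have "m j (Xv om) = B (b j) om - B ?p om" using mp(4)[OF j, of "Xv om"] IJ[OF j] TJ(2)[OF j] by (simp add: Xv_def)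
      also have "\<dots> \<le> K om * \<bar>b j - ?p\<bar> powr g" using h T01[OF j p] T01[OF j, of "b j"] T[OF j] by (metis abs_le_D1)
      also have "\<dots> \<le> K om * (b j - a j) powr g" using T[OF j] p K(2) g by (intro mult_left_mono powr_mono2) auto
      finally show "m j (Xv om) \<le> K om * (b j - a j) powr g" .
    qed
  qed
  have d1: "(b j - a j) powr g \<le> 1" if "j \<in> S" for j using ab[OF that] g by (intro powr_le1) auto
  have mK1: "AE om in M. \<forall>j\<in>S. m j (Xv om) \<le> K om"
    using mK
  proof eventually_elim
    fix om assume h: "\<forall>j\<in>S. m j (Xv om) \<le> K om * (b j - a j) powr g"
    show "\<forall>j\<in>S. m j (Xv om) \<le> K om"
    proof
      fix j assume j: "j \<in> S"
      have "K om * (b j - a j) powr g \<le> K om * 1" using d1[OF j] K(2) by (intro mult_left_mono) auto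
      then show "m j (Xv om) \<le> K om" using h j by force
    qed
  qed
  have Xm[measurable]: "Xv \<in> measurable M ?P" unfolding Xv_def using G.meas by (intro measurable_restrict) auto
  have Fm[measurable]: "F \<in> borel_measurable ?P" unfolding F_def using mm by (intro borel_measurable_sum) (auto intro: measurable_compose[OF _ lncosh_meas])
  have tanh_m[measurable]: "(tanh :: real => real) \<in> borel_measurable borel"
    by (intro borel_measurable_continuous_onI continuous_intros) auto
  have Dm: "(\<lambda>p. D (fst p) (snd p)) \<in> borel_measurable (?P \<Otimes>\<^sub>M ?P)"
  proof -
    \<comment> \<open>A finite sum over the possible values of \<open>argrise\<close>, each term
      being measurable.\<close>
    have e: "D (fst p) (snd p) = (\<Sum>j\<in>S. \<Sum>q\<in>T j. indicator {x \<in> space ?P. I j x = q} (fst p) * (tanh (m j (fst p)) * (snd p (b j) - snd p q)))"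
      if p: "p \<in> space (?P \<Otimes>\<^sub>M ?P)" for p
      unfolding D_def
    proof (rule sum.cong[OF refl])
      fix j assume j: "j \<in> S"
      have sp: "fst p \<in> space ?P" using p by (auto simp: space_pair_measure)
      have "(\<Sum>q\<in>T j. indicator {x \<in> space ?P. I j x = q} (fst p) * (tanh (m j (fst p)) * (snd p (b j) - snd p q))) =
        (\<Sum>q\<in>T j. if I j (fst p) = q then tanh (m j (fst p)) * (snd p (b j) - snd p q) else 0)"
        using sp by (intro sum.cong refl) (simp add: indicator_def)
      also have "\<dots> = tanh (m j (fst p)) * (snd p (b j) - snd p (I j (fst p)))"
        using T[OF j] mp(3)[OF j] by (subst sum.delta') auto
      finally show "tanh (m j (fst p)) * (snd p (b j) - snd p (I j (fst p))) = (\<Sum>q\<in>T j. indicator {x \<in> space ?P. I j x = q} (fst p) * (tanh (m j (fst p)) * (snd p (b j) - snd p q)))" by simp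
    qed
    have "(\<lambda>p. \<Sum>j\<in>S. \<Sum>q\<in>T j. indicator {x \<in> space ?P. I j x = q} (fst p) * (tanh (m j (fst p)) * (snd p (b j) - snd p q))) \<in> borel_measurable (?P \<Otimes>\<^sub>M ?P)"
    proof (intro borel_measurable_sum borel_measurable_times borel_measurable_diff)
      fix j q assume j: "j \<in> S" "q \<in> T j"
      have "{x \<in> space ?P. I j x = q} \<in> sets ?P" unfolding I_def using T[OF j(1)] TJ[OF j(1)] by (intro argrise_measurable) auto
      then show "(\<lambda>p. indicator {x \<in> space ?P. I j x = q} (fst p) :: real) \<in> borel_measurable (?P \<Otimes>\<^sub>M ?P)"
        by (intro measurable_compose[OF measurable_fst borel_measurable_indicator])
      show "(\<lambda>p. tanh (m j (fst p))) \<in> borel_measurable (?P \<Otimes>\<^sub>M ?P)"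
        by (rule measurable_compose[OF measurable_compose[OF measurable_fst mm[OF j(1)]] tanh_m])
      show "(\<lambda>p. snd p (b j)) \<in> borel_measurable (?P \<Otimes>\<^sub>M ?P)" "(\<lambda>p. snd p q) \<in> borel_measurable (?P \<Otimes>\<^sub>M ?P)"
        using TJ[OF j(1)] j(2) by (auto intro: measurable_compose[OF measurable_snd measurable_component_singleton])
    qed
    then show ?thesis by (subst measurable_cong[OF e]) auto
  qed
  have n2: "integrable M (\<lambda>om. (real (card S) * K om)\<^sup>2)" using K(3) by (simp add: power_mult_distrib)
  have IF: "integrable M (\<lambda>om. (F (Xv om))\<^sup>2)"
  proof (rule Bochner_Integration.integrable_bound[OF n2])
    show "AE om in M. norm ((F (Xv om))\<^sup>2) \<le> norm ((real (card S) * K om)\<^sup>2)"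
      using mK1
    proof eventually_elim
      fix om assume h: "\<forall>j\<in>S. m j (Xv om) \<le> K om"
      have "F (Xv om) \<le> (\<Sum>j\<in>S. K om)" unfolding F_def by (intro sum_mono order_trans[OF lncosh_bounds(2)[OF mp(1)]]) (use h in auto)
      moreover have "0 \<le> F (Xv om)" unfolding F_def using lncosh_bounds(1) by (intro sum_nonneg) auto
      ultimately have "(F (Xv om))\<^sup>2 \<le> (real (card S) * K om)\<^sup>2" by (intro power_mono) auto
      then show "norm ((F (Xv om))\<^sup>2) \<le> norm ((real (card S) * K om)\<^sup>2)" by simp
    qed
  qed measurable
  have Dself: "D x x = (\<Sum>j\<in>S. tanh (m j x) * m j x)" for x unfolding D_def using mp(4) by (intro sum.cong refl) simp
  have ID: "integrable M (\<lambda>om. (D (Xv om) (Xv om))\<^sup>2)"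
  proof (rule Bochner_Integration.integrable_bound[OF n2])
    have mD: "(\<lambda>om. D (Xv om) (Xv om)) \<in> borel_measurable M"
      using measurable_compose[OF measurable_Pair[OF Xm Xm] Dm] by simp
    then show "(\<lambda>om. (D (Xv om) (Xv om))\<^sup>2) \<in> borel_measurable M" by measurable
    show "AE om in M. norm ((D (Xv om) (Xv om))\<^sup>2) \<le> norm ((real (card S) * K om)\<^sup>2)"
      using mK1
    proof eventually_elim
      fix om assume h: "\<forall>j\<in>S. m j (Xv om) \<le> K om"
      have "D (Xv om) (Xv om) \<le> (\<Sum>j\<in>S. 1 * K om)" unfolding Dself by (intro sum_mono mult_mono tanh_bounds(3) mp(1)) (use h mp(1) in auto)
      moreover have "0 \<le> D (Xv om) (Xv om)" unfolding Dself using mp(1) by (intro sum_nonneg) auto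
      ultimately have "(D (Xv om) (Xv om))\<^sup>2 \<le> (real (card S) * K om)\<^sup>2" by (intro power_mono) auto
      then show "norm ((D (Xv om) (Xv om))\<^sup>2) \<le> norm ((real (card S) * K om)\<^sup>2)" by simp
    qed
  qed
  define V where "V = expectation (\<lambda>om. (K om)\<^sup>2) * (\<Sum>j\<in>S. (b j - a j) powr (2 * (H + g)))"
  have V0: "0 \<le> V" unfolding V_def by (intro mult_nonneg_nonneg sum_nonneg integral_nonneg_AE) auto
  have inner: "(\<integral>\<^sup>+om'. ennreal ((D x (Xv om'))\<^sup>2) \<partial>M) \<le> ennreal (\<Sum>j\<in>S. (tanh (m j x))\<^sup>2 * (b j - a j) powr (2 * H))" for x
  proof -
    define c where "c = (\<lambda>j. tanh (m j x))"
    have c0: "0 \<le> c j" if "j \<in> S" for j unfolding c_def using mp(1)[OF that] by simp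
    have bI: "I j x \<in> {0..1}" "b j \<in> {0..1}" "a j \<le> I j x" "I j x \<le> b j" if "j \<in> S" for j
      using T01[OF that mp(3)[OF that, of x]] ab[OF that] subsetD[OF conjunct2[OF conjunct2[OF T[OF that]]] mp(3)[OF that, of x]] by auto
    have e: "D x (Xv om') = (\<Sum>j\<in>S. c j * (B (b j) om' - B (I j x) om'))" for om'
      unfolding D_def c_def Xv_def using IJ TJ(2) by (intro sum.cong refl) auto
    note gi = increments_gaussian[where I=S and s="\<lambda>j. I j x" and t=b and c=c, OF S bI(1,2)]
    have "integrable M (\<lambda>om'. (\<Sum>j\<in>S. c j * (B (b j) om' - B (I j x) om'))\<^sup>2)" by (rule centered_gaussian(1)[OF gi(1,2)])
    then have "(\<integral>\<^sup>+om'. ennreal ((D x (Xv om'))\<^sup>2) \<partial>M) = ennreal (\<Sum>i\<in>S. \<Sum>j\<in>S. c i * c j * cov (I i x) (b i) (I j x) (b j))"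
      unfolding e by (subst nn_integral_eq_integral) (auto simp only: gi(3) zero_le_power2 intro!: AE_I2)
    also have "\<dots> \<le> ennreal (\<Sum>j\<in>S. (c j)\<^sup>2 * (b j - a j) powr (2 * H))"
    proof (intro ennreal_leI sum_mono)
      fix i assume i: "i \<in> S"
      have "(\<Sum>j\<in>S. c i * c j * cov (I i x) (b i) (I j x) (b j)) = c i * c i * cov (I i x) (b i) (I i x) (b i) + (\<Sum>j\<in>S - {i}. c i * c j * cov (I i x) (b i) (I j x) (b j))"
        by (rule sum.remove[OF S i])
      also have "(\<Sum>j\<in>S - {i}. c i * c j * cov (I i x) (b i) (I j x) (b j)) \<le> 0"
      proof (rule sum_nonpos)
        fix j assume j: "j \<in> S - {i}"
        then have jS: "j \<in> S" by auto
        have "cov (I i x) (b i) (I j x) (b j) \<le> 0"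
        proof -
          have ij: "i \<noteq> j" using j by auto
          show ?thesis
            using dis[OF i jS ij]
          proof
            assume "b i \<le> a j"
            then show ?thesis using bI(3,4)[OF i] bI(3,4)[OF jS] by (intro cov_disjoint_nonpos(2)) auto
          next
            assume "b j \<le> a i"
            then show ?thesis using bI(3,4)[OF i] bI(3,4)[OF jS] by (intro cov_disjoint_nonpos(1)) auto
          qed
        qed
        then show "c i * c j * cov (I i x) (b i) (I j x) (b j) \<le> 0" using c0[OF i] c0[OF jS] by (intro mult_nonneg_nonpos) auto
      qed
      also have "c i * c i * cov (I i x) (b i) (I i x) (b i) \<le> c i * c i * (b i - a i) powr (2 * H)"
        unfolding cov_self using bI[OF i] H by (intro mult_left_mono powr_mono2) auto
      finally show "(\<Sum>j\<in>S. c i * c j * cov (I i x) (b i) (I j x) (b j)) \<le> (c i)\<^sup>2 * (b i - a i) powr (2 * H)"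
        by (simp add: power2_eq_square)
    qed
    finally show ?thesis unfolding c_def .
  qed
  have "(\<integral>\<^sup>+om. (\<integral>\<^sup>+om'. ennreal ((D (Xv om) (Xv om'))\<^sup>2) \<partial>M) \<partial>M) \<le> (\<integral>\<^sup>+om. ennreal ((K om)\<^sup>2 * (\<Sum>j\<in>S. (b j - a j) powr (2 * (H + g)))) \<partial>M)"
  proof (rule nn_integral_mono_AE)
    show "AE om in M. (\<integral>\<^sup>+om'. ennreal ((D (Xv om) (Xv om'))\<^sup>2) \<partial>M) \<le> ennreal ((K om)\<^sup>2 * (\<Sum>j\<in>S. (b j - a j) powr (2 * (H + g))))"
      using mK
    proof eventually_elim
      fix om assume h: "\<forall>j\<in>S. m j (Xv om) \<le> K om * (b j - a j) powr g"
      have "(\<Sum>j\<in>S. (tanh (m j (Xv om)))\<^sup>2 * (b j - a j) powr (2 * H)) \<le> (\<Sum>j\<in>S. (K om)\<^sup>2 * (b j - a j) powr (2 * (H + g)))"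
      proof (rule sum_mono)
        fix j assume j: "j \<in> S"
        have "tanh (m j (Xv om)) \<le> K om * (b j - a j) powr g" using tanh_bounds(2)[OF mp(1)[OF j]] h j by (meson order_trans)
        then have "(tanh (m j (Xv om)))\<^sup>2 \<le> (K om * (b j - a j) powr g)\<^sup>2" using mp(1)[OF j] by (intro power_mono) auto
        then have "(tanh (m j (Xv om)))\<^sup>2 * (b j - a j) powr (2 * H) \<le> (K om * (b j - a j) powr g)\<^sup>2 * (b j - a j) powr (2 * H)"
          by (intro mult_right_mono) auto
        also have "\<dots> = (K om)\<^sup>2 * ((b j - a j) powr g * (b j - a j) powr g * (b j - a j) powr (2 * H))" by (simp add: power2_eq_square)
        also have "(b j - a j) powr g * (b j - a j) powr g * (b j - a j) powr (2 * H) = (b j - a j) powr (2 * (H + g))"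
          unfolding powr_add[symmetric] by (simp add: algebra_simps)
        finally show "(tanh (m j (Xv om)))\<^sup>2 * (b j - a j) powr (2 * H) \<le> (K om)\<^sup>2 * (b j - a j) powr (2 * (H + g))" .
      qed
      then show "(\<integral>\<^sup>+om'. ennreal ((D (Xv om) (Xv om'))\<^sup>2) \<partial>M) \<le> ennreal ((K om)\<^sup>2 * (\<Sum>j\<in>S. (b j - a j) powr (2 * (H + g))))"
        by (intro order_trans[OF inner] ennreal_leI) (simp add: sum_distrib_left)
    qed
  qed
  also have "\<dots> = ennreal V"
    unfolding V_def using K(3) by (subst nn_integral_eq_integral) (auto intro!: mult_nonneg_nonneg sum_nonneg)
  finally have VV: "(\<integral>\<^sup>+om. (\<integral>\<^sup>+om'. ennreal ((D (Xv om) (Xv om'))\<^sup>2) \<partial>M) \<partial>M) \<le> ennreal V" .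
  have "variance (\<lambda>om. F (Xv om)) \<le> (pi\<^sup>2 / 2) * V"
    unfolding Xv_def
  proof (rule G.gaussian_poincare[OF Fm Dm])
    show "D x (\<lambda>j\<in>J. a * y j + b * z j) = a * D x y + b * D x z" for x y z a b
      unfolding D_def sum_distrib_left sum.distrib[symmetric] using IJ TJ(2) by (intro sum.cong refl) (simp add: algebra_simps)
    show "D x (\<lambda>j\<in>J. y j - x j) \<le> F y - F x" for x y
      unfolding D_def F_def sum_subtractf[symmetric]
    proof (rule sum_mono)
      fix j assume j: "j \<in> S"
      have "tanh (m j x) * ((\<lambda>j\<in>J. y j - x j) (b j) - (\<lambda>j\<in>J. y j - x j) (I j x)) = tanh (m j x) * ((y (b j) - y (I j x)) - m j x)"
        using mp(4)[OF j, of x] IJ[OF j] TJ(2)[OF j] by simp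
      also have "\<dots> \<le> tanh (m j x) * (m j y - m j x)"
        using mp(1,3)[OF j, of x] mp(2)[OF j, of "I j x" y] by (intro mult_left_mono) auto
      also have "\<dots> \<le> lncosh (m j y) - lncosh (m j x)" by (rule lncosh_tangent)
      finally show "tanh (m j x) * ((\<lambda>j\<in>J. y j - x j) (b j) - (\<lambda>j\<in>J. y j - x j) (I j x)) \<le> lncosh (m j y) - lncosh (m j x)" .
    qed
    show "integrable M (\<lambda>om. (F (\<lambda>j\<in>J. B j om))\<^sup>2)" using IF by (simp add: Xv_def)
    show "integrable M (\<lambda>om. (D (\<lambda>j\<in>J. B j om) (\<lambda>j\<in>J. B j om))\<^sup>2)" using ID by (simp add: Xv_def)
    show "(\<integral>\<^sup>+om. (\<integral>\<^sup>+om'. ennreal ((D (\<lambda>j\<in>J. B j om) (\<lambda>j\<in>J. B j om'))\<^sup>2) \<partial>M) \<partial>M) \<le> ennreal V" using VV by (simp add: Xv_def)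
    show "0 \<le> V" by (rule V0)
  qed
  then show ?thesis unfolding V_def F_def using mXv by simp
qed

end

section \<open>Rises in continuous time\<close>

definition rise :: "real => real => (real => real) => real" where
  "rise a b w = w b + flow w a b (- w a)"

definition grid :: "real => real => nat => real set" where
  "grid a b N = (\<lambda>i. a + real i / real (Suc N) * (b - a)) ` {..Suc N}"

lemma grid_props:
  assumes "a \<le> b"
  shows "finite (grid a b N)" "b \<in> grid a b N" "grid a b N \<subseteq> {a..b}"
proof -
  show "finite (grid a b N)" by (simp add: grid_def)
  show "b \<in> grid a b N" unfolding grid_def by (rule image_eqI[of _ _ "Suc N"]) auto
  show "grid a b N \<subseteq> {a..b}"
  proof
    fix p assume "p \<in> grid a b N"
    then obtain i where i: "i \<le> Suc N" "p = a + real i / real (Suc N) * (b - a)" by (auto simp: grid_def)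
    have "real i / real (Suc N) \<le> 1" using i(1) by (simp add: divide_le_eq)
    then have "real i / real (Suc N) * (b - a) \<le> 1 * (b - a)" using assms by (intro mult_right_mono) auto
    moreover have "0 \<le> real i / real (Suc N) * (b - a)" using assms by simp
    ultimately show "p \<in> {a..b}" using i by auto
  qed
qed

lemma rise_props:
  assumes w: "continuous_on {a..b} w" and ab: "a \<le> b"
  shows "\<And>y. y \<in> {a..b} ==> w b - w y \<le> rise a b w" "\<exists>y\<in>{a..b}. rise a b w = w b - w y" "0 \<le> rise a b w"
proof -
  obtain y where y: "a \<le> y" "y \<le> b" "runmax w a b = - w y" "\<And>x. a \<le> x ==> x \<le> b ==> - w x \<le> runmax w a b"
    using runmax_attained[OF w ab] by metis
  have r: "rise a b w = w b - w y" using y(3) y(4)[of a] ab by (simp add: rise_def flow_def)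
  show "w b - w z \<le> rise a b w" if "z \<in> {a..b}" for z using y(4)[of z] that unfolding r y(3) by auto
  from this[of b] show "0 \<le> rise a b w" using ab by auto
  show "\<exists>y\<in>{a..b}. rise a b w = w b - w y" using y r by auto
qed

lemma maxrise_grid:
  assumes w: "continuous_on {a..b} w" and ab: "a \<le> b"
  shows "maxrise b (grid a b N) w \<le> rise a b w" "(\<lambda>N. maxrise b (grid a b N) w) \<longlonglongrightarrow> rise a b w"
proof -
  show le: "maxrise b (grid a b N) w \<le> rise a b w" for N
    using maxrise_props(3,4)[OF grid_props(1,2)[OF ab], of N w] grid_props(3)[OF ab, of N] rise_props(1)[OF w ab] by (metis subsetD)
  obtain y where y: "y \<in> {a..b}" "rise a b w = w b - w y" using rise_props(2)[OF w ab] by blast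
  \<comment> \<open>The last grid point not exceeding y, where w is minimal.\<close>
  define p where "p = (\<lambda>N::nat. a + real (nat \<lfloor>(y - a) / (b - a) * real (Suc N)\<rfloor>) / real (Suc N) * (b - a))"
  have p: "p N \<in> grid a b N \<and> \<bar>p N - y\<bar> \<le> (b - a) * (1 / real (Suc N))" for N
  proof (cases "a = b")
    case True
    then show ?thesis using y grid_props(2)[OF ab, of N] by (simp add: p_def)
  next
    case False
    then have lt: "a < b" using ab by auto
    define z where "z = (y - a) / (b - a) * real (Suc N)"
    have z: "0 \<le> z" "z \<le> real (Suc N)"
    proof -
      have "0 \<le> (y - a) / (b - a)" "(y - a) / (b - a) \<le> 1" using y lt by auto
      then show "0 \<le> z" "z \<le> real (Suc N)" unfolding z_def using mult_right_mono[of "(y - a) / (b - a)" 1 "real (Suc N)"]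
        by (auto simp del: of_nat_Suc times_divide_eq_left)
    qed
    define i where "i = nat \<lfloor>z\<rfloor>"
    have i: "real i \<le> z" "z < real i + 1" using z by (auto simp: i_def)
    then have "i \<le> Suc N" using z by linarith
    have pi: "p N = a + real i / real (Suc N) * (b - a)" by (simp add: p_def i_def z_def)
    have yz: "y = a + z / real (Suc N) * (b - a)" unfolding z_def using lt by simp
    have "p N - y = (real i - z) / real (Suc N) * (b - a)" unfolding pi by (subst yz) (simp only: diff_divide_distrib left_diff_distrib add_diff_cancel_left)
    then have "\<bar>p N - y\<bar> = \<bar>real i - z\<bar> / real (Suc N) * (b - a)" using lt by (simp add: abs_mult)
    also have "\<dots> \<le> 1 / real (Suc N) * (b - a)" using i lt by (intro mult_right_mono divide_right_mono) auto
    finally show ?thesis using \<open>i \<le> Suc N\<close> pi by (auto simp: grid_def mult.commute)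
  qed
  have "p \<longlonglongrightarrow> y"
  proof (rule LIM_zero_cancel, rule Lim_null_comparison)
    show "eventually (\<lambda>N. norm (p N - y) \<le> (b - a) * (1 / real (Suc N))) sequentially" using p by (intro always_eventually) auto
    show "(\<lambda>N. (b - a) * (1 / real (Suc N))) \<longlonglongrightarrow> 0" by (intro tendsto_mult_right_zero LIMSEQ_Suc[OF lim_1_over_n])
  qed
  then have "(\<lambda>N. w (p N)) \<longlonglongrightarrow> w y"
    by (rule continuous_on_tendsto_compose[OF w _ y(1)]) (intro always_eventually allI, rule subsetD[OF grid_props(3)[OF ab]], rule conjunct1[OF p])
  then have l: "(\<lambda>N. w b - w (p N)) \<longlonglongrightarrow> rise a b w" unfolding y(2) by (intro tendsto_intros)
  have "w b - w (p N) \<le> maxrise b (grid a b N) w" for N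
    using maxrise_props(2)[OF grid_props(1,2)[OF ab]] p by blast
  then show "(\<lambda>N. maxrise b (grid a b N) w) \<longlonglongrightarrow> rise a b w"
    by (intro tendsto_sandwich[OF _ _ l tendsto_const]) (use le in \<open>auto intro!: always_eventually\<close>)
qed

text \<open>cosh x >= 1 + u with u = x^2/2, and ln (1 + u) >= u/(1 + u) >= u/2 for u <= 1.\<close>

lemma lncosh_ge_square:
  assumes "0 \<le> x" "x \<le> 1" shows "x\<^sup>2 / 4 \<le> lncosh x"
proof -
  have s: "y \<le> sinh y" if "0 \<le> y" for y :: real
  proof -
    have "((\<lambda>x. sinh x - x) has_real_derivative (cosh x - 1)) (at x)" for x :: real
      by (auto intro!: derivative_eq_intros)
    then have "sinh 0 - 0 \<le> sinh y - y" using that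
      by (intro DERIV_nonneg_imp_nondecreasing[of 0 y "\<lambda>x. sinh x - x"]) (auto intro!: exI simp: cosh_real_ge_1)
    then show ?thesis by simp
  qed
  have "cosh 0 - 0\<^sup>2 / 2 \<le> cosh x - x\<^sup>2 / 2"
  proof (rule DERIV_nonneg_imp_nondecreasing[OF assms(1)])
    fix y assume "0 \<le> y" "y \<le> x"
    then show "\<exists>d. ((\<lambda>x. cosh x - x\<^sup>2 / 2) has_real_derivative d) (at y) \<and> 0 \<le> d"
      using s[of y] by (intro exI[of _ "sinh y - y"]) (auto intro!: derivative_eq_intros)
  qed
  then have c: "1 + x\<^sup>2 / 2 \<le> cosh x" by simp
  define u where "u = x\<^sup>2 / 2"
  have u: "0 \<le> u" "u \<le> 1" unfolding u_def using assms power_le_one[of x 2] by auto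
  have "ln (1 / (1 + u)) \<le> 1 / (1 + u) - 1" using u by (intro ln_le_minus_one) auto
  then have "1 - 1 / (1 + u) \<le> ln (1 + u)" using u by (simp add: ln_div)
  moreover have "u / 2 \<le> 1 - 1 / (1 + u)" using u mult_right_mono[of u 1 u] by (simp add: field_simps power2_eq_square)
  moreover have "ln (1 + u) \<le> lncosh x" unfolding lncosh_def using c u by (subst ln_le_cancel_iff) (auto simp: u_def cosh_real_pos add_pos_nonneg)
  ultimately show ?thesis unfolding u_def by simp
qed

lemma (in prob_space) AE_summable:
  fixes f :: "nat => 'a => real"
  assumes f: "\<And>i. integrable M (f i)" "\<And>i om. 0 \<le> f i om" "\<And>i. expectation (f i) \<le> u i" and u: "summable u"
  shows "AE om in M. summable (\<lambda>i. f i om)"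
proof -
  have u0: "0 \<le> u i" for i by (rule order_trans[OF Bochner_Integration.integral_nonneg f(3)]) (rule f(2))
  have m: "(\<lambda>om. ennreal (f i om)) \<in> borel_measurable M" for i using f(1)[of i] by measurable
  have "(\<integral>\<^sup>+om. (\<Sum>i. ennreal (f i om)) \<partial>M) = (\<Sum>i. \<integral>\<^sup>+om. ennreal (f i om) \<partial>M)" by (rule nn_integral_suminf[OF m])
  also have "\<dots> \<le> (\<Sum>i. ennreal (u i))"
    using f by (intro suminf_le) (auto simp: nn_integral_eq_integral ennreal_leI)
  also have "\<dots> = ennreal (suminf u)" by (rule suminf_ennreal2[OF u0 u])
  finally have "(\<integral>\<^sup>+om. (\<Sum>i. ennreal (f i om)) \<partial>M) \<noteq> \<infinity>" by (auto simp: top_unique)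
  then have "AE om in M. (\<Sum>i. ennreal (f i om)) \<noteq> \<infinity>" using m by (intro nn_integral_PInf_AE borel_measurable_suminf_order) auto
  then show ?thesis
  proof eventually_elim
    fix om assume "(\<Sum>i. ennreal (f i om)) \<noteq> \<infinity>"
    then show "summable (\<lambda>i. f i om)" using f(2) by (intro summable_suminf_not_top) auto
  qed
qed

context fbm
begin

lemma rise_measurable:
  assumes "0 \<le> a" "a \<le> b" "b \<le> 1"
  shows "(\<lambda>om. rise a b (\<lambda>t. B t om)) \<in> borel_measurable M"
proof (rule borel_measurable_LIMSEQ_real)
  fix om assume "om \<in> space M"
  then have "continuous_on {a..b} (\<lambda>t. B t om)" using assms by (intro continuous_on_subset[OF path_cont]) auto
  then show "(\<lambda>N. maxrise b (grid a b N) (\<lambda>t. B t om)) \<longlonglongrightarrow> rise a b (\<lambda>t. B t om)" by (rule maxrise_grid(2)[OF _ assms(2)])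
next
  fix N
  have "(\<lambda>om. MAX p\<in>grid a b N. B b om - B p om) \<in> borel_measurable M"
    using grid_props[OF assms(2), of N] assms by (intro borel_measurable_MAX borel_measurable_diff B_meas) auto
  then show "(\<lambda>om. maxrise b (grid a b N) (\<lambda>t. B t om)) \<in> borel_measurable M" unfolding maxrise_def .
qed

text \<open>The grid versions converge to F on every path and are dominated by F, so means, mean
  squares and hence the variance bound pass to the limit.\<close>

lemma variance_sum_lncosh:
  fixes S :: "'k set" and a b :: "'k => real"
  assumes S: "finite S" and ab: "\<And>j. j \<in> S ==> 0 \<le> a j \<and> a j \<le> b j \<and> b j \<le> 1"
    and dis: "\<And>j k. j \<in> S ==> k \<in> S ==> j \<noteq> k ==> b j \<le> a k \<or> b k \<le> a j"
    and K: "K \<in> borel_measurable M" "\<And>om. 0 \<le> K om" "integrable M (\<lambda>om. (K om)\<^sup>2)"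
      "AE om in M. \<forall>s\<in>{0..1}. \<forall>t\<in>{0..1}. \<bar>B t om - B s om\<bar> \<le> K om * \<bar>t - s\<bar> powr g" and g: "0 < g"
  defines "F \<equiv> \<lambda>om. \<Sum>j\<in>S. lncosh (rise (a j) (b j) (\<lambda>t. B t om))"
  shows "F \<in> borel_measurable M" "integrable M (\<lambda>om. (F om)\<^sup>2)" "integrable M F"
    and "variance F \<le> (pi\<^sup>2 / 2) * (expectation (\<lambda>om. (K om)\<^sup>2) * (\<Sum>j\<in>S. (b j - a j) powr (2 * (H + g))))"
proof -
  define FN where "FN = (\<lambda>N om. \<Sum>j\<in>S. lncosh (maxrise (b j) (grid (a j) (b j) N) (\<lambda>t. B t om)))"
  define V where "V = (pi\<^sup>2 / 2) * (expectation (\<lambda>om. (K om)\<^sup>2) * (\<Sum>j\<in>S. (b j - a j) powr (2 * (H + g))))"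
  have T: "finite (grid (a j) (b j) N) \<and> b j \<in> grid (a j) (b j) N \<and> grid (a j) (b j) N \<subseteq> {a j..b j}" if "j \<in> S" for j N
    using grid_props[of "a j" "b j" N] ab[OF that] by auto
  have vN: "variance (FN N) \<le> V" for N
    unfolding FN_def V_def by (rule variance_sum_lncosh_finite[OF S ab dis T K g]) auto
  show Fm[measurable]: "F \<in> borel_measurable M"
    unfolding F_def using ab by (intro borel_measurable_sum measurable_compose[OF rise_measurable lncosh_meas]) auto
  have FNm[measurable]: "FN N \<in> borel_measurable M" for N
  proof -
    have "(\<lambda>om. MAX p\<in>grid (a j) (b j) N. B (b j) om - B p om) \<in> borel_measurable M" if "j \<in> S" for j
      using T[OF that, of N] ab[OF that] by (intro borel_measurable_MAX borel_measurable_diff B_meas) auto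
    then show ?thesis unfolding FN_def maxrise_def by (intro borel_measurable_sum measurable_compose[OF _ lncosh_meas]) auto
  qed
  have c: "continuous_on {a j..b j} (\<lambda>t. B t om)" if "j \<in> S" "om \<in> space M" for j om
    using ab[OF that(1)] by (intro continuous_on_subset[OF path_cont[OF that(2)]]) auto
  have lim: "(\<lambda>N. FN N om) \<longlonglongrightarrow> F om" if "om \<in> space M" for om
    unfolding FN_def F_def using ab by (intro tendsto_sum isCont_tendsto_compose[OF lncosh_cont] maxrise_grid(2) c that) auto
  have FN0: "0 \<le> FN N om" for N om unfolding FN_def using lncosh_bounds(1) by (intro sum_nonneg) auto
  have F0: "0 \<le> F om" for om unfolding F_def using lncosh_bounds(1) by (intro sum_nonneg) auto
  have FNF: "FN N om \<le> F om" if "om \<in> space M" for N om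
    unfolding FN_def F_def
  proof (rule sum_mono)
    fix j assume j: "j \<in> S"
    have "0 \<le> maxrise (b j) (grid (a j) (b j) N) (\<lambda>t. B t om)" using T[OF j, of N] by (intro maxrise_props) auto
    then show "lncosh (maxrise (b j) (grid (a j) (b j) N) (\<lambda>t. B t om)) \<le> lncosh (rise (a j) (b j) (\<lambda>t. B t om))"
      using maxrise_grid(1)[OF c[OF j that]] ab[OF j] by (intro lncosh_bounds(3)) auto
  qed
  have FK: "AE om in M. F om \<le> real (card S) * K om"
    using K(4) AE_space
  proof eventually_elim
    fix om assume h: "\<forall>s\<in>{0..1}. \<forall>t\<in>{0..1}. \<bar>B t om - B s om\<bar> \<le> K om * \<bar>t - s\<bar> powr g" and om: "om \<in> space M"
    have "F om \<le> (\<Sum>j\<in>S. K om)"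
      unfolding F_def
    proof (rule sum_mono)
      fix j assume j: "j \<in> S"
      have abj: "a j \<le> b j" using ab[OF j] by auto
      obtain y where y: "y \<in> {a j..b j}" "rise (a j) (b j) (\<lambda>t. B t om) = B (b j) om - B y om" using rise_props(2)[OF c[OF j om] abj] by blast
      have "B (b j) om - B y om \<le> \<bar>B (b j) om - B y om\<bar>" by simp
      also have "\<dots> \<le> K om * \<bar>b j - y\<bar> powr g"
        by (rule h[THEN bspec, THEN bspec]) (use y(1) ab[OF j] in auto)
      also have "\<dots> \<le> K om * 1" using y ab[OF j] K(2) g by (intro mult_left_mono powr_le1) auto
      finally have "rise (a j) (b j) (\<lambda>t. B t om) \<le> K om" using y by simp
      then show "lncosh (rise (a j) (b j) (\<lambda>t. B t om)) \<le> K om" using lncosh_bounds(2)[OF rise_props(3)[OF c[OF j om] abj]] by simp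
    qed
    then show "F om \<le> real (card S) * K om" by simp
  qed
  have n2: "integrable M (\<lambda>om. (real (card S) * K om)\<^sup>2)" using K(3) by (simp add: power_mult_distrib)
  show IF2: "integrable M (\<lambda>om. (F om)\<^sup>2)"
  proof (rule Bochner_Integration.integrable_bound[OF n2])
    show "AE om in M. norm ((F om)\<^sup>2) \<le> norm ((real (card S) * K om)\<^sup>2)"
      using FK by eventually_elim (use F0 in \<open>auto intro: power_mono\<close>)
  qed measurable
  show IF: "integrable M F" by (rule square_integrable_imp_integrable[OF Fm IF2])
  have IFN2: "integrable M (\<lambda>om. (FN N om)\<^sup>2)" for N
    by (rule Bochner_Integration.integrable_bound[OF IF2]) (use FN0 FNF in \<open>auto intro!: AE_I2 power_mono\<close>)
  have IFN: "integrable M (FN N)" for N by (rule square_integrable_imp_integrable[OF FNm IFN2])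
  have l1: "(\<lambda>N. expectation (FN N)) \<longlonglongrightarrow> expectation F"
    by (rule integral_dominated_convergence[where w=F]) (use lim FN0 FNF IF in \<open>auto intro!: AE_I2\<close>)
  have l2: "(\<lambda>N. expectation (\<lambda>om. (FN N om)\<^sup>2)) \<longlonglongrightarrow> expectation (\<lambda>om. (F om)\<^sup>2)"
    by (rule integral_dominated_convergence[where w="\<lambda>om. (F om)\<^sup>2"]) (use lim FN0 FNF IF2 in \<open>auto intro!: AE_I2 tendsto_power power_mono\<close>)
  have "(\<lambda>N. expectation (\<lambda>om. (FN N om)\<^sup>2) - (expectation (FN N))\<^sup>2) \<longlonglongrightarrow> expectation (\<lambda>om. (F om)\<^sup>2) - (expectation F)\<^sup>2"
    by (intro tendsto_intros l1 l2)
  then have "(\<lambda>N. variance (FN N)) \<longlonglongrightarrow> variance F" using variance_eq[OF IFN IFN2] variance_eq[OF IF IF2] by simp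
  then have "variance F \<le> V" using vN by (intro LIMSEQ_le_const2) auto
  then show "variance F \<le> (pi\<^sup>2 / 2) * (expectation (\<lambda>om. (K om)\<^sup>2) * (\<Sum>j\<in>S. (b j - a j) powr (2 * (H + g))))"
    unfolding V_def .
qed

text \<open>The rise is at least \<open>B b - B a\<close>, which reaches its standard deviation with
  probability \<open>std_normal_tail\<close>. That deviation is at most 1, so
  \<open>lncosh_ge_square\<close> applies to it.\<close>

lemma expectation_lncosh_rise:
  assumes ab: "0 \<le> a" "a < b" "b \<le> 1" and I: "integrable M (\<lambda>om. lncosh (rise a b (\<lambda>t. B t om)))"
  shows "std_normal_tail / 4 * (b - a) powr (2 * H) \<le> expectation (\<lambda>om. lncosh (rise a b (\<lambda>t. B t om)))"
proof -
  let ?d = "(b - a) powr H"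
  note G = increment_gaussian[of a b]
  have v: "expectation (\<lambda>om. (B b om - B a om)\<^sup>2) = ?d\<^sup>2" using G(3) ab by (simp add: power2_eq_square powr_add[symmetric])
  have d: "0 < ?d" "?d \<le> 1" using ab H by (auto intro: powr_le1)
  have P: "prob {om \<in> space M. ?d \<le> B b om - B a om} = std_normal_tail"
    using centered_gaussian(4)[OF G(1,2)] ab d unfolding v by simp
  have [measurable]: "B a \<in> borel_measurable M" "B b \<in> borel_measurable M" using ab by (auto intro: B_meas)
  have m: "{om \<in> space M. ?d \<le> B b om - B a om} \<in> events" by measurable
  have "std_normal_tail / 4 * (b - a) powr (2 * H) = expectation (\<lambda>om. ?d\<^sup>2 / 4 * indicator {om \<in> space M. ?d \<le> B b om - B a om} om)"
    using m by (simp add: P power2_eq_square powr_add[symmetric])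
  also have "\<dots> \<le> expectation (\<lambda>om. lncosh (rise a b (\<lambda>t. B t om)))"
  proof (rule integral_mono[OF _ I])
    show "integrable M (\<lambda>om. ?d\<^sup>2 / 4 * indicator {om \<in> space M. ?d \<le> B b om - B a om} om)"
      using m by (intro integrable_mult_right) (auto simp: less_top[symmetric])
    fix om assume om: "om \<in> space M"
    show "?d\<^sup>2 / 4 * indicator {om \<in> space M. ?d \<le> B b om - B a om} om \<le> lncosh (rise a b (\<lambda>t. B t om))"
    proof (cases "?d \<le> B b om - B a om")
      case True
      have "continuous_on {a..b} (\<lambda>t. B t om)" using ab by (intro continuous_on_subset[OF path_cont[OF om]]) auto
      then have "?d \<le> rise a b (\<lambda>t. B t om)" using rise_props(1)[of a b "\<lambda>t. B t om" a] ab True by auto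
      then have "lncosh ?d \<le> lncosh (rise a b (\<lambda>t. B t om))" using d by (intro lncosh_bounds(3)) auto
      then show ?thesis using lncosh_ge_square[of ?d] d True om by auto
    next
      case False then show ?thesis using lncosh_bounds(1) by simp
    qed
  qed
  finally show ?thesis .
qed

end

section \<open>Almost sure behaviour of sums with summable variance bounds\<close>

context prob_space
begin

lemma integrable_variance_le:
  fixes f :: "'a => real"
  assumes f: "f \<in> borel_measurable M" "integrable M (\<lambda>om. (f om)\<^sup>2)"
  shows "integrable M f" "integrable M (\<lambda>om. (f om - expectation f)\<^sup>2)"
proof -
  show i: "integrable M f" by (rule square_integrable_imp_integrable[OF f])
  have "(\<lambda>om. (f om - expectation f)\<^sup>2) = (\<lambda>om. (f om)\<^sup>2 - 2 * expectation f * f om + (expectation f)\<^sup>2)"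
    by (simp add: fun_eq_iff power2_eq_square algebra_simps)
  then show "integrable M (\<lambda>om. (f om - expectation f)\<^sup>2)" using i f(2) by simp
qed

text \<open>Only variances of blocks are controlled. The deterministic times \<open>N i\<close> make
  the block from \<open>N i\<close> to \<open>N (Suc i)\<close> have variance at most 4^(-i), and
  then the block sums are almost surely absolutely summable.\<close>

lemma centered_sums_converge_along:
  fixes l :: "nat => 'a => real"
  assumes l: "\<And>S. finite S ==> (\<lambda>om. \<Sum>j\<in>S. l j om) \<in> borel_measurable M"
      "\<And>S. finite S ==> integrable M (\<lambda>om. (\<Sum>j\<in>S. l j om)\<^sup>2)"
      "\<And>S. finite S ==> variance (\<lambda>om. \<Sum>j\<in>S. l j om) \<le> (\<Sum>j\<in>S. v j)"
    and v: "summable v"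
  obtains N :: "nat => nat" where "filterlim N at_top sequentially"
    "AE om in M. convergent (\<lambda>i. (\<Sum>j<N i. l j om) - expectation (\<lambda>om. \<Sum>j<N i. l j om))"
proof -
  have "\<exists>n0. \<forall>m\<ge>n0. \<forall>n. \<bar>sum v {m..<n}\<bar> < (1/4)^i" for i :: nat
  proof -
    have "0 < (1/4::real)^i" by simp
    then show ?thesis using v[unfolded summable_Cauchy] by (metis real_norm_def)
  qed
  then obtain n0 where n0: "\<And>i m n. n0 i \<le> m ==> \<bar>sum v {m..<n}\<bar> < (1/4)^i" for i :: nat by metis
  \<comment> \<open>Summing the thresholds makes N nondecreasing; the summand i makes it tend to
    infinity.\<close>
  define N where "N = (\<lambda>i. i + (\<Sum>k\<le>i. n0 k))"
  have N: "n0 i \<le> N i" "i \<le> N i" "N i \<le> N (Suc i)" for i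
    unfolding N_def using member_le_sum[of i "{..i}" n0] by auto
  define X where "X = (\<lambda>n om. (\<Sum>j<n. l j om) - expectation (\<lambda>om. \<Sum>j<n. l j om))"
  have i1: "integrable M (\<lambda>om. \<Sum>j\<in>S. l j om)" if "finite S" for S by (rule integrable_variance_le(1)[OF l(1,2)[OF that]])
  define Y where "Y = (\<lambda>i om. X (N (Suc i)) om - X (N i) om)"
  have Y: "Y i om = (\<Sum>j\<in>{N i..<N (Suc i)}. l j om) - expectation (\<lambda>om. \<Sum>j\<in>{N i..<N (Suc i)}. l j om)" for i om
  proof -
    have s: "(\<Sum>j<N (Suc i). l j om) = (\<Sum>j<N i. l j om) + (\<Sum>j\<in>{N i..<N (Suc i)}. l j om)" for om
      using sum.atLeastLessThan_concat[of 0 "N i" "N (Suc i)" "\<lambda>j. l j om"] N(3)[of i] by (simp add: atLeast0LessThan)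
    show ?thesis unfolding Y_def X_def s using i1 by simp
  qed
  have YI: "integrable M (\<lambda>om. (Y i om)\<^sup>2)" and YV: "expectation (\<lambda>om. (Y i om)\<^sup>2) \<le> (1/4)^i" for i
  proof -
    have fin: "finite {N i..<N (Suc i)}" by simp
    show "integrable M (\<lambda>om. (Y i om)\<^sup>2)" unfolding Y by (rule integrable_variance_le(2)[OF l(1,2)[OF fin]])
    have "expectation (\<lambda>om. (Y i om)\<^sup>2) \<le> sum v {N i..<N (Suc i)}" unfolding Y by (rule l(3)[OF fin])
    then show "expectation (\<lambda>om. (Y i om)\<^sup>2) \<le> (1/4)^i" using n0[OF N(1), of i "N (Suc i)"] by linarith
  qed
  \<comment> \<open>The weight 2^i still leaves a geometric series of expectations. The inequality
    |y| <= 2^i y^2 + 2^(-i) then turns square summability into absolute convergence.\<close>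
  have "AE om in M. summable (\<lambda>i. 2^i * (Y i om)\<^sup>2)"
  proof (rule AE_summable)
    show "integrable M (\<lambda>om. 2^i * (Y i om)\<^sup>2)" for i using YI by simp
    show "0 \<le> 2^i * (Y i om)\<^sup>2" for i om by simp
    show "expectation (\<lambda>om. 2^i * (Y i om)\<^sup>2) \<le> (1/2)^i" for i
    proof -
      have "expectation (\<lambda>om. 2^i * (Y i om)\<^sup>2) \<le> 2^i * (1/4)^i" using YV[of i] by simp
      also have "\<dots> = (1/2::real)^i" unfolding power_mult_distrib[symmetric] by simp
      finally show ?thesis .
    qed
    show "summable (\<lambda>i. (1/2::real)^i)" by (rule summable_geometric) simp
  qed
  then have "AE om in M. convergent (\<lambda>i. X (N i) om)"
  proof eventually_elim
    fix om assume s: "summable (\<lambda>i. 2^i * (Y i om)\<^sup>2)"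
    have "summable (\<lambda>i. 2^i * (Y i om)\<^sup>2 + (1/2::real)^i)" by (intro summable_add s summable_geometric) simp
    moreover have "norm (Y i om) \<le> 2^i * (Y i om)\<^sup>2 + (1/2::real)^i" for i
    proof (cases "\<bar>Y i om\<bar> \<le> (1/2)^i")
      case True
      then show ?thesis by (simp add: add_increasing)
    next
      case False
      then have "1 \<le> 2^i * \<bar>Y i om\<bar>" by (simp add: power_one_over field_simps)
      then have "1 * \<bar>Y i om\<bar> \<le> 2^i * \<bar>Y i om\<bar> * \<bar>Y i om\<bar>" by (intro mult_right_mono) auto
      then show ?thesis by (simp add: power2_eq_square mult.assoc add_increasing2)
    qed
    ultimately have "summable (\<lambda>i. Y i om)" by (rule summable_comparison_test'[where N=0])
    then have "convergent (\<lambda>n. \<Sum>i<n. Y i om)" by (simp add: summable_iff_convergent)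
    moreover have "(\<Sum>i<n. Y i om) = X (N n) om - X (N 0) om" for n
      unfolding Y_def by (rule sum_lessThan_telescope)
    ultimately have "convergent (\<lambda>n. X (N n) om + - X (N 0) om)" by simp
    then show "convergent (\<lambda>i. X (N i) om)" by (simp only: convergent_add_const_right_iff)
  qed
  moreover have "filterlim N at_top sequentially" by (rule filterlim_at_top_mono[OF filterlim_ident]) (use N(2) in auto)
  ultimately show ?thesis using that unfolding X_def by blast
qed

text \<open>At the times 2^i the variance stays bounded while the squared lower bound of the mean
  grows like 2^(2 p i), so the deviation is eventually at most half of that bound and c becomes c/2.
  Between powers of 2 the terms are nonnegative, at the cost of another factor 2^p <= 2.\<close>

lemma sums_grow:
  fixes l :: "nat => 'a => real"
  assumes l: "\<And>S. finite S ==> (\<lambda>om. \<Sum>j\<in>S. l j om) \<in> borel_measurable M"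
      "\<And>S. finite S ==> integrable M (\<lambda>om. (\<Sum>j\<in>S. l j om)\<^sup>2)"
      "\<And>S. finite S ==> variance (\<lambda>om. \<Sum>j\<in>S. l j om) \<le> (\<Sum>j\<in>S. v j)"
    and v: "summable v" "\<And>j. 0 \<le> v j" and l0: "\<And>j om. 0 \<le> l j om"
    and p: "0 < p" "p \<le> 1" and c: "0 < c" "eventually (\<lambda>n. c * real n powr p \<le> expectation (\<lambda>om. \<Sum>j<n. l j om)) sequentially"
  shows "AE om in M. eventually (\<lambda>n. c / 4 * real n powr p \<le> (\<Sum>j<n. l j om)) sequentially"
proof -
  define X where "X = (\<lambda>n om. (\<Sum>j<n. l j om) - expectation (\<lambda>om. \<Sum>j<n. l j om))"
  define a where "a = (\<lambda>i::nat. real (2^i) powr p)"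
  have a0: "0 < a i" for i by (simp add: a_def)
  have aq: "1 / (a i)\<^sup>2 = (1 / (2 powr p)\<^sup>2)^i" for i
  proof -
    have "a i = (2 powr p)^i" unfolding a_def by (simp add: powr_realpow[symmetric] powr_powr mult.commute powr_power)
    then show ?thesis by (simp add: power_one_over power_mult[symmetric] mult.commute)
  qed
  have "AE om in M. summable (\<lambda>i. (X (2^i) om)\<^sup>2 * (1 / (a i)\<^sup>2))"
  proof (rule AE_summable)
    fix i
    have I: "integrable M (\<lambda>om. (X (2^i) om)\<^sup>2)" unfolding X_def by (rule integrable_variance_le(2)[OF l(1,2)]) auto
    then show "integrable M (\<lambda>om. (X (2^i) om)\<^sup>2 * (1 / (a i)\<^sup>2))" by simp
    show "0 \<le> (X (2^i) om)\<^sup>2 * (1 / (a i)\<^sup>2)" for om by simp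
    have "expectation (\<lambda>om. (X (2^i) om)\<^sup>2) \<le> sum v {..<2^i}" unfolding X_def by (rule l(3)) simp
    also have "\<dots> \<le> suminf v" using v by (intro sum_le_suminf) auto
    finally have "expectation (\<lambda>om. (X (2^i) om)\<^sup>2) * (1 / (a i)\<^sup>2) \<le> suminf v * (1 / (a i)\<^sup>2)" by (intro mult_right_mono) auto
    then show "expectation (\<lambda>om. (X (2^i) om)\<^sup>2 * (1 / (a i)\<^sup>2)) \<le> suminf v * (1 / (2 powr p)\<^sup>2)^i" unfolding aq by simp
  next
    have "1 < 2 powr p" using p by simp
    then have "1 < (2 powr p)\<^sup>2" by (simp add: one_less_power)
    then show "summable (\<lambda>i. suminf v * (1 / (2 powr p)\<^sup>2)^i)" by (intro summable_mult summable_geometric) simp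
  qed
  then show ?thesis
  proof eventually_elim
    fix om assume "summable (\<lambda>i. (X (2^i) om)\<^sup>2 * (1 / (a i)\<^sup>2))"
    then have lim: "(\<lambda>i. (X (2^i) om)\<^sup>2 * (1 / (a i)\<^sup>2)) \<longlonglongrightarrow> 0" by (rule summable_LIMSEQ_zero)
    have "eventually (\<lambda>i. (X (2^i) om)\<^sup>2 * (1 / (a i)\<^sup>2) < (c/2)\<^sup>2) sequentially"
      by (rule order_tendstoD(2)[OF lim]) (use c in simp)
    moreover have "filterlim (\<lambda>i. 2^i :: nat) at_top sequentially"
      by (rule filterlim_at_top_mono[OF filterlim_ident]) (auto intro!: always_eventually less_imp_le)
    then have "eventually (\<lambda>i. c * real (2^i) powr p \<le> expectation (\<lambda>om. \<Sum>j<2^i. l j om)) sequentially"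
      by (rule eventually_compose_filterlim[OF c(2)])
    ultimately have "eventually (\<lambda>i. c / 2 * a i \<le> (\<Sum>j<2^i. l j om)) sequentially"
    proof eventually_elim
      fix i assume h: "(X (2^i) om)\<^sup>2 * (1 / (a i)\<^sup>2) < (c/2)\<^sup>2" "c * real (2^i) powr p \<le> expectation (\<lambda>om. \<Sum>j<2^i. l j om)"
      have "(X (2^i) om)\<^sup>2 \<le> (c/2 * a i)\<^sup>2" using h(1) a0[of i] by (simp add: field_simps power_mult_distrib power_divide)
      then have "\<bar>X (2^i) om\<bar> \<le> c / 2 * a i" unfolding abs_le_square_iff[symmetric] using c a0[of i] by (simp add: abs_of_nonneg less_imp_le)
      then have "- (c / 2 * a i) \<le> X (2^i) om" by linarith
      then show "c / 2 * a i \<le> (\<Sum>j<2^i. l j om)" using h(2) unfolding X_def a_def by linarith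
    qed
    then obtain i0 where i0: "\<And>i. i0 \<le> i ==> c / 2 * a i \<le> (\<Sum>j<2^i. l j om)" by (auto simp: eventually_sequentially)
    show "eventually (\<lambda>n. c / 4 * real n powr p \<le> (\<Sum>j<n. l j om)) sequentially"
      unfolding eventually_sequentially
    proof (intro exI allI impI)
      fix n :: nat assume n: "2^i0 \<le> n"
      have "1 \<le> n" using n one_le_power[of "2::nat" i0] by linarith
      then obtain i where i: "2^i \<le> n" "n < 2^(i+1)" using ex_power_ivl1[of 2 n] by auto
      have "i0 \<le> i"
      proof (rule ccontr)
        assume "\<not> i0 \<le> i"
        then have "(2::nat)^(i+1) \<le> 2^i0" by (intro power_increasing) auto
        then show False using n i by simp
      qed
      have "real n \<le> 2 * real (2^i)" using i(2) by (simp add: of_nat_less_iff[symmetric, where 'a=real] del: of_nat_less_iff of_nat_power)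
      then have "real n powr p \<le> (2 * real (2^i)) powr p" using p by (intro powr_mono2) auto
      also have "\<dots> = 2 powr p * a i" unfolding a_def by (simp add: powr_mult)
      also have "\<dots> \<le> 2 powr 1 * a i" using p a0[of i] by (intro mult_right_mono powr_mono) auto
      finally have "c / 4 * real n powr p \<le> c / 4 * (2 * a i)" using c by (intro mult_left_mono) auto
      also have "\<dots> \<le> (\<Sum>j<2^i. l j om)" using i0[OF \<open>i0 \<le> i\<close>] by simp
      also have "\<dots> \<le> (\<Sum>j<n. l j om)" using i(1) l0 by (intro sum_mono2) auto
      finally show "c / 4 * real n powr p \<le> (\<Sum>j<n. l j om)" .
    qed
  qed
qed

end

text \<open>A renormalised infinite product: in the application l j is the ln cosh of the rise over
  [\<tau>(j+1), \<tau>(j)], whose sum over j >= k diverges, and c removes its mean along N. Only j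
  >= k occur, that is the path up to \<open>\<tau> k\<close>, so the value can serve as an adapted
  starting radius.\<close>

definition scale :: "(nat => real) => (nat => nat) => (nat => real) => nat => real" where
  "scale l N c k = exp (lim (\<lambda>i. (\<Sum>j\<in>{k..<N i}. l j) - c i))"

text \<open>The exponent is X minus the sum over j < k, where X is the limit of the centred sums.
  Growth of the partial sums is thus decay of the scale, and \<theta> < p lets it beat
  \<open>exp (- (real k powr \<theta>))\<close> with any factor \<eta>.\<close>

lemma scale_props:
  assumes N: "filterlim N at_top sequentially" and c: "convergent (\<lambda>i. (\<Sum>j<N i. l j) - c i)"
    and grow: "eventually (\<lambda>n. b * real n powr p \<le> (\<Sum>j<n. l j)) sequentially" and b: "0 < b" "0 < \<theta>" "\<theta> < p"
  shows "scale l N c k = scale l N c (Suc k) * exp (l k)" "scale l N c \<longlonglongrightarrow> 0"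
    "eventually (\<lambda>k. \<eta> * scale l N c k \<le> exp (- (real k powr \<theta>))) sequentially"
proof -
  obtain X where X: "(\<lambda>i. (\<Sum>j<N i. l j) - c i) \<longlonglongrightarrow> X" using c by (auto simp: convergent_def)
  have s: "scale l N c k = exp (X - (\<Sum>j<k. l j))" for k
  proof -
    have "(\<lambda>i. ((\<Sum>j<N i. l j) - c i) - (\<Sum>j<k. l j)) \<longlonglongrightarrow> X - (\<Sum>j<k. l j)" by (intro tendsto_intros X)
    moreover have "eventually (\<lambda>i. ((\<Sum>j<N i. l j) - c i) - (\<Sum>j<k. l j) = (\<Sum>j\<in>{k..<N i}. l j) - c i) sequentially"
    proof -
      have "eventually (\<lambda>i. k \<le> N i) sequentially" using N by (simp add: filterlim_at_top)
      then show ?thesis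
      proof eventually_elim
        fix i assume "k \<le> N i"
        then show "((\<Sum>j<N i. l j) - c i) - (\<Sum>j<k. l j) = (\<Sum>j\<in>{k..<N i}. l j) - c i"
          using sum.atLeastLessThan_concat[of 0 k "N i" l] by (simp add: atLeast0LessThan)
      qed
    qed
    ultimately have "(\<lambda>i. (\<Sum>j\<in>{k..<N i}. l j) - c i) \<longlonglongrightarrow> X - (\<Sum>j<k. l j)" by (rule Lim_transform_eventually)
    then show ?thesis unfolding scale_def by (simp add: limI)
  qed
  show "scale l N c k = scale l N c (Suc k) * exp (l k)" unfolding s by (simp add: exp_add[symmetric])
  have p: "0 < p" using b by simp
  have small: "eventually (\<lambda>k. \<eta> * scale l N c k \<le> exp (- (real k powr \<theta>))) sequentially" for \<eta>
  proof -
    have "eventually (\<lambda>k. \<bar>\<eta>\<bar> * exp X * exp (- (b * real k powr p)) \<le> exp (- (real k powr \<theta>))) sequentially"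
      using b p by real_asymp
    then show ?thesis using grow
    proof eventually_elim
      fix k assume h: "\<bar>\<eta>\<bar> * exp X * exp (- (b * real k powr p)) \<le> exp (- (real k powr \<theta>))" "b * real k powr p \<le> (\<Sum>j<k. l j)"
      have "\<eta> * scale l N c k \<le> \<bar>\<eta>\<bar> * (exp X * exp (- (\<Sum>j<k. l j)))" unfolding s exp_diff exp_minus divide_inverse by (intro mult_right_mono) auto
      also have "\<dots> \<le> \<bar>\<eta>\<bar> * (exp X * exp (- (b * real k powr p)))" using h(2) by (intro mult_left_mono) auto
      finally show "\<eta> * scale l N c k \<le> exp (- (real k powr \<theta>))" using h(1) by (simp add: mult.assoc)
    qed
  qed
  then show "eventually (\<lambda>k. \<eta> * scale l N c k \<le> exp (- (real k powr \<theta>))) sequentially" .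
  show "scale l N c \<longlonglongrightarrow> 0"
  proof (rule tendsto_sandwich[where f="\<lambda>_. 0"])
    show "eventually (\<lambda>k. scale l N c k \<le> exp (- (real k powr \<theta>))) sequentially" using small[of 1] by simp
    show "(\<lambda>k. exp (- (real k powr \<theta>))) \<longlonglongrightarrow> 0" using b by real_asymp
  qed (auto simp: s)
qed

context fbm
begin

lemma scale_sequence:
  assumes \<tau>: "\<And>k. 0 < \<tau> k \<and> \<tau> k \<le> 1" "decseq \<tau>"
    and as: "asymp_equiv (\<lambda>k. \<tau> k - \<tau> (Suc k)) sequentially (\<lambda>k. real k powr (- \<alpha>))"
    and \<alpha>: "1 / (4 * H) < \<alpha>" "\<alpha> < 1 / (2 * H)" "0 < \<theta>" "\<theta> < 1 - 2 * \<alpha> * H"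
  defines "l \<equiv> \<lambda>w j. lncosh (rise (\<tau> (Suc j)) (\<tau> j) w)"
  obtains N c where "eventually (\<lambda>k. \<tau> (Suc k) < \<tau> k) sequentially"
    "AE om in M. \<forall>k. scale (l (\<lambda>t. B t om)) N c k = scale (l (\<lambda>t. B t om)) N c (Suc k) * exp (l (\<lambda>t. B t om) k)"
    "AE om in M. scale (l (\<lambda>t. B t om)) N c \<longlonglongrightarrow> 0"
    "AE om in M. \<forall>\<eta>. eventually (\<lambda>k. \<eta> * scale (l (\<lambda>t. B t om)) N c k \<le> exp (- (real k powr \<theta>))) sequentially"
proof -
  define d where "d = (\<lambda>k. \<tau> k - \<tau> (Suc k))"
  define q where "q = (\<lambda>k. real k powr (- \<alpha>))"
  have H2: "0 < H" "H < 1/2" using H by auto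
  have \<alpha>0: "0 < \<alpha>" using \<alpha>(1) H2 by (meson divide_pos_pos less_trans mult_pos_pos zero_less_numeral zero_less_one)
  have \<tau>': "\<tau> (Suc k) \<le> \<tau> k" for k using \<tau>(2) by (simp add: decseq_SucD)
  have d0: "0 \<le> d k" for k using \<tau>' by (simp add: d_def)
  have dq: "(\<lambda>k. d k / q k) \<longlonglongrightarrow> 1"
  proof (rule asymp_equivD_strong)
    show "asymp_equiv d sequentially q" using as unfolding d_def q_def .
    show "eventually (\<lambda>k. d k \<noteq> 0 \<or> q k \<noteq> 0) sequentially" using eventually_gt_at_top[of 0] by eventually_elim (auto simp: q_def)
  qed
  have "eventually (\<lambda>k. d k / q k < 2) sequentially" "eventually (\<lambda>k. 1/2 < d k / q k) sequentially"
    by (rule order_tendstoD(2)[OF dq], simp, rule order_tendstoD(1)[OF dq], simp)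
  then have "eventually (\<lambda>k. d k \<le> 2 * q k \<and> q k / 2 \<le> d k \<and> 0 < k) sequentially"
    using eventually_gt_at_top[of 0]
  proof eventually_elim
    fix k :: nat assume h: "d k / q k < 2" "1/2 < d k / q k" "0 < k"
    have "0 < q k" using h by (simp add: q_def)
    then show "d k \<le> 2 * q k \<and> q k / 2 \<le> d k \<and> 0 < k" using h by (simp add: field_simps)
  qed
  then obtain J where J: "\<And>k. J \<le> k ==> d k \<le> 2 * q k" "\<And>k. J \<le> k ==> q k / 2 \<le> d k" "\<And>k. J \<le> k ==> 0 < k"
    by (auto simp: eventually_sequentially)
  have q0: "0 < q k" if "J \<le> k" for k using J(3)[OF that] by (simp add: q_def)
  have dec: "eventually (\<lambda>k. \<tau> (Suc k) < \<tau> k) sequentially"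
    unfolding eventually_sequentially
  proof (intro exI[of _ J] allI impI)
    fix k assume "J \<le> k" from J(2)[OF this] q0[OF this] show "\<tau> (Suc k) < \<tau> k" by (simp add: d_def)
  qed
  \<comment> \<open>The midpoint between the lower bound for 2 \<alpha> (H + g) > 1, cut off at 0,
    and the upper bound H of \<open>holder_constant\<close>; there is room between them because
    \<alpha> > 1/(4 H).\<close>
  define g where "g = (max 0 (1 / (2 * \<alpha>) - H) + H) / 2"
  have "1 / (2 * \<alpha>) < 2 * H" using \<alpha>(1) \<alpha>0 H2 by (simp add: field_simps)
  then have g: "0 < g" "g < H" "1 / (2 * \<alpha>) < H + g" unfolding g_def using H2 \<alpha>0 by (simp_all add: max_def)
  have g2: "1 < \<alpha> * (2 * (H + g))" using g(3) \<alpha>0 by (simp add: field_simps)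
  obtain K where K: "K \<in> borel_measurable M" "\<And>om. 0 \<le> K om" "integrable M (\<lambda>om. (K om)\<^sup>2)"
      "AE om in M. \<forall>s\<in>{0..1}. \<forall>t\<in>{0..1}. \<bar>B t om - B s om\<bar> \<le> K om * \<bar>t - s\<bar> powr g"
    using holder_constant[OF g(1,2)] by blast
  define v where "v = (\<lambda>j. (pi\<^sup>2 / 2) * (expectation (\<lambda>om. (K om)\<^sup>2) * d j powr (2 * (H + g))))"
  have v0: "0 \<le> v j" for j unfolding v_def by (intro mult_nonneg_nonneg integral_nonneg_AE) auto
  have v: "summable v"
    unfolding v_def
  proof (intro summable_mult, rule summable_comparison_test'[where N=J])
    show "summable (\<lambda>k. 2 powr (2 * (H + g)) * real k powr (- \<alpha> * (2 * (H + g))))"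
      using g2 by (intro summable_mult) (simp add: summable_real_powr_iff)
    fix k assume k: "J \<le> k"
    have "d k powr (2 * (H + g)) \<le> (2 * q k) powr (2 * (H + g))" using J(1)[OF k] d0 H2 g by (intro powr_mono2) auto
    also have "\<dots> = 2 powr (2 * (H + g)) * real k powr (- \<alpha> * (2 * (H + g)))" using q0[OF k] by (simp add: powr_mult q_def powr_powr)
    finally show "norm (d k powr (2 * (H + g))) \<le> 2 powr (2 * (H + g)) * real k powr (- \<alpha> * (2 * (H + g)))" by simp
  qed
  define L where "L = (\<lambda>j om. l (\<lambda>t. B t om) j)"
  have ab: "0 \<le> \<tau> (Suc j) \<and> \<tau> (Suc j) \<le> \<tau> j \<and> \<tau> j \<le> 1" for j using \<tau>(1)[of j] \<tau>(1)[of "Suc j"] \<tau>'[of j] by simp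
  have dis: "\<tau> j \<le> \<tau> (Suc k) \<or> \<tau> k \<le> \<tau> (Suc j)" if "j \<noteq> k" for j k
    using that \<tau>(2) by (cases "j < k") (auto simp: decseq_def)
  have L1: "(\<lambda>om. \<Sum>j\<in>S. L j om) \<in> borel_measurable M" "integrable M (\<lambda>om. (\<Sum>j\<in>S. L j om)\<^sup>2)" "integrable M (\<lambda>om. \<Sum>j\<in>S. L j om)"
    "variance (\<lambda>om. \<Sum>j\<in>S. L j om) \<le> (\<Sum>j\<in>S. v j)" if "finite S" for S
  proof -
    note VS = variance_sum_lncosh[where S=S and a="\<lambda>j. \<tau> (Suc j)" and b=\<tau>, OF that _ _ K g(1)]
    show "(\<lambda>om. \<Sum>j\<in>S. L j om) \<in> borel_measurable M" unfolding L_def l_def by (rule VS(1)) (use ab dis in blast)+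
    show "integrable M (\<lambda>om. (\<Sum>j\<in>S. L j om)\<^sup>2)" unfolding L_def l_def by (rule VS(2)) (use ab dis in blast)+
    show "integrable M (\<lambda>om. \<Sum>j\<in>S. L j om)" unfolding L_def l_def by (rule VS(3)) (use ab dis in blast)+
    show "variance (\<lambda>om. \<Sum>j\<in>S. L j om) \<le> (\<Sum>j\<in>S. v j)" unfolding L_def l_def v_def d_def sum_distrib_left[symmetric] by (rule VS(4)) (use ab dis in blast)+
  qed
  have L0: "0 \<le> L j om" for j om unfolding L_def l_def by (rule lncosh_bounds(1))
  define p where "p = 1 - 2 * \<alpha> * H"
  have p: "0 < p" "p \<le> 1" "\<theta> < p" unfolding p_def using \<alpha> \<alpha>0 H2 by (auto intro: less_trans)
  \<comment> \<open>\<open>std_normal_tail / 4\<close> comes from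
    \<open>expectation_lncosh_rise\<close>, \<open>(1/2) powr (2 * H)\<close> from d >= q/2, and the
    final 1/2 from keeping only the indices j >= J, at least half of those below n.\<close>
  define b where "b = std_normal_tail / 4 * (1/2) powr (2 * H) / 2"
  have b: "0 < b" unfolding b_def using std_normal_tail_pos by simp
  have grow: "eventually (\<lambda>n. b * real n powr p \<le> expectation (\<lambda>om. \<Sum>j<n. L j om)) sequentially"
    unfolding eventually_sequentially
  proof (intro exI[of _ "2 * J + 1"] allI impI)
    fix n assume n: "2 * J + 1 \<le> n"
    have Lj: "integrable M (L j)" for j using L1(3)[of "{j}"] by simp
    have one: "std_normal_tail / 4 * ((1/2) powr (2 * H) * real n powr (- \<alpha> * (2 * H))) \<le> expectation (L j)" if j: "j \<in> {J..<n}" for j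
    proof -
      have Jj: "J \<le> j" using j by simp
      have "real n powr (- \<alpha>) \<le> q j" unfolding q_def using j J(3)[OF Jj] \<alpha>0 by (intro powr_mono2') auto
      then have "(1/2 * real n powr (- \<alpha>)) powr (2 * H) \<le> (d j) powr (2 * H)" using J(2)[OF Jj] H2 by (intro powr_mono2) auto
      moreover have "(1/2 * real n powr (- \<alpha>)) powr (2 * H) = (1/2) powr (2 * H) * real n powr (- \<alpha> * (2 * H))"
        by (subst powr_mult) (simp_all only: powr_powr powr_ge_zero minus_mult_left)
      ultimately have "std_normal_tail / 4 * ((1/2) powr (2 * H) * real n powr (- \<alpha> * (2 * H))) \<le> std_normal_tail / 4 * (d j) powr (2 * H)"
        using std_normal_tail_pos by (intro mult_left_mono) auto
      also have "\<dots> \<le> expectation (L j)"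
        unfolding d_def L_def l_def
      proof (rule expectation_lncosh_rise)
        show "0 \<le> \<tau> (Suc j)" "\<tau> j \<le> 1" using ab[of j] by auto
        show "\<tau> (Suc j) < \<tau> j" using J(2)[OF Jj] q0[OF Jj] by (simp add: d_def)
        show "integrable M (\<lambda>om. lncosh (rise (\<tau> (Suc j)) (\<tau> j) (\<lambda>t. B t om)))" using Lj[of j] by (simp add: L_def[abs_def] l_def)
      qed
      finally show ?thesis .
    qed
    have "b * real n powr p = b * (real n * real n powr (- \<alpha> * (2 * H)))"
      using n unfolding p_def by (simp add: powr_diff powr_minus divide_inverse mult.assoc mult.left_commute)
    also have "\<dots> = real n / 2 * (std_normal_tail / 4 * ((1/2) powr (2 * H) * real n powr (- \<alpha> * (2 * H))))" unfolding b_def by simp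
    also have "\<dots> \<le> real (n - J) * (std_normal_tail / 4 * ((1/2) powr (2 * H) * real n powr (- \<alpha> * (2 * H))))"
      using n std_normal_tail_pos by (intro mult_right_mono) auto
    also have "\<dots> = (\<Sum>j\<in>{J..<n}. std_normal_tail / 4 * ((1/2) powr (2 * H) * real n powr (- \<alpha> * (2 * H))))" by simp
    also have "\<dots> \<le> (\<Sum>j\<in>{J..<n}. expectation (L j))" by (rule sum_mono[OF one])
    also have "\<dots> \<le> (\<Sum>j<n. expectation (L j))" using L0 by (intro sum_mono2 integral_nonneg_AE) auto
    also have "\<dots> = expectation (\<lambda>om. \<Sum>j<n. L j om)" using Lj by simp
    finally show "b * real n powr p \<le> expectation (\<lambda>om. \<Sum>j<n. L j om)" .
  qed
  have AE2: "AE om in M. eventually (\<lambda>n. b / 4 * real n powr p \<le> (\<Sum>j<n. L j om)) sequentially"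
    by (rule sums_grow[OF L1(1,2,4) v v0 L0 p(1,2) b grow])
  obtain N where N: "filterlim N at_top sequentially"
    "AE om in M. convergent (\<lambda>i. (\<Sum>j<N i. L j om) - expectation (\<lambda>om. \<Sum>j<N i. L j om))"
    using centered_sums_converge_along[OF L1(1,2,4) v] by blast
  define c where "c = (\<lambda>i. expectation (\<lambda>om. \<Sum>j<N i. L j om))"
  have b4: "0 < b / 4" using b by simp
  have A: "AE om in M. convergent (\<lambda>i. (\<Sum>j<N i. l (\<lambda>t. B t om) j) - c i)
     \<and> eventually (\<lambda>n. b / 4 * real n powr p \<le> (\<Sum>j<n. l (\<lambda>t. B t om) j)) sequentially"
    using N(2) AE2 unfolding L_def c_def by (rule AE_conjI)
  have p1: "AE om in M. \<forall>k. scale (l (\<lambda>t. B t om)) N c k = scale (l (\<lambda>t. B t om)) N c (Suc k) * exp (l (\<lambda>t. B t om) k)"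
      using A by eventually_elim (intro allI scale_props(1)[OF N(1) _ _ b4 \<alpha>(3) p(3)], auto)
  have p2: "AE om in M. scale (l (\<lambda>t. B t om)) N c \<longlonglongrightarrow> 0"
      using A by eventually_elim (rule scale_props(2)[OF N(1) _ _ b4 \<alpha>(3) p(3)], auto)
  have p3: "AE om in M. \<forall>\<eta>. eventually (\<lambda>k. \<eta> * scale (l (\<lambda>t. B t om)) N c k \<le> exp (- (real k powr \<theta>))) sequentially"
      using A by eventually_elim (intro allI scale_props(3)[OF N(1) _ _ b4 \<alpha>(3) p(3)], auto)
  show ?thesis by (rule that[OF dec p1 p2 p3])
qed

end

section \<open>Small balls and rises\<close>

text \<open>Read as a formula for exp (- |y|^2 / 2) as an average of cosines, it lets the
  characteristic function of the increments enter \<open>small_ball\<close>.\<close>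

lemma std_gauss_cos:
  fixes y :: "'i => real"
  assumes I: "finite I"
  shows "(\<integral>\<xi>. cos (\<Sum>i\<in>I. \<xi> i * y i) \<partial>PiM I (\<lambda>_. std_normal_distribution)) = exp (- (\<Sum>i\<in>I. (y i)\<^sup>2) / 2)"
proof -
  interpret R: real_distribution std_normal_distribution by (rule real_dist_normal_dist)
  interpret PF: product_prob_space "\<lambda>_::'i. std_normal_distribution" I ..
  have iexp_int: "integrable std_normal_distribution (\<lambda>x. iexp (y i * x))" for i
    by (rule R.integrable_iexp) simp_all
  have e: "iexp (\<Sum>i\<in>I. \<xi> i * y i) = (\<Prod>i\<in>I. iexp (y i * \<xi> i))" for \<xi>
    using I by (simp add: exp_sum[symmetric] sum_distrib_left mult.commute)
  have "(\<integral>\<xi>. iexp (\<Sum>i\<in>I. \<xi> i * y i) \<partial>PiM I (\<lambda>_. std_normal_distribution)) = (\<Prod>i\<in>I. (\<integral>x. iexp (y i * x) \<partial>std_normal_distribution))"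
    unfolding e by (rule PF.product_integral_prod[OF I iexp_int])
  also have "\<dots> = (\<Prod>i\<in>I. char std_normal_distribution (y i))" by (simp add: char_def)
  also have "\<dots> = (\<Prod>i\<in>I. complex_of_real (exp (- (y i)\<^sup>2 / 2)))" by (simp add: char_std_normal_distribution)
  also have "\<dots> = complex_of_real (exp (- (\<Sum>i\<in>I. (y i)\<^sup>2) / 2))"
  proof -
    have "(\<Sum>i\<in>I. - (y i)\<^sup>2 / 2) = - (\<Sum>i\<in>I. (y i)\<^sup>2) / 2" by (simp add: sum_negf sum_divide_distrib)
    then show ?thesis using I by (simp only: of_real_prod[symmetric] exp_sum[symmetric])
  qed
  finally have c: "(\<integral>\<xi>. iexp (\<Sum>i\<in>I. \<xi> i * y i) \<partial>PiM I (\<lambda>_. std_normal_distribution)) = complex_of_real (exp (- (\<Sum>i\<in>I. (y i)\<^sup>2) / 2))" .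
  have m: "(\<lambda>\<xi>. \<Sum>i\<in>I. \<xi> i * y i) \<in> borel_measurable (PiM I (\<lambda>_. std_normal_distribution))"
  proof (intro borel_measurable_sum borel_measurable_times borel_measurable_const)
    fix i assume i: "i \<in> I"
    have "(\<lambda>\<xi>. \<xi> i) \<in> measurable (PiM I (\<lambda>_. std_normal_distribution)) std_normal_distribution" by (rule measurable_component_singleton[OF i])
    then show "(\<lambda>\<xi>. \<xi> i) \<in> borel_measurable (PiM I (\<lambda>_. std_normal_distribution))" by simp
  qed
  have "integrable (PiM I (\<lambda>_. std_normal_distribution)) (\<lambda>\<xi>. iexp (\<Sum>i\<in>I. \<xi> i * y i))"
  proof (rule finite_measure.integrable_const_bound[OF prob_space.finite_measure[OF prob_space_PiM[OF R.prob_space_axioms]], where B=1])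
    have "iexp \<in> borel_measurable borel" by (intro borel_measurable_continuous_onI continuous_intros)
    then show "(\<lambda>\<xi>. iexp (\<Sum>i\<in>I. \<xi> i * y i)) \<in> borel_measurable (PiM I (\<lambda>_. std_normal_distribution))" by (rule measurable_compose[OF m])
  qed (simp add: AE_I2)
  then have "(\<integral>\<xi>. Re (iexp (\<Sum>i\<in>I. \<xi> i * y i)) \<partial>PiM I (\<lambda>_. std_normal_distribution)) = Re (\<integral>\<xi>. iexp (\<Sum>i\<in>I. \<xi> i * y i) \<partial>PiM I (\<lambda>_. std_normal_distribution))"
    by (rule integral_Re)
  then show ?thesis unfolding c Re_complex_of_real by (simp add: Re_exp)
qed

lemma std_gauss_exp:
  assumes I: "finite (I :: 'i set)" and \<theta>: "0 \<le> \<theta>"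
  shows "(\<integral>\<xi>. exp (- (\<theta> * (\<Sum>i\<in>I. (\<xi> i)\<^sup>2)) / 2) \<partial>PiM I (\<lambda>_. std_normal_distribution)) = (1 / sqrt (1 + \<theta>)) ^ card I"
    "integrable (PiM I (\<lambda>_. std_normal_distribution)) (\<lambda>\<xi>. exp (- (\<theta> * (\<Sum>i\<in>I. (\<xi> i)\<^sup>2)) / 2))"
proof -
  interpret R: real_distribution std_normal_distribution by (rule real_dist_normal_dist)
  interpret PF: product_prob_space "\<lambda>_::'i. std_normal_distribution" I ..
  have int: "integrable std_normal_distribution (\<lambda>x. exp (- (\<theta> * x\<^sup>2) / 2))"
    using \<theta> by (intro R.integrable_const_bound[where B=1]) (auto intro!: AE_I2)
  define s where "s = 1 / sqrt (1 + \<theta>)"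
  have s0: "0 < s" "s\<^sup>2 = 1 / (1 + \<theta>)" using \<theta> by (auto simp: s_def power_divide)
  have "(\<integral>x. exp (- (\<theta> * x\<^sup>2) / 2) \<partial>std_normal_distribution) = (\<integral>x. std_normal_density x * exp (- (\<theta> * x\<^sup>2) / 2) \<partial>lborel)"
    by (subst integral_density) auto
  also have "(\<lambda>x. std_normal_density x * exp (- (\<theta> * x\<^sup>2) / 2)) = (\<lambda>x. s * normal_density 0 s x)"
  proof
    fix x
    have "- x\<^sup>2 / 2 + - (\<theta> * x\<^sup>2) / 2 = - x\<^sup>2 / (2 * s\<^sup>2)" using \<theta> unfolding s0 by (simp add: field_simps)
    then have "exp (- x\<^sup>2 / 2) * exp (- (\<theta> * x\<^sup>2) / 2) = exp (- x\<^sup>2 / (2 * s\<^sup>2))" by (simp add: exp_add[symmetric])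
    moreover have "sqrt (2 * pi * s\<^sup>2) = sqrt (2 * pi) * s" using s0(1) by (simp only: real_sqrt_mult real_sqrt_abs abs_of_pos)
    ultimately show "std_normal_density x * exp (- (\<theta> * x\<^sup>2) / 2) = s * normal_density 0 s x"
      using s0(1) unfolding normal_density_def std_normal_density_def by simp
  qed
  also have "(\<integral>x. s * normal_density 0 s x \<partial>lborel) = s" using s0 by simp
  finally have one: "(\<integral>x. exp (- (\<theta> * x\<^sup>2) / 2) \<partial>std_normal_distribution) = s" .
  have e: "exp (- (\<theta> * (\<Sum>i\<in>I. (\<xi> i)\<^sup>2)) / 2) = (\<Prod>i\<in>I. exp (- (\<theta> * (\<xi> i)\<^sup>2) / 2))" for \<xi>
    using I by (simp only: exp_sum[symmetric] sum_distrib_left sum_negf[symmetric] sum_divide_distrib)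
  show "(\<integral>\<xi>. exp (- (\<theta> * (\<Sum>i\<in>I. (\<xi> i)\<^sup>2)) / 2) \<partial>PiM I (\<lambda>_. std_normal_distribution)) = (1 / sqrt (1 + \<theta>)) ^ card I"
    unfolding e PF.product_integral_prod[OF I int] one by (simp add: s_def)
  show "integrable (PiM I (\<lambda>_. std_normal_distribution)) (\<lambda>\<xi>. exp (- (\<theta> * (\<Sum>i\<in>I. (\<xi> i)\<^sup>2)) / 2))"
    unfolding e by (rule PF.product_integrable_prod[OF I int])
qed

context fbm
begin

text \<open>A lower bound, for unit spacing, for every row sum of the covariance matrix of N
  consecutive increments.\<close>

definition rowsum :: "nat => real" where
  "rowsum N = (real N powr (2 * H) - (real N - 1) powr (2 * H)) / 2"

lemma rowsum_pos: "1 \<le> N ==> 0 < rowsum N"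
  using H unfolding rowsum_def by (simp add: powr_less_mono2)

text \<open>Off-diagonal covariances are nonpositive, so u_i u_j <= (u_i^2 + u_j^2)/2 bounds the
  form below by the u_i^2 weighted with the row sums. A row sum telescopes to the covariance with
  the whole increment and is bounded below by concavity of x^(2 H).\<close>

lemma increment_form_bound:
  assumes d: "0 < d" and N: "1 \<le> N"
  shows "rowsum N * d powr (2 * H) * (\<Sum>i<N. (u i)\<^sup>2) \<le>
    (\<Sum>i<N. \<Sum>j<N. u i * u j * cov (a + real i * d) (a + real (Suc i) * d) (a + real j * d) (a + real (Suc j) * d))"
proof -
  define c where "c = (\<lambda>i j. cov (a + real i * d) (a + real (Suc i) * d) (a + real j * d) (a + real (Suc j) * d))"
  have sym: "c i j = c j i" for i j unfolding c_def cov_def by (simp add: abs_minus_commute)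
  have neg: "c i j \<le> 0" if "i \<noteq> j" for i j
  proof -
    have le: "a + real (Suc i) * d \<le> a + real j * d" if "i < j" for i j
    proof -
      have "real (Suc i) * d \<le> real j * d" using that d by (intro mult_right_mono) auto
      then show ?thesis by simp
    qed
    have st: "a + real i * d \<le> a + real (Suc i) * d" for i using d by (simp add: algebra_simps)
    show ?thesis
    proof (cases "i < j")
      case True
      show ?thesis unfolding c_def by (rule cov_disjoint_nonpos(2)[OF st le[OF True] st])
    next
      case False
      then have "j < i" using that by simp
      show ?thesis unfolding c_def by (rule cov_disjoint_nonpos(1)[OF st le[OF \<open>j < i\<close>] st])
    qed
  qed
  have row: "rowsum N * d powr (2 * H) \<le> (\<Sum>j<N. c i j)" if i: "i < N" for i
  proof -
    define G where "G = (\<lambda>j::nat. (\<bar>a + real i * d - (a + real j * d)\<bar> powr (2 * H) - \<bar>a + real (Suc i) * d - (a + real j * d)\<bar> powr (2 * H)) / 2)"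
    have "(\<Sum>j<N. c i j) = (\<Sum>j<N. G (Suc j) - G j)"
      unfolding c_def cov_def G_def by (intro sum.cong refl) (simp add: field_simps)
    also have "\<dots> = G N - G 0" by (rule sum_lessThan_telescope)
    also have "\<dots> = (((real N - real i) * d) powr (2 * H) - ((real N - real (Suc i)) * d) powr (2 * H)
        + ((real (Suc i)) * d) powr (2 * H) - (real i * d) powr (2 * H)) / 2"
    proof -
      have 1: "\<bar>a + real i * d - (a + real N * d)\<bar> = (real N - real i) * d" "\<bar>a + real (Suc i) * d - (a + real N * d)\<bar> = (real N - real (Suc i)) * d"
      proof -
        have "0 \<le> (real N - real i) * d" "0 \<le> (real N - real (Suc i)) * d" using i d by (auto intro!: mult_nonneg_nonneg)
        moreover have "a + real i * d - (a + real N * d) = - ((real N - real i) * d)" "a + real (Suc i) * d - (a + real N * d) = - ((real N - real (Suc i)) * d)"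
          by (simp_all add: algebra_simps)
        ultimately show "\<bar>a + real i * d - (a + real N * d)\<bar> = (real N - real i) * d" "\<bar>a + real (Suc i) * d - (a + real N * d)\<bar> = (real N - real (Suc i)) * d"
          by (simp_all only: abs_minus_cancel abs_of_nonneg)
      qed
      have 2: "\<bar>a + real k * d - (a + real 0 * d)\<bar> = real k * d" for k using d by simp
      show ?thesis unfolding G_def 1 2 by (simp add: field_simps)
    qed
    also have "\<dots> = d powr (2 * H) * (((real N - real i) powr (2 * H) - (real N - real (Suc i)) powr (2 * H)) + ((real i + 1) powr (2 * H) - real i powr (2 * H))) / 2"
    proof -
      have p: "(x * d) powr (2 * H) = d powr (2 * H) * x powr (2 * H)" if "0 \<le> x" for x using d that by (simp add: powr_mult)
      have "0 \<le> real N - real i" "0 \<le> real N - real (Suc i)" "0 \<le> real (Suc i)" "0 \<le> real i" "real (Suc i) = real i + 1" using i by auto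
      then show ?thesis by (simp only: p) (simp only: right_diff_distrib distrib_left add_diff_eq)
    qed
    also have "\<dots> \<ge> d powr (2 * H) * (0 + (real N powr (2 * H) - (real N - 1) powr (2 * H))) / 2"
    proof -
      have "(real N - real (Suc i)) powr (2 * H) \<le> (real N - real i) powr (2 * H)" using i H by (intro powr_mono2) auto
      moreover have "((real N - 1) + 1) powr (2 * H) - (real N - 1) powr (2 * H) \<le> (real i + 1) powr (2 * H) - real i powr (2 * H)"
        using i H by (intro concave_increment) auto
      ultimately have "0 + (real N powr (2 * H) - (real N - 1) powr (2 * H)) \<le> ((real N - real i) powr (2 * H) - (real N - real (Suc i)) powr (2 * H)) + ((real i + 1) powr (2 * H) - real i powr (2 * H))"
        by simp
      from mult_left_mono[OF this, of "d powr (2 * H)"] show ?thesis by (intro divide_right_mono) auto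
    qed
    finally show ?thesis unfolding rowsum_def by (simp add: mult.commute)
  qed
  have "(\<Sum>i<N. \<Sum>j<N. c i j * (((u i)\<^sup>2 + (u j)\<^sup>2) / 2)) \<le> (\<Sum>i<N. \<Sum>j<N. u i * u j * c i j)"
  proof (intro sum_mono)
    fix i j
    show "c i j * (((u i)\<^sup>2 + (u j)\<^sup>2) / 2) \<le> u i * u j * c i j"
    proof (cases "i = j")
      case False
      have "u i * u j \<le> ((u i)\<^sup>2 + (u j)\<^sup>2) / 2" using sum_squares_bound[of "u i" "u j"] by simp
      from mult_left_mono_neg[OF this neg[OF False]] show ?thesis by (simp add: mult.commute)
    qed (simp add: power2_eq_square mult.commute)
  qed
  moreover have "(\<Sum>i<N. \<Sum>j<N. c i j * (((u i)\<^sup>2 + (u j)\<^sup>2) / 2)) = (\<Sum>i<N. (u i)\<^sup>2 * (\<Sum>j<N. c i j))"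
  proof -
    have "(\<Sum>i<N. \<Sum>j<N. c i j * (u j)\<^sup>2) = (\<Sum>j<N. \<Sum>i<N. c i j * (u j)\<^sup>2)" by (rule sum.swap)
    also have "\<dots> = (\<Sum>i<N. \<Sum>j<N. c i j * (u i)\<^sup>2)" by (simp add: sym)
    finally show ?thesis
      by (simp add: add_divide_distrib distrib_left sum.distrib sum_divide_distrib[symmetric]) (simp add: sum_distrib_left sum_distrib_right mult.commute)
  qed
  moreover have "rowsum N * d powr (2 * H) * (\<Sum>i<N. (u i)\<^sup>2) \<le> (\<Sum>i<N. (u i)\<^sup>2 * (\<Sum>j<N. c i j))"
    unfolding sum_distrib_left[of "rowsum N * d powr (2 * H)"]
  proof (rule sum_mono)
    fix i assume "i \<in> {..<N}"
    then have "(u i)\<^sup>2 * (rowsum N * d powr (2 * H)) \<le> (u i)\<^sup>2 * (\<Sum>j<N. c i j)" by (intro mult_left_mono row) auto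
    then show "rowsum N * d powr (2 * H) * (u i)\<^sup>2 \<le> (u i)\<^sup>2 * (\<Sum>j<N. c i j)" by (simp only: mult.commute)
  qed
  ultimately show ?thesis unfolding c_def by linarith
qed

text \<open>Let y be the increments divided by \<eta>. On the event, |y|^2 <= N, so its probability
  is at most exp (N/2) times the mean of exp (- |y|^2 / 2). Writing that as a Gaussian average of
  cosines and exchanging the integrals leaves exp of minus half the covariance form, and
  \<open>increment_form_bound\<close> reduces it to a product of one-dimensional integrals.\<close>

lemma small_ball:
  assumes a: "0 \<le> a" "0 < d" "a + real N * d \<le> 1" "1 \<le> N" and \<eta>: "0 < \<eta>"
  shows "prob {om\<in>space M. \<forall>j<N. \<bar>B (a + real (Suc j) * d) om - B (a + real j * d) om\<bar> \<le> \<eta>}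
    \<le> (exp 1 / sqrt (rowsum N) * (\<eta> / d powr H)) ^ N"
proof -
  define X where "X = (\<lambda>j om. B (a + real (Suc j) * d) om - B (a + real j * d) om)"
  define A where "A = {om\<in>space M. \<forall>j<N. \<bar>X j om\<bar> \<le> \<eta>}"
  let ?G = "PiM {..<N} (\<lambda>_::nat. std_normal_distribution)"
  interpret R: real_distribution std_normal_distribution by (rule real_dist_normal_dist)
  interpret PF: product_prob_space "\<lambda>_::nat. std_normal_distribution" "{..<N}" ..
  interpret G: prob_space ?G by (intro prob_space_PiM R.prob_space_axioms)
  interpret MG: pair_prob_space M ?G ..
  have pt: "a + real j * d \<in> {0..1}" if "j \<le> N" for j
  proof -
    have "real j * d \<le> real N * d" using that a by (intro mult_right_mono) auto
    moreover have "0 \<le> real j * d" using a by simp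
    ultimately show ?thesis unfolding atLeastAtMost_iff using a by linarith
  qed
  have pt': "a + real j * d \<in> {0..1}" "a + real (Suc j) * d \<in> {0..1}" if "j \<in> {..<N}" for j using pt[of j] pt[of "Suc j"] that by auto
  have Xm[measurable]: "X j \<in> borel_measurable M" if "j < N" for j
    unfolding X_def using pt'[of j] that by (intro borel_measurable_diff B_meas) auto
  have Am: "A \<in> events" unfolding A_def using Xm by measurable
  define y where "y = (\<lambda>om j. X j om / \<eta>)"
  have ym: "(\<lambda>om. y om j) \<in> borel_measurable M" if "j < N" for j unfolding y_def using Xm[OF that] by simp
  have Em: "(\<lambda>om. exp (- (\<Sum>j<N. (y om j)\<^sup>2) / 2)) \<in> borel_measurable M" using ym by measurable
  have EI: "integrable M (\<lambda>om. exp (- (\<Sum>j<N. (y om j)\<^sup>2) / 2))"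
    by (rule integrable_const_bound[where B=1]) (use Em in \<open>auto intro!: AE_I2 sum_nonneg\<close>)
  have "prob A = expectation (indicator A)" using Am by simp
  also have "\<dots> \<le> expectation (\<lambda>om. exp (real N / 2) * exp (- (\<Sum>j<N. (y om j)\<^sup>2) / 2))"
  proof (rule integral_mono)
    show "integrable M (indicator A :: _ => real)" using Am by (simp add: less_top[symmetric])
    show "integrable M (\<lambda>om. exp (real N / 2) * exp (- (\<Sum>j<N. (y om j)\<^sup>2) / 2))" using EI by simp
    fix om
    show "indicator A om \<le> exp (real N / 2) * exp (- (\<Sum>j<N. (y om j)\<^sup>2) / 2)"
    proof (cases "om \<in> A")
      case True
      have "(\<Sum>j<N. (y om j)\<^sup>2) \<le> (\<Sum>j<N. 1)"
      proof (rule sum_mono)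
        fix j assume "j \<in> {..<N}"
        then have "\<bar>y om j\<bar> \<le> 1" using True \<eta> by (simp add: A_def y_def)
        then show "(y om j)\<^sup>2 \<le> 1" by (simp add: abs_square_le_1)
      qed
      then show ?thesis using True by (simp add: exp_add[symmetric])
    qed simp
  qed
  also have "\<dots> = exp (real N / 2) * expectation (\<lambda>om. \<integral>\<xi>. cos (\<Sum>i<N. \<xi> i * y om i) \<partial>?G)"
    by (simp add: std_gauss_cos)
  also have "expectation (\<lambda>om. \<integral>\<xi>. cos (\<Sum>i<N. \<xi> i * y om i) \<partial>?G) = (\<integral>\<xi>. expectation (\<lambda>om. cos (\<Sum>i<N. \<xi> i * y om i)) \<partial>?G)"
  proof (rule MG.Fubini_integral[symmetric])
    have c: "(\<lambda>p. snd p i) \<in> borel_measurable (M \<Otimes>\<^sub>M ?G)" if "i < N" for i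
    proof -
      have "(\<lambda>\<xi>. \<xi> i) \<in> measurable ?G std_normal_distribution" by (rule measurable_component_singleton) (use that in simp)
      then have "(\<lambda>\<xi>. \<xi> i) \<in> borel_measurable ?G" by simp
      then show ?thesis by (rule measurable_compose[OF measurable_snd])
    qed
    have y1: "(\<lambda>p. y (fst p) i) \<in> borel_measurable (M \<Otimes>\<^sub>M ?G)" if "i < N" for i by (rule measurable_compose[OF measurable_fst ym[OF that]])
    have "(\<lambda>p. cos (\<Sum>i<N. snd p i * y (fst p) i)) \<in> borel_measurable (M \<Otimes>\<^sub>M ?G)" using c y1
      by (intro measurable_compose[OF _ borel_measurable_continuous_onI[OF continuous_on_cos[OF continuous_on_id]]] borel_measurable_sum borel_measurable_times) auto
    then show "integrable (M \<Otimes>\<^sub>M ?G) (\<lambda>(om, \<xi>). cos (\<Sum>i<N. \<xi> i * y om i))"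
      by (intro MG.integrable_const_bound[where B=1]) (auto simp: split_beta' intro!: AE_I2)
  qed
  also have "\<dots> \<le> (\<integral>\<xi>. exp (- (rowsum N * d powr (2 * H) / \<eta>\<^sup>2 * (\<Sum>i<N. (\<xi> i)\<^sup>2)) / 2) \<partial>?G)"
  proof -
    have le: "expectation (\<lambda>om. cos (\<Sum>i<N. \<xi> i * y om i)) \<le> exp (- (rowsum N * d powr (2 * H) / \<eta>\<^sup>2 * (\<Sum>i<N. (\<xi> i)\<^sup>2)) / 2)"
      and ge: "0 \<le> expectation (\<lambda>om. cos (\<Sum>i<N. \<xi> i * y om i))" for \<xi>
    proof -
      note gi = increments_gaussian[where I="{..<N}" and s="\<lambda>j. a + real j * d" and t="\<lambda>j. a + real (Suc j) * d" and c="\<lambda>j. \<xi> j / \<eta>", OF finite_lessThan pt']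
      have e: "(\<Sum>i<N. \<xi> i * y om i) = (\<Sum>i<N. \<xi> i / \<eta> * (B (a + real (Suc i) * d) om - B (a + real i * d) om))" for om
        by (simp add: y_def X_def)
      have v: "expectation (\<lambda>om. cos (\<Sum>i<N. \<xi> i * y om i)) =
          exp (- (\<Sum>i<N. \<Sum>j<N. \<xi> i / \<eta> * (\<xi> j / \<eta>) * cov (a + real i * d) (a + real (Suc i) * d) (a + real j * d) (a + real (Suc j) * d)) / 2)"
        unfolding e using centered_gaussian(3)[OF gi(1,2), of 0] by (simp only: gi(3) add_0_right cos_zero mult_1)
      show "0 \<le> expectation (\<lambda>om. cos (\<Sum>i<N. \<xi> i * y om i))" unfolding v by simp
      have "rowsum N * d powr (2 * H) / \<eta>\<^sup>2 * (\<Sum>i<N. (\<xi> i)\<^sup>2) = rowsum N * d powr (2 * H) * (\<Sum>i<N. (\<xi> i / \<eta>)\<^sup>2)"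
        by (simp add: power_divide sum_divide_distrib[symmetric])
      also have "\<dots> \<le> (\<Sum>i<N. \<Sum>j<N. \<xi> i / \<eta> * (\<xi> j / \<eta>) * cov (a + real i * d) (a + real (Suc i) * d) (a + real j * d) (a + real (Suc j) * d))"
        by (rule increment_form_bound[OF a(2,4)])
      finally show "expectation (\<lambda>om. cos (\<Sum>i<N. \<xi> i * y om i)) \<le> exp (- (rowsum N * d powr (2 * H) / \<eta>\<^sup>2 * (\<Sum>i<N. (\<xi> i)\<^sup>2)) / 2)"
        unfolding v by simp
    qed
    show ?thesis
    proof (rule integral_mono')
      show "integrable ?G (\<lambda>\<xi>. exp (- (rowsum N * d powr (2 * H) / \<eta>\<^sup>2 * (\<Sum>i<N. (\<xi> i)\<^sup>2)) / 2))"
        using rowsum_pos[OF a(4)] by (intro std_gauss_exp(2)) auto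
    qed (use le ge in auto)
  qed
  also have "\<dots> = (1 / sqrt (1 + rowsum N * d powr (2 * H) / \<eta>\<^sup>2)) ^ N"
    using rowsum_pos[OF a(4)] by (subst std_gauss_exp(1)) auto
  also have "\<dots> \<le> (1 / sqrt (rowsum N) * (\<eta> / d powr H)) ^ N"
  proof (rule power_mono)
    have pos: "0 < rowsum N * d powr (2 * H) / \<eta>\<^sup>2" using rowsum_pos[OF a(4)] a \<eta> by simp
    have "d powr (2 * H) = (d powr H)\<^sup>2" by (simp add: power2_eq_square powr_add[symmetric])
    then have "sqrt (rowsum N * d powr (2 * H) / \<eta>\<^sup>2) = sqrt (rowsum N) * d powr H / \<eta>" using \<eta> by (simp add: real_sqrt_mult real_sqrt_divide)
    moreover have "1 / sqrt (1 + rowsum N * d powr (2 * H) / \<eta>\<^sup>2) \<le> 1 / sqrt (rowsum N * d powr (2 * H) / \<eta>\<^sup>2)"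
      using pos by (intro divide_left_mono) auto
    ultimately show "1 / sqrt (1 + rowsum N * d powr (2 * H) / \<eta>\<^sup>2) \<le> 1 / sqrt (rowsum N) * (\<eta> / d powr H)" by simp
    show "0 \<le> 1 / sqrt (1 + rowsum N * d powr (2 * H) / \<eta>\<^sup>2)" using pos by simp
  qed
  finally have "prob A \<le> exp (real N / 2) * (1 / sqrt (rowsum N) * (\<eta> / d powr H)) ^ N" by simp
  \<comment> \<open>Enlarged so that the factor is an N-th power of a simple constant.\<close>
  also have "\<dots> \<le> exp (real N) * (1 / sqrt (rowsum N) * (\<eta> / d powr H)) ^ N"
    using rowsum_pos[OF a(4)] \<eta> a by (intro mult_right_mono) auto
  also have "exp (real N) = exp 1 ^ N" by (simp add: exp_of_nat_mult[symmetric])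
  finally show ?thesis unfolding A_def X_def power_mult_distrib[symmetric] by simp
qed

end

section \<open>From oscillations to rises\<close>

lemma powers_of_half_bracket:
  fixes y :: real
  assumes "0 < y" "y < 1"
  obtains n where "(1/2)^n \<le> y" "y < 2 * (1/2)^n"
proof -
  have "\<exists>n. (1/2)^n \<le> y" using real_arch_pow_inv[of y "1/2"] assms by (auto intro: less_imp_le)
  then have n: "(1/2)^(LEAST n. (1/2)^n \<le> y) \<le> y" by (rule LeastI_ex)
  define n where "n = (LEAST n. (1/2)^n \<le> y)"
  have "n \<noteq> 0" using n assms unfolding n_def[symmetric] by (intro notI) simp
  then obtain m where m: "n = Suc m" by (cases n) auto
  have "\<not> (1/2)^m \<le> y" by (rule not_less_Least) (simp add: n_def[symmetric] m)
  then show ?thesis using that[of n] n m unfolding n_def[symmetric] by simp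
qed

text \<open>If no rise in an interval of length \<open>D\<close> reached \<open>D powr h\<close>, every dyadic block of length
  about \<open>D powr e\<close>, having oscillation at least \<open>b powr h'\<close>, would have to go down by half of that, and
  the blocks together would contradict the Hoelder bound.\<close>

lemma oscillation_imp_upward:
  fixes w :: "real => real"
  assumes hol: "\<And>x y. 0 \<le> x ==> x \<le> y ==> y \<le> 1 ==> \<bar>w y - w x\<bar> \<le> C * (y - x) powr \<kappa>" and C: "0 < C"
    and osc: "\<And>n i. n0 \<le> n ==> i < 2^n ==>
      \<exists>p q. real i * (1/2)^n \<le> p \<and> p \<le> q \<and> q \<le> real (Suc i) * (1/2)^n \<and> ((1/2)^n) powr h' \<le> \<bar>w q - w p\<bar>"
    and par: "0 < h'" "h' < 1" "0 < \<epsilon>" "1 < e" "e = (1 - \<kappa>) / (1 - h') + \<epsilon>" "h = h' * e + \<epsilon>" "0 < \<kappa>"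
  obtains D0 where "0 < D0" "D0 \<le> 1"
    "\<And>a D. 0 \<le> a ==> 0 < D ==> D \<le> D0 ==> a + D \<le> 1 ==> \<exists>s t. a \<le> s \<and> s \<le> t \<and> t \<le> a + D \<and> D powr h \<le> w t - w s"
proof -
  have e1: "0 < e - 1" using par by simp
  have l: "((\<lambda>D::real. D powr \<epsilon>) \<longlongrightarrow> 0) (at_right 0)" "((\<lambda>D::real. D powr (e - 1)) \<longlongrightarrow> 0) (at_right 0)" "((\<lambda>D::real. D powr (\<epsilon> * (1 - h'))) \<longlongrightarrow> 0) (at_right 0)"
    using par e1 by (auto intro!: tendsto_eq_intros tendsto_powr2 simp: eventually_at_filter)
  have "eventually (\<lambda>D::real. 0 < D \<and> D < (1/2)^n0 \<and> D < 1 \<and> D powr \<epsilon> < 1/8 \<and> D powr (e - 1) < 1/4 \<and> D powr (\<epsilon> * (1 - h')) < 1 / (4 * C)) (at_right 0)"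
  proof -
    have "eventually (\<lambda>D::real. D powr \<epsilon> < 1/8) (at_right 0)" by (rule order_tendstoD(2)[OF l(1)]) simp
    moreover have "eventually (\<lambda>D::real. D powr (e - 1) < 1/4) (at_right 0)" by (rule order_tendstoD(2)[OF l(2)]) simp
    moreover have "eventually (\<lambda>D::real. D powr (\<epsilon> * (1 - h')) < 1 / (4 * C)) (at_right 0)" by (rule order_tendstoD(2)[OF l(3)]) (use C in simp)
    moreover have "eventually (\<lambda>D::real. D \<in> {0<..<min 1 ((1/2)^n0)}) (at_right 0)" by (rule eventually_at_right_real) simp
    ultimately show ?thesis by eventually_elim simp
  qed
  then obtain D1 where D1: "0 < D1" "\<And>D. 0 < D ==> D < D1 ==> D < (1/2)^n0 \<and> D < 1 \<and> D powr \<epsilon> < 1/8 \<and> D powr (e - 1) < 1/4 \<and> D powr (\<epsilon> * (1 - h')) < 1 / (4 * C)"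
    unfolding eventually_at_right_field by auto
  define D0 where "D0 = min 1 (D1 / 2)"
  show ?thesis
  proof (rule that[of D0])
    show "0 < D0" "D0 \<le> 1" using D1 by (auto simp: D0_def)
    fix a D :: real assume a: "0 \<le> a" "0 < D" "D \<le> D0" "a + D \<le> 1"
    have D: "D < (1/2)^n0" "D < 1" "D powr \<epsilon> < 1/8" "D powr (e - 1) < 1/4" "D powr (\<epsilon> * (1 - h')) < 1 / (4 * C)"
      using D1(2)[of D] a D1(1) by (auto simp: D0_def)
    have De: "D powr e \<le> D / 4"
    proof -
      have "D powr e = D * D powr (e - 1)" using a by (simp add: powr_diff)
      also have "\<dots> \<le> D * (1/4)" using D a by (intro mult_left_mono) auto
      finally show ?thesis by simp
    qed
    have De0: "0 < D powr e" using a by simp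
    have De1: "D powr e < 1" using De D(2) by linarith
    \<comment> \<open>The block length 2^(-n) agrees with \<open>D powr e\<close> up to a factor 2;
      as e > 1, it is small compared with D.\<close>
    obtain n where n: "(1/2)^n \<le> D powr e" "D powr e < 2 * (1/2)^n" using powers_of_half_bracket[OF De0 De1] by blast
    define b where "b = (1/2::real)^n"
    have b0: "0 < b" by (simp add: b_def)
    have n0: "n0 \<le> n"
    proof (rule ccontr)
      assume "\<not> n0 \<le> n"
      then have "(1/2::real)^n0 \<le> (1/2)^n" by (intro power_decreasing) auto
      then show False using n(1) De D(1) a by linarith
    qed
    \<comment> \<open>With the factor 1/4, an increment of size at least \<open>b powr h'\<close>
      must be a descent, and the two remaining pieces of the block, each rising by less than
      \<open>b powr h' / 4\<close>, leave a descent of at least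
      \<open>b powr h' / 2\<close>.\<close>
    have \<rho>: "D powr h \<le> b powr h' / 4"
    proof -
      have "D powr h = (D powr e) powr h' * D powr \<epsilon>" unfolding par(6) using a by (simp add: powr_powr powr_add mult.commute)
      also have "\<dots> \<le> (2 * b) powr h' * (1/8)" using n(2) D(3) par a unfolding b_def[symmetric] by (intro mult_mono powr_mono2) auto
      also have "(2 * b) powr h' = 2 powr h' * b powr h'" using b0 by (simp add: powr_mult)
      also have "2 powr h' * b powr h' * (1/8) \<le> 2 powr 1 * b powr h' * (1/8)" using par by (intro mult_right_mono powr_mono) auto
      finally show ?thesis by simp
    qed
    show "\<exists>s t. a \<le> s \<and> s \<le> t \<and> t \<le> a + D \<and> D powr h \<le> w t - w s"
    proof (rule ccontr)
      assume neg: "\<not> ?thesis"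
      have small: "w t - w s < D powr h" if st: "a \<le> s" "s \<le> t" "t \<le> a + D" for s t
      proof (rule ccontr)
        assume "\<not> w t - w s < D powr h"
        then have "D powr h \<le> w t - w s" by simp
        with st neg show False by blast
      qed
      \<comment> \<open>The blocks i0, ..., i0 + m - 1 are those contained in [a, a + D]. Since D /
        b is at least 4, the loss at the two ends leaves m at least D / (2 b).\<close>
      define i0 where "i0 = nat \<lceil>a / b\<rceil>"
      define m where "m = nat \<lfloor>(a + D) / b\<rfloor> - i0"
      have i0: "a / b \<le> real i0" "real i0 \<le> a / b + 1" unfolding i0_def using a b0 by (auto intro: real_nat_ceiling_ge)
      have Db: "4 \<le> D / b" using n(1) De b0 unfolding b_def[symmetric] by (simp add: field_simps)
      have ab0: "0 \<le> (a + D) / b" using a b0 by simp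
      have "real (nat \<lfloor>(a + D) / b\<rfloor>) = real_of_int \<lfloor>(a + D) / b\<rfloor>" using ab0 by (intro of_nat_nat) simp
      then have fl: "(a + D) / b - 1 \<le> real (nat \<lfloor>(a + D) / b\<rfloor>)" "real (nat \<lfloor>(a + D) / b\<rfloor>) \<le> (a + D) / b" by linarith+
      have ab: "(a + D) / b = a / b + D / b" by (simp add: add_divide_distrib)
      have m: "D / b / 2 \<le> real m" "real i0 + real m \<le> (a + D) / b"
      proof -
        have "i0 \<le> nat \<lfloor>(a + D) / b\<rfloor>" using fl(1) i0(2) Db unfolding ab by (subst of_nat_le_iff[symmetric, where 'a=real]) linarith
        then have mm: "real m = real (nat \<lfloor>(a + D) / b\<rfloor>) - real i0" unfolding m_def by simp
        show "real i0 + real m \<le> (a + D) / b" using fl(2) mm by linarith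
        have gen: "y / 2 \<le> m'" if "x + y - 1 \<le> q" "i \<le> x + 1" "4 \<le> y" "m' = q - i" for x y q i m' :: real using that by linarith
        show "D / b / 2 \<le> real m" by (rule gen[OF fl(1)[unfolded ab] i0(2) Db mm[unfolded ab]])
      qed
      have lo: "a \<le> real i * b" if "i0 \<le> i" for i
      proof -
        have "real i0 \<le> real i" using that by simp
        then have "a / b \<le> real i" using i0(1) by linarith
        then show ?thesis using b0 by (simp add: field_simps)
      qed
      have hi: "real i * b \<le> a + D" if "i \<le> i0 + m" for i
      proof -
        have "real i \<le> real i0 + real m" using that by linarith
        then have "real i \<le> (a + D) / b" using m(2) by linarith
        then show ?thesis using b0 by (simp add: field_simps)
      qed
      have block: "w (real (Suc i) * b) - w (real i * b) \<le> - (b powr h' / 2)" if i: "i0 \<le> i" "i < i0 + m" for i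
      proof -
        have "real (Suc i) * b \<le> 1" using hi[of "Suc i"] i a by simp
        then have "real (Suc i) \<le> 2^n" unfolding b_def by (simp add: power_one_over field_simps)
        then have "real (Suc i) \<le> real (2^n)" by (simp only: of_nat_power of_nat_numeral)
        then have "i < 2^n" by (simp only: of_nat_le_iff Suc_le_eq)
        then obtain p q where pq: "real i * b \<le> p" "p \<le> q" "q \<le> real (Suc i) * b" "b powr h' \<le> \<bar>w q - w p\<bar>"
          using osc[OF n0 \<open>i < 2^n\<close>] unfolding b_def[symmetric] by blast
        have l: "a \<le> real i * b" "real (Suc i) * b \<le> a + D" using lo[of i] hi[of "Suc i"] i by auto
        have 1: "w q - w p < D powr h" using pq l by (intro small) auto
        have 2: "w p - w (real i * b) < D powr h" using pq l by (intro small) auto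
        have 3: "w (real (Suc i) * b) - w q < D powr h" using pq l by (intro small) auto
        have bp: "0 < b powr h'" using b0 by simp
        show ?thesis using 1 2 3 pq(4) \<rho> bp by linarith
      qed
      have tot: "w (real (i0 + k) * b) - w (real i0 * b) \<le> - (real k * (b powr h' / 2))" if "k \<le> m" for k
        using that
      proof (induction k)
        case (Suc k)
        have "w (real (i0 + Suc k) * b) - w (real (i0 + k) * b) \<le> - (b powr h' / 2)"
          unfolding add_Suc_right using Suc.prems by (intro block) auto
        moreover have "w (real (i0 + k) * b) - w (real i0 * b) \<le> - (real k * (b powr h' / 2))" using Suc by simp
        moreover have "real (Suc k) * (b powr h' / 2) = real k * (b powr h' / 2) + b powr h' / 2" by (simp add: distrib_right)
        ultimately show ?case by linarith
      qed simp
      have pos: "0 \<le> real m * b" using b0 by simp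
      have le: "real m * b \<le> D"
      proof -
        have "real (i0 + m) * b \<le> a + D" "a \<le> real i0 * b" using hi[of "i0 + m"] lo[of i0] by auto
        then show ?thesis by (simp add: distrib_right)
      qed
      have lr: "0 \<le> real i0 * b" "real i0 * b \<le> real (i0 + m) * b" "real (i0 + m) * b \<le> 1"
        using b0 hi[of "i0 + m"] a by (auto intro!: mult_right_mono)
      \<comment> \<open>The descents add up to order D b^(h' - 1), to be compared with the Hoelder
        bound C D^\<kappa>.\<close>
      have "real m * (b powr h' / 2) \<le> C * (real (i0 + m) * b - real i0 * b) powr \<kappa>" using tot[of m] hol[OF lr] by linarith
      also have "\<dots> \<le> C * D powr \<kappa>" using le C pos par(7) by (intro mult_left_mono powr_mono2) (auto simp: distrib_right)
      finally have up: "real m * (b powr h' / 2) \<le> C * D powr \<kappa>" .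
      have le2: "D / b / 2 * (b powr h' / 2) \<le> real m * (b powr h' / 2)" using m(1) by (intro mult_right_mono) auto
      have eq2: "D / b / 2 * (b powr h' / 2) = D * (b powr h' / b) / 4" by simp
      have gen: "p \<le> 4 * z" if "p / 4 \<le> z" for p z :: real using that by simp
      have "D * (b powr h' / b) \<le> 4 * (C * D powr \<kappa>)" by (rule gen[OF order_trans[OF le2 up, unfolded eq2]])
      then have u1: "D * b powr (h' - 1) \<le> 4 * (C * D powr \<kappa>)" using b0 by (simp add: powr_diff)
      have "D * (D powr e) powr (h' - 1) \<le> D * b powr (h' - 1)"
        using n(1) b0 a par unfolding b_def[symmetric] by (intro mult_left_mono powr_mono2') auto
      moreover have "D * (D powr e) powr (h' - 1) = D powr (1 + e * (h' - 1))" using a by (simp add: powr_powr powr_add)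
      \<comment> \<open>The reason for the choice of e: as b is at most D^e, the total descent is at
        least of order D to this exponent, which lies below \<kappa>. For small D that exceeds the
        Hoelder bound.\<close>
      moreover have "1 + e * (h' - 1) = \<kappa> - \<epsilon> * (1 - h')"
      proof -
        have "e * (1 - h') = 1 - \<kappa> + \<epsilon> * (1 - h')" using par(2) unfolding par(5) by (simp add: distrib_right)
        then show ?thesis by (simp add: algebra_simps)
      qed
      ultimately have "D powr \<kappa> / D powr (\<epsilon> * (1 - h')) \<le> 4 * (C * D powr \<kappa>)" using u1 by (simp add: powr_diff)
      moreover have Dp: "0 < D powr (\<epsilon> * (1 - h'))" using a by simp
      ultimately have "D powr \<kappa> \<le> 4 * (C * D powr \<kappa>) * D powr (\<epsilon> * (1 - h'))" by (simp only: pos_divide_le_eq)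
      then have "D powr \<kappa> * 1 \<le> D powr \<kappa> * (4 * C * D powr (\<epsilon> * (1 - h')))" by (simp only: mult_ac mult_1_right)
      then have "1 \<le> 4 * C * D powr (\<epsilon> * (1 - h'))" using a by (subst (asm) mult_le_cancel_left_pos) auto
      then show False using D(5) C by (simp add: field_simps)
    qed
  qed
qed

context fbm
begin

text \<open>Each dyadic interval is cut into N pieces. That all N increments stay below 2^(- n h')
  has probability of order 2^(- n N (h' - H)), and N (h' - H) > 1 outweighs the 2^n intervals of
  level n. The Borel-Cantelli lemma over n concludes.\<close>

lemma dyadic_oscillation:
  assumes h: "H < h'"
  shows "AE om in M. \<exists>n0. \<forall>n\<ge>n0. \<forall>i<2^n. \<exists>p q. real i * (1/2)^n \<le> p \<and> p \<le> q \<and> q \<le> real (Suc i) * (1/2)^n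
     \<and> ((1/2)^n) powr h' \<le> \<bar>B q om - B p om\<bar>"
proof -
  obtain N :: nat where N: "1 / (h' - H) < real N" using reals_Archimedean2 by blast
  have "0 < 1 / (h' - H)" using h by simp
  then have N1: "1 \<le> N" using N by (cases N) auto
  have Nh: "1 < real N * (h' - H)" using N h by (simp add: field_simps)
  define d where "d = (\<lambda>n::nat. (1/2)^n / real N)"
  define E where "E = (\<lambda>n i. {om\<in>space M. \<forall>j<N. \<bar>B (real i * (1/2)^n + real (Suc j) * d n) om - B (real i * (1/2)^n + real j * d n) om\<bar> \<le> ((1/2)^n) powr h'})"
  define A where "A = (\<lambda>n. \<Union>i<2^n. E n i)"
  have d0: "0 < d n" for n using N1 by (simp add: d_def)
  have Nd: "real N * d n = (1/2)^n" for n using N1 by (simp add: d_def)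
  have i1: "real i * (1/2)^n + (1/2)^n \<le> 1" if "i < 2^n" for i n :: nat
  proof -
    have "real (Suc i) \<le> real (2^n)" using that by (intro of_nat_mono) simp
    then have "real (Suc i) * (1/2)^n \<le> real (2^n) * (1/2)^n" by (intro mult_right_mono) auto
    also have "\<dots> = 1" by (simp add: power_mult_distrib[symmetric])
    finally show ?thesis by (simp add: distrib_right)
  qed
  have jd: "real j * d n \<le> (1/2)^n" if "j \<le> N" for j n
    unfolding Nd[symmetric] using that d0[of n] by (intro mult_right_mono) auto
  have EM: "E n i \<in> events" if "i < 2^n" for n i
  proof -
    have pt: "real i * (1/2)^n + real j * d n \<in> {0..1}" if "j \<le> N" for j
    proof -
      have "0 \<le> real i * (1/2)^n" "0 \<le> real j * d n" using d0[of n] by auto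
      then show ?thesis using jd[OF that, of n] i1[OF \<open>i < 2^n\<close>] unfolding atLeastAtMost_iff by linarith
    qed
    have "{om\<in>space M. \<bar>B (real i * (1/2)^n + real (Suc j) * d n) om - B (real i * (1/2)^n + real j * d n) om\<bar> \<le> ((1/2)^n) powr h'} \<in> events" if "j < N" for j
    proof -
      have [measurable]: "B (real i * (1/2)^n + real (Suc j) * d n) \<in> borel_measurable M" "B (real i * (1/2)^n + real j * d n) \<in> borel_measurable M"
        by (rule B_meas[OF pt], use that in simp)+
      show ?thesis by measurable
    qed
    then have "{om\<in>space M. \<forall>j\<in>{..<N}. \<bar>B (real i * (1/2)^n + real (Suc j) * d n) om - B (real i * (1/2)^n + real j * d n) om\<bar> \<le> ((1/2)^n) powr h'} \<in> events"
      by (intro sets.sets_Collect_finite_All) (simp_all only: lessThan_iff finite_lessThan)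
    then show ?thesis unfolding E_def lessThan_iff Ball_def .
  qed
  define c where "c = exp 1 / sqrt (rowsum N) * real N powr H"
  have c0: "0 < c" unfolding c_def using rowsum_pos[OF N1] N1 by simp
  have half: "((1/2::real)^n) powr z = ((1/2) powr z)^n" for n z
  proof -
    have "((1/2::real)^n) powr z = ((1/2) powr real n) powr z" by (subst powr_realpow) simp_all
    also have "\<dots> = ((1/2) powr z) powr real n" by (simp only: powr_powr mult.commute)
    also have "\<dots> = ((1/2) powr z)^n" by (rule powr_realpow) simp
    finally show ?thesis .
  qed
  have PE: "prob (E n i) \<le> c ^ N * ((1/2) powr (h' - H)) ^ (n * N)" if "i < 2^n" for n i
  proof -
    have "prob (E n i) \<le> (exp 1 / sqrt (rowsum N) * (((1/2)^n) powr h' / d n powr H)) ^ N"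
      unfolding E_def using i1[OF that] d0[of n] N1 by (intro small_ball) (auto simp: Nd)
    also have "exp 1 / sqrt (rowsum N) * (((1/2)^n) powr h' / d n powr H) = c * ((1/2) powr (h' - H)) ^ n"
    proof -
      have "d n powr H = ((1/2)^n) powr H / real N powr H" unfolding d_def using N1 by (simp add: powr_divide)
      moreover have "((1/2::real)^n) powr h' / ((1/2)^n) powr H = ((1/2) powr (h' - H)) ^ n"
      proof -
        have "((1/2::real) powr (h' - H)) ^ n = ((1/2) powr h') ^ n / ((1/2) powr H) ^ n" by (simp only: powr_diff power_divide)
        then show ?thesis by (simp only: half)
      qed
      moreover have "p / (q / z) = z * (p / q)" for p q z :: real by simp
      ultimately have "((1/2)^n) powr h' / d n powr H = real N powr H * ((1/2) powr (h' - H)) ^ n" by (simp only:)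
      then show ?thesis unfolding c_def by (simp only: mult.assoc)
    qed
    finally show ?thesis by (simp add: power_mult_distrib power_mult)
  qed
  define q where "q = 2 * ((1/2::real) powr (h' - H)) ^ N"
  have q: "0 < q" "q < 1"
  proof -
    have "((1/2::real) powr (h' - H)) ^ N = ((1/2) powr (h' - H)) powr real N" by (rule powr_realpow[symmetric]) simp
    also have "\<dots> = (1/2) powr (real N * (h' - H))" by (simp only: powr_powr mult.commute)
    also have "\<dots> = 1 / 2 powr (real N * (h' - H))" by (simp add: powr_divide)
    also have "\<dots> < 1 / 2"
    proof -
      have "(2::real) powr 1 < 2 powr (real N * (h' - H))" using Nh by (intro powr_less_mono) auto
      then show ?thesis by (simp add: field_simps)
    qed
    finally show "q < 1" unfolding q_def by simp
    show "0 < q" unfolding q_def by simp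
  qed
  have PA: "prob (A n) \<le> c ^ N * q ^ n" for n
  proof -
    have "prob (A n) \<le> (\<Sum>i<2^n. prob (E n i))" unfolding A_def by (rule finite_measure_subadditive_finite) (use EM in auto)
    also have "\<dots> \<le> (\<Sum>i<(2::nat)^n. c ^ N * ((1/2) powr (h' - H)) ^ (n * N))" by (intro sum_mono PE) auto
    also have "\<dots> = c ^ N * q ^ n" by (simp add: q_def power_mult_distrib power_mult[symmetric] mult.commute)
    finally show ?thesis .
  qed
  have "AE om in M. eventually (\<lambda>n. om \<in> space M - A n) sequentially"
  proof (rule borel_cantelli_AE1)
    show "A n \<in> events" for n unfolding A_def using EM by auto
    show "emeasure M (A n) < \<infinity>" for n by (simp add: less_top[symmetric])
    show "summable (\<lambda>n. prob (A n))"
      by (rule summable_comparison_test'[where N=0 and g="\<lambda>n. c ^ N * q ^ n"]) (use q PA in \<open>auto intro!: summable_mult summable_geometric\<close>)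
  qed
  then show ?thesis
  proof eventually_elim
    fix om assume "eventually (\<lambda>n. om \<in> space M - A n) sequentially"
    then obtain n0 where n0: "\<And>n. n0 \<le> n ==> om \<in> space M - A n" by (auto simp: eventually_sequentially)
    show "\<exists>n0. \<forall>n\<ge>n0. \<forall>i<2^n. \<exists>p q. real i * (1/2)^n \<le> p \<and> p \<le> q \<and> q \<le> real (Suc i) * (1/2)^n \<and> ((1/2)^n) powr h' \<le> \<bar>B q om - B p om\<bar>"
    proof (intro exI[of _ n0] allI impI)
      fix n i :: nat assume n: "n0 \<le> n" and i: "i < 2^n"
      have "om \<in> space M" "om \<notin> E n i" using n0[OF n] i by (auto simp: A_def)
      then obtain j where j: "j < N" "((1/2)^n) powr h' \<le> \<bar>B (real i * (1/2)^n + real (Suc j) * d n) om - B (real i * (1/2)^n + real j * d n) om\<bar>"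
        unfolding E_def using linear by blast
      show "\<exists>p q. real i * (1/2)^n \<le> p \<and> p \<le> q \<and> q \<le> real (Suc i) * (1/2)^n \<and> ((1/2)^n) powr h' \<le> \<bar>B q om - B p om\<bar>"
      proof (rule exI[of _ "real i * (1/2)^n + real j * d n"], rule exI[of _ "real i * (1/2)^n + real (Suc j) * d n"], intro conjI)
        show "((1/2)^n) powr h' \<le> \<bar>B (real i * (1/2)^n + real (Suc j) * d n) om - B (real i * (1/2)^n + real j * d n) om\<bar>" by (rule j(2))
        show "real i * (1/2)^n \<le> real i * (1/2)^n + real j * d n" using d0[of n] by simp
        show "real i * (1/2)^n + real j * d n \<le> real i * (1/2)^n + real (Suc j) * d n" using d0[of n] by (simp add: distrib_right)
        have "real (Suc j) * d n \<le> (1/2)^n" using j by (intro jd) simp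
        then show "real i * (1/2)^n + real (Suc j) * d n \<le> real (Suc i) * (1/2)^n" by (simp add: distrib_right)
      qed
    qed
  qed
qed

lemma solutions_from_all_times_AE:
  "AE om in M. \<exists>Z :: real => real => real^2.
        (\<forall>t\<in>{0..1}. is_solution (\<lambda>t. B t om) (\<lambda>u. u) {0..1} (Z t)) \<and>
        (\<forall>s\<in>{0..1}. \<forall>t\<in>{0..1}. Z t s = 0 \<longleftrightarrow> s \<le> t) \<and>
        inj_on (\<lambda>t. restrict (Z t) {0..1}) {0..1}"
proof -
  \<comment> \<open>e and hh are the exponents of \<open>oscillation_imp_upward\<close> for \<kappa>
    = H - \<epsilon> and h' = H + \<epsilon>. They tend to 1 and H as \<epsilon> tends to 0, so the
    expression bounded by 2 in \<open>rough_path\<close> tends to 2 H + 1 < 2, and a small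
    \<epsilon> will do.\<close>
  define e where "e = (\<lambda>\<epsilon>. (1 - (H - \<epsilon>)) / (1 - (H + \<epsilon>)) + \<epsilon>)"
  define hh where "hh = (\<lambda>\<epsilon>. (H + \<epsilon>) * e \<epsilon> + \<epsilon>)"
  have l0: "(e \<longlongrightarrow> 1) (at_right 0)" unfolding e_def using H by (auto intro!: tendsto_eq_intros)
  have l1: "(hh \<longlongrightarrow> H) (at_right 0)" unfolding hh_def by (auto intro!: tendsto_eq_intros l0)
  have l2: "((\<lambda>\<epsilon>. 2 * hh \<epsilon> + hh \<epsilon> / (H - \<epsilon>)) \<longlongrightarrow> 2 * H + 1) (at_right 0)" using H by (auto intro!: tendsto_eq_intros l1)
  have "eventually (\<lambda>\<epsilon>. 2 * hh \<epsilon> + hh \<epsilon> / (H - \<epsilon>) < 2) (at_right 0)" by (rule order_tendstoD(2)[OF l2]) (use H in simp)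
  moreover have "eventually (\<lambda>\<epsilon>. \<epsilon> \<in> {0<..<H}) (at_right 0)" using H by (intro eventually_at_right_real) auto
  ultimately have "eventually (\<lambda>\<epsilon>. 2 * hh \<epsilon> + hh \<epsilon> / (H - \<epsilon>) < 2 \<and> \<epsilon> \<in> {0<..<H}) (at_right 0)" by (rule eventually_conj)
  then obtain \<epsilon> where \<epsilon>: "2 * hh \<epsilon> + hh \<epsilon> / (H - \<epsilon>) < 2" "0 < \<epsilon>" "\<epsilon> < H"
    using eventually_happens'[OF trivial_limit_at_right_real] by fastforce
  define \<kappa> h' where "\<kappa> = H - \<epsilon>" and "h' = H + \<epsilon>"
  have k: "0 < \<kappa>" "\<kappa> < H" "H < h'" "h' < 1" "\<kappa> < 1" using \<epsilon> H by (auto simp: \<kappa>_def h'_def)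
  have "1 \<le> (1 - \<kappa>) / (1 - h')" using k by (simp add: le_divide_eq)
  then have e1: "1 < e \<epsilon>" unfolding e_def using \<epsilon> by (simp add: \<kappa>_def h'_def)
  have hk: "h' \<le> hh \<epsilon>"
  proof -
    have "h' * 1 \<le> h' * e \<epsilon>" using k H e1 by (intro mult_left_mono) auto
    moreover have "hh \<epsilon> = h' * e \<epsilon> + \<epsilon>" by (simp add: hh_def h'_def)
    ultimately show ?thesis using \<epsilon>(2) by linarith
  qed
  have h1: "hh \<epsilon> < 1"
  proof -
    have "0 \<le> hh \<epsilon> / (H - \<epsilon>)" using hk k H \<epsilon> by auto
    then show ?thesis using \<epsilon>(1) by linarith
  qed
  obtain K where K: "K \<in> borel_measurable M" "\<And>om. 0 \<le> K om"
      "AE om in M. \<forall>s\<in>{0..1}. \<forall>t\<in>{0..1}. \<bar>B t om - B s om\<bar> \<le> K om * \<bar>t - s\<bar> powr \<kappa>"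
    using holder_constant[OF k(1,2)] by blast
  show ?thesis
    using K(3) dyadic_oscillation[OF k(3)] AE_space
  proof eventually_elim
    fix om assume hol: "\<forall>s\<in>{0..1}. \<forall>t\<in>{0..1}. \<bar>B t om - B s om\<bar> \<le> K om * \<bar>t - s\<bar> powr \<kappa>"
      and osc: "\<exists>n0. \<forall>n\<ge>n0. \<forall>i<2^n. \<exists>p q. real i * (1/2)^n \<le> p \<and> p \<le> q \<and> q \<le> real (Suc i) * (1/2)^n \<and> ((1/2)^n) powr h' \<le> \<bar>B q om - B p om\<bar>"
      and om: "om \<in> space M"
    obtain n0 where n0: "\<And>n i. n0 \<le> n ==> i < 2^n ==> \<exists>p q. real i * (1/2)^n \<le> p \<and> p \<le> q \<and> q \<le> real (Suc i) * (1/2)^n \<and> ((1/2)^n) powr h' \<le> \<bar>B q om - B p om\<bar>"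
      using osc by blast
    define C where "C = max 1 (K om)"
    have C: "\<bar>B y om - B x om\<bar> \<le> C * (y - x) powr \<kappa>" if "0 \<le> x" "x \<le> y" "y \<le> 1" for x y
    proof -
      have "\<bar>B y om - B x om\<bar> \<le> K om * \<bar>y - x\<bar> powr \<kappa>" by (rule hol[THEN bspec, THEN bspec]) (use that in auto)
      also have "\<dots> \<le> C * \<bar>y - x\<bar> powr \<kappa>" by (intro mult_right_mono) (auto simp: C_def)
      finally show ?thesis using that by simp
    qed
    have C0: "0 < C" by (simp add: C_def)
    have h'0: "0 < h'" using k H by simp
    have ee: "e \<epsilon> = (1 - \<kappa>) / (1 - h') + \<epsilon>" and he: "hh \<epsilon> = h' * e \<epsilon> + \<epsilon>" by (simp_all add: e_def hh_def \<kappa>_def h'_def)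
    obtain D0 where D0: "0 < D0" "D0 \<le> 1"
      "\<And>a D. 0 \<le> a ==> 0 < D ==> D \<le> D0 ==> a + D \<le> 1 ==> \<exists>s t. a \<le> s \<and> s \<le> t \<and> t \<le> a + D \<and> D powr hh \<epsilon> \<le> B t om - B s om"
      using oscillation_imp_upward[where w="\<lambda>t. B t om" and C=C and \<kappa>=\<kappa> and h'=h' and \<epsilon>=\<epsilon> and e="e \<epsilon>" and h="hh \<epsilon>" and ?n0.0=n0, OF C C0 n0 h'0 k(4) \<epsilon>(2) e1 ee he k(1)] by blast
    have cont: "continuous_on {0..1} (\<lambda>t. B t om)" by (rule path_cont[OF om])
    have "bounded ((\<lambda>t. B t om) ` {0..1})" by (intro compact_imp_bounded compact_continuous_image cont) simp
    then obtain b where b: "\<forall>y\<in>{0..1}. \<bar>B y om\<bar> \<le> b" by (auto simp: bounded_iff)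
    interpret R: rough_path "\<lambda>t. B t om" b C \<kappa> "hh \<epsilon>" D0
    proof
      show "1 \<le> C" by (simp add: C_def)
      show "\<kappa> \<le> hh \<epsilon>" using k hk by linarith
      show "2 * hh \<epsilon> + hh \<epsilon> / \<kappa> < 2" using \<epsilon>(1) by (simp add: \<kappa>_def)
      show "\<bar>B y om\<bar> \<le> b" if "0 \<le> y" "y \<le> 1" for y using b that by simp
      show "\<bar>B y om - B x om\<bar> \<le> C * (y - x) powr \<kappa>" if "0 \<le> x" "x \<le> y" "y \<le> 1" for x y by (rule C[OF that])
      show "\<exists>s t. a \<le> s \<and> s \<le> t \<and> t \<le> a + D \<and> D powr hh \<epsilon> \<le> B t om - B s om" if "0 \<le> a" "0 < D" "D \<le> D0" "a + D \<le> 1" for a D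
        by (rule D0(3)[OF that])
    qed (fact cont k(1) h1 D0(1))+
    show "\<exists>Z :: real => real => real^2.
        (\<forall>t\<in>{0..1}. is_solution (\<lambda>t. B t om) (\<lambda>u. u) {0..1} (Z t)) \<and>
        (\<forall>s\<in>{0..1}. \<forall>t\<in>{0..1}. Z t s = 0 \<longleftrightarrow> s \<le> t) \<and>
        inj_on (\<lambda>t. restrict (Z t) {0..1}) {0..1}"
      by (rule R.solutions_from_all_times)
  qed
qed

end

section \<open>Adaptedness and the theorem\<close>

lemma runmax_eq_rise:
  assumes w: "continuous_on {a..b} w" and ab: "a \<le> b"
  shows "runmax w a b = rise a b w - w b"
proof -
  obtain y where "runmax w a b = - w y" "\<And>x. a \<le> x ==> x \<le> b ==> - w x \<le> runmax w a b"
    using runmax_attained[OF w ab] by metis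
  then have "- w a \<le> runmax w a b" using ab by simp
  then show ?thesis by (simp add: rise_def flow_def)
qed

text \<open>F abstracts the completed filtration at time t by two properties: its points are
  continuous paths, and evaluations up to time t are measurable.\<close>

locale path_filtration =
  fixes F :: "(real => real) measure" and t :: real
  assumes t: "0 \<le> t" "t \<le> 1" and paths: "\<And>w. w \<in> space F ==> continuous_on {0..1} w"
    and evals: "\<And>s. 0 \<le> s ==> s \<le> t ==> (\<lambda>w. w s) \<in> borel_measurable F"
begin

lemma meas_rise:
  assumes "0 \<le> a" "a \<le> b" "b \<le> t"
  shows "rise a b \<in> borel_measurable F"
proof (rule borel_measurable_LIMSEQ_real)
  fix w assume "w \<in> space F"
  then have "continuous_on {a..b} w" using assms t by (intro continuous_on_subset[OF paths]) auto
  then show "(\<lambda>N. maxrise b (grid a b N) w) \<longlonglongrightarrow> rise a b w" by (rule maxrise_grid(2)[OF _ assms(2)])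
next
  fix N
  have g: "p \<in> {a..b}" if "p \<in> grid a b N" for p using grid_props(3)[OF assms(2)] that by (rule subsetD)
  have ne: "grid a b N \<noteq> {}" using grid_props(2)[OF assms(2)] by blast
  have "(\<lambda>w. MAX p\<in>grid a b N. w b - w p) \<in> borel_measurable F"
  proof (rule borel_measurable_MAX[OF grid_props(1)[OF assms(2)] ne])
    fix p assume "p \<in> grid a b N"
    then show "(\<lambda>w. w b - w p) \<in> borel_measurable F" using g[of p] assms by (intro borel_measurable_diff evals) auto
  qed
  then show "(\<lambda>w. maxrise b (grid a b N) w) \<in> borel_measurable F" unfolding maxrise_def .
qed

lemma meas_flow:
  assumes "0 \<le> a" "a \<le> b" "b \<le> t" and f: "f \<in> borel_measurable F"
  shows "(\<lambda>w. flow w a b (f w)) \<in> borel_measurable F"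
proof -
  have "(\<lambda>w. max (f w) (rise a b w - w b)) \<in> borel_measurable F"
    using assms by (intro borel_measurable_max borel_measurable_diff f meas_rise evals) auto
  moreover have "max (f w) (rise a b w - w b) = flow w a b (f w)" if "w \<in> space F" for w
  proof -
    have "continuous_on {a..b} w" using assms t by (intro continuous_on_subset[OF paths[OF that]]) auto
    then show ?thesis by (simp add: flow_def runmax_eq_rise[OF _ assms(2)])
  qed
  ultimately show ?thesis by (rule measurable_cong[THEN iffD1, rotated])
qed

lemma meas_jump:
  assumes f[measurable]: "w0 \<in> borel_measurable F" "R \<in> borel_measurable F" "l \<in> borel_measurable F"
  shows "(\<lambda>w. jump_R (w0 w) x (R w) (l w)) \<in> borel_measurable F" "(\<lambda>w. jump_l (w0 w) x (R w) (l w)) \<in> borel_measurable F"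
proof -
  have [measurable]: "(sinh :: real => real) \<in> borel_measurable borel" "(cosh :: real => real) \<in> borel_measurable borel"
      "(arsinh :: real => real) \<in> borel_measurable borel"
    by (intro borel_measurable_continuous_onI continuous_intros)+
  show "(\<lambda>w. jump_R (w0 w) x (R w) (l w)) \<in> borel_measurable F" "(\<lambda>w. jump_l (w0 w) x (R w) (l w)) \<in> borel_measurable F"
    unfolding jump_l_def jump_R_def jump_z_def by measurable
qed

end

locale path_filtration_jumps = path_filtration + jump_times
begin

lemma tau_nn: "0 \<le> \<tau> k" using tau01(1)[of k] by simp

text \<open>Apart from the starting radius, the state at index k involves only the path on
  [\<tau>(n), \<tau>(k)].\<close>

lemma meas_state:
  assumes r: "r \<in> borel_measurable F" and n: "\<tau> k \<le> t" "k \<le> n"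
  shows "(\<lambda>w. fst (start_state w \<tau> \<gamma> (r w) n k)) \<in> borel_measurable F \<and> (\<lambda>w. snd (start_state w \<tau> \<gamma> (r w) n k)) \<in> borel_measurable F"
  using n(2,1)
proof (induction rule: inc_induct)
  case base
  then show ?case using r evals[OF tau_nn] by (simp add: start_state_def backrec_start)
next
  case (step m)
  have le: "\<tau> (Suc m) \<le> \<tau> m" by (rule tau_le) simp
  then have IH: "(\<lambda>w. fst (start_state w \<tau> \<gamma> (r w) n (Suc m))) \<in> borel_measurable F" "(\<lambda>w. snd (start_state w \<tau> \<gamma> (r w) n (Suc m))) \<in> borel_measurable F"
    using step.IH step.prems by auto
  have e: "start_state w \<tau> \<gamma> (r w) n m = state_step w \<tau> \<gamma> m (start_state w \<tau> \<gamma> (r w) n (Suc m))" for w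
    unfolding start_state_def by (rule backrec_step) (use step.hyps in simp)
  note fl = meas_flow[OF tau_nn le step.prems IH(2)]
  note ev = evals[OF tau_nn step.prems]
  show ?case unfolding e state_step_def Let_def fst_conv snd_conv
    using meas_jump[OF ev IH(1) fl] by blast
qed

lemma tidx_props:
  assumes "\<tau> n \<le> t"
  shows "\<tau> (tidx \<tau> t) \<le> t" "tidx \<tau> t \<le> n"
  unfolding tidx_def using assms by (rule LeastI, rule Least_le)

text \<open>The premise on r is guarded: if t < \<tau>(n) the started path is still 0, while the
  radius at \<tau>(n) may depend on the path after t.\<close>

lemma meas_started:
  assumes r: "\<tau> n \<le> t ==> r \<in> borel_measurable F"
  shows "(\<lambda>w. started_U w \<tau> \<gamma> (r w) n t) \<in> borel_measurable F" "(\<lambda>w. started_V w \<tau> \<gamma> (r w) n t) \<in> borel_measurable F"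
proof -
  have "(\<lambda>w. started_U w \<tau> \<gamma> (r w) n t) \<in> borel_measurable F \<and> (\<lambda>w. started_V w \<tau> \<gamma> (r w) n t) \<in> borel_measurable F"
  proof (cases "\<tau> n \<le> t")
    case True
    let ?k = "tidx \<tau> t"
    note k = tidx_props[OF True]
    note S = meas_state[OF r[OF True] k]
    have [measurable]: "(\<lambda>w. fst (start_state w \<tau> \<gamma> (r w) n ?k)) \<in> borel_measurable F"
      "(\<lambda>w. flow w (\<tau> ?k) t (snd (start_state w \<tau> \<gamma> (r w) n ?k))) \<in> borel_measurable F"
      using S by (auto intro!: meas_flow tau_nn k)
    show ?thesis unfolding started_U_def started_V_def Let_def using True by (intro conjI) (simp_all, measurable)
  next
    case False
    then show ?thesis by (simp add: started_U_def started_V_def)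
  qed
  then show "(\<lambda>w. started_U w \<tau> \<gamma> (r w) n t) \<in> borel_measurable F" "(\<lambda>w. started_V w \<tau> \<gamma> (r w) n t) \<in> borel_measurable F" by auto
qed

text \<open>The sums run over j >= n, so only the path up to \<tau>(n) enters; N and c are
  deterministic.\<close>

lemma meas_scale:
  assumes n: "\<tau> n \<le> t"
  shows "(\<lambda>w. scale (\<lambda>j. lncosh (rise (\<tau> (Suc j)) (\<tau> j) w)) N c n) \<in> borel_measurable F"
proof -
  have "(\<lambda>w. \<Sum>j\<in>{n..<N i}. lncosh (rise (\<tau> (Suc j)) (\<tau> j) w)) \<in> borel_measurable F" for i
  proof (intro borel_measurable_sum measurable_compose[OF meas_rise lncosh_meas])
    fix j assume "j \<in> {n..<N i}"
    then have "\<tau> j \<le> \<tau> n" by (intro tau_le) simp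
    then show "\<tau> j \<le> t" using n by simp
  qed (auto intro: tau_nn tau_le)
  then show ?thesis unfolding scale_def
    by (intro measurable_compose[OF _ borel_measurable_exp] borel_measurable_lim_metric borel_measurable_diff) auto
qed

lemma meas_Zsol:
  assumes r: "\<And>n. \<tau> n \<le> t ==> (\<lambda>w. r w n) \<in> borel_measurable F"
  shows "(\<lambda>w. Zsol \<tau> \<gamma> (r w) \<eta> w t) \<in> borel_measurable F"
proof -
  have s: "(\<lambda>w. started_U w \<tau> \<gamma> (\<eta> * r w n) n t) \<in> borel_measurable F" "(\<lambda>w. started_V w \<tau> \<gamma> (\<eta> * r w n) n t) \<in> borel_measurable F" for n
    using r by (intro meas_started borel_measurable_times borel_measurable_const; simp)+
  have U[measurable]: "(\<lambda>w. lim (\<lambda>n. started_U w \<tau> \<gamma> (\<eta> * r w n) n t)) \<in> borel_measurable F" by (rule borel_measurable_lim_metric[OF s(1)])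
  have V[measurable]: "(\<lambda>w. lim (\<lambda>n. started_V w \<tau> \<gamma> (\<eta> * r w n) n t)) \<in> borel_measurable F" by (rule borel_measurable_lim_metric[OF s(2)])
  have [measurable]: "(\<lambda>w. w t) \<in> borel_measurable F" by (rule evals) (use t in auto)
  show ?thesis
    unfolding borel_measurable_euclidean_space[of "\<lambda>w. Zsol \<tau> \<gamma> (r w) \<eta> w t"]
  proof
    fix b :: "real^2" assume "b \<in> Basis"
    then obtain i where b: "b = axis i 1" by (auto simp: Basis_vec_def)
    have c: "v \<bullet> b = v $ i" for v :: "real^2" unfolding b by (simp add: inner_axis)
    show "(\<lambda>w. Zsol \<tau> \<gamma> (r w) \<eta> w t \<bullet> b) \<in> borel_measurable F"
      unfolding c Zsol_def zvec_def using exhaust_2[of i]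
    proof
      assume "i = 1"
      show "(\<lambda>w. (vector [(exp (w t) * lim (\<lambda>n. started_U w \<tau> \<gamma> (\<eta> * r w n) n t) + exp (- w t) * lim (\<lambda>n. started_V w \<tau> \<gamma> (\<eta> * r w n) n t)) / 2,
         (exp (w t) * lim (\<lambda>n. started_U w \<tau> \<gamma> (\<eta> * r w n) n t) - exp (- w t) * lim (\<lambda>n. started_V w \<tau> \<gamma> (\<eta> * r w n) n t)) / 2] :: real^2) $ i) \<in> borel_measurable F"
        unfolding \<open>i = 1\<close> vector_2 by measurable
    next
      assume "i = 2"
      show "(\<lambda>w. (vector [(exp (w t) * lim (\<lambda>n. started_U w \<tau> \<gamma> (\<eta> * r w n) n t) + exp (- w t) * lim (\<lambda>n. started_V w \<tau> \<gamma> (\<eta> * r w n) n t)) / 2,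
         (exp (w t) * lim (\<lambda>n. started_U w \<tau> \<gamma> (\<eta> * r w n) n t) - exp (- w t) * lim (\<lambda>n. started_V w \<tau> \<gamma> (\<eta> * r w n) n t)) / 2] :: real^2) $ i) \<in> borel_measurable F"
        unfolding \<open>i = 2\<close> vector_2 by measurable
    qed
  qed
qed

end

section \<open>The completed filtration and infinitely many solutions\<close>

lemma space_completed_natural_filtration:
  "space (completed_natural_filtration M B t) = space M"
  "(0 \<le> s \<and> s \<le> t) ==> B s \<in> borel_measurable (completed_natural_filtration M B t)"
proof -
  let ?G = "{B s -` S \<inter> space M | s S. 0 \<le> s \<and> s \<le> t \<and> S \<in> sets borel} \<union> null_sets (completion M)"
  have G: "?G \<subseteq> Pow (space M)" using sets.sets_into_space[of _ "completion M"] by (auto simp: null_sets_def)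
  show sp: "space (completed_natural_filtration M B t) = space M"
    unfolding completed_natural_filtration_def using G by (simp add: space_measure_of)
  assume s: "0 \<le> s \<and> s \<le> t"
  show "B s \<in> borel_measurable (completed_natural_filtration M B t)"
  proof (rule measurableI)
    fix A :: "real set" assume "A \<in> sets borel"
    then have "B s -` A \<inter> space M \<in> ?G" using s by blast
    then show "B s -` A \<inter> space (completed_natural_filtration M B t) \<in> sets (completed_natural_filtration M B t)"
      unfolding sp unfolding completed_natural_filtration_def sets_measure_of[OF G] by (rule sigma_sets.Basic)
  qed simp
qed

text \<open>Solutions are counted as extensional functions; this carries the property over to
  restrictions.\<close>

lemma is_solution_cong:
  assumes "\<And>t. t \<in> {a..b} ==> Z t = Z' t" "is_solution w g {a..b} Z"
  shows "is_solution w g {a..b} Z'"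
proof -
  obtain K where K: "solution_pair w g {a..b} Z K" using assms(2) by (auto simp: is_solution_def)
  note K' = K[unfolded solution_pair_def]
  have "solution_pair w g {a..b} Z' K"
    unfolding solution_pair_def
  proof (intro conjI ballI impI)
    show "cadlag_on {a..b} K" "mono_on {a..b} K" using K' by blast+
    show "Z' t \<bullet> e1 \<ge> 0" if "t \<in> {a..b}" for t using K' that assms(1)[OF that] by metis
    fix s t assume st: "s \<in> {a..b}" "t \<in> {a..b}" "s \<le> t"
    have "AE u in stieltjes K s t. u \<in> {s<..t} \<longrightarrow> Z u \<bullet> e1 = 0" using K' st by blast
    then show "AE u in stieltjes K s t. u \<in> {s<..t} \<longrightarrow> Z' u \<bullet> e1 = 0"
    proof eventually_elim
      fix u assume h: "u \<in> {s<..t} \<longrightarrow> Z u \<bullet> e1 = 0"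
      show "u \<in> {s<..t} \<longrightarrow> Z' u \<bullet> e1 = 0"
      proof
        assume u: "u \<in> {s<..t}"
        then have "u \<in> {a..b}" using st by simp
        from h u show "Z' u \<bullet> e1 = 0" unfolding assms(1)[OF \<open>u \<in> {a..b}\<close>, symmetric] by blast
      qed
    qed
    show "Z' t = mat_exp ((w t - w s) *\<^sub>R A_mat) *v Z' s
          + ((LINT u:{s<..t}|stieltjes K s t. mat_exp ((w t - w u) *\<^sub>R A_mat) *v e1)
           - (LINT u:{s<..t}|stieltjes g s t. mat_exp ((w t - w u) *\<^sub>R A_mat) *v e1))"
      unfolding assms(1)[OF st(1), symmetric] assms(1)[OF st(2), symmetric] using K' st by blast
  qed
  then show ?thesis by (auto simp: is_solution_def)
qed

text \<open>If two parameters gave the same restriction, the quotient of norms at small t would be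
  1, whereas it is the quotient of the parameters.\<close>

lemma infinite_solutions:
  fixes Z :: "real => real => real^2"
  assumes Z: "\<And>\<eta>. 0 < \<eta> ==> is_solution w g {0..1} (Z \<eta>)" "\<And>\<eta>. 0 < \<eta> ==> Z \<eta> 0 = 0"
    and ratio: "\<And>\<eta>1 \<eta>2. 0 < \<eta>1 ==> 0 < \<eta>2 ==> eventually (\<lambda>t. norm (Z \<eta>1 t) / norm (Z \<eta>2 t) = \<eta>1 / \<eta>2) (at_right 0)"
  shows "infinite {Z. Z \<in> extensional {0..1} \<and> is_solution w g {0..1} Z \<and> Z 0 = 0}"
proof -
  have inj: "inj_on (\<lambda>\<eta>. restrict (Z \<eta>) {0..1}) {0<..}"
  proof (rule inj_onI)
    fix p q :: real assume pq: "p \<in> {0<..}" "q \<in> {0<..}" and e: "restrict (Z p) {0..1} = restrict (Z q) {0..1}"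
    have "eventually (\<lambda>t. norm (Z p t) / norm (Z q t) = p / q) (at_right 0)" by (rule ratio) (use pq in auto)
    moreover have "eventually (\<lambda>t::real. t \<in> {0<..<1}) (at_right 0)" by (rule eventually_at_right_real) simp
    ultimately have "eventually (\<lambda>t. norm (Z p t) / norm (Z q t) = p / q \<and> t \<in> {0<..<1}) (at_right 0)" by (rule eventually_conj)
    then obtain t where t: "norm (Z p t) / norm (Z q t) = p / q" "t \<in> {0<..<1}"
      using eventually_happens'[OF trivial_limit_at_right_real] by fastforce
    have "Z p t = Z q t" using fun_cong[OF e, of t] t(2) by simp
    then have e': "norm (Z q t) / norm (Z q t) = p / q" using t(1) by simp
    have "0 < p / q" using pq by simp
    \<comment> \<open>Division by 0 has the value 0, which differs from p / q > 0.\<close>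
    then have "norm (Z q t) \<noteq> 0" using e' by (intro notI) (simp only: div_by_0)
    then have "p / q = 1" using e' by simp
    then show "p = q" using pq by simp
  qed
  have "infinite ((\<lambda>\<eta>. restrict (Z \<eta>) {0..1}) ` {0<..})" using inj infinite_Ioi[of "0::real"] by (simp add: finite_image_iff)
  moreover have "(\<lambda>\<eta>. restrict (Z \<eta>) {0..1}) ` {0<..} \<subseteq> {Z. Z \<in> extensional {0..1} \<and> is_solution w g {0..1} Z \<and> Z 0 = 0}"
  proof
    fix Y assume "Y \<in> (\<lambda>\<eta>. restrict (Z \<eta>) {0..1}) ` {0<..}"
    then obtain \<eta> where \<eta>: "0 < \<eta>" "Y = restrict (Z \<eta>) {0..1}" by auto
    have "is_solution w g {0..1} Y" by (rule is_solution_cong[OF _ Z(1)[OF \<eta>(1)]]) (simp add: \<eta>)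
    then show "Y \<in> {Z. Z \<in> extensional {0..1} \<and> is_solution w g {0..1} Z \<and> Z 0 = 0}" using Z(2) \<eta> by simp
  qed
  ultimately show ?thesis by (meson infinite_super)
qed

lemma (in jump_times) Zsol_at_0: "Zsol \<tau> g r \<eta> w 0 = 0"
proof -
  have n: "\<not> \<tau> n \<le> 0" for n using tau01(1)[of n] by simp
  show ?thesis by (simp add: Zsol_def zvec_def started_U_def started_V_def n vec_eq_iff forall_2)
qed

text \<open>All \<eta> share one exceptional null set: the scale does not depend on \<eta>, and
  \<open>scale_sequence\<close> gives its smallness for all \<eta> at once.\<close>

lemma jump_solutions_AE:
  assumes H: "0 < H" "H < 1 / 2" and fb: "fractional_brownian_motion H P (\<lambda>t w. w t)"
    and \<tau>: "\<And>k. \<tau> k \<in> {0<..1}" "decseq \<tau>" "\<tau> \<longlonglongrightarrow> 0" and x: "summable x" "\<And>k. x k \<ge> exp (- (real k powr \<theta>))"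
    and as: "asymp_equiv (\<lambda>k. \<tau> k - \<tau> (Suc k)) sequentially (\<lambda>k. real k powr (- \<alpha>))"
    and \<alpha>: "1 / (4 * H) < \<alpha>" "\<alpha> < 1 / (2 * H)" "0 < \<theta>" "\<theta> < 1 - 2 * \<alpha> * H"
  obtains Z :: "real => (real => real) => real => real^2" where
    "\<And>\<eta> w. Z \<eta> w 0 = 0"
    "\<And>\<eta> t. t \<in> {0..1} ==> (\<lambda>w. Z \<eta> w t) \<in> borel_measurable (completed_natural_filtration P (\<lambda>s w. w s) t)"
    "AE w in P. \<forall>\<eta>>0. is_solution w (jump_path \<tau> x) {0..1} (Z \<eta> w)"
    "AE w in P. \<forall>\<eta>1>0. \<forall>\<eta>2>0. eventually (\<lambda>t. norm (Z \<eta>1 w t) / norm (Z \<eta>2 w t) = \<eta>1 / \<eta>2) (at_right 0)"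
proof -
  interpret prob_space P using fb by (simp add: fractional_brownian_motion_def)
  interpret B: fbm P H "\<lambda>t w. w t" by unfold_locales (use H fb in auto)
  have x0: "0 \<le> x k" for k using x(2)[of k] exp_ge_zero[of "- (real k powr \<theta>)"] by linarith
  interpret J: jump_times \<tau> x by unfold_locales (use \<tau> x x0 in auto)
  define l where "l = (\<lambda>w j. lncosh (rise (\<tau> (Suc j)) (\<tau> j) w))"
  obtain N c where N: "eventually (\<lambda>k. \<tau> (Suc k) < \<tau> k) sequentially"
    "AE w in P. \<forall>k. scale (l w) N c k = scale (l w) N c (Suc k) * exp (l w k)"
    "AE w in P. scale (l w) N c \<longlonglongrightarrow> 0"
    "AE w in P. \<forall>\<eta>. eventually (\<lambda>k. \<eta> * scale (l w) N c k \<le> exp (- (real k powr \<theta>))) sequentially"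
    using B.scale_sequence[OF _ \<tau>(2) as \<alpha>] \<tau>(1) unfolding l_def by (auto simp: greaterThanAtMost_iff)
  define Z where "Z = (\<lambda>\<eta> w. Zsol \<tau> (jump_path \<tau> x) (scale (l w) N c) \<eta> w)"
  have JS: "AE w in P. jump_solution \<tau> x w (scale (l w) N c) (SUP t\<in>{0..1}. \<bar>w t\<bar>)"
    using N(2-4) AE_space
  proof eventually_elim
    fix w assume h: "\<forall>k. scale (l w) N c k = scale (l w) N c (Suc k) * exp (l w k)" "scale (l w) N c \<longlonglongrightarrow> 0"
      "\<forall>\<eta>. eventually (\<lambda>k. \<eta> * scale (l w) N c k \<le> exp (- (real k powr \<theta>))) sequentially" and w: "w \<in> space P"
    have cont: "continuous_on {0..1} w" by (rule B.path_cont[OF w])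
    show "jump_solution \<tau> x w (scale (l w) N c) (SUP t\<in>{0..1}. \<bar>w t\<bar>)"
    proof (intro jump_solution.intro jump_solution_axioms.intro J.jump_times_axioms)
      show "continuous_on {0..1} w" by fact
      show "\<bar>w y\<bar> \<le> (SUP t\<in>{0..1}. \<bar>w t\<bar>)" if "0 \<le> y" "y \<le> 1" for y
      proof (rule cSUP_upper)
        have "continuous_on {0..1} (\<lambda>t. \<bar>w t\<bar>)" using cont by (intro continuous_intros)
        then have "compact ((\<lambda>t. \<bar>w t\<bar>) ` {0..1})" by (rule compact_continuous_image) simp
        then show "bdd_above ((\<lambda>t. \<bar>w t\<bar>) ` {0..1})" by (intro bounded_imp_bdd_above compact_imp_bounded)
      qed (use that in simp)
      show "0 < scale (l w) N c k" for k by (simp add: scale_def)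
      show "scale (l w) N c k = scale (l w) N c (Suc k) * cosh (w (\<tau> k) + flow w (\<tau> (Suc k)) (\<tau> k) (- w (\<tau> (Suc k))))" for k
        using h(1)[rule_format, of k] by (simp add: l_def lncosh_def rise_def cosh_real_pos)
      show "scale (l w) N c \<longlonglongrightarrow> 0" by fact
      show "eventually (\<lambda>k. \<tau> (Suc k) < \<tau> k \<and> \<eta> * scale (l w) N c k \<le> x k) sequentially" for \<eta>
        using N(1) h(3)[rule_format, of \<eta>]
      proof eventually_elim
        fix k assume "\<tau> (Suc k) < \<tau> k" "\<eta> * scale (l w) N c k \<le> exp (- (real k powr \<theta>))"
        then show "\<tau> (Suc k) < \<tau> k \<and> \<eta> * scale (l w) N c k \<le> x k" using x(2)[of k] by linarith
      qed
    qed
  qed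
  show ?thesis
  proof (rule that[of Z])
    show "Z \<eta> w 0 = 0" for \<eta> w unfolding Z_def by (rule J.Zsol_at_0)
    show "(\<lambda>w. Z \<eta> w t) \<in> borel_measurable (completed_natural_filtration P (\<lambda>s w. w s) t)" if t: "t \<in> {0..1}" for \<eta> t
    proof -
      interpret pf: path_filtration_jumps "completed_natural_filtration P (\<lambda>s w. w s) t" t \<tau> x
      proof (intro path_filtration_jumps.intro path_filtration.intro J.jump_times_axioms)
        show "0 \<le> t" "t \<le> 1" using t by auto
        show "continuous_on {0..1} w" if "w \<in> space (completed_natural_filtration P (\<lambda>s w. w s) t)" for w
          using that B.path_cont unfolding space_completed_natural_filtration(1) by blast
        show "(\<lambda>w. w s) \<in> borel_measurable (completed_natural_filtration P (\<lambda>s w. w s) t)" if "0 \<le> s" "s \<le> t" for s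
          by (rule space_completed_natural_filtration(2)[of s t "\<lambda>s w. w s"]) (use that in simp)
      qed
      show ?thesis unfolding Z_def l_def by (intro pf.meas_Zsol pf.meas_scale)
    qed
    show "AE w in P. \<forall>\<eta>>0. is_solution w (jump_path \<tau> x) {0..1} (Z \<eta> w)"
      using JS by eventually_elim (auto simp: Z_def intro: jump_solution.Zsol_is_solution)
    show "AE w in P. \<forall>\<eta>1>0. \<forall>\<eta>2>0. eventually (\<lambda>t. norm (Z \<eta>1 w t) / norm (Z \<eta>2 w t) = \<eta>1 / \<eta>2) (at_right 0)"
      using JS by eventually_elim (auto simp: Z_def intro: jump_solution.Zsol_ratio)
  qed
qed

theorem theorem2p5:
  fixes H :: real and P :: "(real \<Rightarrow> real) measure"
  assumes "0 < H" and "H < 1 / 2" and "fbm_law H P"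
  shows
    "(\<forall>(\<tau> :: nat \<Rightarrow> real) (x :: nat \<Rightarrow> real) (\<alpha> :: real) (\<theta> :: real).
        (\<forall>k. \<tau> k \<in> {0<..1}) \<and> decseq \<tau> \<and> \<tau> \<longlonglongrightarrow> 0 \<and> summable x \<and>
        asymp_equiv (\<lambda>k. \<tau> k - \<tau> (Suc k)) sequentially (\<lambda>k. real k powr (- \<alpha>)) \<and>
        (\<forall>k. x k \<ge> exp (- (real k powr \<theta>))) \<and>
        max (5 / (12 * H)) 1 < \<alpha> \<and> \<alpha> < 1 / (2 * H) \<and> 0 < \<theta> \<and> \<theta> < 1 - 2 * \<alpha> * H \<longrightarrow>
        (AE w in P. infinite {Z. Z \<in> extensional {0..1} \<and>
            is_solution w (jump_path \<tau> x) {0..1} Z \<and> Z 0 = 0}) \<and>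
        (\<exists>Z :: real \<Rightarrow> (real \<Rightarrow> real) \<Rightarrow> real \<Rightarrow> real^2.
           (\<forall>\<eta>>0. \<forall>w\<in>space P. Z \<eta> w 0 = 0) \<and>
           (\<forall>\<eta>>0. \<forall>t\<in>{0..1}. (\<lambda>w. Z \<eta> w t)
              \<in> borel_measurable (completed_natural_filtration P (\<lambda>s w. w s) t)) \<and>
           (AE w in P. \<forall>\<eta>>0. is_solution w (jump_path \<tau> x) {0..1} (Z \<eta> w)) \<and>
           (AE w in P. \<forall>\<eta>\<^sub>1>0. \<forall>\<eta>\<^sub>2>0.
              ((\<lambda>t. norm (Z \<eta>\<^sub>1 w t) / norm (Z \<eta>\<^sub>2 w t)) \<longlongrightarrow> \<eta>\<^sub>1 / \<eta>\<^sub>2) (at_right 0))))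
     \<and>
     (AE w in P. \<exists>Z :: real \<Rightarrow> real \<Rightarrow> real^2.
        (\<forall>t\<in>{0..1}. is_solution w (\<lambda>u. u) {0..1} (Z t)) \<and>
        (\<forall>s\<in>{0..1}. \<forall>t\<in>{0..1}. Z t s = 0 \<longleftrightarrow> s \<le> t) \<and>
        inj_on (\<lambda>t. restrict (Z t) {0..1}) {0..1})"
proof -
  have fb: "fractional_brownian_motion H P (\<lambda>t w. w t)" using assms(3) by (simp add: fbm_law_def)
  interpret prob_space P using fb by (simp add: fractional_brownian_motion_def)
  interpret B: fbm P H "\<lambda>t w. w t" by unfold_locales (use assms(1,2) fb in auto)
  show ?thesis
  proof (intro conjI[OF _ B.solutions_from_all_times_AE] allI impI)
    fix \<tau> x :: "nat \<Rightarrow> real" and \<alpha> \<theta> :: real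
    assume A: "(\<forall>k. \<tau> k \<in> {0<..1}) \<and> decseq \<tau> \<and> \<tau> \<longlonglongrightarrow> 0 \<and> summable x \<and>
        asymp_equiv (\<lambda>k. \<tau> k - \<tau> (Suc k)) sequentially (\<lambda>k. real k powr (- \<alpha>)) \<and>
        (\<forall>k. x k \<ge> exp (- (real k powr \<theta>))) \<and>
        max (5 / (12 * H)) 1 < \<alpha> \<and> \<alpha> < 1 / (2 * H) \<and> 0 < \<theta> \<and> \<theta> < 1 - 2 * \<alpha> * H"
    \<comment> \<open>The lower bound on \<alpha> that \<open>scale_sequence\<close> asks for; 1/4 =
      3/12 lies below 5/12.\<close>
    have "1 / (4 * H) \<le> 5 / (12 * H)" using assms(1) by (simp add: field_simps)
    then have \<alpha>: "1 / (4 * H) < \<alpha>" using A by linarith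
    obtain Z :: "real \<Rightarrow> (real \<Rightarrow> real) \<Rightarrow> real \<Rightarrow> real^2" where Z: "\<And>\<eta> w. Z \<eta> w 0 = 0"
      "\<And>\<eta> t. t \<in> {0..1} \<Longrightarrow> (\<lambda>w. Z \<eta> w t) \<in> borel_measurable (completed_natural_filtration P (\<lambda>s w. w s) t)"
      "AE w in P. \<forall>\<eta>>0. is_solution w (jump_path \<tau> x) {0..1} (Z \<eta> w)"
      "AE w in P. \<forall>\<eta>1>0. \<forall>\<eta>2>0. eventually (\<lambda>t. norm (Z \<eta>1 w t) / norm (Z \<eta>2 w t) = \<eta>1 / \<eta>2) (at_right 0)"
      by (rule jump_solutions_AE[OF assms(1,2) fb, of \<tau> x \<theta> \<alpha>]) (use A \<alpha> in auto)
    show "(AE w in P. infinite {Z. Z \<in> extensional {0..1} \<and>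
            is_solution w (jump_path \<tau> x) {0..1} Z \<and> Z 0 = 0}) \<and>
        (\<exists>Z :: real \<Rightarrow> (real \<Rightarrow> real) \<Rightarrow> real \<Rightarrow> real^2.
           (\<forall>\<eta>>0. \<forall>w\<in>space P. Z \<eta> w 0 = 0) \<and>
           (\<forall>\<eta>>0. \<forall>t\<in>{0..1}. (\<lambda>w. Z \<eta> w t)
              \<in> borel_measurable (completed_natural_filtration P (\<lambda>s w. w s) t)) \<and>
           (AE w in P. \<forall>\<eta>>0. is_solution w (jump_path \<tau> x) {0..1} (Z \<eta> w)) \<and>
           (AE w in P. \<forall>\<eta>\<^sub>1>0. \<forall>\<eta>\<^sub>2>0.
              ((\<lambda>t. norm (Z \<eta>\<^sub>1 w t) / norm (Z \<eta>\<^sub>2 w t)) \<longlongrightarrow> \<eta>\<^sub>1 / \<eta>\<^sub>2) (at_right 0)))"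
    proof (intro conjI exI[of _ Z])
      show "AE w in P. infinite {Z. Z \<in> extensional {0..1} \<and> is_solution w (jump_path \<tau> x) {0..1} Z \<and> Z 0 = 0}"
        using Z(3,4)
      proof eventually_elim
        fix w assume "\<forall>\<eta>>0. is_solution w (jump_path \<tau> x) {0..1} (Z \<eta> w)"
          "\<forall>\<eta>1>0. \<forall>\<eta>2>0. eventually (\<lambda>t. norm (Z \<eta>1 w t) / norm (Z \<eta>2 w t) = \<eta>1 / \<eta>2) (at_right 0)"
        then show "infinite {Z. Z \<in> extensional {0..1} \<and> is_solution w (jump_path \<tau> x) {0..1} Z \<and> Z 0 = 0}"
          using Z(1) by (intro infinite_solutions[of w "jump_path \<tau> x" "\<lambda>\<eta>. Z \<eta> w"]) auto
      qed
      show "AE w in P. \<forall>\<eta>\<^sub>1>0. \<forall>\<eta>\<^sub>2>0. ((\<lambda>t. norm (Z \<eta>\<^sub>1 w t) / norm (Z \<eta>\<^sub>2 w t)) \<longlongrightarrow> \<eta>\<^sub>1 / \<eta>\<^sub>2) (at_right 0)"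
        using Z(4) by eventually_elim (auto intro: tendsto_eventually)
    qed (use Z in auto)
  qed
qed

end
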